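(* There is a polynomial-time algorithm for the laminar minimum crossing spanning tree problem with the following guarantee. Given an instance (a connected undirected graph $G=(V,E)$ with $n=|V|$, costs $c:E\to\mathbb{R}_{\ge 0}$, a laminar family $\{S_1,\dots,S_m\}$ of subsets of $V$ and bounds $b_1,\dots,b_m$) whose natural LP relaxation is feasible, it outputs a spanning tree $T$ of $G$ with $c(T)\le z^*$, where $z^*$ is the optimum value of the natural LP relaxation, and $|T\cap\delta(S_i)|\le b_i+O(\log n)$ for every $i\in[m]$ (the $O(\cdot)$ hides a universal constant).
   Context: For $W\subseteq V$, $\delta(W)=\{(u,v)\in E: u\in W, v\notin W\}$ and $E(W)=\{(u,v)\in E: u,v\in W\}$. A family of vertex sets is laminar if any two members are either disjoint or one contains the other. The laminar minimum crossing spanning tree problem asks for a minimum-cost spanning tree $T$ with $|T\cap\delta(S_i)|\le b_i$ for all $i$. Its natural LP relaxation is: minimize $\sum_{e\in E}c_ex_e$ subject to $x(E(V))=|V|-1$, $x(E(U))\le |U|-1$ for all $\emptyset\ne U\subsetneq V$, $x(\delta(S_i))\le b_i$ for all $i\in[m]$, and $x\ge 0$, where $x(A)=\sum_{e\in A}x_e$. *)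

theory Defs
  imports
    Complex_Main
    "HOL-Library.Log_Nat"
    "HOL-Computational_Algebra.Polynomial"
begin

section \<open>Undirected graphs\<close>

text \<open>A simple undirected graph is a vertex set together with a set of two-element edges.\<close>

definition simple_graph :: "'a set \<Rightarrow> 'a set set \<Rightarrow> bool" where
  "simple_graph V E \<longleftrightarrow> finite V \<and> V \<noteq> {} \<and> E \<subseteq> {{u, v} | u v. u \<in> V \<and> v \<in> V \<and> u \<noteq> v}"

definition cut_edges :: "'a set set \<Rightarrow> 'a set \<Rightarrow> 'a set set" where
  "cut_edges E W = {e \<in> E. \<exists>u v. e = {u, v} \<and> u \<in> W \<and> v \<notin> W}"

definition induced_edges :: "'a set set \<Rightarrow> 'a set \<Rightarrow> 'a set set" where
  "induced_edges E W = {e \<in> E. \<exists>u v. e = {u, v} \<and> u \<in> W \<and> v \<in> W}"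

definition connected_graph :: "'a set \<Rightarrow> 'a set set \<Rightarrow> bool" where
  "connected_graph V E \<longleftrightarrow> (\<forall>u \<in> V. \<forall>v \<in> V. (u, v) \<in> {(x, y). {x, y} \<in> E}\<^sup>*)"

definition is_cycle :: "'a set set \<Rightarrow> 'a list \<Rightarrow> bool" where
  "is_cycle E vs \<longleftrightarrow> length vs \<ge> 3 \<and> distinct vs \<and>
     (\<forall>i < length vs. {vs ! i, vs ! (Suc i mod length vs)} \<in> E)"

definition spanning_tree :: "'a set \<Rightarrow> 'a set set \<Rightarrow> 'a set set \<Rightarrow> bool" where
  "spanning_tree V E T \<longleftrightarrow> T \<subseteq> E \<and> connected_graph V T \<and> (\<nexists>vs. is_cycle T vs)"


section \<open>Laminar minimum crossing spanning tree\<close>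

text \<open>
  The family is a list, so a set may occur several times, with different bounds.
  The values of \<open>cost\<close> outside \<open>edges\<close> are irrelevant.
\<close>

record mcst =
  verts :: "nat set"
  edges :: "nat set set"
  cost :: "nat set \<Rightarrow> real"
  fam :: "nat set list"
  bnd :: "real list"

definition laminar :: "'a set list \<Rightarrow> bool" where
  "laminar Ss \<longleftrightarrow> (\<forall>A \<in> set Ss. \<forall>B \<in> set Ss. A \<inter> B = {} \<or> A \<subseteq> B \<or> B \<subseteq> A)"

definition laminar_mcst :: "mcst \<Rightarrow> bool" where
  "laminar_mcst I \<longleftrightarrow>
     simple_graph (verts I) (edges I) \<and> connected_graph (verts I) (edges I) \<and>
     (\<forall>e \<in> edges I. 0 \<le> cost I e) \<and>
     (\<forall>S \<in> set (fam I). S \<subseteq> verts I) \<and> laminar (fam I) \<and>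
     length (bnd I) = length (fam I)"

definition lp_feasible :: "mcst \<Rightarrow> (nat set \<Rightarrow> real) set" where
  "lp_feasible I = {x.
     sum x (induced_edges (edges I) (verts I)) = real (card (verts I)) - 1 \<and>
     (\<forall>U. U \<noteq> {} \<and> U \<subset> verts I \<longrightarrow>
        sum x (induced_edges (edges I) U) \<le> real (card U) - 1) \<and>
     (\<forall>i < length (fam I). sum x (cut_edges (edges I) (fam I ! i)) \<le> bnd I ! i) \<and>
     (\<forall>e \<in> edges I. 0 \<le> x e)}"

definition lp_opt :: "mcst \<Rightarrow> real" where
  "lp_opt I = (INF x \<in> lp_feasible I. \<Sum>e \<in> edges I. cost I e * x e)"


section \<open>Polynomial time\<close>

text \<open>
  The machine model is a random access machine under the logarithmic cost criterion,
  presented as a structured language: one memory of integers, addressed by integers,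
  where every evaluated subexpression (in particular every address and every loaded or
  computed integer) is charged its binary length.  Such machines and Turing machines
  simulate each other with polynomial overhead.
\<close>

type_synonym mem = "int \<Rightarrow> int"

datatype aexp =
    Const int
  | Load aexp
  | Add aexp aexp
  | Sub aexp aexp
  | Mul aexp aexp
  | Div aexp aexp

datatype com =
    Skip
  | Store aexp aexp
  | Seq com com
  | IfPos aexp com com
  | WhilePos aexp com

definition int_size :: "int \<Rightarrow> nat" where
  "int_size k = nat (bitlen \<bar>k\<bar>) + 1"

fun aval :: "aexp \<Rightarrow> mem \<Rightarrow> int" where
  "aval (Const k) s = k"
| "aval (Load a) s = s (aval a s)"
| "aval (Add a b) s = aval a s + aval b s"
| "aval (Sub a b) s = aval a s - aval b s"
| "aval (Mul a b) s = aval a s * aval b s"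
| "aval (Div a b) s = aval a s div aval b s"

fun acost :: "aexp \<Rightarrow> mem \<Rightarrow> nat" where
  "acost (Const k) s = int_size k"
| "acost (Load a) s = acost a s + int_size (aval (Load a) s)"
| "acost (Add a b) s = acost a s + acost b s + int_size (aval (Add a b) s)"
| "acost (Sub a b) s = acost a s + acost b s + int_size (aval (Sub a b) s)"
| "acost (Mul a b) s = acost a s + acost b s + int_size (aval (Mul a b) s)"
| "acost (Div a b) s = acost a s + acost b s + int_size (aval (Div a b) s)"

text \<open>\<open>exec c s t s'\<close>: started in memory \<open>s\<close>, the program \<open>c\<close> halts in memory \<open>s'\<close> after time \<open>t\<close>.\<close>

inductive exec :: "com \<Rightarrow> mem \<Rightarrow> nat \<Rightarrow> mem \<Rightarrow> bool" where
  Skip: "exec Skip s 1 s"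
| Store: "exec (Store a b) s (acost a s + acost b s) (s(aval a s := aval b s))"
| Seq: "exec c s t s' \<Longrightarrow> exec d s' t' s'' \<Longrightarrow> exec (Seq c d) s (t + t') s''"
| IfTrue: "aval a s > 0 \<Longrightarrow> exec c s t s' \<Longrightarrow> exec (IfPos a c d) s (acost a s + t) s'"
| IfFalse: "\<not> aval a s > 0 \<Longrightarrow> exec d s t s' \<Longrightarrow> exec (IfPos a c d) s (acost a s + t) s'"
| WhileFalse: "\<not> aval a s > 0 \<Longrightarrow> exec (WhilePos a c) s (acost a s) s"
| WhileTrue: "aval a s > 0 \<Longrightarrow> exec c s t s' \<Longrightarrow> exec (WhilePos a c) s' t' s'' \<Longrightarrow>
    exec (WhilePos a c) s (acost a s + t + t') s''"

text \<open>Input and output words are stored from address 1 on, with their length at address 0.\<close>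

definition input_mem :: "int list \<Rightarrow> mem" where
  "input_mem ks a =
     (if a = 0 then int (length ks)
      else if 1 \<le> a \<and> a \<le> int (length ks) then ks ! nat (a - 1)
      else 0)"

definition output_word :: "mem \<Rightarrow> int list" where
  "output_word s = map s [1..s 0]"

definition word_size :: "int list \<Rightarrow> nat" where
  "word_size ks = (\<Sum>k \<leftarrow> ks. int_size k)"

text \<open>\<open>f\<close> is computed in polynomial time on the inputs satisfying the promise \<open>D\<close>.\<close>

definition polytime_computable ::
  "('a \<Rightarrow> int list) \<Rightarrow> ('b \<Rightarrow> int list) \<Rightarrow> 'a set \<Rightarrow> ('a \<Rightarrow> 'b) \<Rightarrow> bool" where
  "polytime_computable enc_in enc_out D f \<longleftrightarrow>
     (\<exists>prog. \<exists>p :: nat poly. \<forall>x \<in> D. \<exists>t s.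
        exec prog (input_mem (enc_in x)) t s \<and>
        t \<le> poly p (word_size (enc_in x)) \<and>
        output_word s = enc_out (f x))"


section \<open>Encoding of instances and edge sets\<close>

text \<open>Only instances with rational data are finite objects that can be given to a machine.\<close>

definition rational_mcst :: "mcst \<Rightarrow> bool" where
  "rational_mcst I \<longleftrightarrow> (\<forall>e \<in> edges I. cost I e \<in> \<rat>) \<and> set (bnd I) \<subseteq> \<rat>"

definition encode_rat :: "real \<Rightarrow> int list" where
  "encode_rat r = (let (a, b) = quotient_of (THE q. of_rat q = r) in [a, b])"

text \<open>Each edge is listed once, as the pair of its endpoints in increasing order.\<close>

definition edge_list :: "nat set set \<Rightarrow> (nat \<times> nat) list" where
  "edge_list E =
     [(u, v). u \<leftarrow> sorted_list_of_set (\<Union>E), v \<leftarrow> sorted_list_of_set (\<Union>E), u < v \<and> {u, v} \<in> E]"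

definition encode_vertices :: "nat set \<Rightarrow> int list" where
  "encode_vertices W = int (card W) # map int (sorted_list_of_set W)"

definition encode_edges :: "nat set set \<Rightarrow> int list" where
  "encode_edges T = concat [[int u, int v]. (u, v) \<leftarrow> edge_list T]"

definition encode_mcst :: "mcst \<Rightarrow> int list" where
  "encode_mcst I =
     encode_vertices (verts I) @
     int (length (edge_list (edges I))) #
     concat [[int u, int v] @ encode_rat (cost I {u, v}). (u, v) \<leftarrow> edge_list (edges I)] @
     int (length (fam I)) #
     concat [encode_vertices S @ encode_rat b. (S, b) \<leftarrow> zip (fam I) (bnd I)]"

end

theory Submission
  imports Defs "HOL-Analysis.Analysis"
begin

text \<open>
  No linear program is solved. For a target slack \<open>h\<close>, a penalty iteration (repeated minimum spanning
  trees, with multipliers that grow on violated cuts) finds a convex combination of spanning trees with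
  small crossing excess and cost at most that of any fractional point in the current region. Edges are
  fixed in or out one at a time as long as this succeeds. When no further edge can be fixed, a point
  with maximal sum of squares has few fractional edges: symmetric exchanges turn more of them than
  active constraints into a feasible direction. By laminarity only a constant fraction of the
  constraints has a cut that is far, on the unfixed edges, from that of every other kept
  constraint; the others are dropped, each at an additive loss \<open>O(1)\<close>. So \<open>O(log n)\<close> rounds of dropping suffice.
  The numerical errors are absorbed by relaxing each \<open>b\<close> by one: mixing an LP point with the
  minimum spanning tree \<open>T\<close> then saves \<open>(c(x) - c(T)) / n\<close> in cost, which beats the error when \<open>h\<close> is the right
  power of two; all powers are tried. The program is written in a loop language whose
  well-formed programs compile to polynomial time. Irrational instances follow by
  approximation, as there are finitely many trees.
\<close>

section \<open>A loop language with polynomial running time\<close>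

text \<open>The cost bound leaves no slack, while every penalty run has an error; this conflict
  fixes the constants. Let D be the gap between the LP value and the minimum tree cost. At scale
  \<open>h\<close> a run is sure to lose at most 1/L in the cuts if the comparison point costs at
  most \<open>h\<close> more than the minimum tree, and all runs together lose at most about h/(4 L)
  in cost. The mixture saves D/n, so a power of two between 2 D and 4 D meets both demands; if D <
  1/2, integrality of the scaled costs lets \<open>h = 1\<close> work. Apart from the initial run,
  only runs that fix an edge count, so the cut errors add up to at most (m + 1)/L <= 1. When no edge
  can be fixed, \<open>a\<close> active constraints leave at most 2 (a + 1) unfixed edges. Cuts that
  differ pairwise, and from the empty set, on at least 32 of these number at most an eighth of them,
  hence at most a/2. The first sweep leaves at most n^2/8 constraints, so about 2 log n sweeps
  suffice. A sweep costs 62, twice the distance 31; a constraint that is dropped outright costs 32,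
  which is 31 plus the accumulated cut error.\<close>

text \<open>
  \<open>Loop\<close> repeats its body as often as the length \<open>L\<close> of the input word, in bits, so that running times are
  polynomial by construction.
\<close>

type_synonym store = "nat \<Rightarrow> int \<Rightarrow> int"

datatype ex = K int | At nat ex | Plus ex ex | Minus ex ex | Times ex ex | Quot ex ex

datatype lc = Nop | Asg nat ex ex | Sq lc lc | Cond ex lc lc | Loop lc

primrec ev :: "ex \<Rightarrow> store \<Rightarrow> int" where
  "ev (K n) s = n"
| "ev (At v i) s = s v (ev i s)"
| "ev (Plus a b) s = ev a s + ev b s"
| "ev (Minus a b) s = ev a s - ev b s"
| "ev (Times a b) s = ev a s * ev b s"
| "ev (Quot a b) s = ev a s div ev b s"

primrec den :: "nat \<Rightarrow> lc \<Rightarrow> store \<Rightarrow> store" where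
  "den L Nop s = s"
| "den L (Asg v i e) s = s(v := (s v)(ev i s := ev e s))"
| "den L (Sq a b) s = den L b (den L a s)"
| "den L (Cond e a b) s = (if ev e s > 0 then den L a s else den L b s)"
| "den L (Loop a) s = (den L a ^^ L) s"

text \<open>Constants count with their absolute value, a crude bound on their length; as programs
  are fixed, this only affects the polynomial.\<close>

primrec esz :: "ex \<Rightarrow> nat" where
  "esz (K n) = nat \<bar>n\<bar> + 1"
| "esz (At v i) = esz i + 1"
| "esz (Plus a b) = esz a + esz b + 1"
| "esz (Minus a b) = esz a + esz b + 1"
| "esz (Times a b) = esz a + esz b + 1"
| "esz (Quot a b) = esz a + esz b + 1"

primrec arrays_ok :: "ex \<Rightarrow> bool" where
  "arrays_ok (K n) = True"
| "arrays_ok (At v i) = (v < 192 \<and> arrays_ok i)"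
| "arrays_ok (Plus a b) = (arrays_ok a \<and> arrays_ok b)"
| "arrays_ok (Minus a b) = (arrays_ok a \<and> arrays_ok b)"
| "arrays_ok (Times a b) = (arrays_ok a \<and> arrays_ok b)"
| "arrays_ok (Quot a b) = (arrays_ok a \<and> arrays_ok b)"

text \<open>
  Array \<open>v\<close> has level \<open>v div 64\<close>, and a product stored at some level has a right factor of lower level (or a
  constant one). Hence no entry is ever squared repeatedly, and its length stays polynomial.
\<close>

fun tame :: "nat \<Rightarrow> ex \<Rightarrow> bool" where
  "tame l (K n) = True"
| "tame l (At v i) = (v div 64 \<le> l)"
| "tame l (Plus a b) = (tame l a \<and> tame l b)"
| "tame l (Minus a b) = (tame l a \<and> tame l b)"
| "tame l (Times a b) =
     (tame l a \<and> (case b of K n \<Rightarrow> True | _ \<Rightarrow> 0 < l \<and> tame (l - 1) b))"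
| "tame l (Quot a b) = tame l a"

primrec wfc :: "lc \<Rightarrow> bool" where
  "wfc Nop = True"
| "wfc (Asg v i e) = (v < 192 \<and> arrays_ok i \<and> arrays_ok e \<and> tame (v div 64) e)"
| "wfc (Sq a b) = (wfc a \<and> wfc b)"
| "wfc (Cond e a b) = (arrays_ok e \<and> wfc a \<and> wfc b)"
| "wfc (Loop a) = wfc a"

primrec depth :: "lc \<Rightarrow> nat" where
  "depth Nop = 0"
| "depth (Asg v i e) = 0"
| "depth (Sq a b) = max (depth a) (depth b)"
| "depth (Cond e a b) = max (depth a) (depth b)"
| "depth (Loop a) = Suc (depth a)"

primrec csz :: "lc \<Rightarrow> nat" where
  "csz Nop = 1"
| "csz (Asg v i e) = esz i + esz e"
| "csz (Sq a b) = csz a + csz b"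
| "csz (Cond e a b) = esz e + csz a + csz b"
| "csz (Loop a) = csz a"

text \<open>An upper bound on the number of elementary steps that counts both branches of a
  conditional. It depends on the program and on \<open>L\<close> alone and is a polynomial in
  \<open>L\<close>.\<close>

primrec nst :: "nat \<Rightarrow> lc \<Rightarrow> nat" where
  "nst L Nop = 1"
| "nst L (Asg v i e) = 2"
| "nst L (Sq a b) = nst L a + nst L b"
| "nst L (Cond e a b) = 1 + nst L a + nst L b"
| "nst L (Loop a) = 2 + (L + 1) * (nst L a + 4)"

text \<open>
  The arrays are interleaved in the negative addresses; the input and the output occupy the others.
  The numbers from 192 on serve as loop counters, 255 holds \<open>L\<close>.
\<close>

definition addr :: "nat \<Rightarrow> int \<Rightarrow> int" where
  "addr v i = - 1 - int v - 256 * i"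

lemma addr_eq: "v < 256 \<Longrightarrow> w < 256 \<Longrightarrow> addr v i = addr w j \<longleftrightarrow> v = w \<and> i = j"
proof -
  assume "v < 256" "w < 256"
  then have "int v = (- 1 - addr v i) mod 256" "int w = (- 1 - addr w j) mod 256" by (simp_all add: addr_def)
  then have "addr v i = addr w j \<Longrightarrow> v = w" by presburger
  then show ?thesis by (auto simp: addr_def)
qed

section \<open>Compilation to the machine and the growth of the integers\<close>

primrec cex :: "ex \<Rightarrow> aexp" where
  "cex (K n) = Const n"
| "cex (At v i) = Load (Sub (Const (- 1 - int v)) (Mul (Const 256) (cex i)))"
| "cex (Plus a b) = Add (cex a) (cex b)"
| "cex (Minus a b) = Sub (cex a) (cex b)"
| "cex (Times a b) = Mul (cex a) (cex b)"
| "cex (Quot a b) = Div (cex a) (cex b)"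

abbreviation counter :: "nat \<Rightarrow> aexp" where
  "counter d \<equiv> Const (addr (192 + d) 0)"

text \<open>\<open>d\<close> is the number of enclosing loops. Each nesting level owns one of the
  reserved cells, so the body of a loop cannot disturb the counters outside it.\<close>

primrec compile :: "nat \<Rightarrow> lc \<Rightarrow> com" where
  "compile d Nop = Skip"
| "compile d (Asg v i e) = Store (Sub (Const (- 1 - int v)) (Mul (Const 256) (cex i))) (cex e)"
| "compile d (Sq a b) = Seq (compile d a) (compile d b)"
| "compile d (Cond e a b) = IfPos (cex e) (compile d a) (compile d b)"
| "compile d (Loop a) = Seq (Store (counter d) (Load (Const (addr 255 0))))
     (WhilePos (Load (counter d))
        (Seq (compile (Suc d) a) (Store (counter d) (Sub (Load (counter d)) (Const 1)))))"

definition agree :: "mem \<Rightarrow> store \<Rightarrow> bool" where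
  "agree s \<sigma> \<longleftrightarrow> (\<forall>v<192. \<forall>i. s (addr v i) = \<sigma> v i)"

lemma aval_cex: "arrays_ok e \<Longrightarrow> agree s \<sigma> \<Longrightarrow> aval (cex e) s = ev e \<sigma>"
proof (induction e)
  case (At v i)
  then have "- 1 - int v - 256 * ev i \<sigma> = addr v (ev i \<sigma>)" by (simp add: addr_def)
  with At show ?case by (simp add: agree_def)
qed auto

lemma pow_add_le:
  fixes a b :: int
  assumes "\<bar>a\<bar> \<le> 2 ^ m" "\<bar>b\<bar> \<le> 2 ^ n" "m < k" "n < k"
  shows "\<bar>a + b\<bar> \<le> 2 ^ k" "\<bar>a - b\<bar> \<le> 2 ^ k"
proof -
  obtain j where j: "k = Suc j" using assms(3) by (cases k) auto
  have "(2::int) ^ m \<le> 2 ^ j" "(2::int) ^ n \<le> 2 ^ j" using assms j by (simp_all add: power_increasing)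
  then have "\<bar>a\<bar> \<le> 2 ^ j" "\<bar>b\<bar> \<le> 2 ^ j" using assms(1,2) by linarith+
  then show "\<bar>a + b\<bar> \<le> 2 ^ k" "\<bar>a - b\<bar> \<le> 2 ^ k" unfolding j power_Suc by linarith+
qed

lemma pow_mult_le:
  fixes a b :: int
  assumes "\<bar>a\<bar> \<le> 2 ^ m" "\<bar>b\<bar> \<le> 2 ^ n" "m + n \<le> k"
  shows "\<bar>a * b\<bar> \<le> 2 ^ k"
proof -
  have "\<bar>a * b\<bar> \<le> 2 ^ m * 2 ^ n" unfolding abs_mult using assms by (intro mult_mono) auto
  also have "\<dots> = 2 ^ (m + n)" by (simp add: power_add)
  also have "\<dots> \<le> 2 ^ k" using assms(3) by (intro power_increasing) auto
  finally show ?thesis .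
qed

lemma div_abs_le: "\<bar>a div b\<bar> \<le> \<bar>a\<bar>" for a b :: int
proof -
  have pos: "\<bar>a div b\<bar> \<le> \<bar>a\<bar>" if "0 < b" for a b :: int
  proof (cases "0 \<le> a")
    case True
    then show ?thesis using zdiv_mono2[of a 1 b] that pos_imp_zdiv_nonneg_iff[of b a] by simp
  next
    case False
    then show ?thesis using zdiv_mono2_neg[of a 1 b] that div_nonpos_pos_le0[of a b] by simp
  qed
  show ?thesis
  proof (cases "b < 0")
    case True
    have "a div b = (- a) div (- b)" by simp
    then show ?thesis using pos[of "- b" "- a"] True by linarith
  next
    case False
    then show ?thesis using pos[of b a] by (cases "b = 0") auto
  qed
qed

lemma abs_le_pow: "\<bar>n\<bar> \<le> 2 ^ nat \<bar>n\<bar>" for n :: int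
proof -
  have "nat \<bar>n\<bar> < 2 ^ nat \<bar>n\<bar>" by (rule less_exp)
  then have "int (nat \<bar>n\<bar>) \<le> int (2 ^ nat \<bar>n\<bar>)" by linarith
  then show ?thesis by simp
qed

lemma int_size_le: "\<bar>k\<bar> \<le> 2 ^ m \<Longrightarrow> int_size k \<le> m + 2"
proof -
  assume "\<bar>k\<bar> \<le> 2 ^ m"
  then have "\<bar>k\<bar> < 2 ^ nat (int (m + 1))" unfolding nat_int using power_strict_increasing[of m "m + 1" "2::int"] by linarith
  then have "bitlen \<bar>k\<bar> \<le> int (m + 1)" by (intro bitlen_le_iff_power[THEN iffD2]) auto
  then show ?thesis unfolding int_size_def by linarith
qed

text \<open>The growth measure: entries of level l have about y^(l+1) bits. Assigning an expression
  of size at most C turns y into y + C, because y^(l+1) + C y^l <= (y + C)^(l+1). Hence y grows only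
  linearly with the number of steps.\<close>

definition bounded_store :: "nat \<Rightarrow> store \<Rightarrow> bool" where
  "bounded_store y \<sigma> \<longleftrightarrow> (\<forall>v<192. \<forall>i. \<bar>\<sigma> v i\<bar> \<le> 2 ^ (y ^ (v div 64 + 1)))"

lemma bounded_store_mono: "bounded_store y \<sigma> \<Longrightarrow> y \<le> y' \<Longrightarrow> 0 < y \<Longrightarrow> bounded_store y' \<sigma>"
  unfolding bounded_store_def
  by (meson order_trans power_increasing power_mono zero_le one_le_numeral)

text \<open>In a product the left factor brings the dominating term y^(l+1), and the right one, of
  lower level, only a multiple of y^l; so the excess over y^(l+1) stays additive in the size of the
  expression.\<close>

lemma ev_tame:
  assumes "bounded_store y \<sigma>" "0 < y" "arrays_ok e" "tame l e"
  shows "\<bar>ev e \<sigma>\<bar> \<le> 2 ^ (y ^ (l + 1) + esz e * y ^ l)"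
  using assms(3,4)
proof (induction e arbitrary: l)
  case (K n)
  have "nat \<bar>n\<bar> \<le> y ^ (l + 1) + (nat \<bar>n\<bar> + 1) * y ^ l"
  proof -
    have "nat \<bar>n\<bar> * 1 \<le> (nat \<bar>n\<bar> + 1) * y ^ l" using assms(2) by (intro mult_mono) auto
    then show ?thesis by linarith
  qed
  then have "(2::int) ^ nat \<bar>n\<bar> \<le> 2 ^ (y ^ (l + 1) + (nat \<bar>n\<bar> + 1) * y ^ l)" by (intro power_increasing) auto
  then show ?case using order_trans[OF abs_le_pow[of n]] unfolding ev.simps esz.simps by blast
next
  case (At v i)
  have "y ^ (v div 64 + 1) \<le> y ^ (l + 1)" using At assms(2) by (intro power_increasing) auto
  then have "y ^ (v div 64 + 1) \<le> y ^ (l + 1) + esz (At v i) * y ^ l" by linarith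
  then have "(2::int) ^ (y ^ (v div 64 + 1)) \<le> 2 ^ (y ^ (l + 1) + esz (At v i) * y ^ l)"
    by (rule power_increasing) simp
  moreover have "\<bar>\<sigma> v (ev i \<sigma>)\<bar> \<le> 2 ^ (y ^ (v div 64 + 1))" using assms(1) At(2) unfolding bounded_store_def by auto
  ultimately show ?case unfolding ev.simps by (rule order_trans[rotated])
next
  case (Plus a b)
  have "0 < y ^ l" using assms(2) by simp
  then have "esz a * y ^ l < esz (Plus a b) * y ^ l" "esz b * y ^ l < esz (Plus a b) * y ^ l"
    by (simp_all add: add_mult_distrib)
  then show ?case using Plus.prems
    unfolding ev.simps by (intro pow_add_le(1)[OF Plus.IH(1)[of l] Plus.IH(2)[of l]]) (simp_all only: arrays_ok.simps tame.simps nat_add_left_cancel_less)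
next
  case (Minus a b)
  have "0 < y ^ l" using assms(2) by simp
  then have "esz a * y ^ l < esz (Minus a b) * y ^ l" "esz b * y ^ l < esz (Minus a b) * y ^ l"
    by (simp_all add: add_mult_distrib)
  then show ?case using Minus.prems
    unfolding ev.simps by (intro pow_add_le(2)[OF Minus.IH(1)[of l] Minus.IH(2)[of l]]) (simp_all only: arrays_ok.simps tame.simps nat_add_left_cancel_less)
next
  case (Times a b)
  have b: "\<bar>ev b \<sigma>\<bar> \<le> 2 ^ (y ^ l + esz b * y ^ l)"
  proof (cases "\<exists>n. b = K n")
    case True
    then obtain n where n: "b = K n" by auto
    have "nat \<bar>n\<bar> * 1 \<le> (nat \<bar>n\<bar> + 1) * y ^ l" using assms(2) by (intro mult_mono) auto
    then have "nat \<bar>n\<bar> \<le> y ^ l + (nat \<bar>n\<bar> + 1) * y ^ l" by linarith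
    then have "(2::int) ^ nat \<bar>n\<bar> \<le> 2 ^ (y ^ l + (nat \<bar>n\<bar> + 1) * y ^ l)" by (intro power_increasing) auto
    then show ?thesis using order_trans[OF abs_le_pow[of n]] n by simp
  next
    case False
    then have l: "0 < l" "tame (l - 1) b" using Times.prems by (auto split: ex.splits)
    have "\<bar>ev b \<sigma>\<bar> \<le> 2 ^ (y ^ (l - 1 + 1) + esz b * y ^ (l - 1))" using Times.IH(2)[of "l - 1"] l Times.prems by auto
    also have "\<dots> \<le> 2 ^ (y ^ l + esz b * y ^ l)"
      using l assms(2) by (intro power_increasing add_mono mult_left_mono) auto
    finally show ?thesis .
  qed
  have "y ^ (l + 1) + esz a * y ^ l + (y ^ l + esz b * y ^ l) \<le> y ^ (l + 1) + esz (Times a b) * y ^ l"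
    by (simp add: algebra_simps)
  then show ?case using Times.prems
    unfolding ev.simps by (intro pow_mult_le[OF Times.IH(1)[of l] b]) (simp_all only: arrays_ok.simps tame.simps)
next
  case (Quot a b)
  have "\<bar>ev a \<sigma>\<bar> \<le> 2 ^ (y ^ (l + 1) + esz a * y ^ l)" using Quot by auto
  also have "\<dots> \<le> 2 ^ (y ^ (l + 1) + esz (Quot a b) * y ^ l)"
    using assms(2) by (intro power_increasing add_mono mult_le_mono1) auto
  finally show ?case using div_abs_le[of "ev a \<sigma>" "ev b \<sigma>"] by simp
qed

text \<open>A cruder bound that serves the running time. It also covers addresses and tests, which
  are not \<open>tame\<close>, and allows lengths to be multiplied by the size of the
  expression.\<close>

lemma ev_bound:
  assumes "\<And>v i. v < 192 \<Longrightarrow> \<bar>\<sigma> v i\<bar> \<le> 2 ^ Z" "0 < Z" "arrays_ok e"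
  shows "\<bar>ev e \<sigma>\<bar> \<le> 2 ^ (Z * esz e)"
  using assms(3)
proof (induction e)
  case (K n)
  have "1 * nat \<bar>n\<bar> \<le> Z * (nat \<bar>n\<bar> + 1)" using assms(2) by (intro mult_mono) auto
  then have "(2::int) ^ nat \<bar>n\<bar> \<le> 2 ^ (Z * (nat \<bar>n\<bar> + 1))" by (intro power_increasing) auto
  then show ?case using order_trans[OF abs_le_pow[of n]] by simp
next
  case (At v i)
  have "(2::int) ^ Z \<le> 2 ^ (Z * (esz i + 1))" by (intro power_increasing) auto
  then show ?case using order_trans[OF assms(1)[of v "ev i \<sigma>"]] At by simp
next
  case (Plus a b)
  then have "\<bar>ev a \<sigma>\<bar> \<le> 2 ^ (Z * esz a)" "\<bar>ev b \<sigma>\<bar> \<le> 2 ^ (Z * esz b)" by auto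
  from pow_add_le(1)[OF this, of "Z * esz (Plus a b)"] show ?case
    using assms(2) by (simp add: add_mult_distrib2)
next
  case (Minus a b)
  then have "\<bar>ev a \<sigma>\<bar> \<le> 2 ^ (Z * esz a)" "\<bar>ev b \<sigma>\<bar> \<le> 2 ^ (Z * esz b)" by auto
  from pow_add_le(2)[OF this, of "Z * esz (Minus a b)"] show ?case
    using assms(2) by (simp add: add_mult_distrib2)
next
  case (Times a b)
  then have "\<bar>ev a \<sigma>\<bar> \<le> 2 ^ (Z * esz a)" "\<bar>ev b \<sigma>\<bar> \<le> 2 ^ (Z * esz b)" by auto
  from pow_mult_le[OF this, of "Z * esz (Times a b)"] show ?case by (simp add: add_mult_distrib2)
next
  case (Quot a b)
  have "(2::int) ^ (Z * esz a) \<le> 2 ^ (Z * esz (Quot a b))" by (intro power_increasing mult_le_mono2) auto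
  moreover have "\<bar>ev a \<sigma>\<bar> \<le> 2 ^ (Z * esz a)" using Quot by auto
  ultimately show ?case using div_abs_le[of "ev a \<sigma>" "ev b \<sigma>"] unfolding ev.simps by linarith
qed

lemma acost_addr:
  assumes "agree s \<sigma>" "arrays_ok i" "v < 192" "\<bar>ev i \<sigma>\<bar> \<le> 2 ^ m"
  shows "acost (Sub (Const (- 1 - int v)) (Mul (Const 256) (cex i))) s \<le> acost (cex i) s + 2 * m + 41"
    "aval (Sub (Const (- 1 - int v)) (Mul (Const 256) (cex i))) s = addr v (ev i \<sigma>)"
proof -
  have 1: "\<bar>- 1 - int v\<bar> \<le> 2 ^ 8" using assms(3) by simp
  have 2: "\<bar>256 * ev i \<sigma>\<bar> \<le> 2 ^ (8 + m)" using pow_mult_le[of 256 8 "ev i \<sigma>" m "8 + m"] assms(4) by simp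
  have 3: "\<bar>- 1 - int v - 256 * ev i \<sigma>\<bar> \<le> 2 ^ (9 + m)" by (rule pow_add_le(2)[OF 1 2]) auto
  show "acost (Sub (Const (- 1 - int v)) (Mul (Const 256) (cex i))) s \<le> acost (cex i) s + 2 * m + 41"
  proof -
    have "acost (Sub (Const (- 1 - int v)) (Mul (Const 256) (cex i))) s = int_size (- 1 - int v) +
        (int_size 256 + acost (cex i) s + int_size (256 * ev i \<sigma>)) + int_size (- 1 - int v - 256 * ev i \<sigma>)"
      by (simp only: acost.simps aval.simps aval_cex[OF assms(2,1)])
    moreover have "int_size 256 \<le> 8 + 2" by (rule int_size_le) simp
    ultimately show ?thesis using int_size_le[OF 1] int_size_le[OF 2] int_size_le[OF 3] by linarith
  qed
  show "aval (Sub (Const (- 1 - int v)) (Mul (Const 256) (cex i))) s = addr v (ev i \<sigma>)"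
    using aval_cex[OF assms(2,1)] by (simp add: addr_def)
qed

lemma acost_step1:
  fixes X Y :: nat
  assumes "z1 \<le> Y" "z * 1 \<le> Y" "c \<le> X" "s \<le> z + 2" "t = u + s" "u \<le> c + 2 * z1 + 41"
  shows "t \<le> X + 6 * (Y + 12)"
  using assms by arith

lemma acost_step2:
  fixes X1 X2 Y :: nat
  assumes "s \<le> z + 2" "z \<le> Y" "a \<le> X1" "b \<le> X2"
  shows "a + b + s \<le> X1 + X2 + 6 * (Y + 12)"
  using assms by arith

lemma acost_bound:
  assumes "agree s \<sigma>" "\<And>v i. v < 192 \<Longrightarrow> \<bar>\<sigma> v i\<bar> \<le> 2 ^ Z" "0 < Z" "arrays_ok e" "esz e \<le> E"
  shows "acost (cex e) s \<le> 6 * esz e * (Z * E + 12)"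
  using assms(4,5)
proof (induction e)
  case (K n)
  have "\<bar>n\<bar> \<le> 2 ^ (Z * esz (K n))" using ev_bound[OF assms(2,3), where e = "K n"] by simp
  then have "int_size n \<le> Z * esz (K n) + 2" by (rule int_size_le)
  also have "\<dots> \<le> 1 * 1 * (Z * E + 12)" unfolding mult_1 using mult_le_mono2[OF K.prems(2), of Z] by (rule add_mono) simp
  also have "\<dots> \<le> 6 * esz (K n) * (Z * E + 12)" by (intro mult_mono) auto
  finally show ?case by simp
next
  case (At v i)
  have b: "\<bar>ev i \<sigma>\<bar> \<le> 2 ^ (Z * esz i)" using ev_bound[OF assms(2,3), where e = i] At by auto
  have "Z * esz i \<le> Z * E" "Z * 1 \<le> Z * E" using At by (auto intro!: mult_left_mono)
  moreover have "acost (cex i) s \<le> 6 * esz i * (Z * E + 12)" using At by auto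
  moreover have "int_size (\<sigma> v (ev i \<sigma>)) \<le> Z + 2" using assms(2) At by (intro int_size_le) auto
  moreover have "acost (cex (At v i)) s = acost (Sub (Const (- 1 - int v)) (Mul (Const 256) (cex i))) s + int_size (\<sigma> v (ev i \<sigma>))"
    using aval_cex[OF At.prems(1) assms(1)] by simp
  moreover have "acost (Sub (Const (- 1 - int v)) (Mul (Const 256) (cex i))) s \<le> acost (cex i) s + 2 * (Z * esz i) + 41"
    using At by (intro acost_addr(1)[OF assms(1) _ _ b]) auto
  ultimately have "acost (cex (At v i)) s \<le> 6 * esz i * (Z * E + 12) + 6 * (Z * E + 12)"
    by (rule acost_step1)
  moreover have "6 * esz (At v i) * (Z * E + 12) = 6 * esz i * (Z * E + 12) + 6 * (Z * E + 12)"
    by (simp only: esz.simps add_mult_distrib add_mult_distrib2 mult_1_right)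
  ultimately show ?case by metis
next
  case (Plus a b)
  have "int_size (ev (Plus a b) \<sigma>) \<le> Z * esz (Plus a b) + 2"
    using ev_bound[OF assms(2,3) Plus.prems(1)] by (rule int_size_le)
  moreover have "Z * esz (Plus a b) \<le> Z * E" using Plus by (intro mult_left_mono) auto
  moreover have "acost (cex a) s \<le> 6 * esz a * (Z * E + 12)" "acost (cex b) s \<le> 6 * esz b * (Z * E + 12)" using Plus by auto
  ultimately have "acost (cex a) s + acost (cex b) s + int_size (ev (Plus a b) \<sigma>)
      \<le> 6 * esz a * (Z * E + 12) + 6 * esz b * (Z * E + 12) + 6 * (Z * E + 12)" by (rule acost_step2)
  moreover have "acost (cex (Plus a b)) s = acost (cex a) s + acost (cex b) s + int_size (ev (Plus a b) \<sigma>)"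
    using aval_cex[of a s \<sigma>] aval_cex[of b s \<sigma>] assms(1) Plus.prems(1) by simp
  moreover have "6 * esz (Plus a b) * (Z * E + 12)
      = 6 * esz a * (Z * E + 12) + 6 * esz b * (Z * E + 12) + 6 * (Z * E + 12)"
    by (simp only: esz.simps add_mult_distrib add_mult_distrib2 mult_1_right)
  ultimately show ?case by metis
next
  case (Minus a b)
  have "int_size (ev (Minus a b) \<sigma>) \<le> Z * esz (Minus a b) + 2"
    using ev_bound[OF assms(2,3) Minus.prems(1)] by (rule int_size_le)
  moreover have "Z * esz (Minus a b) \<le> Z * E" using Minus by (intro mult_left_mono) auto
  moreover have "acost (cex a) s \<le> 6 * esz a * (Z * E + 12)" "acost (cex b) s \<le> 6 * esz b * (Z * E + 12)" using Minus by auto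
  ultimately have "acost (cex a) s + acost (cex b) s + int_size (ev (Minus a b) \<sigma>)
      \<le> 6 * esz a * (Z * E + 12) + 6 * esz b * (Z * E + 12) + 6 * (Z * E + 12)" by (rule acost_step2)
  moreover have "acost (cex (Minus a b)) s = acost (cex a) s + acost (cex b) s + int_size (ev (Minus a b) \<sigma>)"
    using aval_cex[of a s \<sigma>] aval_cex[of b s \<sigma>] assms(1) Minus.prems(1) by simp
  moreover have "6 * esz (Minus a b) * (Z * E + 12)
      = 6 * esz a * (Z * E + 12) + 6 * esz b * (Z * E + 12) + 6 * (Z * E + 12)"
    by (simp only: esz.simps add_mult_distrib add_mult_distrib2 mult_1_right)
  ultimately show ?case by metis
next
  case (Times a b)
  have "int_size (ev (Times a b) \<sigma>) \<le> Z * esz (Times a b) + 2"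
    using ev_bound[OF assms(2,3) Times.prems(1)] by (rule int_size_le)
  moreover have "Z * esz (Times a b) \<le> Z * E" using Times by (intro mult_left_mono) auto
  moreover have "acost (cex a) s \<le> 6 * esz a * (Z * E + 12)" "acost (cex b) s \<le> 6 * esz b * (Z * E + 12)" using Times by auto
  ultimately have "acost (cex a) s + acost (cex b) s + int_size (ev (Times a b) \<sigma>)
      \<le> 6 * esz a * (Z * E + 12) + 6 * esz b * (Z * E + 12) + 6 * (Z * E + 12)" by (rule acost_step2)
  moreover have "acost (cex (Times a b)) s = acost (cex a) s + acost (cex b) s + int_size (ev (Times a b) \<sigma>)"
    using aval_cex[of a s \<sigma>] aval_cex[of b s \<sigma>] assms(1) Times.prems(1) by simp
  moreover have "6 * esz (Times a b) * (Z * E + 12)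
      = 6 * esz a * (Z * E + 12) + 6 * esz b * (Z * E + 12) + 6 * (Z * E + 12)"
    by (simp only: esz.simps add_mult_distrib add_mult_distrib2 mult_1_right)
  ultimately show ?case by metis
next
  case (Quot a b)
  have "int_size (ev (Quot a b) \<sigma>) \<le> Z * esz (Quot a b) + 2"
    using ev_bound[OF assms(2,3) Quot.prems(1)] by (rule int_size_le)
  moreover have "Z * esz (Quot a b) \<le> Z * E" using Quot by (intro mult_left_mono) auto
  moreover have "acost (cex a) s \<le> 6 * esz a * (Z * E + 12)" "acost (cex b) s \<le> 6 * esz b * (Z * E + 12)" using Quot by auto
  ultimately have "acost (cex a) s + acost (cex b) s + int_size (ev (Quot a b) \<sigma>)
      \<le> 6 * esz a * (Z * E + 12) + 6 * esz b * (Z * E + 12) + 6 * (Z * E + 12)" by (rule acost_step2)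
  moreover have "acost (cex (Quot a b)) s = acost (cex a) s + acost (cex b) s + int_size (ev (Quot a b) \<sigma>)"
    using aval_cex[of a s \<sigma>] aval_cex[of b s \<sigma>] assms(1) Quot.prems(1) by simp
  moreover have "6 * esz (Quot a b) * (Z * E + 12)
      = 6 * esz a * (Z * E + 12) + 6 * esz b * (Z * E + 12) + 6 * (Z * E + 12)"
    by (simp only: esz.simps add_mult_distrib add_mult_distrib2 mult_1_right)
  ultimately show ?case by metis
qed

text \<open>The guard is evaluated once more than the body, hence the factor
  \<open>N + 1\<close>.\<close>

lemma while_rule:
  assumes "P 0 s"
    and "\<And>i s. i < N \<Longrightarrow> P i s \<Longrightarrow> aval a s > 0 \<and> (\<exists>t s'. exec c s t s' \<and> P (Suc i) s' \<and> acost a s + t \<le> B)"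
    and "\<And>s. P N s \<Longrightarrow> aval a s \<le> 0 \<and> acost a s \<le> B"
  shows "\<exists>t s'. exec (WhilePos a c) s t s' \<and> P N s' \<and> t \<le> (N + 1) * B"
proof -
  have "\<exists>t s'. exec (WhilePos a c) s t s' \<and> P N s' \<and> t \<le> (n + 1) * B" if "P (N - n) s" "n \<le> N" for n s
    using that
  proof (induction n arbitrary: s)
    case 0
    then show ?case using assms(3)[of s] by (auto intro!: exI[of _ "acost a s"] exI[of _ s] WhileFalse)
  next
    case (Suc n)
    from assms(2)[OF _ Suc.prems(1)] Suc.prems(2) obtain t s' where
      1: "aval a s > 0" "exec c s t s'" "P (Suc (N - Suc n)) s'" "acost a s + t \<le> B" by auto
    moreover have "Suc (N - Suc n) = N - n" using Suc.prems(2) by simp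
    ultimately obtain t' s'' where 2: "exec (WhilePos a c) s' t' s''" "P N s''" "t' \<le> (n + 1) * B"
      using Suc.IH[of s'] Suc.prems(2) by auto
    have "acost a s + t + t' \<le> (Suc n + 1) * B" using 1(4) 2(3) by simp
    then show ?case using WhileTrue[OF 1(1,2) 2(1)] 2(2) by blast
  qed
  from this[of N s] assms(1) show ?thesis by simp
qed

lemma bounded_store_step:
  assumes "bounded_store y \<sigma>" "0 < y" "arrays_ok e" "tame (v div 64) e" "esz e \<le> C" "v < 192"
  shows "bounded_store (y + C) (\<sigma>(v := (\<sigma> v)(j := ev e \<sigma>)))"
proof -
  have "\<bar>ev e \<sigma>\<bar> \<le> 2 ^ ((y + C) ^ (v div 64 + 1))"
  proof -
    define l where "l = v div 64"
    have "y ^ (l + 1) + esz e * y ^ l \<le> (y + C) * y ^ l" using assms(5) by (simp add: algebra_simps)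
    also have "\<dots> \<le> (y + C) * (y + C) ^ l" by (intro mult_left_mono power_mono) auto
    finally have "y ^ (l + 1) + esz e * y ^ l \<le> (y + C) ^ (l + 1)" by simp
    then have "(2::int) ^ (y ^ (l + 1) + esz e * y ^ l) \<le> 2 ^ ((y + C) ^ (l + 1))" by (intro power_increasing) auto
    then show ?thesis using ev_tame[OF assms(1-4)] unfolding l_def by linarith
  qed
  moreover have "bounded_store (y + C) \<sigma>" using bounded_store_mono[OF assms(1)] assms(2) by simp
  ultimately show ?thesis unfolding bounded_store_def by auto
qed

text \<open>Execution within a budget: \<open>exec\<close> fixes the time exactly, whereas only
  upper bounds compose without bookkeeping.\<close>

definition runs :: "com \<Rightarrow> mem \<Rightarrow> nat \<Rightarrow> mem \<Rightarrow> bool" where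
  "runs c s B s' \<longleftrightarrow> (\<exists>t. exec c s t s' \<and> t \<le> B)"

lemma runs_mono: "runs c s B s' \<Longrightarrow> B \<le> B' \<Longrightarrow> runs c s B' s'"
  unfolding runs_def by (meson order_trans)

lemma runs_Store: "aval a s = p \<Longrightarrow> aval b s = q \<Longrightarrow> acost a s + acost b s \<le> B \<Longrightarrow> runs (Store a b) s B (s(p := q))"
  unfolding runs_def using exec.Store by blast

lemma runs_Seq: "runs c s B s' \<Longrightarrow> runs d s' B' s'' \<Longrightarrow> runs (Seq c d) s (B + B') s''"
  unfolding runs_def using exec.Seq by (meson add_mono)

lemma runs_While:
  assumes "P 0 s"
    and "\<And>i s. i < N \<Longrightarrow> P i s \<Longrightarrow> aval a s > 0 \<and> acost a s \<le> B \<and> (\<exists>s'. runs c s B' s' \<and> P (Suc i) s')"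
    and "\<And>s. P N s \<Longrightarrow> aval a s \<le> 0 \<and> acost a s \<le> B"
  shows "\<exists>s'. runs (WhilePos a c) s ((N + 1) * (B + B')) s' \<and> P N s'"
proof -
  have "\<exists>t s'. exec (WhilePos a c) s t s' \<and> P N s' \<and> t \<le> (N + 1) * (B + B')"
  proof (rule while_rule)
    show "P 0 s" by fact
    show "0 < aval a s \<and> (\<exists>t s'. exec c s t s' \<and> P (Suc i) s' \<and> acost a s + t \<le> B + B')"
      if "i < N" "P i s" for i s
      using assms(2)[OF that] unfolding runs_def by (meson add_mono)
    show "aval a s \<le> 0 \<and> acost a s \<le> B + B'" if "P N s" for s
      using assms(3)[OF that] by auto
  qed
  then show ?thesis unfolding runs_def by blast
qed

lemma esz_pos: "0 < esz e"
  by (induction e) auto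

lemma csz_pos: "0 < csz c"
  by (induction c) (auto simp: esz_pos)

lemma addr_size: "v < 256 \<Longrightarrow> int_size (addr v 0) \<le> 10"
  using int_size_le[of "addr v 0" 8] by (simp add: addr_def)

lemma bounded_storeD:
  assumes "bounded_store y \<sigma>" "0 < y" "y \<le> Y" "v < 192"
  shows "\<bar>\<sigma> v i\<bar> \<le> 2 ^ (Y ^ 3)"
proof -
  have "y ^ (v div 64 + 1) \<le> Y ^ (v div 64 + 1)" using assms by (intro power_mono) auto
  also have "\<dots> \<le> Y ^ 3" using assms by (intro power_increasing) auto
  finally have "(2::int) ^ (y ^ (v div 64 + 1)) \<le> 2 ^ (Y ^ 3)" by (intro power_increasing) auto
  then show ?thesis using assms(1,4) unfolding bounded_store_def by (meson order_trans)
qed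

text \<open>\<open>Y\<close> bounds the growth measure at the end of the whole program, so one cost
  per elementary step serves throughout; with three levels all entries have at most Y^3 bits. The
  bound 60 on the depth keeps the loop counters below the cell that holds \<open>L\<close>.\<close>

lemma compile_correct:
  assumes "wfc c" "d + depth c \<le> 60" "csz c \<le> C" "agree s \<sigma>" "s (addr 255 0) = int L"
    "bounded_store y \<sigma>" "0 < y" "y + C * nst L c \<le> Y" "L \<le> Y"
  shows "\<exists>s'. runs (compile d c) s (nst L c * (10 * C * (Y ^ 3 * C + 12))) s' \<and> agree s' (den L c \<sigma>) \<and>
    s' (addr 255 0) = int L \<and> (\<forall>j<d. s' (addr (192 + j) 0) = s (addr (192 + j) 0)) \<and>
    bounded_store (y + C * nst L c) (den L c \<sigma>)"
  using assms(1-8)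
proof (induction c arbitrary: d s \<sigma> y)
  case Nop
  have "C > 0" using Nop by simp
  then have "1 \<le> 10 * C * (Y ^ 3 * C + 12)" by simp
  then have "runs (compile d Nop) s (nst L Nop * (10 * C * (Y ^ 3 * C + 12))) s"
    unfolding runs_def by (auto intro!: exI[of _ 1] exec.Skip)
  then show ?case using Nop bounded_store_mono[OF Nop.prems(6), of "y + C"] by auto
next
  case (Asg v i e)
  define Z where "Z = Y ^ 3"
  have YZ: "0 < Y" "0 < Z" using Asg.prems(7,8) unfolding Z_def by auto
  have b: "\<bar>\<sigma> w j\<bar> \<le> 2 ^ Z" if "w < 192" for w j
    unfolding Z_def using Asg.prems that by (intro bounded_storeD[OF Asg.prems(6)]) auto
  have wf: "v < 192" "arrays_ok i" "arrays_ok e" "tame (v div 64) e" "esz i + esz e \<le> C"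
    using Asg.prems by auto
  have ci: "acost (cex i) s \<le> 6 * esz i * (Z * C + 12)"
    using acost_bound[OF Asg.prems(4) b YZ(2) wf(2), of C] wf(5) by simp
  have ce: "acost (cex e) s \<le> 6 * esz e * (Z * C + 12)"
    using acost_bound[OF Asg.prems(4) b YZ(2) wf(3), of C] wf(5) by simp
  note ad = acost_addr[OF Asg.prems(4) wf(2) wf(1) ev_bound[OF b YZ(2) wf(2)]]
  have le: "Z * esz i \<le> Z * C" using wf(5) by (intro mult_left_mono) auto
  have "acost (Sub (Const (- 1 - int v)) (Mul (Const 256) (cex i))) s + acost (cex e) s
      \<le> 6 * esz i * (Z * C + 12) + (2 * (Z * C) + 41) + 6 * esz e * (Z * C + 12)"
    using ad(1) ci ce le by linarith
  also have "\<dots> \<le> 6 * (esz i + esz e) * (Z * C + 12) + 4 * 1 * (Z * C + 12)"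
    by (simp add: algebra_simps)
  also have "\<dots> \<le> 6 * C * (Z * C + 12) + 4 * C * (Z * C + 12)"
    using wf(5) esz_pos[of i] by (intro add_mono mult_le_mono1 mult_le_mono2) auto
  also have "\<dots> = 10 * C * (Z * C + 12)" by (simp add: algebra_simps)
  also have "\<dots> \<le> nst L (Asg v i e) * (10 * C * (Z * C + 12))" by simp
  finally have "runs (compile d (Asg v i e)) s (nst L (Asg v i e) * (10 * C * (Z * C + 12))) (s(addr v (ev i \<sigma>) := ev e \<sigma>))"
    unfolding compile.simps by (intro runs_Store ad(2) aval_cex[OF wf(3) Asg.prems(4)])
  moreover have "agree (s(addr v (ev i \<sigma>) := ev e \<sigma>)) (den L (Asg v i e) \<sigma>)"
    using Asg.prems(4) wf(1) unfolding agree_def by (auto simp: addr_eq)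
  moreover have "(s(addr v (ev i \<sigma>) := ev e \<sigma>)) (addr 255 0) = int L" using wf(1) Asg.prems(5) by (simp add: addr_eq)
  moreover have "\<forall>j<d. (s(addr v (ev i \<sigma>) := ev e \<sigma>)) (addr (192 + j) 0) = s (addr (192 + j) 0)"
    using wf(1) Asg.prems(2) by (simp add: addr_eq)
  moreover have "bounded_store (y + C * nst L (Asg v i e)) (den L (Asg v i e) \<sigma>)"
    unfolding den.simps
    by (rule bounded_store_mono[OF bounded_store_step[OF Asg.prems(6,7) wf(3,4) _ wf(1)]])
      (use wf(5) Asg.prems(7) in auto)
  ultimately show ?case unfolding Z_def by blast
next
  case (Sq a b)
  let ?B = "10 * C * (Y ^ 3 * C + 12)"
  have "\<exists>s'. runs (compile d a) s (nst L a * ?B) s' \<and> agree s' (den L a \<sigma>) \<and>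
    s' (addr 255 0) = int L \<and> (\<forall>j<d. s' (addr (192 + j) 0) = s (addr (192 + j) 0)) \<and>
    bounded_store (y + C * nst L a) (den L a \<sigma>)"
    using Sq.prems by (intro Sq.IH(1)) (auto simp: algebra_simps)
  then obtain s' where 1: "runs (compile d a) s (nst L a * ?B) s'" "agree s' (den L a \<sigma>)"
    "s' (addr 255 0) = int L" "\<forall>j<d. s' (addr (192 + j) 0) = s (addr (192 + j) 0)"
    "bounded_store (y + C * nst L a) (den L a \<sigma>)" by blast
  have "\<exists>s''. runs (compile d b) s' (nst L b * ?B) s'' \<and> agree s'' (den L b (den L a \<sigma>)) \<and>
    s'' (addr 255 0) = int L \<and> (\<forall>j<d. s'' (addr (192 + j) 0) = s' (addr (192 + j) 0)) \<and>
    bounded_store (y + C * nst L a + C * nst L b) (den L b (den L a \<sigma>))"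
    using Sq.prems 1 by (intro Sq.IH(2)) (auto simp: algebra_simps)
  then obtain s'' where 2: "runs (compile d b) s' (nst L b * ?B) s''" "agree s'' (den L b (den L a \<sigma>))"
    "s'' (addr 255 0) = int L" "\<forall>j<d. s'' (addr (192 + j) 0) = s' (addr (192 + j) 0)"
    "bounded_store (y + C * nst L a + C * nst L b) (den L b (den L a \<sigma>))" by blast
  have "runs (compile d (Sq a b)) s (nst L (Sq a b) * ?B) s''"
    using runs_Seq[OF 1(1) 2(1)] by (simp only: compile.simps nst.simps add_mult_distrib)
  then show ?case using 1 2 by (intro exI[of _ s'']) (simp add: add_mult_distrib2 add.assoc)
next
  case (Cond e a b)
  let ?B = "10 * C * (Y ^ 3 * C + 12)"
  define Z where "Z = Y ^ 3"
  have YZ: "0 < Y" "0 < Z" using Cond.prems(7,8) unfolding Z_def by auto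
  have bd: "\<bar>\<sigma> w j\<bar> \<le> 2 ^ Z" if "w < 192" for w j
    unfolding Z_def using Cond.prems that by (intro bounded_storeD[OF Cond.prems(6)]) auto
  have "acost (cex e) s \<le> 6 * esz e * (Z * C + 12)"
    using acost_bound[OF Cond.prems(4) bd YZ(2), of e C] Cond.prems by simp
  also have "\<dots> \<le> 10 * C * (Z * C + 12)" using Cond.prems by (intro mult_le_mono) auto
  finally have cost: "acost (cex e) s \<le> ?B" unfolding Z_def .
  have val: "aval (cex e) s = ev e \<sigma>" using Cond.prems by (intro aval_cex) auto
  have *: "\<exists>s'. runs (compile d (Cond e a b)) s (nst L (Cond e a b) * ?B) s' \<and> agree s' (den L x \<sigma>) \<and>
    s' (addr 255 0) = int L \<and> (\<forall>j<d. s' (addr (192 + j) 0) = s (addr (192 + j) 0)) \<and>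
    bounded_store (y + C * nst L (Cond e a b)) (den L x \<sigma>)"
    if IH: "\<exists>s'. runs (compile d x) s (nst L x * ?B) s' \<and> agree s' (den L x \<sigma>) \<and>
      s' (addr 255 0) = int L \<and> (\<forall>j<d. s' (addr (192 + j) 0) = s (addr (192 + j) 0)) \<and>
      bounded_store (y + C * nst L x) (den L x \<sigma>)"
      and x: "(ev e \<sigma> > 0 \<and> x = a) \<or> (\<not> ev e \<sigma> > 0 \<and> x = b)" for x
  proof -
    from IH obtain s' where 1: "runs (compile d x) s (nst L x * ?B) s'" "agree s' (den L x \<sigma>)"
      "s' (addr 255 0) = int L" "\<forall>j<d. s' (addr (192 + j) 0) = s (addr (192 + j) 0)"
      "bounded_store (y + C * nst L x) (den L x \<sigma>)" by blast
    from 1(1) obtain t where t: "exec (compile d x) s t s'" "t \<le> nst L x * ?B" unfolding runs_def by blast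
    have nx: "1 + nst L x \<le> nst L (Cond e a b)" using x by auto
    have "exec (compile d (Cond e a b)) s (acost (cex e) s + t) s'"
      using x t(1) val by (auto intro: exec.IfTrue exec.IfFalse)
    moreover have "acost (cex e) s + t \<le> (1 + nst L x) * ?B"
      unfolding add_mult_distrib mult_1 using cost t(2) by (rule add_mono)
    moreover have "(1 + nst L x) * ?B \<le> nst L (Cond e a b) * ?B" using nx by (intro mult_le_mono1)
    ultimately have "runs (compile d (Cond e a b)) s (nst L (Cond e a b) * ?B) s'"
      unfolding runs_def by (meson order_trans)
    moreover have "y + C * nst L x \<le> y + C * nst L (Cond e a b)" using nx by (intro add_mono mult_le_mono2) auto
    then have "bounded_store (y + C * nst L (Cond e a b)) (den L x \<sigma>)"
      using bounded_store_mono[OF 1(5)] Cond.prems(7) by auto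
    ultimately show ?thesis using 1 by blast
  qed
  show ?case
  proof (cases "ev e \<sigma> > 0")
    case True
    have "?thesis = (\<exists>s'. runs (compile d (Cond e a b)) s (nst L (Cond e a b) * ?B) s' \<and> agree s' (den L a \<sigma>) \<and>
      s' (addr 255 0) = int L \<and> (\<forall>j<d. s' (addr (192 + j) 0) = s (addr (192 + j) 0)) \<and>
      bounded_store (y + C * nst L (Cond e a b)) (den L a \<sigma>))" using True by simp
    moreover have \<dots>
    proof (rule *)
      show "\<exists>s'. runs (compile d a) s (nst L a * ?B) s' \<and> agree s' (den L a \<sigma>) \<and>
        s' (addr 255 0) = int L \<and> (\<forall>j<d. s' (addr (192 + j) 0) = s (addr (192 + j) 0)) \<and>
        bounded_store (y + C * nst L a) (den L a \<sigma>)"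
        using Cond.prems by (intro Cond.IH(1)) (auto simp: algebra_simps)
    qed (use True in blast)
    ultimately show ?thesis by blast
  next
    case False
    have "?thesis = (\<exists>s'. runs (compile d (Cond e a b)) s (nst L (Cond e a b) * ?B) s' \<and> agree s' (den L b \<sigma>) \<and>
      s' (addr 255 0) = int L \<and> (\<forall>j<d. s' (addr (192 + j) 0) = s (addr (192 + j) 0)) \<and>
      bounded_store (y + C * nst L (Cond e a b)) (den L b \<sigma>))" using False by simp
    moreover have \<dots>
    proof (rule *)
      show "\<exists>s'. runs (compile d b) s (nst L b * ?B) s' \<and> agree s' (den L b \<sigma>) \<and>
        s' (addr 255 0) = int L \<and> (\<forall>j<d. s' (addr (192 + j) 0) = s (addr (192 + j) 0)) \<and>
        bounded_store (y + C * nst L b) (den L b \<sigma>)"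
        using Cond.prems by (intro Cond.IH(2)) (auto simp: algebra_simps)
    qed (use False in blast)
    ultimately show ?thesis by blast
  qed
next
  case (Loop a)
  define B where "B = 10 * C * (Y ^ 3 * C + 12)"
  let ?c = "addr (192 + d) 0"
  have C: "0 < C" using csz_pos[of a] Loop.prems by simp
  have Y: "0 < Y" using Loop.prems by auto
  have d: "d < 60" using Loop.prems by simp
  have YB: "2 * Y + 60 \<le> B"
  proof -
    have "Y * 1 * 1 \<le> Y ^ 3 * C" using C Y by (intro mult_le_mono) (auto simp: self_le_power)
    then have "10 * 1 * (Y + 12) \<le> B" unfolding B_def using C by (intro mult_le_mono) auto
    then show ?thesis by simp
  qed
  have LY: "L \<le> Y" by fact
  have sz: "int_size (int k) \<le> Y + 2" if "k \<le> L" for k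
  proof (rule int_size_le)
    have "k < 2 ^ k" by (rule less_exp)
    also have "(2::nat) ^ k \<le> 2 ^ Y" using that LY by (intro power_increasing) auto
    finally have "int k \<le> int (2 ^ Y)" by linarith
    then show "\<bar>int k\<bar> \<le> 2 ^ Y" by simp
  qed
  have ad: "int_size ?c \<le> 10" "int_size (addr 255 0) \<le> 10" using d by (auto intro!: addr_size)
  define n where "n = nst L a"
  have nl: "y + C * (Suc i * n) \<le> Y" if "i < L" for i
  proof -
    have "Suc i * n \<le> nst L (Loop a)"
    proof -
      have "Suc i * n \<le> (L + 1) * (nst L a + 4)" using that unfolding n_def by (intro mult_le_mono) auto
      then show ?thesis by simp
    qed
    then have "C * (Suc i * n) \<le> C * nst L (Loop a)" by (rule mult_le_mono2)
    then show ?thesis using Loop.prems(8) by linarith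
  qed
  define P where "P = (\<lambda>i s'. agree s' ((den L a ^^ i) \<sigma>) \<and> s' (addr 255 0) = int L \<and>
      (\<forall>j<d. s' (addr (192 + j) 0) = s (addr (192 + j) 0)) \<and> s' ?c = int (L - i) \<and>
      bounded_store (y + C * (i * n)) ((den L a ^^ i) \<sigma>))"
  have "\<exists>s'. runs (WhilePos (Load (counter d)) (Seq (compile (Suc d) a) (Store (counter d) (Sub (Load (counter d)) (Const 1)))))
     (s(?c := int L)) ((L + 1) * (B + (n * B + B))) s' \<and> P L s'"
  proof (rule runs_While)
    show "P 0 (s(?c := int L))"
      using Loop.prems d by (auto simp: P_def agree_def addr_eq)
  next
    fix i s1 assume i: "i < L" and P: "P i s1"
    have val: "s1 ?c = int (L - i)" using P by (simp add: P_def)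
    have c1: "acost (Load (counter d)) s1 \<le> B" using val sz[of "L - i"] ad YB by simp
    have pos: "aval (Load (counter d)) s1 > 0" using val i by simp
    have "\<exists>s'. runs (compile (Suc d) a) s1 (nst L a * (10 * C * (Y ^ 3 * C + 12))) s' \<and> agree s' (den L a ((den L a ^^ i) \<sigma>)) \<and>
    s' (addr 255 0) = int L \<and> (\<forall>j<Suc d. s' (addr (192 + j) 0) = s1 (addr (192 + j) 0)) \<and>
    bounded_store (y + C * (i * n) + C * nst L a) (den L a ((den L a ^^ i) \<sigma>))"
      using Loop.prems P nl[OF i] by (intro Loop.IH) (auto simp: P_def n_def algebra_simps)
    then obtain s2 where 2: "runs (compile (Suc d) a) s1 (n * B) s2" "agree s2 (den L a ((den L a ^^ i) \<sigma>))"
      "s2 (addr 255 0) = int L" "\<forall>j<Suc d. s2 (addr (192 + j) 0) = s1 (addr (192 + j) 0)"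
      "bounded_store (y + C * (i * n) + C * n) (den L a ((den L a ^^ i) \<sigma>))" unfolding B_def n_def by blast
    have v2: "s2 ?c = int (L - i)" using 2(4) val by simp
    have "runs (Store (counter d) (Sub (Load (counter d)) (Const 1))) s2 B (s2(?c := int (L - Suc i)))"
    proof (rule runs_Store)
      show "aval (Sub (Load (counter d)) (Const 1)) s2 = int (L - Suc i)" using v2 i by simp
      have eq: "int (L - i) - 1 = int (L - Suc i)" using i by simp
      have "acost (counter d) s2 + acost (Sub (Load (counter d)) (Const 1)) s2 =
        int_size ?c + (int_size ?c + int_size (int (L - i)) + int_size 1 + int_size (int (L - Suc i)))"
        by (simp only: acost.simps aval.simps v2 eq)
      moreover have "int_size 1 \<le> 0 + 2" by (rule int_size_le) simp
      ultimately show "acost (counter d) s2 + acost (Sub (Load (counter d)) (Const 1)) s2 \<le> B"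
        using sz[of "L - i"] sz[of "L - Suc i"] ad YB by simp
    qed simp
    from runs_Seq[OF 2(1) this]
    have "runs (Seq (compile (Suc d) a) (Store (counter d) (Sub (Load (counter d)) (Const 1)))) s1 (n * B + B) (s2(?c := int (L - Suc i)))" .
    moreover have "P (Suc i) (s2(?c := int (L - Suc i)))"
      using 2 P d unfolding P_def by (auto simp: agree_def addr_eq algebra_simps)
    ultimately show "0 < aval (Load (counter d)) s1 \<and> acost (Load (counter d)) s1 \<le> B \<and>
        (\<exists>s'. runs (Seq (compile (Suc d) a) (Store (counter d) (Sub (Load (counter d)) (Const 1)))) s1 (n * B + B) s' \<and> P (Suc i) s')"
      using c1 pos by blast
  next
    fix s1 assume "P L s1"
    then have "s1 ?c = int 0" by (simp add: P_def)
    then show "aval (Load (counter d)) s1 \<le> 0 \<and> acost (Load (counter d)) s1 \<le> B"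
      using sz[of 0] ad YB by simp
  qed
  then obtain s' where s': "runs (WhilePos (Load (counter d)) (Seq (compile (Suc d) a) (Store (counter d) (Sub (Load (counter d)) (Const 1)))))
     (s(?c := int L)) ((L + 1) * (B + (n * B + B))) s'" and P: "P L s'" by blast
  have "runs (Store (counter d) (Load (Const (addr 255 0)))) s B (s(?c := int L))"
    by (rule runs_Store) (use Loop.prems(5) ad sz[of L] YB in auto)
  from runs_Seq[OF this s'] have "runs (compile d (Loop a)) s (B + (L + 1) * (B + (n * B + B))) s'" by simp
  moreover have "B + (L + 1) * (B + (n * B + B)) \<le> nst L (Loop a) * B"
    by (simp add: n_def algebra_simps)
  ultimately have r: "runs (compile d (Loop a)) s (nst L (Loop a) * B) s'" by (rule runs_mono)
  have "L * n \<le> nst L (Loop a)" by (simp add: n_def algebra_simps)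
  then have "y + C * (L * n) \<le> y + C * nst L (Loop a)" by simp
  then have "bounded_store (y + C * nst L (Loop a)) (den L (Loop a) \<sigma>)"
    using P Loop.prems(7) unfolding P_def den.simps by (meson bounded_store_mono add_pos_nonneg zero_le)
  then show ?case using r P unfolding P_def B_def den.simps by blast
qed

section \<open>Moving input and output between the machine addresses and the arrays\<close>

abbreviation cnt_cell :: int where "cnt_cell \<equiv> addr 192 0"
abbreviation bit_cell :: int where "bit_cell \<equiv> addr 193 0"
abbreviation size_cell :: int where "size_cell \<equiv> addr 255 0"

text \<open>Repeated halving measures nonnegative integers only, hence the sign condition on the
  input words later on.\<close>

definition count_bits :: com where
  "count_bits = WhilePos (Load (Const bit_cell))
     (Seq (Store (Const bit_cell) (Div (Load (Const bit_cell)) (Const 2)))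
       (Store (Const size_cell) (Add (Load (Const size_cell)) (Const 1))))"

definition array_cell :: "nat \<Rightarrow> aexp" where
  "array_cell v = Sub (Const (- 1 - int v)) (Mul (Const 256) (Load (Const cnt_cell)))"

definition decrement :: com where
  "decrement = Store (Const cnt_cell) (Sub (Load (Const cnt_cell)) (Const 1))"

text \<open>The words are taken from the last to the first, and each adds its bit length plus one,
  as in \<open>int_size\<close>. The auxiliary cells are those of the two outermost loop counters,
  which are free before the compiled program starts.\<close>

definition prologue :: com where
  "prologue = Seq (Store (Const cnt_cell) (Load (Const 0)))
    (Seq (WhilePos (Load (Const cnt_cell))
      (Seq (Store (array_cell 0) (Load (Load (Const cnt_cell))))
        (Seq (Store (Const bit_cell) (Load (Load (Const cnt_cell))))
          (Seq (Store (Const size_cell) (Add (Load (Const size_cell)) (Const 1)))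
            (Seq count_bits decrement)))))
     (Store (Const (addr 0 0)) (Load (Const size_cell))))"

text \<open>Nonnegative indices of array 1 have negative addresses, so writing the output to
  positive addresses does not disturb the entries still to be read.\<close>

definition epilogue :: com where
  "epilogue = Seq (Store (Const cnt_cell) (Load (Const (addr 1 0))))
    (Seq (WhilePos (Load (Const cnt_cell))
      (Seq (Store (Load (Const cnt_cell)) (Load (array_cell 1))) decrement))
     (Store (Const 0) (Load (Const (addr 1 0)))))"

lemma cells: "int_size cnt_cell \<le> 10" "int_size bit_cell \<le> 10" "int_size size_cell \<le> 10"
  "int_size (addr 0 0) \<le> 10" "int_size (addr 1 0) \<le> 10" "int_size 1 \<le> 2" "int_size 2 \<le> 3" "int_size 0 \<le> 2"
  "int_size 256 \<le> 10"
  using int_size_le[of 1 0] int_size_le[of 2 1] int_size_le[of 0 0] int_size_le[of 256 8] by (simp_all add: addr_size)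

lemma less_pow2: "n \<le> L \<Longrightarrow> int n \<le> 2 ^ L"
proof -
  assume "n \<le> L"
  moreover have "L < 2 ^ L" by (rule less_exp)
  ultimately have "int n \<le> int (2 ^ L)" by linarith
  then show ?thesis by simp
qed

lemma size_nat: "n \<le> L \<Longrightarrow> int_size (int n) \<le> L + 2"
  using less_pow2 by (intro int_size_le) simp

lemma count_bits_runs:
  assumes "0 \<le> k" "s bit_cell = k" "s size_cell = int l" "l + nat (bitlen k) \<le> L" "k \<le> 2 ^ L"
  shows "\<exists>s'. runs count_bits s ((nat (bitlen k) + 1) * (3 * (6 * L + 100))) s' \<and>
    s' size_cell = int (l + nat (bitlen k)) \<and> (\<forall>a. a \<noteq> bit_cell \<and> a \<noteq> size_cell \<longrightarrow> s' a = s a)"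
proof -
  define N where "N = nat (bitlen k)"
  let ?D = "6 * L + 100"
  define P where "P = (\<lambda>i s'. s' bit_cell = k div 2 ^ i \<and> s' size_cell = int (l + i) \<and>
     (\<forall>a. a \<noteq> bit_cell \<and> a \<noteq> size_cell \<longrightarrow> s' a = s a))"
  have ne: "bit_cell \<noteq> size_cell" by (simp add: addr_eq)
  have kb: "\<bar>k div 2 ^ i\<bar> \<le> 2 ^ L" for i
    using div_abs_le[of k "2 ^ i"] assms(1,5) by linarith
  have sk: "int_size (k div 2 ^ i) \<le> L + 2" for i using int_size_le[OF kb] .
  have k2: "k < 2 ^ N"
    using bitlen_bounds[of k] assms(1) by (cases "k = 0") (auto simp: N_def)
  have k1: "k div 2 ^ i > 0" if "i < N" for i
  proof -
    have "k > 0" using that assms(1) by (cases "k = 0") (auto simp: N_def)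
    moreover have "N - 1 = nat (bitlen k - 1)" unfolding N_def by linarith
    ultimately have "2 ^ (N - 1) \<le> k" using bitlen_bounds[of k] by simp
    moreover have "(2::int) ^ i \<le> 2 ^ (N - 1)" using that by (intro power_increasing) auto
    ultimately have "2 ^ i \<le> k" by linarith
    then show ?thesis by (simp add: pos_imp_zdiv_pos_iff)
  qed
  have "\<exists>s'. runs count_bits s ((N + 1) * (?D + (?D + ?D))) s' \<and> P N s'"
    unfolding count_bits_def
  proof (rule runs_While)
    show "P 0 s" using assms by (simp add: P_def)
  next
    fix i s1 assume i: "i < N" and P: "P i s1"
    let ?s2 = "s1(bit_cell := k div 2 ^ Suc i)"
    have "runs (Store (Const bit_cell) (Div (Load (Const bit_cell)) (Const 2))) s1 ?D ?s2"
    proof (rule runs_Store)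
      have eq: "s1 bit_cell div 2 = k div 2 ^ Suc i" using P by (simp add: P_def zdiv_zmult2_eq[symmetric] mult.commute)
      then show "aval (Div (Load (Const bit_cell)) (Const 2)) s1 = k div 2 ^ Suc i" by simp
      have "acost (Const bit_cell) s1 + acost (Div (Load (Const bit_cell)) (Const 2)) s1 =
        int_size bit_cell + (int_size bit_cell + int_size (k div 2 ^ i) + int_size 2 + int_size (k div 2 ^ Suc i))"
        using P eq by (simp only: acost.simps aval.simps P_def)
      then show "acost (Const bit_cell) s1 + acost (Div (Load (Const bit_cell)) (Const 2)) s1 \<le> ?D"
        using cells sk[of i] sk[of "Suc i"] by linarith
    qed simp
    moreover have "runs (Store (Const size_cell) (Add (Load (Const size_cell)) (Const 1))) ?s2 ?D (?s2(size_cell := int (l + Suc i)))"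
    proof (rule runs_Store)
      have eq: "?s2 size_cell = int (l + i)" using P ne by (simp add: P_def)
      then show "aval (Add (Load (Const size_cell)) (Const 1)) ?s2 = int (l + Suc i)" by simp
      have e2: "int (l + i) + 1 = int (l + Suc i)" by simp
      have "acost (Const size_cell) ?s2 + acost (Add (Load (Const size_cell)) (Const 1)) ?s2 =
        int_size size_cell + (int_size size_cell + int_size (int (l + i)) + int_size 1 + int_size (int (l + Suc i)))"
        by (simp only: acost.simps aval.simps eq e2)
      then show "acost (Const size_cell) ?s2 + acost (Add (Load (Const size_cell)) (Const 1)) ?s2 \<le> ?D"
        using cells size_nat[of "l + i" L] size_nat[of "l + Suc i" L] i assms(4) unfolding N_def by linarith
    qed simp
    moreover have "P (Suc i) (?s2(size_cell := int (l + Suc i)))" using P ne by (auto simp: P_def)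
    moreover have "0 < aval (Load (Const bit_cell)) s1" using P k1[OF i] by (simp add: P_def)
    moreover have "acost (Load (Const bit_cell)) s1 \<le> ?D" using P cells sk[of i] by (simp add: P_def)
    ultimately show "0 < aval (Load (Const bit_cell)) s1 \<and> acost (Load (Const bit_cell)) s1 \<le> ?D \<and>
      (\<exists>s'. runs (Seq (Store (Const bit_cell) (Div (Load (Const bit_cell)) (Const 2)))
       (Store (Const size_cell) (Add (Load (Const size_cell)) (Const 1)))) s1 (?D + ?D) s' \<and> P (Suc i) s')"
      using runs_Seq by blast
  next
    fix s1 assume P: "P N s1"
    have "k div 2 ^ N = 0" using k2 assms(1) by (simp add: div_pos_pos_trivial)
    then show "aval (Load (Const bit_cell)) s1 \<le> 0 \<and> acost (Load (Const bit_cell)) s1 \<le> ?D"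
      using P cells by (simp add: P_def)
  qed
  moreover have "?D + (?D + ?D) = 3 * ?D" by simp
  ultimately show ?thesis unfolding P_def N_def by metis
qed

definition init_store :: "int list \<Rightarrow> store \<Rightarrow> bool" where
  "init_store ks \<sigma> \<longleftrightarrow> \<sigma> 0 0 = int (word_size ks) \<and> (\<forall>i<length ks. \<sigma> 0 (int i + 1) = ks ! i)"

lemma array_cell_val: "aval (array_cell v) s = addr v (s cnt_cell)"
  by (simp add: array_cell_def addr_def)

lemma array_cell_cost:
  assumes "v < 192" "\<bar>s cnt_cell\<bar> \<le> 2 ^ m"
  shows "acost (array_cell v) s \<le> 3 * m + 55"
proof -
  have 1: "\<bar>- 1 - int v\<bar> \<le> 2 ^ 8" using assms(1) by simp
  have 2: "\<bar>256 * s cnt_cell\<bar> \<le> 2 ^ (8 + m)" using pow_mult_le[of 256 8 "s cnt_cell" m "8 + m"] assms(2) by simp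
  have 3: "\<bar>- 1 - int v - 256 * s cnt_cell\<bar> \<le> 2 ^ (9 + m)" by (rule pow_add_le(2)[OF 1 2]) auto
  have "acost (array_cell v) s = int_size (- 1 - int v) +
      (int_size 256 + (int_size cnt_cell + int_size (s cnt_cell)) + int_size (256 * s cnt_cell)) + int_size (- 1 - int v - 256 * s cnt_cell)"
    by (simp only: array_cell_def acost.simps aval.simps)
  then show ?thesis using int_size_le[OF 1] int_size_le[OF 2] int_size_le[OF 3] int_size_le[OF assms(2)] cells by linarith
qed

lemma decrement_runs:
  assumes "s cnt_cell = int (Suc n)" "Suc n \<le> L"
  shows "runs decrement s (6 * L + 100) (s(cnt_cell := int n))"
  unfolding decrement_def
proof (rule runs_Store)
  have e: "int (Suc n) - 1 = int n" by simp
  have "acost (Const cnt_cell) s + acost (Sub (Load (Const cnt_cell)) (Const 1)) s =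
    int_size cnt_cell + (int_size cnt_cell + int_size (int (Suc n)) + int_size 1 + int_size (int n))"
    by (simp only: acost.simps aval.simps assms(1) e)
  then show "acost (Const cnt_cell) s + acost (Sub (Load (Const cnt_cell)) (Const 1)) s \<le> 6 * L + 100"
    using cells size_nat[of n L] size_nat[of "Suc n" L] assms(2) by linarith
qed (use assms in auto)

lemma word_size_Cons: "word_size (k # ks) = int_size k + word_size ks"
  by (simp add: word_size_def)

lemma length_le_word_size: "length ks \<le> word_size ks"
  by (induction ks) (auto simp: word_size_Cons int_size_def word_size_def)

lemma word_size_drop: "word_size (drop i ks) \<le> word_size ks"
proof (induction ks arbitrary: i)
  case (Cons k ks)
  then show ?case by (cases i) (auto simp: word_size_Cons intro: trans_le_add2)
qed simp

lemma word_le_pow: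
  assumes "k \<in> set ks" "0 \<le> k"
  shows "k \<le> 2 ^ word_size ks"
proof -
  obtain i where i: "i < length ks" "ks ! i = k" using assms(1) by (auto simp: in_set_conv_nth)
  have "nat (bitlen k) \<le> word_size ks"
    using word_size_drop[of i ks] i assms(2) by (simp add: Cons_nth_drop_Suc[symmetric] word_size_Cons int_size_def)
  moreover have "k \<le> 2 ^ nat (bitlen k)" using bitlen_bounds[of k] assms(2) by (cases "k = 0") auto
  moreover have "nat (bitlen k) \<le> word_size ks \<Longrightarrow> (2::int) ^ nat (bitlen k) \<le> 2 ^ word_size ks" by (intro power_increasing) auto
  ultimately show ?thesis by linarith
qed

lemma addr_neg: "0 \<le> i \<Longrightarrow> addr v i < 0"
  by (simp add: addr_def)

lemma prologue_runs:
  assumes ks: "\<forall>k\<in>set ks. 0 \<le> k"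
  defines "L \<equiv> word_size ks"
  shows "\<exists>s'. runs prologue (input_mem ks) ((L + 2) * (6 * L + 100) * (3 * L + 7)) s' \<and> s' size_cell = int L \<and>
    s' (addr 0 0) = int L \<and> (\<forall>i<length ks. s' (addr 0 (int i + 1)) = ks ! i) \<and>
    (\<forall>v<192. \<forall>i. \<bar>s' (addr v i)\<bar> \<le> 2 ^ L)"
proof -
  let ?D = "6 * L + 100"
  define n where "n = length ks"
  have nL: "n \<le> L" using length_le_word_size unfolding n_def L_def .
  have inb: "\<bar>input_mem ks a\<bar> \<le> 2 ^ L" for a
  proof -
    have "ks ! nat (a - 1) \<in> set ks" if "1 \<le> a" "a \<le> int (length ks)" using that by (intro nth_mem) linarith
    moreover have "\<bar>int n\<bar> \<le> 2 ^ L" using less_pow2[OF nL] by simp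
    ultimately show ?thesis using ks word_le_pow[of _ ks] unfolding input_mem_def L_def n_def by auto
  qed
  let ?s0 = "(input_mem ks)(cnt_cell := int n)"
  have ad: "cnt_cell < 0" "bit_cell < 0" "size_cell < 0" by (auto intro: addr_neg)
  have r0: "runs (Store (Const cnt_cell) (Load (Const 0))) (input_mem ks) ?D ?s0"
    by (rule runs_Store) (use cells size_nat[OF nL] in \<open>auto simp: input_mem_def n_def\<close>)
  \<comment> \<open>The last clause ranges over negative indices as well; those are addresses in the
    input area.\<close>
  define P where "P = (\<lambda>i s. s cnt_cell = int (n - i) \<and> s size_cell = int (word_size (drop (n - i) ks)) \<and>
     (\<forall>a\<ge>0. s a = input_mem ks a) \<and> (\<forall>j. n - i \<le> j \<and> j < n \<longrightarrow> s (addr 0 (int j + 1)) = ks ! j) \<and>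
     (\<forall>v<192. \<forall>i. \<bar>s (addr v i)\<bar> \<le> 2 ^ L))"
  let ?body = "Seq (Store (array_cell 0) (Load (Load (Const cnt_cell))))
        (Seq (Store (Const bit_cell) (Load (Load (Const cnt_cell))))
          (Seq (Store (Const size_cell) (Add (Load (Const size_cell)) (Const 1)))
            (Seq count_bits decrement)))"
  have "\<exists>s'. runs (WhilePos (Load (Const cnt_cell)) ?body) ?s0 ((n + 1) * (?D + (?D + (?D + (?D + (L * (3 * ?D) + ?D)))))) s' \<and> P n s'"
  proof (rule runs_While)
    have "int v + 256 * i \<noteq> 192" if "v < 192" for v i
      using addr_eq[of v 192 i 0] that by (auto simp: addr_def)
    then show "P 0 ?s0"
      using inb ad unfolding P_def n_def by (auto simp: addr_eq input_mem_def word_size_def)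
  next
    fix i s assume i: "i < n" and P: "P i s"
    define m where "m = n - Suc i"
    have m: "m < n" "n - i = Suc m" "Suc m \<le> L" using i nL by (auto simp: m_def)
    define k where "k = ks ! m"
    have k: "k \<in> set ks" "0 \<le> k" "k \<le> 2 ^ L" using m ks word_le_pow[of k ks] by (auto simp: k_def n_def L_def)
    have c: "s cnt_cell = int (Suc m)" using P m by (simp add: P_def)
    have sk: "s (int (Suc m)) = k" using P m by (simp add: P_def input_mem_def k_def n_def)
    have szk: "int_size k \<le> L + 2" using k by (intro int_size_le) auto
    have szm: "int_size (int (Suc m)) \<le> L + 2" using size_nat[OF m(3)] .
    define l where "l = word_size (drop (Suc m) ks)"
    have l: "s size_cell = int l" using P m by (simp add: P_def l_def)
    have dl: "word_size (drop m ks) = int_size k + l"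
      using m by (simp add: l_def k_def n_def Cons_nth_drop_Suc[symmetric] word_size_Cons)
    have lL: "l + 1 + nat (bitlen k) \<le> L" using dl word_size_drop[of m ks] k(2) by (simp add: int_size_def L_def)
    have ikL: "nat (bitlen k) + 1 \<le> L" using lL by simp
    let ?a = "addr 0 (int (Suc m))"
    let ?s1 = "s(?a := k)"
    have r1: "runs (Store (array_cell 0) (Load (Load (Const cnt_cell)))) s ?D ?s1"
    proof (rule runs_Store)
      have "acost (array_cell 0) s \<le> 3 * L + 55" using less_pow2[OF m(3)] c by (intro array_cell_cost) auto
      moreover have "acost (Load (Load (Const cnt_cell))) s = int_size cnt_cell + int_size (int (Suc m)) + int_size k"
        by (simp only: acost.simps aval.simps c sk)
      ultimately show "acost (array_cell 0) s + acost (Load (Load (Const cnt_cell))) s \<le> ?D"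
        using szk szm cells by linarith
    qed (use c sk in \<open>simp_all add: array_cell_val\<close>)
    have c1: "?s1 cnt_cell = int (Suc m)" "?s1 (int (Suc m)) = k" "?s1 size_cell = int l"
      using c sk l addr_neg[of "int (Suc m)" 0] by (auto simp: addr_eq)
    let ?s2 = "?s1(bit_cell := k)"
    have r2: "runs (Store (Const bit_cell) (Load (Load (Const cnt_cell)))) ?s1 ?D ?s2"
    proof (rule runs_Store)
      have "acost (Const bit_cell) ?s1 + acost (Load (Load (Const cnt_cell))) ?s1 = int_size bit_cell + (int_size cnt_cell + int_size (int (Suc m)) + int_size k)"
        by (simp only: acost.simps aval.simps c1)
      then show "acost (Const bit_cell) ?s1 + acost (Load (Load (Const cnt_cell))) ?s1 \<le> ?D"
        using szk szm cells by linarith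
      show "aval (Load (Load (Const cnt_cell))) ?s1 = k" by (simp only: aval.simps c1)
    qed simp
    have c2: "?s2 size_cell = int l" using c1 by (simp add: addr_eq)
    let ?s3 = "?s2(size_cell := int (l + 1))"
    have r3: "runs (Store (Const size_cell) (Add (Load (Const size_cell)) (Const 1))) ?s2 ?D ?s3"
    proof (rule runs_Store)
      have e: "int l + 1 = int (l + 1)" by simp
      have "acost (Const size_cell) ?s2 + acost (Add (Load (Const size_cell)) (Const 1)) ?s2 = int_size size_cell + (int_size size_cell + int_size (int l) + int_size 1 + int_size (int (l + 1)))"
        by (simp only: acost.simps aval.simps c2 e)
      then show "acost (Const size_cell) ?s2 + acost (Add (Load (Const size_cell)) (Const 1)) ?s2 \<le> ?D"
        using cells size_nat[of l L] size_nat[of "l + 1" L] lL by linarith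
      show "aval (Add (Load (Const size_cell)) (Const 1)) ?s2 = int (l + 1)" by (simp only: aval.simps c2 e)
    qed simp
    have "\<exists>s'. runs count_bits ?s3 ((nat (bitlen k) + 1) * (3 * ?D)) s' \<and>
      s' size_cell = int (l + 1 + nat (bitlen k)) \<and> (\<forall>a. a \<noteq> bit_cell \<and> a \<noteq> size_cell \<longrightarrow> s' a = ?s3 a)"
      by (rule count_bits_runs) (use k lL in \<open>auto simp: addr_eq\<close>)
    then obtain s4 where r4: "runs count_bits ?s3 ((nat (bitlen k) + 1) * (3 * ?D)) s4"
      and s4: "s4 size_cell = int (l + 1 + nat (bitlen k))" "\<And>a. a \<noteq> bit_cell \<Longrightarrow> a \<noteq> size_cell \<Longrightarrow> s4 a = ?s3 a" by blast
    have r4': "runs count_bits ?s3 (L * (3 * ?D)) s4" by (rule runs_mono[OF r4]) (use ikL in \<open>intro mult_le_mono1\<close>)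
    have "s4 cnt_cell = int (Suc m)" using s4(2)[of cnt_cell] c1(1) by (simp add: addr_eq)
    then have r5: "runs decrement s4 ?D (s4(cnt_cell := int m))" using m by (intro decrement_runs)
    let ?s5 = "s4(cnt_cell := int m)"
    have R: "runs ?body s (?D + (?D + (?D + (L * (3 * ?D) + ?D)))) ?s5"
      by (rule runs_Seq[OF r1 runs_Seq[OF r2 runs_Seq[OF r3 runs_Seq[OF r4' r5]]]])
    have "?s5 size_cell = int (word_size (drop m ks))"
      using s4(1) dl k(2) by (simp add: addr_eq int_size_def)
    moreover have in5: "?s5 a = (if a = ?a then k else s a)" if "a \<notin> {cnt_cell, bit_cell, size_cell}" for a
      using that s4(2)[of a] by auto
    have "\<forall>a\<ge>0. ?s5 a = input_mem ks a"
    proof (intro allI impI)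
      fix a :: int assume a: "0 \<le> a"
      then have "a \<notin> {cnt_cell, bit_cell, size_cell}" "a \<noteq> ?a" using ad addr_neg[of "int (Suc m)" 0] by auto
      then show "?s5 a = input_mem ks a" using in5[of a] P a by (simp add: P_def)
    qed
    moreover have "?s5 (addr 0 (int j + 1)) = ks ! j" if "m \<le> j" "j < n" for j
    proof -
      have "?s5 (addr 0 (int j + 1)) = (if addr 0 (int j + 1) = ?a then k else s (addr 0 (int j + 1)))"
        by (rule in5) (simp add: addr_eq)
      then show ?thesis using P m that by (auto simp: P_def addr_eq k_def)
    qed
    moreover have "\<bar>?s5 (addr v j)\<bar> \<le> 2 ^ L" if "v < 192" for v j
    proof -
      have "?s5 (addr v j) = (if addr v j = ?a then k else s (addr v j))"
        by (rule in5) (use that in \<open>simp add: addr_eq\<close>)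
      then show ?thesis using P k that by (auto simp: P_def)
    qed
    ultimately have "P (Suc i) ?s5" unfolding P_def m_def by auto
    moreover have "0 < aval (Load (Const cnt_cell)) s" using c by simp
    moreover have "acost (Load (Const cnt_cell)) s = int_size cnt_cell + int_size (int (Suc m))"
      by (simp only: acost.simps aval.simps c)
    then have "acost (Load (Const cnt_cell)) s \<le> ?D" using szm cells by linarith
    ultimately show "0 < aval (Load (Const cnt_cell)) s \<and> acost (Load (Const cnt_cell)) s \<le> ?D \<and>
      (\<exists>s'. runs ?body s (?D + (?D + (?D + (L * (3 * ?D) + ?D)))) s' \<and> P (Suc i) s')" using R by blast
  next
    fix s assume "P n s"
    then show "aval (Load (Const cnt_cell)) s \<le> 0 \<and> acost (Load (Const cnt_cell)) s \<le> ?D"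
      using cells by (simp add: P_def)
  qed
  then obtain s1 where r1: "runs (WhilePos (Load (Const cnt_cell)) ?body) ?s0 ((n + 1) * (?D + (?D + (?D + (?D + (L * (3 * ?D) + ?D)))))) s1" and P: "P n s1" by blast
  have sL: "s1 size_cell = int L" using P by (simp add: P_def L_def)
  have r2: "runs (Store (Const (addr 0 0)) (Load (Const size_cell))) s1 ?D (s1(addr 0 0 := int L))"
    by (rule runs_Store) (use sL cells size_nat[of L L] in auto)
  have "runs prologue (input_mem ks) (?D + ((n + 1) * (?D + (?D + (?D + (?D + (L * (3 * ?D) + ?D))))) + ?D)) (s1(addr 0 0 := int L))"
    unfolding prologue_def by (rule runs_Seq[OF r0 runs_Seq[OF r1 r2]])
  moreover have "?D + ((n + 1) * (?D + (?D + (?D + (?D + (L * (3 * ?D) + ?D))))) + ?D) \<le> (L + 2) * ?D * (3 * L + 7)"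
  proof -
    define D where "D = ?D"
    have "(n + 1) * (D + (D + (D + (D + (L * (3 * D) + D))))) \<le> (L + 1) * (D + (D + (D + (D + (L * (3 * D) + D)))))"
      using nL by (intro mult_le_mono1) simp
    moreover have "D + ((L + 1) * (D + (D + (D + (D + (L * (3 * D) + D))))) + D) \<le> (L + 2) * D * (3 * L + 7)"
      by (simp add: algebra_simps)
    ultimately show ?thesis unfolding D_def by linarith
  qed
  ultimately have "runs prologue (input_mem ks) ((L + 2) * ?D * (3 * L + 7)) (s1(addr 0 0 := int L))" by (rule runs_mono)
  moreover have "(s1(addr 0 0 := int L)) (addr 0 (int i + 1)) = ks ! i" if "i < length ks" for i
    using P that by (auto simp: P_def n_def addr_eq)
  moreover have "\<bar>(s1(addr 0 0 := int L)) (addr v i)\<bar> \<le> 2 ^ L" if "v < 192" for v i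
    using P that less_pow2[of L L] by (auto simp: P_def)
  ultimately show ?thesis using sL by (intro exI[of _ "s1(addr 0 0 := int L)"]) (auto simp: addr_eq)
qed

lemma epilogue_runs:
  assumes "\<And>i. \<bar>s (addr 1 i)\<bar> \<le> 2 ^ Z" "s (addr 1 0) = int n" "n \<le> Z"
  shows "\<exists>s'. runs epilogue s ((Z + 2) * (4 * (6 * Z + 100))) s' \<and> output_word s' = map (\<lambda>i. s (addr 1 i)) [1..int n]"
proof -
  let ?D = "6 * Z + 100"
  have sz: "int_size (s (addr 1 i)) \<le> Z + 2" for i using assms(1) by (rule int_size_le)
  have r0: "runs (Store (Const cnt_cell) (Load (Const (addr 1 0)))) s ?D (s(cnt_cell := int n))"
    by (rule runs_Store) (use assms(2) cells size_nat[OF assms(3)] in auto)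
  define P where "P = (\<lambda>i s'. s' cnt_cell = int (n - i) \<and> (\<forall>j\<ge>0. s' (addr 1 j) = s (addr 1 j)) \<and>
    (\<forall>j. int (n - i) < j \<and> j \<le> int n \<longrightarrow> s' j = s (addr 1 j)))"
  let ?body = "Seq (Store (Load (Const cnt_cell)) (Load (array_cell 1))) decrement"
  have "\<exists>s'. runs (WhilePos (Load (Const cnt_cell)) ?body) (s(cnt_cell := int n)) ((n + 1) * (?D + (?D + ?D))) s' \<and> P n s'"
  proof (rule runs_While)
    show "P 0 (s(cnt_cell := int n))" by (auto simp: P_def addr_eq)
  next
    fix i s1 assume i: "i < n" and P: "P i s1"
    define m where "m = n - Suc i"
    have m: "n - i = Suc m" "Suc m \<le> Z" using i assms(3) by (auto simp: m_def)
    have c: "s1 cnt_cell = int (Suc m)" using P m by (simp add: P_def)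
    have szm: "int_size (int (Suc m)) \<le> Z + 2" using size_nat[OF m(2)] .
    let ?k = "s (addr 1 (int (Suc m)))"
    have av: "s1 (aval (array_cell 1) s1) = ?k" using P c by (simp add: P_def array_cell_val)
    have r1: "runs (Store (Load (Const cnt_cell)) (Load (array_cell 1))) s1 ?D (s1(int (Suc m) := ?k))"
    proof (rule runs_Store)
      have "acost (array_cell 1) s1 \<le> 3 * Z + 55" using less_pow2[OF m(2)] c by (intro array_cell_cost) auto
      moreover have "acost (Load (Const cnt_cell)) s1 + acost (Load (array_cell 1)) s1 = int_size cnt_cell + int_size (int (Suc m)) + (acost (array_cell 1) s1 + int_size ?k)"
        by (simp only: acost.simps aval.simps c av)
      ultimately show "acost (Load (Const cnt_cell)) s1 + acost (Load (array_cell 1)) s1 \<le> ?D"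
        using szm sz[of "int (Suc m)"] cells by linarith
    qed (use c av in simp_all)
    have ne: "cnt_cell \<noteq> int (Suc m)" using addr_neg[of 0 192] by simp
    have r2: "runs decrement (s1(int (Suc m) := ?k)) ?D (s1(int (Suc m) := ?k, cnt_cell := int m))"
      by (rule decrement_runs) (use c ne m in auto)
    have "P (Suc i) (s1(int (Suc m) := ?k, cnt_cell := int m))"
      unfolding P_def
    proof (intro conjI allI impI)
      show "(s1(int (Suc m) := ?k, cnt_cell := int m)) cnt_cell = int (n - Suc i)" by (simp add: m_def)
      show "(s1(int (Suc m) := ?k, cnt_cell := int m)) (addr 1 j) = s (addr 1 j)" if "0 \<le> j" for j
        using that P addr_neg[OF that, of 1] by (auto simp: P_def addr_eq)
      show "(s1(int (Suc m) := ?k, cnt_cell := int m)) j = s (addr 1 j)" if "int (n - Suc i) < j \<and> j \<le> int n" for j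
      proof -
        have "j \<noteq> cnt_cell" using that addr_neg[of 0 192] by auto
        then show ?thesis using that P m by (auto simp: P_def m_def)
      qed
    qed
    moreover have "acost (Load (Const cnt_cell)) s1 = int_size cnt_cell + int_size (int (Suc m))"
      by (simp only: acost.simps aval.simps c)
    then have "acost (Load (Const cnt_cell)) s1 \<le> ?D" using szm cells by linarith
    moreover have "0 < aval (Load (Const cnt_cell)) s1" using c by simp
    ultimately show "0 < aval (Load (Const cnt_cell)) s1 \<and> acost (Load (Const cnt_cell)) s1 \<le> ?D \<and>
      (\<exists>s'. runs ?body s1 (?D + ?D) s' \<and> P (Suc i) s')" using runs_Seq[OF r1 r2] by blast
  next
    fix s1 assume "P n s1"
    then show "aval (Load (Const cnt_cell)) s1 \<le> 0 \<and> acost (Load (Const cnt_cell)) s1 \<le> ?D"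
      using cells by (simp add: P_def)
  qed
  then obtain s1 where r1: "runs (WhilePos (Load (Const cnt_cell)) ?body) (s(cnt_cell := int n)) ((n + 1) * (?D + (?D + ?D))) s1" and P: "P n s1" by blast
  have s1: "s1 (addr 1 0) = int n" using P assms(2) by (simp add: P_def)
  have r2: "runs (Store (Const 0) (Load (Const (addr 1 0)))) s1 ?D (s1(0 := int n))"
    by (rule runs_Store) (use s1 cells size_nat[OF assms(3)] in auto)
  have "runs epilogue s (?D + ((n + 1) * (?D + (?D + ?D)) + ?D)) (s1(0 := int n))"
    unfolding epilogue_def by (rule runs_Seq[OF r0 runs_Seq[OF r1 r2]])
  moreover have "?D + ((n + 1) * (?D + (?D + ?D)) + ?D) \<le> (Z + 2) * (4 * ?D)"
  proof -
    define D where "D = ?D"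
    have "(n + 1) * (D + (D + D)) \<le> (Z + 1) * (D + (D + D))"
      using assms(3) by (intro mult_le_mono1) simp
    moreover have "D + ((Z + 1) * (D + (D + D)) + D) \<le> (Z + 2) * (4 * D)"
      by (simp add: algebra_simps)
    ultimately show ?thesis unfolding D_def by linarith
  qed
  ultimately have "runs epilogue s ((Z + 2) * (4 * ?D)) (s1(0 := int n))" by (rule runs_mono)
  moreover have "output_word (s1(0 := int n)) = map (\<lambda>i. s (addr 1 i)) [1..int n]"
    using P by (auto simp: output_word_def P_def)
  ultimately show ?thesis by blast
qed

section \<open>Polynomial running time of well-formed programs\<close>

definition polyb :: "(nat \<Rightarrow> nat) \<Rightarrow> bool" where
  "polyb f \<longleftrightarrow> (\<exists>p. \<forall>n. f n = poly p n)"

lemma polyb_const: "polyb (\<lambda>n. c)" unfolding polyb_def by (rule exI[of _ "[:c:]"]) simp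
lemma polyb_id: "polyb (\<lambda>n. n)" unfolding polyb_def by (rule exI[of _ "[:0, 1:]"]) simp
lemma polyb_add: "polyb f \<Longrightarrow> polyb g \<Longrightarrow> polyb (\<lambda>n. f n + g n)" unfolding polyb_def by (metis poly_add)
lemma polyb_mult: "polyb f \<Longrightarrow> polyb g \<Longrightarrow> polyb (\<lambda>n. f n * g n)" unfolding polyb_def by (metis poly_mult)
lemma polyb_pow: "polyb f \<Longrightarrow> polyb (\<lambda>n. f n ^ k)" by (induction k) (auto intro: polyb_mult polyb_const)
lemmas polyb_intros = polyb_id polyb_add polyb_mult polyb_pow

lemma polyb_nst: "polyb (\<lambda>n. nst n c)"
  by (induction c) (simp_all only: nst.simps, (intro polyb_intros polyb_const | assumption)+)

text \<open>The store is the memory that the prologue leaves; only its input entries matter. The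
  condition on \<open>n\<close> keeps the epilogue within polynomial time.\<close>

theorem lc_polytime:
  assumes "wfc c" "depth c \<le> 60"
  shows "\<exists>prog (p :: nat poly). \<forall>ks. (\<forall>k\<in>set ks. 0 \<le> k) \<longrightarrow> (\<exists>\<sigma>. init_store ks \<sigma> \<and>
    (\<forall>n \<le> word_size ks. den (word_size ks) c \<sigma> 1 0 = int n \<longrightarrow>
      (\<exists>t s. exec prog (input_mem ks) t s \<and> t \<le> poly p (word_size ks) \<and>
        output_word s = map (den (word_size ks) c \<sigma> 1) [1..int n])))"
proof -
  define C where "C = csz c"
  define Y where "Y = (\<lambda>L. L + 1 + C * nst L c)"
  define f where "f = (\<lambda>L. (L + 2) * (6 * L + 100) * (3 * L + 7) +
    (nst L c * (10 * C * (Y L ^ 3 * C + 12)) + (Y L ^ 3 + 2) * (4 * (6 * Y L ^ 3 + 100))))"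
  have "polyb Y" unfolding Y_def by (intro polyb_intros polyb_const polyb_nst)
  then have "polyb f" unfolding f_def by (intro polyb_intros polyb_const polyb_nst)
  then obtain p where p: "\<And>n. f n = poly p n" unfolding polyb_def by blast
  show ?thesis
  proof (intro exI[of _ "Seq prologue (Seq (compile 0 c) epilogue)"] exI[of _ p] allI impI)
    fix ks :: "int list" assume ks: "\<forall>k\<in>set ks. 0 \<le> k"
    define L where "L = word_size ks"
    obtain s1 where r1: "runs prologue (input_mem ks) ((L + 2) * (6 * L + 100) * (3 * L + 7)) s1"
      and s1: "s1 size_cell = int L" "s1 (addr 0 0) = int L" "\<forall>i<length ks. s1 (addr 0 (int i + 1)) = ks ! i"
        "\<forall>v<192. \<forall>i. \<bar>s1 (addr v i)\<bar> \<le> 2 ^ L"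
      using prologue_runs[OF ks] unfolding L_def by blast
    define \<sigma> where "\<sigma> = (\<lambda>v i. s1 (addr v i))"
    have init: "init_store ks \<sigma>" using s1 by (simp add: init_store_def \<sigma>_def L_def)
    have bs: "bounded_store (L + 1) \<sigma>"
      unfolding bounded_store_def
    proof (intro allI impI)
      fix v :: nat and i assume "v < 192"
      have "L \<le> (L + 1) ^ 1" by simp
      also have "\<dots> \<le> (L + 1) ^ (v div 64 + 1)" by (intro power_increasing) auto
      finally have "(2::int) ^ L \<le> 2 ^ ((L + 1) ^ (v div 64 + 1))" by (intro power_increasing) auto
      then show "\<bar>\<sigma> v i\<bar> \<le> 2 ^ ((L + 1) ^ (v div 64 + 1))" using s1(4) \<open>v < 192\<close> unfolding \<sigma>_def by (meson order_trans)
    qed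
    have "\<exists>s'. runs (compile 0 c) s1 (nst L c * (10 * C * (Y L ^ 3 * C + 12))) s' \<and> agree s' (den L c \<sigma>) \<and>
      s' (addr 255 0) = int L \<and> (\<forall>j<0. s' (addr (192 + j) 0) = s1 (addr (192 + j) 0)) \<and>
      bounded_store (L + 1 + C * nst L c) (den L c \<sigma>)"
      by (rule compile_correct) (use assms s1 bs in \<open>auto simp: C_def Y_def agree_def \<sigma>_def\<close>)
    then obtain s2 where r2: "runs (compile 0 c) s1 (nst L c * (10 * C * (Y L ^ 3 * C + 12))) s2"
      and s2: "agree s2 (den L c \<sigma>)" "bounded_store (Y L) (den L c \<sigma>)" unfolding Y_def by blast
    have "\<exists>t s. exec (Seq prologue (Seq (compile 0 c) epilogue)) (input_mem ks) t s \<and> t \<le> poly p L \<and>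
        output_word s = map (den L c \<sigma> 1) [1..int n]" if "n \<le> L" "den L c \<sigma> 1 0 = int n" for n
    proof -
      have "0 < Y L" "n \<le> Y L" using that(1) by (auto simp: Y_def)
      then have nY: "n \<le> Y L ^ 3" using self_le_power[of "Y L" 3] by simp
      have ag: "s2 (addr 1 i) = den L c \<sigma> 1 i" for i using s2(1) by (simp add: agree_def)
      have "\<exists>s'. runs epilogue s2 ((Y L ^ 3 + 2) * (4 * (6 * Y L ^ 3 + 100))) s' \<and> output_word s' = map (\<lambda>i. s2 (addr 1 i)) [1..int n]"
        using bounded_storeD[OF s2(2) \<open>0 < Y L\<close> order_refl, of 1] ag that nY by (intro epilogue_runs) auto
      then obtain s3 where r3: "runs epilogue s2 ((Y L ^ 3 + 2) * (4 * (6 * Y L ^ 3 + 100))) s3"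
        and o: "output_word s3 = map (\<lambda>i. s2 (addr 1 i)) [1..int n]" by blast
      have "runs (Seq prologue (Seq (compile 0 c) epilogue)) (input_mem ks) (f L) s3"
        unfolding f_def by (rule runs_Seq[OF r1 runs_Seq[OF r2 r3]])
      then show ?thesis using o ag p[of L] unfolding runs_def by auto
    qed
    then show "\<exists>\<sigma>. init_store ks \<sigma> \<and>
      (\<forall>n \<le> word_size ks. den (word_size ks) c \<sigma> 1 0 = int n \<longrightarrow>
      (\<exists>t s. exec (Seq prologue (Seq (compile 0 c) epilogue)) (input_mem ks) t s \<and> t \<le> poly p (word_size ks) \<and>
        output_word s = map (den (word_size ks) c \<sigma> 1) [1..int n]))"
      using init unfolding L_def by blast
  qed
qed

section \<open>Spanning trees and fractional points\<close>

text \<open>Edges are numbered from 0 to \<open>m - 1\<close>.\<close>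

locale mgraph =
  fixes V :: "nat set" and m :: nat and src tgt :: "nat \<Rightarrow> nat"
  assumes finite_V: "finite V" and V_ne: "V \<noteq> {}"
    and ends: "\<And>e. e < m \<Longrightarrow> src e \<in> V \<and> tgt e \<in> V \<and> src e \<noteq> tgt e"
begin

definition adj :: "nat set \<Rightarrow> (nat \<times> nat) set" where
  "adj F = {(u, v). \<exists>e\<in>F. (u = src e \<and> v = tgt e) \<or> (u = tgt e \<and> v = src e)}"

definition con :: "nat set \<Rightarrow> bool" where
  "con F \<longleftrightarrow> (\<forall>u\<in>V. \<forall>v\<in>V. (u, v) \<in> (adj F)\<^sup>*)"

text \<open>Connectedness and the number of edges determine a tree, and counting is what contraction
  and exchange arguments use; acyclicity appears only in \<open>tree_spanning\<close>.\<close>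

definition tree :: "nat set \<Rightarrow> bool" where
  "tree T \<longleftrightarrow> T \<subseteq> {..<m} \<and> con T \<and> card T + 1 = card V"

lemma adj_edge: "e \<in> F \<Longrightarrow> (src e, tgt e) \<in> adj F" "e \<in> F \<Longrightarrow> (tgt e, src e) \<in> adj F"
  by (auto simp: adj_def)

lemma adj_mono: "F \<subseteq> G \<Longrightarrow> (adj F)\<^sup>* \<subseteq> (adj G)\<^sup>*"
  by (rule rtrancl_mono) (auto simp: adj_def)

lemma adj_sym: "(u, v) \<in> (adj F)\<^sup>* \<Longrightarrow> (v, u) \<in> (adj F)\<^sup>*"
proof -
  have "sym (adj F)" by (auto simp: sym_def adj_def)
  then show "(u, v) \<in> (adj F)\<^sup>* \<Longrightarrow> (v, u) \<in> (adj F)\<^sup>*" by (meson sym_rtrancl symD)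
qed

lemma crossing:
  assumes "(u, v) \<in> (adj F)\<^sup>*" "u \<in> A" "v \<notin> A"
  shows "\<exists>e\<in>F. (src e \<in> A) \<noteq> (tgt e \<in> A)"
  using assms
proof (induction rule: rtrancl_induct)
  case (step w z)
  then show ?case by (cases "w \<in> A") (auto simp: adj_def)
qed auto

text \<open>\<open>f\<close> contracts vertices. Identifying the two classes joined by a crossing
  edge loses one class and at least that edge, so induction on the number of classes applies. The
  identity gives the minimal size of a connected edge set, and collapsing one set gives
  \<open>tree_inner\<close>.\<close>

lemma card_quotient:
  assumes "F \<subseteq> {..<m}" "con F"
  shows "card (f ` V) \<le> card {e \<in> F. f (src e) \<noteq> f (tgt e)} + 1"
proof (induction "card (f ` V)" arbitrary: f rule: less_induct)
  case less
  have finF: "finite F" using assms(1) finite_subset by blast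
  show ?case
  proof (cases "card (f ` V) \<le> 1")
    case False
    then obtain a b where ab: "a \<in> f ` V" "b \<in> f ` V" "a \<noteq> b"
      by (metis card_le_Suc0_iff_eq finite_V finite_imageI One_nat_def)
    then obtain u v where uv: "u \<in> V" "v \<in> V" "f u = a" "f v = b" by auto
    then have "(u, v) \<in> (adj F)\<^sup>*" using assms(2) by (auto simp: con_def)
    then obtain e where e: "e \<in> F" "(f (src e) = a) \<noteq> (f (tgt e) = a)"
      using crossing[of u v F "{w. f w = a}"] uv ab by auto
    define p q where "p = f (src e)" and "q = f (tgt e)"
    have pq: "p \<noteq> q" using e by (auto simp: p_def q_def)
    have eV: "src e \<in> V" "tgt e \<in> V" using e assms(1) ends by auto
    define g where "g = (\<lambda>w. if f w = p then q else f w)"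
    have gV: "g ` V = f ` V - {p}"
      using eV pq by (auto simp: g_def p_def q_def image_iff)
    have c: "card (g ` V) + 1 = card (f ` V)"
      unfolding gV using eV finite_V by (simp add: p_def card_gt_0_iff Suc_leI card_Diff_singleton)
        (metis Suc_pred card_gt_0_iff empty_iff finite_imageI imageI)
    have "{e \<in> F. g (src e) \<noteq> g (tgt e)} \<subset> {e \<in> F. f (src e) \<noteq> f (tgt e)}"
    proof -
      have "e \<in> {e \<in> F. f (src e) \<noteq> f (tgt e)}" using e by auto
      moreover have "e \<notin> {e \<in> F. g (src e) \<noteq> g (tgt e)}" by (auto simp: g_def p_def q_def)
      moreover have "{e \<in> F. g (src e) \<noteq> g (tgt e)} \<subseteq> {e \<in> F. f (src e) \<noteq> f (tgt e)}" by (auto simp: g_def)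
      ultimately show ?thesis by blast
    qed
    then have "card {e \<in> F. g (src e) \<noteq> g (tgt e)} < card {e \<in> F. f (src e) \<noteq> f (tgt e)}"
      using finF by (intro psubset_card_mono) auto
    moreover have "card (g ` V) \<le> card {e \<in> F. g (src e) \<noteq> g (tgt e)} + 1" using less c by simp
    ultimately show ?thesis using c by linarith
  qed simp
qed

lemma con_card: "F \<subseteq> {..<m} \<Longrightarrow> con F \<Longrightarrow> card V \<le> card F + 1"
proof -
  assume F: "F \<subseteq> {..<m}" "con F"
  have "{e \<in> F. id (src e) \<noteq> id (tgt e)} = F" using F ends by auto
  then show ?thesis using card_quotient[OF F, of id] by simp
qed

definition inner :: "nat set \<Rightarrow> nat set" where
  "inner C = {e. e < m \<and> src e \<in> C \<and> tgt e \<in> C}"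

lemma tree_inner:
  assumes "tree T" "C \<subseteq> V" "C \<noteq> {}"
  shows "card (T \<inter> inner C) + 1 \<le> card C"
proof -
  obtain c where c: "c \<in> C" using assms by auto
  define f where "f = (\<lambda>w. if w \<in> C then c else w)"
  have T: "T \<subseteq> {..<m}" "con T" "card T + 1 = card V" "finite T"
    using assms(1) finite_subset by (auto simp: tree_def)
  have finC: "finite C" using assms(2) finite_V finite_subset by auto
  have "f ` V = insert c (V - C)" using c assms(2) by (auto simp: f_def)
  then have "card (f ` V) = card (V - C) + 1" using c finite_V by simp
  moreover have "card (V - C) = card V - card C" using assms(2) finC by (simp add: card_Diff_subset)
  moreover have "card C \<le> card V" using assms(2) finite_V by (simp add: card_mono)
  moreover have "card {e \<in> T. f (src e) \<noteq> f (tgt e)} \<le> card (T - inner C)"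
    using T by (intro card_mono) (auto simp: f_def inner_def)
  moreover have "card (T - inner C) = card T - card (T \<inter> inner C)" using T by (simp add: card_Diff_subset_Int)
  moreover have "card (T \<inter> inner C) \<le> card T" using T by (simp add: card_mono)
  ultimately show ?thesis using card_quotient[OF T(1,2), of f] T(3) by linarith
qed

section \<open>The spanning tree polytope\<close>

text \<open>Edmonds' description of the polytope: the relaxation without its crossing
  constraints.\<close>

definition pst :: "(nat \<Rightarrow> real) \<Rightarrow> bool" where
  "pst x \<longleftrightarrow> (\<forall>e<m. 0 \<le> x e) \<and> sum x {..<m} = real (card V) - 1 \<and>
     (\<forall>C. C \<subseteq> V \<and> C \<noteq> {} \<longrightarrow> sum x (inner C) \<le> real (card C) - 1)"

abbreviation chi :: "nat set \<Rightarrow> nat \<Rightarrow> real" where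
  "chi T e \<equiv> of_bool (e \<in> T)"

lemma sum_chi: "finite F \<Longrightarrow> sum (chi T) F = real (card (T \<inter> F))"
  by (simp add: Int_commute)

lemma tree_pst: "tree T \<Longrightarrow> pst (chi T)"
proof -
  assume T: "tree T"
  then have "T \<inter> {..<m} = T" "card T + 1 = card V" by (auto simp: tree_def)
  moreover have "finite (inner C)" for C by (auto simp: inner_def)
  moreover have "real (card (T \<inter> inner C)) \<le> real (card C) - 1" if "C \<subseteq> V" "C \<noteq> {}" for C
    using tree_inner[OF T that] by linarith
  ultimately show ?thesis unfolding pst_def by (auto simp: sum_chi simp del: sum_of_bool_eq)
qed

lemma pst_le1: "pst x \<Longrightarrow> e < m \<Longrightarrow> x e \<le> 1"
proof -
  assume x: "pst x" and e: "e < m"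
  have "sum x (inner {src e, tgt e}) \<le> real (card {src e, tgt e}) - 1"
    using x ends[OF e] unfolding pst_def by (metis empty_subsetI insert_not_empty insert_subset)
  then have "sum x (inner {src e, tgt e}) \<le> 1" using ends[OF e] by simp
  moreover have "x e \<le> sum x (inner {src e, tgt e})"
    using x e ends[OF e] unfolding pst_def by (intro member_le_sum) (auto simp: inner_def)
  ultimately show ?thesis by linarith
qed

text \<open>Convexity. Membership is asked of terms with nonzero weight only, so that sums over all
  edge sets with weights vanishing off the trees are covered.\<close>

lemma pst_sum:
  assumes "finite I" "\<And>i. i \<in> I \<Longrightarrow> 0 \<le> p i" "sum p I = 1" "\<And>i. i \<in> I \<Longrightarrow> p i \<noteq> 0 \<Longrightarrow> pst (y i)"
    and x: "\<And>e. e < m \<Longrightarrow> x e = (\<Sum>i\<in>I. p i * y i e)"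
  shows "pst x"
proof -
  have sx: "sum x F = (\<Sum>i\<in>I. p i * sum (y i) F)" if "F \<subseteq> {..<m}" for F
  proof -
    have "sum x F = (\<Sum>e\<in>F. \<Sum>i\<in>I. p i * y i e)" using that x by (intro sum.cong) auto
    also have "\<dots> = (\<Sum>i\<in>I. p i * sum (y i) F)" by (subst sum.swap) (simp add: sum_distrib_left)
    finally show ?thesis .
  qed
  have "0 \<le> x e" if "e < m" for e
    unfolding x[OF that] using assms(2,4) that
    by (intro sum_nonneg) (metis mult_nonneg_nonneg mult_zero_left order_refl pst_def)
  moreover have "sum x {..<m} = real (card V) - 1"
  proof -
    have "sum x {..<m} = (\<Sum>i\<in>I. p i * sum (y i) {..<m})" by (rule sx) simp
    also have "\<dots> = (\<Sum>i\<in>I. p i * (real (card V) - 1))"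
      by (intro sum.cong refl) (metis assms(4) mult_zero_left pst_def)
    also have "\<dots> = real (card V) - 1" using assms(3) by (simp add: sum_distrib_right[symmetric])
    finally show ?thesis .
  qed
  moreover have "sum x (inner C) \<le> real (card C) - 1" if "C \<subseteq> V" "C \<noteq> {}" for C
  proof -
    have "sum x (inner C) = (\<Sum>i\<in>I. p i * sum (y i) (inner C))" by (rule sx) (auto simp: inner_def)
    also have "\<dots> \<le> (\<Sum>i\<in>I. p i * (real (card C) - 1))"
    proof (rule sum_mono)
      fix i assume i: "i \<in> I"
      show "p i * sum (y i) (inner C) \<le> p i * (real (card C) - 1)"
      proof (cases "p i = 0")
        case False
        then show ?thesis using assms(2,4)[OF i] that by (intro mult_left_mono) (auto simp: pst_def)
      qed simp
    qed
    also have "\<dots> = real (card C) - 1" using assms(3) by (simp add: sum_distrib_right[symmetric])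
    finally show ?thesis .
  qed
  ultimately show ?thesis unfolding pst_def by blast
qed

section \<open>Exchanging edges between two trees\<close>

text \<open>A walk either avoids \<open>f\<close>, or it can be cut before the first and after the
  last use of \<open>f\<close>.\<close>

lemma adj_remove:
  assumes "(u, v) \<in> (adj P)\<^sup>*"
  shows "(u, v) \<in> (adj (P - {f}))\<^sup>* \<or>
    ((u, src f) \<in> (adj (P - {f}))\<^sup>* \<or> (u, tgt f) \<in> (adj (P - {f}))\<^sup>*) \<and>
    ((src f, v) \<in> (adj (P - {f}))\<^sup>* \<or> (tgt f, v) \<in> (adj (P - {f}))\<^sup>*)"
  using assms
proof (induction rule: rtrancl_induct)
  case (step w z)
  then obtain e where e: "e \<in> P" "(w = src e \<and> z = tgt e) \<or> (w = tgt e \<and> z = src e)" by (auto simp: adj_def)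
  show ?case
  proof (cases "e = f")
    case False
    then have "(w, z) \<in> adj (P - {f})" using e by (auto simp: adj_def)
    then show ?thesis using step.IH by (meson rtrancl.rtrancl_into_rtrancl)
  next
    case True
    then show ?thesis using step.IH e by (metis rtrancl.rtrancl_refl)
  qed
qed simp

lemma con_swap:
  assumes "con F" "(src e, tgt e) \<in> (adj G)\<^sup>*" "F - {e} \<subseteq> G"
  shows "con G"
proof -
  have "adj F \<subseteq> (adj G)\<^sup>*"
  proof
    fix z assume "z \<in> adj F"
    then obtain g where g: "g \<in> F" "z = (src g, tgt g) \<or> z = (tgt g, src g)" by (auto simp: adj_def)
    show "z \<in> (adj G)\<^sup>*"
    proof (cases "g = e")
      case True
      then show ?thesis using g assms(2) adj_sym by blast
    next
      case False
      then show ?thesis using g assms(3) adj_edge[of g G] by auto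
    qed
  qed
  then have "(adj F)\<^sup>* \<subseteq> (adj G)\<^sup>*" using rtrancl_subset_rtrancl by blast
  then show ?thesis using assms(1) unfolding con_def by blast
qed

text \<open>\<open>f\<close> has to cross the cut that \<open>T1\<close> without \<open>e\<close>
  leaves, and to lie on the path of \<open>T2\<close> between the ends of \<open>e\<close>. A
  minimal edge set of \<open>T2\<close> that connects these ends plays the role of the path: it has
  an edge across the cut, and by minimality the removal of that edge separates the ends.\<close>

lemma symmetric_exchange:
  assumes T1: "tree T1" and T2: "tree T2" and e: "e \<in> T1" "e \<notin> T2"
  shows "\<exists>f. f \<in> T2 \<and> f \<notin> T1 \<and> tree (insert f (T1 - {e})) \<and> tree (insert e (T2 - {f}))"
proof -
  have t1: "T1 \<subseteq> {..<m}" "con T1" "card T1 + 1 = card V" "finite T1"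
    and t2: "T2 \<subseteq> {..<m}" "con T2" "card T2 + 1 = card V" "finite T2"
    using T1 T2 finite_subset by (auto simp: tree_def)
  let ?u = "src e" and ?v = "tgt e"
  let ?R = "(adj (T1 - {e}))\<^sup>*"
  have uv: "?u \<in> V" "?v \<in> V" using e t1 ends by auto
  define A where "A = {w. (?u, w) \<in> ?R}"
  have uA: "?u \<in> A" by (simp add: A_def)
  have vA: "?v \<notin> A"
  proof
    assume "?v \<in> A"
    then have "con (T1 - {e})" using con_swap[OF t1(2), of e "T1 - {e}"] by (simp add: A_def)
    then have "card V \<le> card (T1 - {e}) + 1" using t1 by (intro con_card) auto
    then show False using t1 e card_Diff1_less[of T1 e] by simp
  qed
  have "(?u, ?v) \<in> (adj T2)\<^sup>*" using t2(2) uv by (auto simp: con_def)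
  then have "\<exists>n P. card P = n \<and> P \<subseteq> T2 \<and> (?u, ?v) \<in> (adj P)\<^sup>*" by auto
  then obtain P where P: "P \<subseteq> T2" "(?u, ?v) \<in> (adj P)\<^sup>*"
    and min: "\<And>Q. Q \<subseteq> T2 \<Longrightarrow> (?u, ?v) \<in> (adj Q)\<^sup>* \<Longrightarrow> card P \<le> card Q"
    using exists_least_iff[of "\<lambda>n. \<exists>P. card P = n \<and> P \<subseteq> T2 \<and> (?u, ?v) \<in> (adj P)\<^sup>*"] by (metis not_le)
  obtain f where f: "f \<in> P" "(src f \<in> A) \<noteq> (tgt f \<in> A)" using crossing[OF P(2) uA vA] by blast
  have fT2: "f \<in> T2" using f P by auto
  have fe: "f \<noteq> e" using fT2 e by auto
  have fT1: "f \<notin> T1"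
  proof
    assume "f \<in> T1"
    then have "(src f, tgt f) \<in> adj (T1 - {e})" "(tgt f, src f) \<in> adj (T1 - {e})" using fe adj_edge by auto
    then show False using f(2) unfolding A_def by (auto intro: rtrancl.rtrancl_into_rtrancl)
  qed
  have finP: "finite P" using P t2 finite_subset by blast
  have nP: "(?u, ?v) \<notin> (adj (P - {f}))\<^sup>*"
    using min[of "P - {f}"] P f finP card_Diff1_less[of P f] by (auto simp: not_le)
  let ?G1 = "insert f (T1 - {e})" and ?G2 = "insert e (T2 - {f})"
  have g1: "(src f, tgt f) \<in> (adj ?G1)\<^sup>*" "(tgt f, src f) \<in> (adj ?G1)\<^sup>*" using adj_edge[of f ?G1] by auto
  have other: "(?v, w) \<in> ?R" if "w \<in> V" "w \<notin> A" for w
  proof -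
    have "(?u, w) \<in> (adj T1)\<^sup>*" using t1(2) uv that by (auto simp: con_def)
    from adj_remove[OF this, of e] show ?thesis using that by (auto simp: A_def)
  qed
  have fV: "src f \<in> V" "tgt f \<in> V" using fT2 t2 ends by auto
  have sub1: "?R \<subseteq> (adj ?G1)\<^sup>*" by (rule adj_mono) auto
  have "(?u, ?v) \<in> (adj ?G1)\<^sup>*"
  proof (cases "src f \<in> A")
    case True
    then have "(?u, src f) \<in> ?R" "(?v, tgt f) \<in> ?R" using f other[of "tgt f"] fV by (auto simp: A_def)
    then show ?thesis using g1 sub1 adj_sym by (meson rtrancl_trans subsetD)
  next
    case False
    then have "(?u, tgt f) \<in> ?R" "(?v, src f) \<in> ?R" using f other[of "src f"] fV by (auto simp: A_def)
    then show ?thesis using g1 sub1 adj_sym by (meson rtrancl_trans subsetD)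
  qed
  then have c1: "con ?G1" using con_swap[OF t1(2), of e ?G1] by auto
  have sub2: "(adj (P - {f}))\<^sup>* \<subseteq> (adj ?G2)\<^sup>*" using P by (intro adj_mono) auto
  have g2: "(?u, ?v) \<in> (adj ?G2)\<^sup>*" "(?v, ?u) \<in> (adj ?G2)\<^sup>*" using adj_edge[of e ?G2] by auto
  have "((?u, src f) \<in> (adj (P - {f}))\<^sup>* \<and> (tgt f, ?v) \<in> (adj (P - {f}))\<^sup>*) \<or>
      ((?u, tgt f) \<in> (adj (P - {f}))\<^sup>* \<and> (src f, ?v) \<in> (adj (P - {f}))\<^sup>*)"
    using adj_remove[OF P(2), of f] nP by (meson rtrancl_trans)
  then have "(src f, tgt f) \<in> (adj ?G2)\<^sup>*"
    using sub2 g2 adj_sym by (meson rtrancl_trans subsetD)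
  then have c2: "con ?G2" using con_swap[OF t2(2), of f ?G2] by auto
  have "card ?G1 = card T1" "card ?G2 = card T2"
    using t1(4) t2(4) e fT1 fT2 card.remove[of T1 e] card.remove[of T2 f] by (simp_all add: card_insert_if)
  moreover have "?G1 \<subseteq> {..<m}" "?G2 \<subseteq> {..<m}" using t1 t2 e fT2 by auto
  ultimately show ?thesis using c1 c2 t1 t2 fT1 fT2 unfolding tree_def by auto
qed

section \<open>Convex combinations of trees\<close>

definition mix :: "(nat set \<Rightarrow> real) \<Rightarrow> nat \<Rightarrow> real" where
  "mix p e = (\<Sum>T\<in>Pow {..<m}. p T * chi T e)"

text \<open>Weights are functions on all edge sets that vanish off the trees; this makes the
  distributions a closed part of a product space.\<close>

definition distr :: "(nat set \<Rightarrow> real) \<Rightarrow> bool" where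
  "distr p \<longleftrightarrow> (\<forall>T. 0 \<le> p T) \<and> (\<forall>T. \<not> tree T \<longrightarrow> p T = 0) \<and> sum p (Pow {..<m}) = 1"

lemma distr_le1: "distr p \<Longrightarrow> p T \<le> 1"
proof -
  assume p: "distr p"
  show ?thesis
  proof (cases "tree T")
    case True
    then have "p T \<le> sum p (Pow {..<m})" using p by (intro member_le_sum) (auto simp: distr_def tree_def)
    then show ?thesis using p by (simp add: distr_def)
  next
    case False
    then have "p T = 0" using p by (simp add: distr_def)
    then show ?thesis by simp
  qed
qed

lemma mix_pst: "distr p \<Longrightarrow> pst (mix p)"
  by (rule pst_sum[of "Pow {..<m}" p "\<lambda>T. chi T"]) (auto simp: distr_def mix_def intro: tree_pst)

lemma mix_support:
  assumes "distr p" "e < m"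
  shows "0 < mix p e \<longleftrightarrow> (\<exists>T. 0 < p T \<and> e \<in> T)" "mix p e < 1 \<longleftrightarrow> (\<exists>T. 0 < p T \<and> e \<notin> T)"
proof -
  have p0: "0 \<le> p T" for T using assms by (simp add: distr_def)
  have tr: "0 < p T \<Longrightarrow> T \<in> Pow {..<m}" for T using assms by (auto simp: distr_def tree_def)
  show "0 < mix p e \<longleftrightarrow> (\<exists>T. 0 < p T \<and> e \<in> T)"
  proof
    assume "0 < mix p e"
    then have "mix p e \<noteq> 0" by simp
    then obtain T where "p T * chi T e \<noteq> 0" unfolding mix_def by (meson sum.neutral)
    then show "\<exists>T. 0 < p T \<and> e \<in> T" using p0[of T] by (intro exI[of _ T]) (auto split: if_splits)
  next
    assume "\<exists>T. 0 < p T \<and> e \<in> T"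
    then obtain T where "0 < p T" "e \<in> T" by auto
    then show "0 < mix p e" unfolding mix_def using tr p0 by (intro sum_pos2[of _ T]) auto
  qed
  have "1 - mix p e = (\<Sum>T\<in>Pow {..<m}. p T * (1 - chi T e))"
    using assms by (simp add: mix_def distr_def algebra_simps sum_subtractf)
  moreover have "0 < (\<Sum>T\<in>Pow {..<m}. p T * (1 - chi T e)) \<longleftrightarrow> (\<exists>T. 0 < p T \<and> e \<notin> T)"
  proof
    assume "0 < (\<Sum>T\<in>Pow {..<m}. p T * (1 - chi T e))"
    then have "(\<Sum>T\<in>Pow {..<m}. p T * (1 - chi T e)) \<noteq> 0" by simp
    then obtain T where "p T * (1 - chi T e) \<noteq> 0" by (meson sum.neutral)
    then show "\<exists>T. 0 < p T \<and> e \<notin> T" using p0[of T] by (intro exI[of _ T]) (auto split: if_splits)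
  next
    assume "\<exists>T. 0 < p T \<and> e \<notin> T"
    then obtain T where "0 < p T" "e \<notin> T" by auto
    then show "0 < (\<Sum>T\<in>Pow {..<m}. p T * (1 - chi T e))" using tr p0 by (intro sum_pos2[of _ T]) auto
  qed
  ultimately show "mix p e < 1 \<longleftrightarrow> (\<exists>T. 0 < p T \<and> e \<notin> T)" by (metis diff_gt_0_iff_gt)
qed

end

section \<open>Points with few fractional edges\<close>

text \<open>Gaussian elimination: a variable with nonzero coefficient in the new equation is removed
  from the others and recovered at the end.\<close>

lemma homogeneous_system:
  fixes L :: "'i \<Rightarrow> 'j \<Rightarrow> real"
  assumes "finite A" "finite J" "card A < card J"
  shows "\<exists>\<alpha>. (\<exists>j\<in>J. \<alpha> j \<noteq> 0) \<and> (\<forall>i\<in>A. (\<Sum>j\<in>J. \<alpha> j * L i j) = 0)"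
  using assms
proof (induction A arbitrary: J L rule: finite_induct)
  case empty
  then have "J \<noteq> {}" by auto
  then show ?case by (intro exI[of _ "\<lambda>_. 1"]) auto
next
  case (insert i A)
  show ?case
  proof (cases "\<forall>j\<in>J. L i j = 0")
    case True
    then show ?thesis using insert.IH[of J L] insert.prems insert.hyps by auto
  next
    case False
    then obtain j0 where j0: "j0 \<in> J" "L i j0 \<noteq> 0" by auto
    define J' where "J' = J - {j0}"
    have J: "J = insert j0 J'" "j0 \<notin> J'" "finite J'" using j0 insert.prems by (auto simp: J'_def)
    have "card A < card J'" using insert.prems insert.hyps j0 by (simp add: J'_def)
    from insert.IH[OF J(3) this, of "\<lambda>k j. L k j - L k j0 * L i j / L i j0"] obtain \<alpha> where
      \<alpha>: "\<exists>j\<in>J'. \<alpha> j \<noteq> 0" "\<forall>k\<in>A. (\<Sum>j\<in>J'. \<alpha> j * (L k j - L k j0 * L i j / L i j0)) = 0" by blast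
    define \<beta> where "\<beta> = \<alpha>(j0 := - (\<Sum>j\<in>J'. \<alpha> j * L i j) / L i j0)"
    have s: "(\<Sum>j\<in>J. \<beta> j * L k j) = - (\<Sum>j\<in>J'. \<alpha> j * L i j) / L i j0 * L k j0 + (\<Sum>j\<in>J'. \<alpha> j * L k j)" for k
    proof -
      have "(\<Sum>j\<in>J'. \<beta> j * L k j) = (\<Sum>j\<in>J'. \<alpha> j * L k j)" using J(2) by (intro sum.cong) (auto simp: \<beta>_def)
      then show ?thesis using J by (simp add: \<beta>_def)
    qed
    have "(\<Sum>j\<in>J. \<beta> j * L k j) = 0" if "k \<in> insert i A" for k
    proof (cases "k = i")
      case True
      then show ?thesis unfolding s using j0 by simp
    next
      case False
      then have "(\<Sum>j\<in>J'. \<alpha> j * (L k j - L k j0 * L i j / L i j0)) = 0" using \<alpha>(2) that by auto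
      moreover have "(\<Sum>j\<in>J'. \<alpha> j * (L k j - L k j0 * L i j / L i j0)) =
        (\<Sum>j\<in>J'. \<alpha> j * L k j) - (\<Sum>j\<in>J'. \<alpha> j * L i j) / L i j0 * L k j0"
        by (simp add: algebra_simps sum_subtractf sum_distrib_left sum_divide_distrib)
      ultimately show ?thesis unfolding s by simp
    qed
    moreover have "\<exists>j\<in>J. \<beta> j \<noteq> 0" using \<alpha>(1) J by (auto simp: \<beta>_def)
    ultimately show ?thesis by blast
  qed
qed

context mgraph
begin

text \<open>
  Every point has a representation by trees; an edge \<open>e\<close> that is fractional lies in one tree \<open>T1\<close> of the
  support and is missing from another one \<open>T2\<close>.  A symmetric exchange of \<open>e\<close> and some \<open>f\<close>, performed in
  \<open>T1\<close> or in \<open>T2\<close>, moves the point along \<open>\<plusminus>(\<chi>(e) - \<chi>(f))\<close>.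
\<close>

lemma shift_mix:
  assumes p: "distr p" and J: "finite J" "J \<subseteq> {..<m}"
    and old: "\<And>e. e \<in> J \<Longrightarrow> 0 < p (old1 e) \<and> e \<in> old1 e \<and> 0 < p (old2 e) \<and> e \<notin> old2 e"
    and f: "\<And>e. e \<in> J \<Longrightarrow> f e \<in> old2 e \<and> f e \<notin> old1 e \<and> tree (insert (f e) (old1 e - {e})) \<and> tree (insert e (old2 e - {f e}))"
  shows "\<exists>s0>0. \<forall>s. 0 < s \<and> s \<le> s0 \<longrightarrow> (\<exists>q. distr q \<and>
    (\<forall>g<m. mix q g = mix p g + s * (\<Sum>e\<in>J. \<beta> e * (of_bool (g = e) - of_bool (g = f e)))))"
proof -
  define old where "old = (\<lambda>e. if \<beta> e \<ge> 0 then old2 e else old1 e)"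
  define new where "new = (\<lambda>e. if \<beta> e \<ge> 0 then insert e (old2 e - {f e}) else insert (f e) (old1 e - {e}))"
  have posp: "0 < p T \<Longrightarrow> tree T" for T using p unfolding distr_def by (metis less_irrefl)
  have old_pos: "0 < p (old e)" if "e \<in> J" for e using old[OF that] by (simp add: old_def)
  have trees: "tree (old e)" "tree (new e)" if "e \<in> J" for e
    using old_pos[OF that] posp f[OF that] by (auto simp: new_def)
  have Pow: "T \<in> Pow {..<m}" if "tree T" for T using that by (auto simp: tree_def)
  define B where "B = (\<Sum>e\<in>J. \<bar>\<beta> e\<bar>)"
  have B: "0 \<le> B" by (simp add: B_def sum_nonneg)
  \<comment> \<open>All exchanges together take at most \<open>s * B\<close> from the weight of any
    tree, so weights remain nonnegative while this is at most the least weight \<open>pm\<close>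
    involved. The element 1 covers the case that \<open>J\<close> is empty.\<close>
  define pm where "pm = Min (insert 1 (p ` old ` J))"
  have pm: "0 < pm" "\<And>e. e \<in> J \<Longrightarrow> pm \<le> p (old e)"
    using J old_pos unfolding pm_def by (auto intro!: Min.coboundedI)
  define s0 where "s0 = pm / (B + 1)"
  have s0: "0 < s0" using pm B by (simp add: s0_def)
  have "\<exists>q. distr q \<and>
    (\<forall>g<m. mix q g = mix p g + s * (\<Sum>e\<in>J. \<beta> e * (of_bool (g = e) - of_bool (g = f e))))" if s: "0 < s" "s \<le> s0" for s
  proof -
    \<comment> \<open>The exchanges act on the weights and not on a common tree, so they can be made
      simultaneously even if they are incompatible.\<close>
    define q where "q = (\<lambda>T. p T + s * (\<Sum>e\<in>J. \<bar>\<beta> e\<bar> * (of_bool (T = new e) - of_bool (T = old e))))"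
    have sB: "s * B \<le> pm"
    proof -
      have "s * (B + 1) \<le> pm" using s B by (simp add: s0_def pos_le_divide_eq)
      moreover have "s * B \<le> s * (B + 1)" using s by simp
      ultimately show ?thesis by linarith
    qed
    have "0 \<le> q T" for T
    proof (cases "\<exists>e\<in>J. T = old e")
      case True
      then have "pm \<le> p T" using pm by auto
      moreover have "- B \<le> (\<Sum>e\<in>J. \<bar>\<beta> e\<bar> * (of_bool (T = new e) - of_bool (T = old e)))"
        unfolding B_def sum_negf[symmetric] by (intro sum_mono) auto
      then have "s * (- B) \<le> s * (\<Sum>e\<in>J. \<bar>\<beta> e\<bar> * (of_bool (T = new e) - of_bool (T = old e)))"
        using s by (intro mult_left_mono) auto
      ultimately show ?thesis using sB unfolding q_def by linarith
    next
      case False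
      then have "0 \<le> (\<Sum>e\<in>J. \<bar>\<beta> e\<bar> * (of_bool (T = new e) - of_bool (T = old e)))"
        by (intro sum_nonneg) auto
      then show ?thesis using p s unfolding q_def distr_def by simp
    qed
    moreover have "q T = 0" if "\<not> tree T" for T
    proof -
      have "(\<Sum>e\<in>J. \<bar>\<beta> e\<bar> * (of_bool (T = new e) - of_bool (T = old e))) = 0"
        using trees that by (intro sum.neutral) auto
      then show ?thesis using p that by (simp add: q_def distr_def)
    qed
    moreover have sumq: "(\<Sum>T\<in>Pow {..<m}. q T * h T) = (\<Sum>T\<in>Pow {..<m}. p T * h T) +
        s * (\<Sum>e\<in>J. \<bar>\<beta> e\<bar> * (h (new e) - h (old e)))" for h
    proof -
      have "(\<Sum>T\<in>Pow {..<m}. q T * h T) = (\<Sum>T\<in>Pow {..<m}. p T * h T) +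
         s * (\<Sum>T\<in>Pow {..<m}. \<Sum>e\<in>J. \<bar>\<beta> e\<bar> * (of_bool (T = new e) * h T - of_bool (T = old e) * h T))"
        by (simp add: q_def algebra_simps sum.distrib sum_distrib_left sum_distrib_right)
      also have "(\<Sum>T\<in>Pow {..<m}. \<Sum>e\<in>J. \<bar>\<beta> e\<bar> * (of_bool (T = new e) * h T - of_bool (T = old e) * h T)) =
         (\<Sum>e\<in>J. \<bar>\<beta> e\<bar> * ((\<Sum>T\<in>Pow {..<m}. of_bool (T = new e) * h T) - (\<Sum>T\<in>Pow {..<m}. of_bool (T = old e) * h T)))"
        unfolding sum_subtractf[symmetric] sum_distrib_left by (rule sum.swap)
      also have "\<dots> = (\<Sum>e\<in>J. \<bar>\<beta> e\<bar> * (h (new e) - h (old e)))"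
      proof (intro sum.cong refl)
        fix e assume "e \<in> J"
        have "(\<Sum>T\<in>Pow {..<m}. of_bool (T = T0) * h T) = h T0" if "tree T0" for T0
        proof -
          have "(\<Sum>T\<in>Pow {..<m}. of_bool (T = T0) * h T) = (\<Sum>T\<in>Pow {..<m}. if T = T0 then h T else 0)"
            by (intro sum.cong) auto
          then show ?thesis using Pow[OF that] by simp
        qed
        then show "\<bar>\<beta> e\<bar> * ((\<Sum>T\<in>Pow {..<m}. of_bool (T = new e) * h T) - (\<Sum>T\<in>Pow {..<m}. of_bool (T = old e) * h T)) =
          \<bar>\<beta> e\<bar> * (h (new e) - h (old e))" using trees[OF \<open>e \<in> J\<close>] by presburger
      qed
      finally show ?thesis .
    qed
    moreover have "sum q (Pow {..<m}) = 1" using sumq[of "\<lambda>_. 1"] p by (simp add: distr_def)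
    ultimately have "distr q" unfolding distr_def by blast
    moreover have "mix q g = mix p g + s * (\<Sum>e\<in>J. \<beta> e * (of_bool (g = e) - of_bool (g = f e)))" for g
    proof -
      have "(\<Sum>e\<in>J. \<bar>\<beta> e\<bar> * (chi (new e) g - chi (old e) g)) = (\<Sum>e\<in>J. \<beta> e * (of_bool (g = e) - of_bool (g = f e)))"
      proof (intro sum.cong refl)
        fix e assume "e \<in> J"
        then show "\<bar>\<beta> e\<bar> * (chi (new e) g - chi (old e) g) = \<beta> e * (of_bool (g = e) - of_bool (g = f e))"
          using old[of e] f[of e] by (cases "g = e"; cases "g = f e") (auto simp: new_def old_def)
      qed
      then show ?thesis unfolding mix_def sumq by simp
    qed
    ultimately show ?thesis by blast
  qed
  then show ?thesis using s0 by blast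
qed

lemma continuous_mix: "continuous_on UNIV (\<lambda>p. mix p e)"
  unfolding mix_def by (intro continuous_intros continuous_on_product_coordinates)

text \<open>The product of intervals [0, 1] over the trees and of {0} elsewhere is compact, and the
  remaining conditions are closed since \<open>mix\<close> is continuous. This provides the maximal
  point in \<open>few_fractional\<close>.\<close>

lemma compact_dists:
  "compact {p. distr p \<and> (\<forall>e<m. e \<notin> U \<longrightarrow> mix p e = v e) \<and> (\<forall>i\<in>A. (\<Sum>e<m. a i e * mix p e) \<le> r i)}"
proof -
  have "compact (Pi\<^sub>E UNIV (\<lambda>T. if tree T then {0..1::real} else {0}))"
    using compactin_PiE[of "\<lambda>_ :: nat set. euclidean :: real topology" UNIV "\<lambda>T. if tree T then {0..1::real} else {0}"]
    by (auto simp: euclidean_product_topology compactin_euclidean_iff)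
  moreover have "closed {p. sum p (Pow {..<m}) = 1 \<and> (\<forall>e. e < m \<longrightarrow> e \<notin> U \<longrightarrow> mix p e = v e) \<and>
     (\<forall>i. i \<in> A \<longrightarrow> (\<Sum>e<m. a i e * mix p e) \<le> r i)}"
  proof -
    have "closed {p. sum p (Pow {..<m}) = (1::real)}"
      by (intro closed_Collect_eq continuous_intros continuous_on_product_coordinates)
    moreover have "closed {p. e < m \<longrightarrow> e \<notin> U \<longrightarrow> mix p e = v e}" for e
      by (cases "e < m \<and> e \<notin> U") (auto intro!: closed_Collect_eq continuous_intros continuous_mix)
    moreover have "closed {p. i \<in> A \<longrightarrow> (\<Sum>e<m. a i e * mix p e) \<le> r i}" for i
      by (cases "i \<in> A") (auto intro!: closed_Collect_le continuous_intros continuous_mix)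
    ultimately show ?thesis by (intro closed_Collect_conj closed_Collect_all)
  qed
  ultimately have "compact (Pi\<^sub>E UNIV (\<lambda>T. if tree T then {0..1::real} else {0}) \<inter>
     {p. sum p (Pow {..<m}) = 1 \<and> (\<forall>e. e < m \<longrightarrow> e \<notin> U \<longrightarrow> mix p e = v e) \<and>
     (\<forall>i. i \<in> A \<longrightarrow> (\<Sum>e<m. a i e * mix p e) \<le> r i)})"
    by (rule compact_Int_closed)
  moreover have "p \<in> Pi\<^sub>E UNIV (\<lambda>T. if tree T then {0..1::real} else {0}) \<and> sum p (Pow {..<m}) = 1 \<longleftrightarrow> distr p"
    (is "?l \<longleftrightarrow> _") for p
  proof
    assume "distr p"
    then show ?l using distr_le1[of p] by (auto simp: PiE_iff distr_def)
  next
    assume l: ?l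
    then have "0 \<le> p T \<and> (\<not> tree T \<longrightarrow> p T = 0)" for T
      by (cases "tree T") (auto simp: PiE_iff split: if_splits)
    then show "distr p" using l by (auto simp: distr_def)
  qed
  then have "Pi\<^sub>E UNIV (\<lambda>T. if tree T then {0..1::real} else {0}) \<inter>
     {p. sum p (Pow {..<m}) = 1 \<and> (\<forall>e. e < m \<longrightarrow> e \<notin> U \<longrightarrow> mix p e = v e) \<and>
     (\<forall>i. i \<in> A \<longrightarrow> (\<Sum>e<m. a i e * mix p e) \<le> r i)} =
     {p. distr p \<and> (\<forall>e<m. e \<notin> U \<longrightarrow> mix p e = v e) \<and> (\<forall>i\<in>A. (\<Sum>e<m. a i e * mix p e) \<le> r i)}" by blast
  ultimately show ?thesis by simp
qed

end

context mgraph
begin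

text \<open>Take a maximal independent \<open>J\<close>. An element \<open>u\<close> of
  \<open>U\<close> outside \<open>J\<close> and its image could be added, since coordinate
  \<open>u\<close> occurs in the new vector only. So \<open>J\<close> and its image cover
  \<open>U\<close>.\<close>

lemma independent_exchanges:
  fixes f :: "nat \<Rightarrow> nat"
  assumes U: "U \<subseteq> {..<m}" and f: "\<And>e. e \<in> U \<Longrightarrow> f e \<in> U \<and> f e \<noteq> e"
  shows "\<exists>J\<subseteq>U. card U \<le> 2 * card J \<and> (\<forall>\<alpha>. (\<forall>g<m. (\<Sum>e\<in>J. \<alpha> e * (of_bool (g = e) - of_bool (g = f e))) = (0::real)) \<longrightarrow> (\<forall>e\<in>J. \<alpha> e = 0))"
proof -
  define ind where "ind = (\<lambda>J. J \<subseteq> U \<and> (\<forall>\<alpha>. (\<forall>g<m. (\<Sum>e\<in>J. \<alpha> e * (of_bool (g = e) - of_bool (g = f e))) = (0::real)) \<longrightarrow> (\<forall>e\<in>J. \<alpha> e = 0)))"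
  have finU: "finite U" using U finite_subset by blast
  have "ind {}" by (simp add: ind_def)
  moreover have "\<forall>J. ind J \<longrightarrow> card J \<le> card U" using finU by (auto simp: ind_def card_mono)
  ultimately obtain J where J: "ind J" and max: "\<And>J'. ind J' \<Longrightarrow> card J' \<le> card J"
    using ex_has_greatest_nat[of ind "{}" card "Suc (card U)"] by (metis le_imp_less_Suc)
  have JU: "J \<subseteq> U" "finite J" using J finU finite_subset by (auto simp: ind_def)
  have "U \<subseteq> J \<union> f ` J"
  proof
    fix u assume u: "u \<in> U"
    show "u \<in> J \<union> f ` J"
    proof (rule ccontr)
      assume n: "u \<notin> J \<union> f ` J"
      have "ind (insert u J)"
        unfolding ind_def
      proof (intro conjI allI impI)
        show "insert u J \<subseteq> U" using u JU by auto
        fix \<alpha> :: "nat \<Rightarrow> real"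
        assume z: "\<forall>g<m. (\<Sum>e\<in>insert u J. \<alpha> e * (of_bool (g = e) - of_bool (g = f e))) = 0"
        have "(\<Sum>e\<in>J. \<alpha> e * (of_bool (u = e) - of_bool (u = f e))) = 0"
          using n by (intro sum.neutral) auto
        moreover have "u < m" "f u \<noteq> u" using u U f by auto
        ultimately have au: "\<alpha> u = 0" using z n JU by (auto simp: sum.insert)
        then have "\<forall>g<m. (\<Sum>e\<in>J. \<alpha> e * (of_bool (g = e) - of_bool (g = f e))) = 0"
          using z n JU by (auto simp: sum.insert)
        then show "\<forall>e\<in>insert u J. \<alpha> e = 0" using au J by (auto simp: ind_def)
      qed
      from max[OF this] show False using n JU by simp
    qed
  qed
  then have "card U \<le> card (J \<union> f ` J)" using JU by (intro card_mono) auto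
  also have "\<dots> \<le> card J + card (f ` J)" by (rule card_Un_le)
  also have "\<dots> \<le> 2 * card J" using card_image_le[OF JU(2), of f] by simp
  finally show ?thesis using J JU unfolding ind_def by blast
qed

text \<open>At a point with maximal sum of squares no nonzero direction can be followed with both
  signs, as one of the two shifted points would have a larger sum. More than \<open>card A\<close>
  independent exchanges would yield a combination on which all constraints are constant, and hence
  such a direction.\<close>

lemma few_fractional:
  fixes a :: "'i \<Rightarrow> nat \<Rightarrow> real"
  assumes A: "finite A" and U: "U \<subseteq> {..<m}"
    and v: "\<And>e. e < m \<Longrightarrow> e \<notin> U \<Longrightarrow> v e = 0 \<or> v e = 1"
    and ne: "distr p0" "\<forall>e<m. e \<notin> U \<longrightarrow> mix p0 e = v e" "\<forall>i\<in>A. (\<Sum>e<m. a i e * mix p0 e) \<le> r i"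
    and frac: "\<And>p e. distr p \<Longrightarrow> \<forall>e<m. e \<notin> U \<longrightarrow> mix p e = v e \<Longrightarrow> \<forall>i\<in>A. (\<Sum>e<m. a i e * mix p e) \<le> r i \<Longrightarrow>
       e \<in> U \<Longrightarrow> mix p e \<noteq> 0 \<and> mix p e \<noteq> 1"
  shows "card U \<le> 2 * card A"
proof (rule ccontr)
  assume big: "\<not> card U \<le> 2 * card A"
  define W where "W = {p. distr p \<and> (\<forall>e<m. e \<notin> U \<longrightarrow> mix p e = v e) \<and> (\<forall>i\<in>A. (\<Sum>e<m. a i e * mix p e) \<le> r i)}"
  have "compact W" "W \<noteq> {}" using compact_dists ne unfolding W_def by auto
  moreover have "continuous_on W (\<lambda>p. \<Sum>e<m. (mix p e)\<^sup>2)"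
    by (intro continuous_intros continuous_on_subset[OF continuous_mix]) auto
  ultimately obtain p where p: "p \<in> W" and max: "\<And>q. q \<in> W \<Longrightarrow> (\<Sum>e<m. (mix q e)\<^sup>2) \<le> (\<Sum>e<m. (mix p e)\<^sup>2)"
    using continuous_attains_sup[of W "\<lambda>p. \<Sum>e<m. (mix p e)\<^sup>2"] by blast
  have dp: "distr p" using p by (simp add: W_def)
  have x01: "0 < mix p e \<and> mix p e < 1" if "e \<in> U" for e
  proof -
    have "e < m" using that U by auto
    then have "0 \<le> mix p e" "mix p e \<le> 1" using mix_pst[OF dp] pst_le1 unfolding pst_def by auto
    moreover have "mix p e \<noteq> 0 \<and> mix p e \<noteq> 1" using frac[of p e] p that by (auto simp: W_def)
    ultimately show ?thesis by linarith
  qed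
  have "\<exists>T1 T2 g. 0 < p T1 \<and> e \<in> T1 \<and> 0 < p T2 \<and> e \<notin> T2 \<and> g \<in> T2 \<and> g \<notin> T1 \<and>
     tree (insert g (T1 - {e})) \<and> tree (insert e (T2 - {g})) \<and> g \<in> U \<and> g \<noteq> e" if e: "e \<in> U" for e
  proof -
    have em: "e < m" using e U by auto
    obtain T1 T2 where T: "0 < p T1" "e \<in> T1" "0 < p T2" "e \<notin> T2"
      using x01[OF e] mix_support[OF dp em] by blast
    have tr: "tree T1" "tree T2" using T dp unfolding distr_def by (metis less_irrefl)+
    from symmetric_exchange[OF tr T(2,4)] obtain g where
      g: "g \<in> T2" "g \<notin> T1" "tree (insert g (T1 - {e}))" "tree (insert e (T2 - {g}))" by blast
    have gm: "g < m" using g tr by (auto simp: tree_def)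
    \<comment> \<open>The partner \<open>g\<close> lies in \<open>T2\<close> and not in
      \<open>T1\<close>, both of positive weight. So it is fractional too and cannot be one of the
      fixed edges; the direction stays inside \<open>U\<close>.\<close>
    have "0 < mix p g" using mix_support(1)[OF dp gm] T(3) g(1) by blast
    moreover have "mix p g < 1" using mix_support(2)[OF dp gm] T(1) g(2) by blast
    moreover have "g \<notin> U \<Longrightarrow> mix p g = v g" using p gm unfolding W_def by blast
    ultimately have "g \<in> U" using v[OF gm] by fastforce
    then show ?thesis using T g by blast
  qed
  then obtain old1 old2 f where f: "\<And>e. e \<in> U \<Longrightarrow> 0 < p (old1 e) \<and> e \<in> old1 e \<and> 0 < p (old2 e) \<and> e \<notin> old2 e \<and>
     f e \<in> old2 e \<and> f e \<notin> old1 e \<and> tree (insert (f e) (old1 e - {e})) \<and> tree (insert e (old2 e - {f e})) \<and> f e \<in> U \<and> f e \<noteq> e"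
    by metis
  obtain J where J: "J \<subseteq> U" "card U \<le> 2 * card J"
    and ind: "\<And>\<alpha>. \<forall>g<m. (\<Sum>e\<in>J. \<alpha> e * (of_bool (g = e) - of_bool (g = f e))) = (0::real) \<Longrightarrow> \<forall>e\<in>J. \<alpha> e = 0"
    using independent_exchanges[OF U, of f] f by blast
  have Jf: "finite J" "J \<subseteq> {..<m}" using J U finite_subset[of J "{..<m}"] by auto
  have "card A < card J" using big J by linarith
  from homogeneous_system[OF A Jf(1) this, of "\<lambda>i e. a i e - a i (f e)"] obtain \<alpha> where
    \<alpha>: "\<exists>e\<in>J. \<alpha> e \<noteq> 0" "\<forall>i\<in>A. (\<Sum>e\<in>J. \<alpha> e * (a i e - a i (f e))) = 0" by blast
  define d where "d = (\<lambda>g. \<Sum>e\<in>J. \<alpha> e * (of_bool (g = e) - of_bool (g = f e)))"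
  obtain g0 where g0: "g0 < m" "d g0 \<noteq> 0" using ind[of \<alpha>] \<alpha>(1) unfolding d_def by blast
  have dU: "d g = 0" if "g \<notin> U" for g
    unfolding d_def using that J f by (intro sum.neutral) auto
  have dA: "(\<Sum>g<m. a i g * d g) = 0" if "i \<in> A" for i
  proof -
    have "(\<Sum>g<m. a i g * d g) = (\<Sum>e\<in>J. \<Sum>g<m. a i g * (\<alpha> e * (of_bool (g = e) - of_bool (g = f e))))"
      unfolding d_def sum_distrib_left by (rule sum.swap)
    also have "\<dots> = (\<Sum>e\<in>J. \<alpha> e * (a i e - a i (f e)))"
    proof (intro sum.cong refl)
      fix e assume "e \<in> J"
      then have em: "e < m" "f e < m" using f J U by blast+
      have "(\<Sum>g<m. a i g * (\<alpha> e * (of_bool (g = e) - of_bool (g = f e)))) =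
        (\<Sum>g<m. (if g = e then a i g * \<alpha> e else 0)) - (\<Sum>g<m. (if g = f e then a i g * \<alpha> e else 0))"
        unfolding sum_subtractf[symmetric] by (intro sum.cong) auto
      also have "\<dots> = \<alpha> e * (a i e - a i (f e))" using em by (simp add: algebra_simps)
      finally show "(\<Sum>g<m. a i g * (\<alpha> e * (of_bool (g = e) - of_bool (g = f e)))) = \<alpha> e * (a i e - a i (f e))" .
    qed
    finally show ?thesis using \<alpha>(2) that by simp
  qed
  have inW: "q \<in> W" if "distr q" "\<forall>g<m. mix q g = mix p g + s * d g" for q s
  proof -
    have "(\<Sum>e<m. a i e * mix q e) = (\<Sum>e<m. a i e * mix p e) + s * (\<Sum>e<m. a i e * d e)" for i
    proof -
      have "(\<Sum>e<m. a i e * mix q e) = (\<Sum>e<m. a i e * (mix p e + s * d e))" using that by (intro sum.cong) auto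
      then show ?thesis by (simp add: algebra_simps sum.distrib sum_distrib_left)
    qed
    then show ?thesis using that p dU dA unfolding W_def by simp
  qed
  have ol: "0 < p (old1 e) \<and> e \<in> old1 e \<and> 0 < p (old2 e) \<and> e \<notin> old2 e" if "e \<in> J" for e using f J that by blast
  have fl: "f e \<in> old2 e \<and> f e \<notin> old1 e \<and> tree (insert (f e) (old1 e - {e})) \<and> tree (insert e (old2 e - {f e}))" if "e \<in> J" for e
    using f J that by blast
  obtain s1 where s1: "s1 > 0" "\<And>s. 0 < s \<and> s \<le> s1 \<Longrightarrow> \<exists>q. distr q \<and> (\<forall>g<m. mix q g = mix p g + s * d g)"
    using shift_mix[OF dp Jf ol fl, of \<alpha>] unfolding d_def by blast
  have dm: "(\<Sum>e\<in>J. - \<alpha> e * (of_bool (g = e) - of_bool (g = f e))) = - d g" for g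
    by (simp add: d_def sum_negf)
  obtain s2 where s2: "s2 > 0" "\<And>s. 0 < s \<and> s \<le> s2 \<Longrightarrow> \<exists>q. distr q \<and> (\<forall>g<m. mix q g = mix p g + s * - d g)"
    using shift_mix[OF dp Jf ol fl, of "\<lambda>e. - \<alpha> e"] unfolding dm by blast
  define s where "s = min s1 s2"
  have s: "0 < s" "s \<le> s1" "s \<le> s2" using s1 s2 by (auto simp: s_def)
  obtain q1 where q1: "distr q1" "\<forall>g<m. mix q1 g = mix p g + s * d g" using s1(2)[of s] s by blast
  obtain q2 where q2: "distr q2" "\<forall>g<m. mix q2 g = mix p g + (- s) * d g" using s2(2)[of s] s by auto
  \<comment> \<open>The parallelogram law: the mean over the two shifts exceeds the value at
    \<open>p\<close> by a multiple of the squared length of the direction.\<close>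
  have "(\<Sum>e<m. (mix q1 e)\<^sup>2) + (\<Sum>e<m. (mix q2 e)\<^sup>2) = 2 * (\<Sum>e<m. (mix p e)\<^sup>2) + 2 * s\<^sup>2 * (\<Sum>e<m. (d e)\<^sup>2)"
  proof -
    have "(\<Sum>e<m. (mix q1 e)\<^sup>2) + (\<Sum>e<m. (mix q2 e)\<^sup>2) = (\<Sum>e<m. 2 * (mix p e)\<^sup>2 + 2 * s\<^sup>2 * (d e)\<^sup>2)"
      unfolding sum.distrib[symmetric]
    proof (intro sum.cong refl)
      fix e assume "e \<in> {..<m}"
      then have q: "mix q1 e = mix p e + s * d e" "mix q2 e = mix p e + (- s) * d e" using q1(2) q2(2) by auto
      show "(mix q1 e)\<^sup>2 + (mix q2 e)\<^sup>2 = 2 * (mix p e)\<^sup>2 + 2 * s\<^sup>2 * (d e)\<^sup>2"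
        unfolding q by (simp add: power2_eq_square algebra_simps)
    qed
    then show ?thesis by (simp add: sum.distrib sum_distrib_left)
  qed
  moreover have "0 < (\<Sum>e<m. (d e)\<^sup>2)" using g0 by (intro sum_pos2[of _ g0]) auto
  then have "0 < 2 * s\<^sup>2 * (\<Sum>e<m. (d e)\<^sup>2)" using s by simp
  ultimately show False using max[OF inW[OF q1]] max[OF inW[OF q2]] by linarith
qed

section \<open>Laminar families whose cuts are pairwise far apart\<close>

text \<open>A charging argument that removes a maximal set \<open>S\<close>. If at most one maximal
  remaining set \<open>C\<close> lies in \<open>S\<close>, an edge on which the two cuts differ has
  an end in \<open>S - C\<close>, so more than \<open>k\<close> edge ends lose their cover. If there
  are two or more, removing \<open>S\<close> raises the number of maximal sets, which makes up for
  the lost set. The potential \<open>card G + card (mx G)\<close> treats both cases; each edge has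
  two ends, whence the factor 4.\<close>

lemma laminar_net:
  assumes U: "finite U" and F: "finite F" "{} \<notin> F"
    and lam: "\<And>X Y. X \<in> F \<Longrightarrow> Y \<in> F \<Longrightarrow> X \<inter> Y = {} \<or> X \<subseteq> Y \<or> Y \<subseteq> X"
    and far: "\<And>X Y. X \<in> F \<Longrightarrow> Y \<in> insert {} F \<Longrightarrow> X \<noteq> Y \<Longrightarrow>
      k < card {e \<in> U. ((src e \<in> X) \<noteq> (tgt e \<in> X)) \<noteq> ((src e \<in> Y) \<noteq> (tgt e \<in> Y))}"
  shows "(k + 1) * card F \<le> 4 * card U"
proof -
  define pt where "pt = (\<lambda>(e, b). if b then src e else tgt e)"
  define ends where "ends = (\<lambda>F. {z \<in> U \<times> (UNIV :: bool set). pt z \<in> \<Union>F})"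
  define mx where "mx = (\<lambda>F :: nat set set. {X \<in> F. \<forall>Y\<in>F. X \<subseteq> Y \<longrightarrow> Y = X})"
  have fe: "finite (ends F)" for F using U by (auto simp: ends_def)
  have "(k + 1) * (card G + card (mx G)) \<le> 2 * card (ends G)" if "G \<subseteq> F" for G
    using finite_subset[OF that F(1)] that
  proof (induction "card G" arbitrary: G)
    case 0
    then show ?case by (auto simp: mx_def)
  next
    case (Suc n)
    then have "G \<noteq> {}" by auto
    then obtain S where S: "S \<in> G" "\<And>Y. Y \<in> G \<Longrightarrow> S \<subseteq> Y \<Longrightarrow> Y = S"
      using finite_has_maximal[OF Suc.prems(1)] by metis
    define G' where "G' = G - {S}"
    have G': "G = insert S G'" "S \<notin> G'" "finite G'" "card G' = n" "G' \<subseteq> F"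
      using S Suc by (auto simp: G'_def)
    define Ch where "Ch = {X \<in> mx G'. X \<subseteq> S}"
    have finm: "finite (mx G')" "finite Ch" using G' by (auto simp: mx_def Ch_def)
    have above: "\<exists>Y\<in>mx G'. X \<subseteq> Y" if "X \<in> G'" for X
    proof -
      have "finite {Y \<in> G'. X \<subseteq> Y}" "{Y \<in> G'. X \<subseteq> Y} \<noteq> {}" using G'(3) that by auto
      from finite_has_maximal[OF this] show ?thesis unfolding mx_def by (smt (verit) mem_Collect_eq order_trans)
    qed
    have mG: "mx G = insert S (mx G' - Ch)"
    proof
      show "mx G \<subseteq> insert S (mx G' - Ch)" using S G' by (auto simp: mx_def Ch_def)
      have "X \<in> mx G" if X: "X \<in> mx G' - Ch" for X
      proof -
        have "Y = X" if "Y \<in> G" "X \<subseteq> Y" for Y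
        proof (cases "Y = S")
          case True
          then show ?thesis using X that by (auto simp: Ch_def)
        qed (use X that G' in \<open>auto simp: mx_def\<close>)
        then show ?thesis using X G' by (auto simp: mx_def)
      qed
      then show "insert S (mx G' - Ch) \<subseteq> mx G" using S by (auto simp: mx_def)
    qed
    have "S \<notin> mx G' - Ch" using G' by (auto simp: mx_def)
    then have cm: "card (mx G) + card Ch = 1 + card (mx G')"
      unfolding mG using finm by (simp add: card_Diff_subset Ch_def card_mono)
    have IH: "(k + 1) * (card G' + card (mx G')) \<le> 2 * card (ends G')" using Suc.hyps(1)[OF G'(4)[symmetric] G'(3) G'(5)] .
    have cG: "card G = Suc (card G')" using G' by simp
    have sub: "ends G' \<subseteq> ends G" using G'(1) by (auto simp: ends_def)
    show ?case
    proof (cases "2 \<le> card Ch")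
      case True
      have "card (ends G') \<le> card (ends G)" by (rule card_mono[OF fe sub])
      moreover have "card G + card (mx G) \<le> card G' + card (mx G')" using True cm cG by linarith
      then have "(k + 1) * (card G + card (mx G)) \<le> (k + 1) * (card G' + card (mx G'))" by (rule mult_le_mono2)
      ultimately show ?thesis using IH by linarith
    next
      case False
      define C where "C = \<Union>Ch"
      have C: "C = {} \<or> Ch = {C}"
      proof (cases "Ch = {}")
        case ne: False
        then have "card Ch = 1" using False finm by (metis One_nat_def card_0_eq less_2_cases not_le)
        then show ?thesis unfolding C_def by (metis card_1_singletonE ccpo_Sup_singleton)
      qed (simp add: C_def)
      have CF: "C \<in> insert {} F" "C \<noteq> S" "C \<subseteq> S"
      proof -
        have SF: "S \<in> F" using S(1) Suc.prems(2) by blast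
        have *: "C \<in> insert {} F \<and> C \<noteq> S \<and> C \<subseteq> S"
        proof (cases "C = {}")
          case True
          then show ?thesis using SF F(2) by auto
        next
          case False
          then have "C \<in> Ch" using C by (metis singletonI)
          then have "C \<in> G'" "C \<subseteq> S" by (simp_all add: Ch_def mx_def)
          then show ?thesis using G'(2,5) by blast
        qed
        then show "C \<in> insert {} F" "C \<noteq> S" "C \<subseteq> S" by blast+
      qed
      define D where "D = {e \<in> U. ((src e \<in> S) \<noteq> (tgt e \<in> S)) \<noteq> ((src e \<in> C) \<noteq> (tgt e \<in> C))}"
      have kD: "k < card D" unfolding D_def using S(1) Suc.prems(2) CF(1,2) by (intro far) blast+
      define h where "h = (\<lambda>e. (e, src e \<in> S - C))"
      \<comment> \<open>A remaining set that meets \<open>S\<close> lies in \<open>S\<close> by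
        maximality, and so does the maximal set that contains it; only points of \<open>C\<close>
        are covered.\<close>
      have out: "w \<notin> \<Union>G'" if "w \<in> S - C" for w
      proof
        assume "w \<in> \<Union>G'"
        then obtain X where "X \<in> G'" "w \<in> X" by auto
        then obtain Y where Y: "Y \<in> mx G'" "w \<in> Y" using above by blast
        then have YG: "Y \<in> G'" by (auto simp: mx_def)
        then have "Y \<in> F" "S \<in> F" "Y \<noteq> S" "Y \<in> G" using G' S(1) Suc.prems(2) by auto
        then have "Y \<subseteq> S" using lam[of Y S] Y(2) that S(2)[of Y] by blast
        then have "Y \<in> Ch" using Y by (simp add: Ch_def)
        then show False using Y(2) that by (auto simp: C_def)
      qed
      have "h ` D \<subseteq> ends G - ends G'"
      proof
        fix z assume "z \<in> h ` D"
        then obtain e where e: "e \<in> D" "z = h e" by auto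
        have "pt z \<in> S - C" using e CF(3) by (auto simp: h_def pt_def D_def)
        then show "z \<in> ends G - ends G'" using out[of "pt z"] e S(1) by (auto simp: ends_def h_def D_def)
      qed
      moreover have "inj_on h D" by (auto simp: inj_on_def h_def)
      ultimately have "card D \<le> card (ends G - ends G')" using fe by (metis card_image card_mono finite_Diff)
      moreover have "card (ends G - ends G') = card (ends G) - card (ends G')" using sub fe by (simp add: card_Diff_subset)
      moreover have "card (ends G') \<le> card (ends G)" by (rule card_mono[OF fe sub])
      ultimately have own: "card (ends G') + (k + 1) \<le> card (ends G)" using kD by linarith
      have "card G + card (mx G) \<le> card G' + card (mx G') + 2" using cm cG by linarith
      then have "(k + 1) * (card G + card (mx G)) \<le> (k + 1) * (card G' + card (mx G') + 2)" by (rule mult_le_mono2)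
      also have "\<dots> = (k + 1) * (card G' + card (mx G')) + 2 * (k + 1)" by (simp add: algebra_simps)
      also have "\<dots> \<le> 2 * card (ends G') + 2 * (k + 1)" using IH by (rule add_right_mono)
      also have "\<dots> \<le> 2 * card (ends G)" using own by simp
      finally show ?thesis .
    qed
  qed
  from this[of F] have "(k + 1) * (card F + card (mx F)) \<le> 2 * card (ends F)" by simp
  moreover have "card (ends F) \<le> card (U \<times> (UNIV :: bool set))" using U by (intro card_mono) (auto simp: ends_def)
  then have "card (ends F) \<le> 2 * card U" by (simp add: card_cartesian_product)
  moreover have "(k + 1) * card F \<le> (k + 1) * (card F + card (mx F))" by (rule mult_le_mono2) simp
  ultimately show ?thesis by linarith
qed

end

context mgraph
begin

section \<open>Minimum spanning trees by the greedy algorithm\<close>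

definition merged :: "(nat \<Rightarrow> int) \<Rightarrow> nat set" where
  "merged lb = {e. e < m \<and> lb (src e) = lb (tgt e)}"

lemma finite_merged: "finite (merged lb)"
  by (auto simp: merged_def)

text \<open>The subtour inequalities, added up over the classes of the labelling.\<close>

lemma merged_bound:
  assumes "pst x"
  shows "sum x (merged lb) \<le> real (card V) - real (card (lb ` V))"
proof -
  define cls where "cls = (\<lambda>c. {v \<in> V. lb v = c})"
  have "merged lb = (\<Union>c\<in>lb ` V. inner (cls c))"
  proof (intro set_eqI iffI)
    fix e assume "e \<in> merged lb"
    then have "e \<in> inner (cls (lb (src e)))" "lb (src e) \<in> lb ` V" using ends by (auto simp: merged_def inner_def cls_def)
    then show "e \<in> (\<Union>c\<in>lb ` V. inner (cls c))" by blast
  qed (auto simp: merged_def inner_def cls_def)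
  moreover have "sum x (\<Union>c\<in>lb ` V. inner (cls c)) = (\<Sum>c\<in>lb ` V. sum x (inner (cls c)))"
    using finite_V by (intro sum.UNION_disjoint) (auto simp: inner_def cls_def)
  ultimately have "sum x (merged lb) = (\<Sum>c\<in>lb ` V. sum x (inner (cls c)))" by simp
  also have "\<dots> \<le> (\<Sum>c\<in>lb ` V. real (card (cls c)) - 1)"
  proof (rule sum_mono)
    fix c assume "c \<in> lb ` V"
    then have "cls c \<subseteq> V" "cls c \<noteq> {}" by (auto simp: cls_def)
    then show "sum x (inner (cls c)) \<le> real (card (cls c)) - 1" using assms unfolding pst_def by blast
  qed
  also have "\<dots> = real (\<Sum>c\<in>lb ` V. card (cls c)) - real (card (lb ` V))"
    by (simp add: sum_subtractf)
  also have "(\<Sum>c\<in>lb ` V. card (cls c)) = card (\<Union>c\<in>lb ` V. cls c)"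
    using finite_V by (intro card_UN_disjoint[symmetric]) (auto simp: cls_def)
  also have "(\<Union>c\<in>lb ` V. cls c) = V" by (auto simp: cls_def)
  finally show ?thesis .
qed

text \<open>The dual certificate of the greedy algorithm as a partial summation. \<open>c\<close> is
  a threshold below all weights still to come, and it is multiplied by the deficit
  \<open>card T - sum x (merged lb)\<close>, which is nonnegative by \<open>merged_bound\<close> and
  zero when everything is merged. The last case is optimality against every fractional
  point.\<close>

definition greedy_bound :: "(nat \<Rightarrow> int) \<Rightarrow> nat set \<Rightarrow> (nat \<Rightarrow> int) \<Rightarrow> int \<Rightarrow> bool" where
  "greedy_bound w T lb c \<longleftrightarrow> (\<forall>e<m. lb (src e) \<noteq> lb (tgt e) \<longrightarrow> c \<le> w e) \<and>
       (\<forall>x :: nat \<Rightarrow> real. pst x \<longrightarrow> (\<Sum>e\<in>T. real_of_int (w e)) - real_of_int c * (real (card T) - sum x (merged lb)) \<le> (\<Sum>e\<in>merged lb. real_of_int (w e) * x e))"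

definition kinv :: "(nat \<Rightarrow> int) \<Rightarrow> nat set \<Rightarrow> (nat \<Rightarrow> int) \<Rightarrow> bool" where
  "kinv w T lb \<longleftrightarrow> T \<subseteq> merged lb \<and> card (lb ` V) + card T = card V \<and>
     (\<forall>u\<in>V. \<forall>v\<in>V. lb u = lb v \<longrightarrow> (u, v) \<in> (adj T)\<^sup>*) \<and>
     (\<exists>c. greedy_bound w T lb c)"

lemma kinv_init:
  assumes "inj_on lb V"
  shows "kinv w {} lb"
proof -
  have m0: "merged lb = {}" using assms ends by (auto simp: merged_def inj_on_def)
  \<comment> \<open>Any lower bound can be the first threshold; 0 would not do, since penalties make
    weights negative.\<close>
  have "- (\<Sum>e<m. \<bar>w e\<bar>) \<le> w e" if "e < m" for e
  proof -
    have "\<bar>w e\<bar> \<le> (\<Sum>e<m. \<bar>w e\<bar>)" using that by (intro member_le_sum) auto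
    then show ?thesis by linarith
  qed
  then have "\<exists>c. \<forall>e<m. lb (src e) \<noteq> lb (tgt e) \<longrightarrow> c \<le> w e" by blast
  moreover have "(u, v) \<in> (adj {})\<^sup>*" if "u \<in> V" "v \<in> V" "lb u = lb v" for u v
    using assms that by (auto simp: inj_on_def)
  ultimately show ?thesis using assms unfolding kinv_def greedy_bound_def m0 by (auto simp: card_image)
qed

text \<open>Since the deficit is nonnegative, raising the threshold to \<open>w e\<close> only
  weakens the inequality; all edges merged by this step weigh at least \<open>w e\<close>.\<close>

lemma kinv_step:
  assumes K: "kinv w T lb" and e: "e < m" "lb (src e) \<noteq> lb (tgt e)"
    and min: "\<And>g. g < m \<Longrightarrow> lb (src g) \<noteq> lb (tgt g) \<Longrightarrow> w e \<le> w g"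
    and lb': "\<And>v. v \<in> V \<Longrightarrow> lb' v = (if lb v = lb (src e) then lb (tgt e) else lb v)"
  shows "kinv w (insert e T) lb'" "e \<notin> T"
proof -
  let ?p = "lb (src e)" and ?q = "lb (tgt e)"
  have eV: "src e \<in> V" "tgt e \<in> V" using ends e by auto
  have T: "T \<subseteq> merged lb" "card (lb ` V) + card T = card V"
    using K unfolding kinv_def by blast+
  have finT: "finite T" by (rule finite_subset[OF T(1) finite_merged])
  have con: "(u, v) \<in> (adj T)\<^sup>*" if "u \<in> V" "v \<in> V" "lb u = lb v" for u v
    using K that unfolding kinv_def by blast
  obtain c where gb: "greedy_bound w T lb c" using K unfolding kinv_def by blast
  have c: "c \<le> w g" if "g < m" "lb (src g) \<noteq> lb (tgt g)" for g
    using gb that unfolding greedy_bound_def by blast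
  have opt: "(\<Sum>e\<in>T. real_of_int (w e)) - real_of_int c * (real (card T) - sum x (merged lb)) \<le> (\<Sum>e\<in>merged lb. real_of_int (w e) * x e)" if "pst x" for x :: "nat \<Rightarrow> real"
    using gb that unfolding greedy_bound_def by blast
  have "lb' ` V = lb ` V - {?p}"
  proof (intro set_eqI iffI)
    fix z assume "z \<in> lb' ` V"
    then show "z \<in> lb ` V - {?p}" using eV e(2) lb' by (auto split: if_splits)
  next
    fix z assume "z \<in> lb ` V - {?p}"
    then obtain v where "v \<in> V" "z = lb v" "z \<noteq> ?p" by auto
    then show "z \<in> lb' ` V" using lb'[of v] by (metis imageI)
  qed
  moreover have "card (lb ` V) > 0" using eV finite_V by (auto simp: card_gt_0_iff)
  ultimately have cl: "card (lb' ` V) + 1 = card (lb ` V)" using eV finite_V by (simp add: card_Diff_singleton)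
  have mm: "merged lb \<subseteq> merged lb'" using lb' ends by (auto simp: merged_def)
  have em: "e \<in> merged lb'" "e \<notin> merged lb" using e eV lb' by (auto simp: merged_def)
  show eT: "e \<notin> T" using em T by blast
  have con': "(u, v) \<in> (adj (insert e T))\<^sup>*" if "u \<in> V" "v \<in> V" "lb' u = lb' v" for u v
  proof -
    have sub: "(adj T)\<^sup>* \<subseteq> (adj (insert e T))\<^sup>*" by (rule adj_mono) auto
    have ed: "(src e, tgt e) \<in> (adj (insert e T))\<^sup>*" using adj_edge[of e "insert e T"] by auto
    have to: "(x, tgt e) \<in> (adj (insert e T))\<^sup>*" if "x \<in> V" "lb x = ?p \<or> lb x = ?q" for x
      using con[OF that(1) eV(1)] con[OF that(1) eV(2)] that(2) sub ed by (meson rtrancl_trans subsetD)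
    show ?thesis
    proof (cases "lb u = lb v")
      case False
      then have "lb u = ?p \<or> lb u = ?q" "lb v = ?p \<or> lb v = ?q" using that lb' by (auto split: if_splits)
      then show ?thesis using to that adj_sym by (meson rtrancl_trans)
    qed (use con that sub in blast)
  qed
  have opt': "(\<Sum>g\<in>insert e T. real_of_int (w g)) - real_of_int (w e) * (real (card (insert e T)) - sum x (merged lb')) \<le> (\<Sum>g\<in>merged lb'. real_of_int (w g) * x g)"
    if x: "pst x" for x :: "nat \<Rightarrow> real"
  proof -
    have x0: "g < m \<Longrightarrow> 0 \<le> x g" for g using x by (simp add: pst_def)
    define M where "M = merged lb' - merged lb"
    have s: "sum f (merged lb') = sum f (merged lb) + sum f M" for f :: "nat \<Rightarrow> real"
      unfolding M_def using mm finite_merged by (metis add.commute sum.subset_diff)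
    have "real_of_int (w e) * sum x M \<le> (\<Sum>g\<in>M. real_of_int (w g) * x g)"
      unfolding sum_distrib_left
    proof (rule sum_mono)
      fix g assume "g \<in> M"
      then have "g < m" "w e \<le> w g" using min by (auto simp: M_def merged_def)
      then show "real_of_int (w e) * x g \<le> w g * x g" using x0 by (intro mult_right_mono) auto
    qed
    moreover have "real_of_int c * (real (card T) - sum x (merged lb)) \<le> real_of_int (w e) * (real (card T) - sum x (merged lb))"
    proof (rule mult_right_mono)
      show "real_of_int c \<le> w e" using c e by simp
      have "real (card V) = real (card (lb ` V)) + card T" using T(2) by (metis of_nat_add)
      then show "0 \<le> real (card T) - sum x (merged lb)" using merged_bound[OF x, of lb] by linarith
    qed
    ultimately have "(\<Sum>g\<in>T. real_of_int (w g)) - real_of_int (w e) * (real (card T) - sum x (merged lb)) + real_of_int (w e) * sum x M \<le> (\<Sum>g\<in>merged lb'. real_of_int (w g) * x g)"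
      using opt[OF x] unfolding s by linarith
    then show ?thesis using eT finT unfolding s by (simp add: algebra_simps)
  qed
  show "kinv w (insert e T) lb'"
    unfolding kinv_def
  proof (intro conjI ballI impI)
    show "insert e T \<subseteq> merged lb'" using T mm em by auto
    show "card (lb' ` V) + card (insert e T) = card V" using T(2) cl eT finT by simp
    have "w e \<le> w g" if "g < m" "lb' (src g) \<noteq> lb' (tgt g)" for g
      using min[of g] mm that by (auto simp: merged_def)
    then have "greedy_bound w (insert e T) lb' (w e)" using opt' unfolding greedy_bound_def by blast
    then show "\<exists>c. greedy_bound w (insert e T) lb' c" by blast
  qed (use con' in auto)
qed

lemma kinv_card: "kinv w T lb \<Longrightarrow> card T + 1 \<le> card V"
proof -
  assume "kinv w T lb"
  then have "card (lb ` V) + card T = card V" by (simp add: kinv_def)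
  moreover have "card (lb ` V) > 0" using V_ne finite_V by (auto simp: card_gt_0_iff)
  ultimately show ?thesis by linarith
qed

lemma kinv_final:
  assumes K: "kinv w T lb" and fin: "\<And>e. e < m \<Longrightarrow> lb (src e) = lb (tgt e)" and con: "con {..<m}"
  shows "tree T" "pst x \<Longrightarrow> (\<Sum>e\<in>T. real_of_int (w e)) \<le> (\<Sum>e<m. real_of_int (w e) * x e)"
proof -
  have all: "merged lb = {..<m}" using fin by (auto simp: merged_def)
  have no: "{e \<in> {..<m}. lb (src e) \<noteq> lb (tgt e)} = {}" using fin by auto
  have "card (lb ` V) \<le> card {e \<in> {..<m}. lb (src e) \<noteq> lb (tgt e)} + 1" by (rule card_quotient[OF _ con]) simp
  then have c1: "card (lb ` V) \<le> 1" unfolding no by simp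
  moreover have cV: "card (lb ` V) + card T = card V" using K by (simp add: kinv_def)
  moreover have "card (lb ` V) > 0" using V_ne finite_V by (auto simp: card_gt_0_iff)
  ultimately have cT: "card T + 1 = card V" by linarith
  have "lb u = lb v" if "u \<in> V" "v \<in> V" for u v
    using c1 that finite_V by (metis One_nat_def card_le_Suc0_iff_eq finite_imageI imageI)
  then have "con T" using K unfolding kinv_def con_def by blast
  moreover have "T \<subseteq> {..<m}" using K all unfolding kinv_def by auto
  ultimately show "tree T" using cT by (simp add: tree_def)
  show "(\<Sum>e\<in>T. real_of_int (w e)) \<le> (\<Sum>e<m. real_of_int (w e) * x e)" if x: "pst x"
  proof -
    obtain c where "(\<Sum>e\<in>T. real_of_int (w e)) - real_of_int c * (real (card T) - sum x (merged lb)) \<le> (\<Sum>e\<in>merged lb. real_of_int (w e) * x e)"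
      using K x unfolding kinv_def greedy_bound_def by blast
    moreover have "sum x {..<m} = real (card T)" using x cT unfolding pst_def by linarith
    ultimately show ?thesis unfolding all by simp
  qed
qed

lemma sum_tree:
  fixes g :: "nat \<Rightarrow> real"
  assumes "tree T" shows "(\<Sum>e<m. g e * chi T e) = sum g T"
proof -
  have "T \<subseteq> {..<m}" using assms by (simp add: tree_def)
  have "(\<Sum>e<m. g e * chi T e) = (\<Sum>e<m. if e \<in> T then g e else 0)" by (intro sum.cong) auto
  also have "\<dots> = sum g ({..<m} \<inter> T)" by (simp add: sum.If_cases Int_def)
  also have "{..<m} \<inter> T = T" using \<open>T \<subseteq> {..<m}\<close> by auto
  finally show ?thesis .
qed

section \<open>Enforcing fixed edges by penalties\<close>

definition obeys :: "(nat \<Rightarrow> int) \<Rightarrow> (nat \<Rightarrow> real) \<Rightarrow> bool" where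
  "obeys fx x \<longleftrightarrow> (\<forall>e<m. (fx e = 1 \<longrightarrow> x e = 1) \<and> (fx e = 2 \<longrightarrow> x e = 0))"

text \<open>Relative to an obeying point, every violated fixation costs \<open>bg\<close>, more than
  the whole unpenalised weight of that point. So the minimum tree obeys as soon as some fractional
  point does, and the penalties cancel in the comparison.\<close>

lemma penalised_tree:
  assumes T: "tree T" and opt: "\<And>x :: nat \<Rightarrow> real. pst x \<Longrightarrow> (\<Sum>e\<in>T. real_of_int (w e)) \<le> (\<Sum>e<m. real_of_int (w e) * x e)"
    and w: "\<And>e. e < m \<Longrightarrow> w e = w0 e - (if fx e = 1 then bg else 0) + (if fx e = 2 then bg else 0)"
    and w0: "\<And>e. e < m \<Longrightarrow> 0 \<le> w0 e" and bg: "(\<Sum>e<m. w0 e) < bg"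
    and x: "pst x" "obeys fx x"
  shows "obeys fx (chi T)" "(\<Sum>e<m. real_of_int (w0 e) * chi T e) \<le> (\<Sum>e<m. real_of_int (w0 e) * x e)"
proof -
  define u where "u = (\<lambda>e. if fx e = 1 then real_of_int bg * (1 - chi T e) else if fx e = 2 then bg * chi T e else 0)"
  have bg0: "0 < bg" using bg w0 sum_nonneg[of "{..<m}" w0] by auto
  have u0: "0 \<le> u e" for e using bg0 by (auto simp: u_def)
  have "(\<Sum>e<m. real_of_int (w e) * chi T e) \<le> (\<Sum>e<m. real_of_int (w e) * x e)"
    using opt[OF x(1)] sum_tree[OF T, of "\<lambda>e. real_of_int (w e)"] by simp
  moreover have "(\<Sum>e<m. real_of_int (w e) * chi T e) - (\<Sum>e<m. real_of_int (w e) * x e) =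
    (\<Sum>e<m. real_of_int (w0 e) * chi T e) - (\<Sum>e<m. real_of_int (w0 e) * x e) + sum u {..<m}"
    unfolding sum_subtractf[symmetric] sum.distrib[symmetric]
  proof (intro sum.cong refl)
    fix e assume "e \<in> {..<m}"
    then have "e < m" by simp
    then show "real_of_int (w e) * chi T e - real_of_int (w e) * x e = real_of_int (w0 e) * chi T e - real_of_int (w0 e) * x e + u e"
      using x(2) by (auto simp: w u_def obeys_def algebra_simps)
  qed
  ultimately have le: "(\<Sum>e<m. real_of_int (w0 e) * chi T e) + sum u {..<m} \<le> (\<Sum>e<m. real_of_int (w0 e) * x e)" by linarith
  have "(\<Sum>e<m. real_of_int (w0 e) * x e) \<le> (\<Sum>e<m. real_of_int (w0 e) * 1)"
    using w0 pst_le1[OF x(1)] by (intro sum_mono mult_left_mono) auto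
  also have "\<dots> = real_of_int (\<Sum>e<m. w0 e)" by simp
  also have "\<dots> < bg" using bg by linarith
  finally have "(\<Sum>e<m. real_of_int (w0 e) * x e) < bg" .
  moreover have w0T: "0 \<le> (\<Sum>e<m. real_of_int (w0 e) * chi T e)" using w0 by (intro sum_nonneg) auto
  ultimately have su: "sum u {..<m} < bg" using le by linarith
  have ub: "u e < bg" if "e < m" for e
    using member_le_sum[of e "{..<m}" u] u0 that su by (auto intro: le_less_trans)
  have "(fx e = 1 \<longrightarrow> e \<in> T) \<and> (fx e = 2 \<longrightarrow> e \<notin> T)" if "e < m" for e
    using ub[OF that] unfolding u_def by (cases "e \<in> T") (auto split: if_splits)
  then show "obeys fx (chi T)" unfolding obeys_def by auto
  show "(\<Sum>e<m. real_of_int (w0 e) * chi T e) \<le> (\<Sum>e<m. real_of_int (w0 e) * x e)"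
    using le sum_nonneg[of "{..<m}" u] u0 by fastforce
qed

end

section \<open>The penalty iteration\<close>

text \<open>\<open>L\<close> stands for the length of the input and bounds all sizes, so that the
  numerical parameters can be powers of \<open>L\<close>. The bound 4 gives
  \<open>8 L^7 + L^5 <= L^9\<close>.\<close>

locale crossing_trees = mgraph +
  fixes C :: "nat \<Rightarrow> int" and S :: "nat \<Rightarrow> nat set" and k L :: nat
  assumes connected: "con {..<m}" and C_nonneg: "\<And>e. e < m \<Longrightarrow> 0 \<le> C e"
    and laminar: "\<And>i j. i < k \<Longrightarrow> j < k \<Longrightarrow> S i \<inter> S j = {} \<or> S i \<subseteq> S j \<or> S j \<subseteq> S i"
    and L: "k \<le> L" "card V + 1 \<le> L" "m + 1 \<le> L" "4 \<le> L"
begin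

definition cut :: "nat \<Rightarrow> nat set" where
  "cut i = {e. e < m \<and> (src e \<in> S i) \<noteq> (tgt e \<in> S i)}"

lemma finite_cut: "finite (cut i)"
  by (simp add: cut_def)

lemma cut_sub: "cut i \<subseteq> {..<m}"
  by (auto simp: cut_def)

definition cst :: "(nat \<Rightarrow> real) \<Rightarrow> real" where
  "cst x = (\<Sum>e<m. real_of_int (C e) * x e)"

text \<open>
  \<open>fx\<close> is 0 on unfixed edges, 1 on edges that are fixed in and 2 on those fixed out; \<open>A\<close> is the set of
  active constraints, and \<open>kap\<close> their common error, in units of \<open>1 / L\<close>.
\<close>

definition adm :: "(nat \<Rightarrow> int) \<Rightarrow> nat set \<Rightarrow> (nat \<Rightarrow> int) \<Rightarrow> int \<Rightarrow> (nat \<Rightarrow> real) \<Rightarrow> bool" where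
  "adm fx A B kap x \<longleftrightarrow> pst x \<and> obeys fx x \<and>
     (\<forall>i\<in>A. real L * sum x (cut i) \<le> real L * real_of_int (B i) + real_of_int kap)"

text \<open>
  After \<open>n\<close> steps, \<open>Y\<close> is the sum of the trees found. The bound on the squared multipliers plus the cost
  is a Lyapunov estimate: each step is charged against an arbitrary admissible point \<open>x\<close>.
\<close>

definition drift_inv ::
  "int \<Rightarrow> (nat \<Rightarrow> int) \<Rightarrow> nat set \<Rightarrow> (nat \<Rightarrow> int) \<Rightarrow> int \<Rightarrow> nat \<Rightarrow> (nat \<Rightarrow> int) \<Rightarrow> (nat \<Rightarrow> int) \<Rightarrow> bool" where
  "drift_inv h fx A B kap n lam Y \<longleftrightarrow>
     (\<forall>i\<in>A. 0 \<le> lam i \<and> real L * (\<Sum>e\<in>cut i. real_of_int (Y e)) - real n * (real L * real_of_int (B i) + real_of_int kap) \<le> real_of_int (lam i)) \<and>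
     (\<exists>Ts. length Ts = n \<and> (\<forall>T\<in>set Ts. tree T) \<and> (\<forall>e<m. Y e = int (length (filter (\<lambda>T. e \<in> T) Ts)))) \<and>
     (\<forall>x. adm fx A B kap x \<longrightarrow> real_of_int h * (\<Sum>i\<in>A. (real_of_int (lam i))\<^sup>2) + 8 * real L ^ 7 * cst (\<lambda>e. real_of_int (Y e))
        \<le> real n * (8 * real L ^ 7 * cst x + real_of_int h * real L ^ 5)) \<and>
     (\<forall>x. pst x \<and> obeys fx x \<longrightarrow> (\<forall>e<m. (fx e = 1 \<longrightarrow> Y e = int n) \<and> (fx e = 2 \<longrightarrow> Y e = 0)))"

lemma drift_init: "(\<And>i. i \<in> A \<Longrightarrow> lam i = 0) \<Longrightarrow> (\<And>e. e < m \<Longrightarrow> Y e = 0) \<Longrightarrow> drift_inv h fx A B kap 0 lam Y"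
proof -
  assume a: "\<And>i. i \<in> A \<Longrightarrow> lam i = 0" "\<And>e. e < m \<Longrightarrow> Y e = 0"
  have "(\<Sum>e\<in>cut i. real_of_int (Y e)) = 0" for i using a(2) cut_sub by (intro sum.neutral) auto
  moreover have "cst (\<lambda>e. real_of_int (Y e)) = 0" using a(2) by (simp add: cst_def)
  moreover have "(\<Sum>i\<in>A. (real_of_int (lam i))\<^sup>2) = 0" using a(1) by (intro sum.neutral) auto
  ultimately show ?thesis using a unfolding drift_inv_def by auto
qed

text \<open>Up to a factor 2, these weights are the first-order change of the potential in
  \<open>drift_inv\<close>: a tree adds 8 L^7 times its cost, and each crossing edge changes
  \<open>h lam^2\<close> by about \<open>2 h L lam\<close>.\<close>

lemma weighted_cost:
  assumes w0: "\<And>e. e < m \<Longrightarrow> w0 e = C e * (4 * int L ^ 7) + (\<Sum>i\<in>{i\<in>A. e \<in> cut i}. lam i) * h * int L"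
    and A: "finite A"
  shows "(\<Sum>e<m. real_of_int (w0 e) * y e) = 4 * real L ^ 7 * cst y + real_of_int h * real L * (\<Sum>i\<in>A. real_of_int (lam i) * sum y (cut i))"
proof -
  have "(\<Sum>e<m. real_of_int (w0 e) * y e) = (\<Sum>e<m. 4 * real L ^ 7 * (real_of_int (C e) * y e) +
      real_of_int h * real L * (\<Sum>i\<in>A. real_of_int (lam i) * (if e \<in> cut i then y e else 0)))"
  proof (intro sum.cong refl)
    fix e assume "e \<in> {..<m}"
    then have e: "e < m" by simp
    have "(\<Sum>i\<in>A. real_of_int (lam i) * (if e \<in> cut i then y e else 0)) = (\<Sum>i\<in>A. if e \<in> cut i then real_of_int (lam i) else 0) * y e"
      unfolding sum_distrib_right by (intro sum.cong) auto
    also have "(\<Sum>i\<in>A. if e \<in> cut i then real_of_int (lam i) else 0) = real_of_int (\<Sum>i\<in>{i\<in>A. e \<in> cut i}. lam i)"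
      using A by (simp add: sum.inter_filter) (intro sum.cong, auto)
    finally show "real_of_int (w0 e) * y e = 4 * real L ^ 7 * (real_of_int (C e) * y e) +
      real_of_int h * real L * (\<Sum>i\<in>A. real_of_int (lam i) * (if e \<in> cut i then y e else 0))"
      by (simp add: w0[OF e] algebra_simps)
  qed
  also have "\<dots> = 4 * real L ^ 7 * cst y + real_of_int h * real L * (\<Sum>e<m. \<Sum>i\<in>A. real_of_int (lam i) * (if e \<in> cut i then y e else 0))"
    by (simp add: cst_def sum.distrib sum_distrib_left)
  also have "(\<Sum>e<m. \<Sum>i\<in>A. real_of_int (lam i) * (if e \<in> cut i then y e else 0)) = (\<Sum>i\<in>A. real_of_int (lam i) * sum y (cut i))"
  proof -
    have "(\<Sum>e<m. if e \<in> cut i then y e else 0) = sum y (cut i)" for i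
    proof -
      have "{..<m} \<inter> {e. e \<in> cut i} = cut i" using cut_sub by auto
      then show ?thesis by (simp add: sum.If_cases)
    qed
    then show ?thesis by (subst sum.swap) (simp add: sum_distrib_left[symmetric])
  qed
  finally show ?thesis .
qed

text \<open>The linear terms \<open>2 h lam g\<close>, summed over the active constraints, are paid
  for by the optimality of \<open>T\<close> against \<open>x\<close>. What remains are at most
  \<open>k\<close> terms \<open>L^4\<close>, within the allowance \<open>L^5\<close> per
  step.\<close>

lemma drift_step:
  assumes inv: "drift_inv h fx A B kap n lam Y"
    and T: "tree T" and opt: "\<And>x :: nat \<Rightarrow> real. pst x \<Longrightarrow> (\<Sum>e\<in>T. real_of_int (w e)) \<le> (\<Sum>e<m. real_of_int (w e) * x e)"
    and w: "\<And>e. e < m \<Longrightarrow> w e = w0 e - (if fx e = 1 then bg else 0) + (if fx e = 2 then bg else 0)"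
    and w0: "\<And>e. e < m \<Longrightarrow> w0 e = C e * (4 * int L ^ 7) + (\<Sum>i\<in>{i\<in>A. e \<in> cut i}. lam i) * h * int L"
    and bg: "(\<Sum>e<m. w0 e) < bg"
    and A: "A \<subseteq> {..<k}" and B: "\<And>i. i \<in> A \<Longrightarrow> B i \<le> int (card V)" and kap: "0 \<le> kap" "kap \<le> int L" and h: "0 < h"
    and lam': "\<And>i. i \<in> A \<Longrightarrow> lam' i = max 0 (lam i + int L * int (card (T \<inter> cut i)) - int L * B i - kap)"
    and Y': "\<And>e. e < m \<Longrightarrow> Y' e = Y e + of_bool (e \<in> T)"
  shows "drift_inv h fx A B kap (Suc n) lam' Y'"
proof -
  have finA: "finite A" using A finite_subset by blast
  have lam0: "0 \<le> lam i" if "i \<in> A" for i using inv that unfolding drift_inv_def by blast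
  have w0_nonneg: "0 \<le> w0 e" if "e < m" for e
  proof -
    have "0 \<le> (\<Sum>i\<in>{i\<in>A. e \<in> cut i}. lam i)" using lam0 by (intro sum_nonneg) auto
    then show ?thesis using w0[OF that] C_nonneg[OF that] h by simp
  qed
  have pen: "obeys fx (chi T)" "(\<Sum>e<m. real_of_int (w0 e) * chi T e) \<le> (\<Sum>e<m. real_of_int (w0 e) * x e)"
    if "pst x" "obeys fx x" for x :: "nat \<Rightarrow> real"
    using penalised_tree[of T w w0 fx bg x] T opt w w0_nonneg bg that by blast+
  have cut_T: "sum (chi T) (cut i) = real (card (T \<inter> cut i))" for i by (rule sum_chi[OF finite_cut])
  define g where "g = (\<lambda>i. real L * real (card (T \<inter> cut i)) - real L * real_of_int (B i) - real_of_int kap)"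
  have lg: "real_of_int (lam' i) = max 0 (real_of_int (lam i) + g i)" if "i \<in> A" for i
    unfolding lam'[OF that] g_def of_int_max by (simp add: add_diff_eq)
  have sumY: "(\<Sum>e\<in>F. real_of_int (Y' e)) = (\<Sum>e\<in>F. real_of_int (Y e)) + sum (chi T) F" if "F \<subseteq> {..<m}" for F
    unfolding sum.distrib[symmetric] using that Y' by (intro sum.cong) auto
  have 1: "0 \<le> lam' i \<and> real L * (\<Sum>e\<in>cut i. real_of_int (Y' e)) - real (Suc n) * (real L * real_of_int (B i) + real_of_int kap) \<le> real_of_int (lam' i)"
    if i: "i \<in> A" for i
  proof
    show "0 \<le> lam' i" using lam'[OF i] by simp
    have "real L * (\<Sum>e\<in>cut i. real_of_int (Y e)) - real n * (real L * real_of_int (B i) + real_of_int kap) \<le> real_of_int (lam i)"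
      using inv i unfolding drift_inv_def by blast
    moreover have "real L * (\<Sum>e\<in>cut i. real_of_int (Y' e)) - real (Suc n) * (real L * real_of_int (B i) + real_of_int kap)
       = real L * (\<Sum>e\<in>cut i. real_of_int (Y e)) - real n * (real L * real_of_int (B i) + real_of_int kap) + g i"
      unfolding sumY[OF cut_sub] cut_T g_def by (simp add: algebra_simps)
    ultimately show "real L * (\<Sum>e\<in>cut i. real_of_int (Y' e)) - real (Suc n) * (real L * real_of_int (B i) + real_of_int kap) \<le> real_of_int (lam' i)"
      using lg[OF i] by linarith
  qed
  have "\<exists>Ts. length Ts = n \<and> (\<forall>T\<in>set Ts. tree T) \<and> (\<forall>e<m. Y e = int (length (filter (\<lambda>T. e \<in> T) Ts)))"
    using inv unfolding drift_inv_def by (elim conjE)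
  then obtain Ts where Ts: "length Ts = n" "\<forall>T\<in>set Ts. tree T" "\<forall>e<m. Y e = int (length (filter (\<lambda>T. e \<in> T) Ts))" by blast
  have 2: "\<exists>Ts. length Ts = Suc n \<and> (\<forall>T\<in>set Ts. tree T) \<and> (\<forall>e<m. Y' e = int (length (filter (\<lambda>T. e \<in> T) Ts)))"
    using Ts T Y' by (intro exI[of _ "T # Ts"]) auto
  have 3: "real_of_int h * (\<Sum>i\<in>A. (real_of_int (lam' i))\<^sup>2) + 8 * real L ^ 7 * cst (\<lambda>e. real_of_int (Y' e))
        \<le> real (Suc n) * (8 * real L ^ 7 * cst x + real_of_int h * real L ^ 5)" if x: "adm fx A B kap x" for x
  proof -
    have px: "pst x" "obeys fx x" and xA: "\<And>i. i \<in> A \<Longrightarrow> real L * sum x (cut i) \<le> real L * real_of_int (B i) + real_of_int kap"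
      using x by (auto simp: adm_def)
    have IH: "real_of_int h * (\<Sum>i\<in>A. (real_of_int (lam i))\<^sup>2) + 8 * real L ^ 7 * cst (\<lambda>e. real_of_int (Y e))
        \<le> real n * (8 * real L ^ 7 * cst x + real_of_int h * real L ^ 5)" using inv x unfolding drift_inv_def by blast
    \<comment> \<open>Truncation at 0 can only decrease the square. \<open>g\<close> has absolute
      value at most L^2: the crossing number is at most L, and \<open>L * B i + kap\<close> lies
      between 0, because \<open>x\<close> is admissible, and L^2, because \<open>B i\<close> is
      capped by the number of vertices.\<close>
    have sq: "(real_of_int (lam' i))\<^sup>2 \<le> (real_of_int (lam i))\<^sup>2 + 2 * (real_of_int (lam i) * g i) + real L ^ 4" if i: "i \<in> A" for i
    proof -
      have "0 \<le> sum x (cut i)" using px(1) cut_sub unfolding pst_def by (intro sum_nonneg) auto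
      then have "0 \<le> real L * real_of_int (B i) + real_of_int kap"
        using xA[OF i] by (meson mult_nonneg_nonneg of_nat_0_le_iff order_trans)
      moreover have "card (T \<inter> cut i) + 1 \<le> card V"
      proof -
        have "card (T \<inter> cut i) \<le> card T" using T by (intro card_mono) (auto simp: tree_def intro: finite_subset)
        then show ?thesis using T by (simp add: tree_def)
      qed
      then have "real (card (T \<inter> cut i)) \<le> real L" using L by linarith
      then have "real L * real (card (T \<inter> cut i)) \<le> real L * real L" by (intro mult_left_mono) auto
      moreover have "real_of_int (B i) \<le> real L - 1" using B[OF i] L by linarith
      then have "real L * real_of_int (B i) \<le> real L * (real L - 1)" by (intro mult_left_mono) auto
      then have "real L * real_of_int (B i) \<le> real L * real L - real L" by (simp add: algebra_simps)
      moreover have "0 \<le> real L * real (card (T \<inter> cut i))" by simp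
      ultimately have "\<bar>g i\<bar> \<le> real L * real L" using kap unfolding g_def by linarith
      then have "(g i)\<^sup>2 \<le> (real L * real L)\<^sup>2" by (metis abs_ge_zero power2_abs power_mono)
      also have "\<dots> = real L ^ 4" by (simp add: power2_eq_square power4_eq_xxxx)
      finally have "(g i)\<^sup>2 \<le> real L ^ 4" .
      moreover have "(max 0 (real_of_int (lam i) + g i))\<^sup>2 \<le> (real_of_int (lam i) + g i)\<^sup>2" by (auto simp: max_def)
      ultimately show ?thesis unfolding lg[OF i] by (simp add: power2_sum algebra_simps)
    qed
    have "(\<Sum>i\<in>A. (real_of_int (lam' i))\<^sup>2) \<le> (\<Sum>i\<in>A. (real_of_int (lam i))\<^sup>2 + 2 * (real_of_int (lam i) * g i) + real L ^ 4)"
      using sq by (rule sum_mono)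
    also have "\<dots> = (\<Sum>i\<in>A. (real_of_int (lam i))\<^sup>2) + 2 * (\<Sum>i\<in>A. real_of_int (lam i) * g i) + real (card A) * real L ^ 4"
      by (simp add: sum.distrib sum_distrib_left)
    also have "real (card A) * real L ^ 4 \<le> real L * real L ^ 4"
    proof -
      have "card A \<le> k" using card_mono[OF _ A] by simp
      then show ?thesis using L(1) by (intro mult_right_mono) auto
    qed
    finally have "(\<Sum>i\<in>A. (real_of_int (lam' i))\<^sup>2) \<le> (\<Sum>i\<in>A. (real_of_int (lam i))\<^sup>2) + 2 * (\<Sum>i\<in>A. real_of_int (lam i) * g i) + real L ^ 5"
      by (simp add: eval_nat_numeral)
    then have "real_of_int h * (\<Sum>i\<in>A. (real_of_int (lam' i))\<^sup>2) \<le> real_of_int h * ((\<Sum>i\<in>A. (real_of_int (lam i))\<^sup>2) + 2 * (\<Sum>i\<in>A. real_of_int (lam i) * g i) + real L ^ 5)"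
      using h by (intro mult_left_mono) auto
    then have a: "real_of_int h * (\<Sum>i\<in>A. (real_of_int (lam' i))\<^sup>2) \<le> real_of_int h * (\<Sum>i\<in>A. (real_of_int (lam i))\<^sup>2) +
        2 * (real_of_int h * (\<Sum>i\<in>A. real_of_int (lam i) * g i)) + real_of_int h * real L ^ 5"
      by (simp add: algebra_simps)
    have c: "4 * real L ^ 7 * cst (chi T) + real_of_int h * real L * (\<Sum>i\<in>A. real_of_int (lam i) * sum (chi T) (cut i)) \<le>
       4 * real L ^ 7 * cst x + real_of_int h * real L * (\<Sum>i\<in>A. real_of_int (lam i) * sum x (cut i))"
    proof -
      have wc: "(\<Sum>e<m. real_of_int (w0 e) * y e) = 4 * real L ^ 7 * cst y + real_of_int h * real L * (\<Sum>i\<in>A. real_of_int (lam i) * sum y (cut i))" for y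
        by (rule weighted_cost) (use w0 finA in auto)
      show ?thesis using pen(2)[OF px] unfolding wc .
    qed
    have mono: "(\<Sum>i\<in>A. real_of_int (lam i) * g i) \<le> real L * (\<Sum>i\<in>A. real_of_int (lam i) * a i) - real L * (\<Sum>i\<in>A. real_of_int (lam i) * b i)"
      if "\<And>i. i \<in> A \<Longrightarrow> g i \<le> real L * a i - real L * b i" for a b
      unfolding sum_distrib_left sum_subtractf[symmetric]
    proof (rule sum_mono)
      fix i assume i: "i \<in> A"
      have "real_of_int (lam i) * g i \<le> real_of_int (lam i) * (real L * a i - real L * b i)"
        using lam0[OF i] that[OF i] by (intro mult_left_mono) auto
      then show "real_of_int (lam i) * g i \<le> real L * (real_of_int (lam i) * a i) - real L * (real_of_int (lam i) * b i)"
        by (simp add: algebra_simps)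
    qed
    have "(\<Sum>i\<in>A. real_of_int (lam i) * g i) \<le>
       real L * (\<Sum>i\<in>A. real_of_int (lam i) * sum (chi T) (cut i)) - real L * (\<Sum>i\<in>A. real_of_int (lam i) * sum x (cut i))"
    proof (rule mono)
      fix i assume i: "i \<in> A"
      show "g i \<le> real L * sum (chi T) (cut i) - real L * sum x (cut i)" using xA[OF i] unfolding cut_T g_def by linarith
    qed
    then have "real_of_int h * (\<Sum>i\<in>A. real_of_int (lam i) * g i) \<le> real_of_int h *
       (real L * (\<Sum>i\<in>A. real_of_int (lam i) * sum (chi T) (cut i)) - real L * (\<Sum>i\<in>A. real_of_int (lam i) * sum x (cut i)))"
      using h by (intro mult_left_mono) auto
    then have b: "real_of_int h * (\<Sum>i\<in>A. real_of_int (lam i) * g i) \<le>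
       real_of_int h * real L * (\<Sum>i\<in>A. real_of_int (lam i) * sum (chi T) (cut i)) - real_of_int h * real L * (\<Sum>i\<in>A. real_of_int (lam i) * sum x (cut i))"
      by (simp only: right_diff_distrib mult.assoc)
    have d: "cst (\<lambda>e. real_of_int (Y' e)) = cst (\<lambda>e. real_of_int (Y e)) + cst (chi T)"
      unfolding cst_def sum.distrib[symmetric] by (intro sum.cong) (auto simp: Y' algebra_simps)
    define X where "X = 8 * real L ^ 7 * cst (\<lambda>e. real_of_int (Y e))"
    define Z where "Z = 4 * real L ^ 7 * cst (chi T)"
    have e: "8 * real L ^ 7 * cst (\<lambda>e. real_of_int (Y' e)) = X + 2 * Z" unfolding d X_def Z_def by (simp add: algebra_simps)
    have f: "real (Suc n) * (8 * real L ^ 7 * cst x + real_of_int h * real L ^ 5) =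
       real n * (8 * real L ^ 7 * cst x + real_of_int h * real L ^ 5) + 2 * (4 * real L ^ 7 * cst x) + real_of_int h * real L ^ 5"
      by (simp add: algebra_simps)
    show ?thesis using IH a b c unfolding e f X_def[symmetric] Z_def[symmetric] by linarith
  qed
  \<comment> \<open>Penalties are effective only if some point obeys \<open>fx\<close>, so this
    clause is conditional on one.\<close>
  have 4: "(fx e = 1 \<longrightarrow> Y' e = int (Suc n)) \<and> (fx e = 2 \<longrightarrow> Y' e = 0)" if x: "pst x" "obeys fx x" and e: "e < m" for x e
  proof -
    have "(fx e = 1 \<longrightarrow> Y e = int n) \<and> (fx e = 2 \<longrightarrow> Y e = 0)" using inv x e unfolding drift_inv_def by blast
    moreover have "(fx e = 1 \<longrightarrow> e \<in> T) \<and> (fx e = 2 \<longrightarrow> e \<notin> T)" using pen(1)[OF x] e unfolding obeys_def by auto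
    ultimately show ?thesis using Y'[OF e] by auto
  qed
  show ?thesis unfolding drift_inv_def
    by (rule conjI[OF ballI[OF 1] conjI[OF 2 conjI[OF allI[OF impI[OF 3]]]]]) (use 4 in auto)
qed

lemma drift_mix:
  assumes inv: "drift_inv h fx A B kap n lam Y" and n: "0 < n"
  shows "\<exists>p. distr p \<and> (\<forall>e<m. mix p e = real_of_int (Y e) / real n)"
proof -
  have "\<exists>Ts. length Ts = n \<and> (\<forall>T\<in>set Ts. tree T) \<and> (\<forall>e<m. Y e = int (length (filter (\<lambda>T. e \<in> T) Ts)))"
    using inv unfolding drift_inv_def by (elim conjE)
  then obtain Ts where Ts: "length Ts = n" "\<forall>T\<in>set Ts. tree T" "\<forall>e<m. Y e = int (length (filter (\<lambda>T. e \<in> T) Ts))" by blast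
  define p where "p = (\<lambda>T. real (count_list Ts T) / real n)"
  have sub: "set Ts \<subseteq> Pow {..<m}" using Ts(2) by (auto simp: tree_def)
  have filt: "(\<Sum>T\<in>Pow {..<m}. real (count_list Ts' T) * of_bool (P T)) = real (length (filter P Ts'))"
    if "set Ts' \<subseteq> Pow {..<m}" for P Ts'
    using that
  proof (induction Ts')
    case (Cons T Ts')
    have "(\<Sum>X\<in>Pow {..<m}. real (count_list (T # Ts') X) * of_bool (P X)) =
       (\<Sum>X\<in>Pow {..<m}. (if X = T then of_bool (P T) else 0) + real (count_list Ts' X) * of_bool (P X))"
      by (intro sum.cong) auto
    also have "\<dots> = of_bool (P T) + (\<Sum>X\<in>Pow {..<m}. real (count_list Ts' X) * of_bool (P X))"
      using Cons.prems by (simp add: sum.distrib)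
    finally show ?case using Cons by simp
  qed simp
  have "distr p"
    unfolding distr_def
  proof (intro conjI allI impI)
    show "p T = 0" if "\<not> tree T" for T using Ts(2) that by (auto simp: p_def count_list_0_iff)
    have "sum p (Pow {..<m}) = (\<Sum>T\<in>Pow {..<m}. real (count_list Ts T) * of_bool True) / real n"
      by (simp add: p_def sum_divide_distrib)
    also have "\<dots> = 1" using filt[OF sub, of "\<lambda>_. True"] Ts(1) n by simp
    finally show "sum p (Pow {..<m}) = 1" .
  qed (simp add: p_def)
  moreover have "mix p e = real_of_int (Y e) / real n" if "e < m" for e
  proof -
    have "mix p e = (\<Sum>T\<in>Pow {..<m}. real (count_list Ts T) * of_bool (e \<in> T)) / real n"
      unfolding mix_def sum_divide_distrib p_def by (intro sum.cong) auto
    then show ?thesis using filt[OF sub, of "\<lambda>T. e \<in> T"] Ts(3) that by simp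
  qed
  ultimately show ?thesis by blast
qed

lemma drift_cost:
  assumes inv: "drift_inv h fx A B kap n lam Y" and x: "adm fx A B kap x" and h: "0 < h"
  shows "8 * real L ^ 7 * cst (\<lambda>e. real_of_int (Y e)) \<le> real n * (8 * real L ^ 7 * cst x + real_of_int h * real L ^ 5)"
proof -
  have "real_of_int h * (\<Sum>i\<in>A. (real_of_int (lam i))\<^sup>2) + 8 * real L ^ 7 * cst (\<lambda>e. real_of_int (Y e))
        \<le> real n * (8 * real L ^ 7 * cst x + real_of_int h * real L ^ 5)" using inv x unfolding drift_inv_def by blast
  moreover have "0 \<le> real_of_int h * (\<Sum>i\<in>A. (real_of_int (lam i))\<^sup>2)" using h by (simp add: sum_nonneg)
  ultimately show ?thesis by linarith
qed

text \<open>Every tree costs at least \<open>cmin\<close>, so the potential leaves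
  \<open>N h (8 L^7 + L^5)\<close> for the squared multipliers when \<open>x\<close> costs at most
  \<open>cmin + h\<close>. With \<open>N = L^9\<close> steps this is at most \<open>N^2 h\<close>;
  hence each multiplier is at most \<open>N\<close>, and the mean violation beyond
  \<open>kap\<close> is at most one unit 1/L. The exponent 9 is chosen for this.\<close>

lemma drift_tests:
  assumes inv: "drift_inv h fx A B kap (L ^ 9) lam Y" and x: "adm fx A B kap x" and h: "0 < h" and A: "finite A"
    and cmin: "\<And>T. tree T \<Longrightarrow> cmin \<le> cst (chi T)" and near: "cst x \<le> cmin + real_of_int h"
  shows "e < m \<Longrightarrow> (fx e = 1 \<longrightarrow> Y e = int L ^ 9) \<and> (fx e = 2 \<longrightarrow> Y e = 0)"
    "i \<in> A \<Longrightarrow> int L * (\<Sum>e\<in>cut i. Y e) \<le> int L ^ 9 * (int L * B i + kap + 1)"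
proof -
  have px: "pst x" "obeys fx x" using x by (auto simp: adm_def)
  show "(fx e = 1 \<longrightarrow> Y e = int L ^ 9) \<and> (fx e = 2 \<longrightarrow> Y e = 0)" if "e < m"
  proof -
    have "(fx e = 1 \<longrightarrow> Y e = int (L ^ 9)) \<and> (fx e = 2 \<longrightarrow> Y e = 0)"
      using inv px that unfolding drift_inv_def by blast
    then show ?thesis by simp
  qed
  have N0: "0 < L ^ 9" using L by simp
  obtain p where p: "distr p" "\<forall>e<m. mix p e = real_of_int (Y e) / real (L ^ 9)" using drift_mix[OF inv N0] by blast
  define N where "N = real (L ^ 9)"
  have N: "0 < N" using N0 by (simp add: N_def)
  have "cmin \<le> cst (mix p)"
  proof -
    have "cst (mix p) = (\<Sum>T\<in>Pow {..<m}. p T * cst (chi T))"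
      unfolding cst_def mix_def sum_distrib_left by (subst sum.swap) (simp add: algebra_simps)
    also have "\<dots> \<ge> (\<Sum>T\<in>Pow {..<m}. p T * cmin)"
    proof (rule sum_mono)
      fix T show "p T * cmin \<le> p T * cst (chi T)"
      proof (cases "tree T")
        case True
        then show ?thesis using p(1) cmin by (intro mult_left_mono) (auto simp: distr_def)
      next
        case False
        then have "p T = 0" using p(1) unfolding distr_def by blast
        then show ?thesis by simp
      qed
    qed
    moreover have "(\<Sum>T\<in>Pow {..<m}. p T * cmin) = cmin" using p(1) by (simp add: distr_def sum_distrib_right[symmetric])
    ultimately show ?thesis by simp
  qed
  moreover have "cst (mix p) = cst (\<lambda>e. real_of_int (Y e)) / N"
    unfolding cst_def sum_divide_distrib N_def using p(2) by (intro sum.cong) auto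
  ultimately have cY: "N * cmin \<le> cst (\<lambda>e. real_of_int (Y e))" using N by (simp add: field_simps)
  have "real_of_int h * (\<Sum>i\<in>A. (real_of_int (lam i))\<^sup>2) + 8 * real L ^ 7 * cst (\<lambda>e. real_of_int (Y e))
        \<le> N * (8 * real L ^ 7 * cst x + real_of_int h * real L ^ 5)" using inv x unfolding drift_inv_def N_def by blast
  also have "\<dots> \<le> N * (8 * real L ^ 7 * (cmin + real_of_int h) + real_of_int h * real L ^ 5)"
    using near N by (intro mult_left_mono add_right_mono) auto
  finally have "real_of_int h * (\<Sum>i\<in>A. (real_of_int (lam i))\<^sup>2) + 8 * real L ^ 7 * cst (\<lambda>e. real_of_int (Y e))
        \<le> N * (8 * real L ^ 7 * (cmin + real_of_int h) + real_of_int h * real L ^ 5)" .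
  moreover have "8 * real L ^ 7 * (N * cmin) \<le> 8 * real L ^ 7 * cst (\<lambda>e. real_of_int (Y e))"
    using cY by (intro mult_left_mono) auto
  ultimately have "real_of_int h * (\<Sum>i\<in>A. (real_of_int (lam i))\<^sup>2) \<le> real_of_int h * (N * (8 * real L ^ 7 + real L ^ 5))"
    by (simp add: algebra_simps)
  then have sl: "(\<Sum>i\<in>A. (real_of_int (lam i))\<^sup>2) \<le> N * (8 * real L ^ 7 + real L ^ 5)" using h by simp
  have "8 * real L ^ 7 + real L ^ 5 \<le> N"
  proof -
    have L4: "4 \<le> real L" using L by linarith
    have "1 * real L ^ 5 \<le> real L ^ 2 * real L ^ 5" using L4 by (intro mult_right_mono) auto
    then have "real L ^ 5 \<le> real L ^ 7" by (simp add: power_add[symmetric])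
    moreover have "4 * 4 * real L ^ 7 \<le> real L * real L * real L ^ 7" using L4 by (intro mult_mono) auto
    moreover have "real L * real L * real L ^ 7 = real L ^ 9" by (simp add: eval_nat_numeral)
    moreover have "0 \<le> real L ^ 7" by simp
    ultimately have "8 * real L ^ 7 + real L ^ 5 \<le> real L ^ 9" by linarith
    then show ?thesis by (simp add: N_def)
  qed
  then have "N * (8 * real L ^ 7 + real L ^ 5) \<le> N * N" using N by (intro mult_left_mono) auto
  then have sl': "(\<Sum>i\<in>A. (real_of_int (lam i))\<^sup>2) \<le> N\<^sup>2" using sl by (simp add: power2_eq_square)
  show "int L * (\<Sum>e\<in>cut i. Y e) \<le> int L ^ 9 * (int L * B i + kap + 1)" if i: "i \<in> A"
  proof -
    have "(real_of_int (lam i))\<^sup>2 \<le> (\<Sum>i\<in>A. (real_of_int (lam i))\<^sup>2)" using A i by (intro member_le_sum) auto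
    then have "(real_of_int (lam i))\<^sup>2 \<le> N\<^sup>2" using sl' by linarith
    then have "real_of_int (lam i) \<le> N" using N by (simp add: abs_le_square_iff[symmetric])
    moreover have "real L * (\<Sum>e\<in>cut i. real_of_int (Y e)) - N * (real L * real_of_int (B i) + real_of_int kap) \<le> real_of_int (lam i)"
      using inv i unfolding drift_inv_def N_def by blast
    ultimately have "real L * (\<Sum>e\<in>cut i. real_of_int (Y e)) \<le> N * (real L * real_of_int (B i) + real_of_int kap) + N" by linarith
    then have "real_of_int (int L * (\<Sum>e\<in>cut i. Y e)) \<le> real_of_int (int L ^ 9 * (int L * B i + kap + 1))"
      by (simp add: N_def algebra_simps)
    then show ?thesis by linarith
  qed
qed

end

context crossing_trees
begin

section \<open>The current region and the acceptance test of a run\<close>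

text \<open>This is \<open>c0 / L^9\<close>, the mean cost of the initial run, plus
  \<open>kap - 1\<close> increments \<open>h / (4 L^2)\<close>. A run loses at most
  \<open>h / (8 L^2)\<close>, half an increment.\<close>

definition zb :: "int \<Rightarrow> int \<Rightarrow> int \<Rightarrow> real" where
  "zb c0 h kap = (4 * real L ^ 7 * real_of_int c0 + real_of_int (kap - 1) * real L ^ 9 * real_of_int h * real L ^ 5) /
     (4 * real L ^ 7 * real L ^ 9)"

definition rg :: "int \<Rightarrow> int \<Rightarrow> (nat \<Rightarrow> int) \<Rightarrow> nat set \<Rightarrow> (nat \<Rightarrow> int) \<Rightarrow> int \<Rightarrow> (nat \<Rightarrow> real) \<Rightarrow> bool" where
  "rg c0 h fx A B kap x \<longleftrightarrow> adm fx A B kap x \<and> cst x \<le> zb c0 h kap"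

text \<open>The conditions of \<open>rg\<close> at \<open>kap + 1\<close> for the mean
  \<open>Y / L^9\<close>, with denominators cleared so that they can be decided on integers.\<close>

definition test :: "int \<Rightarrow> int \<Rightarrow> (nat \<Rightarrow> int) \<Rightarrow> nat set \<Rightarrow> (nat \<Rightarrow> int) \<Rightarrow> int \<Rightarrow> (nat \<Rightarrow> int) \<Rightarrow> bool" where
  "test c0 h fx A B kap Y \<longleftrightarrow>
     (\<forall>e<m. (fx e = 1 \<longrightarrow> Y e = int L ^ 9) \<and> (fx e = 2 \<longrightarrow> Y e = 0)) \<and>
     (\<forall>i\<in>A. int L * (\<Sum>e\<in>cut i. Y e) \<le> int L ^ 9 * (int L * B i + kap + 1)) \<and>
     4 * int L ^ 7 * ((\<Sum>e<m. C e * Y e) - c0) \<le> kap * int L ^ 9 * h * int L ^ 5"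

lemma L_pos: "0 < real L"
  using L by simp

lemma zb_mult: "4 * real L ^ 7 * (real L ^ 9 * zb c0 h kap) = 4 * real L ^ 7 * real_of_int c0 + real_of_int (kap - 1) * real L ^ 9 * real_of_int h * real L ^ 5"
  unfolding zb_def using L_pos by simp

lemma cst_divide: "cst (\<lambda>e. f e / c) = cst f / c"
  by (simp add: cst_def sum_divide_distrib)

lemma cst_int: "cst (\<lambda>e. real_of_int (Y e)) = real_of_int (\<Sum>e<m. C e * Y e)"
  by (simp add: cst_def)

lemma cst_cong: "(\<And>e. e < m \<Longrightarrow> f e = g e) \<Longrightarrow> cst f = cst g"
  by (simp add: cst_def)

text \<open>The cost test is left out because the initial run has no reference cost yet; it defines
  \<open>c0\<close>.\<close>

lemma test_feasible:
  assumes inv: "drift_inv h fx A B kap (L ^ 9) lam Y"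
    and fixd: "\<forall>e<m. (fx e = 1 \<longrightarrow> Y e = int L ^ 9) \<and> (fx e = 2 \<longrightarrow> Y e = 0)"
    and cuts: "\<forall>i\<in>A. int L * (\<Sum>e\<in>cut i. Y e) \<le> int L ^ 9 * (int L * B i + kap + 1)"
  shows "\<exists>p. distr p \<and> adm fx A B (kap + 1) (mix p) \<and> real L ^ 9 * cst (mix p) = real_of_int (\<Sum>e<m. C e * Y e)"
proof -
  have N: "0 < real L ^ 9" using L_pos by simp
  obtain p where p: "distr p" "\<forall>e<m. mix p e = real_of_int (Y e) / real (L ^ 9)"
    using drift_mix[OF inv] L by auto
  have "obeys fx (mix p)" unfolding obeys_def using p(2) fixd N by auto
  moreover have "real L * sum (mix p) (cut i) \<le> real L * real_of_int (B i) + real_of_int (kap + 1)" if "i \<in> A" for i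
  proof -
    have "sum (mix p) (cut i) = (\<Sum>e\<in>cut i. real_of_int (Y e) / real L ^ 9)"
      using p(2) cut_sub by (intro sum.cong) auto
    then have "sum (mix p) (cut i) = real_of_int (\<Sum>e\<in>cut i. Y e) / real L ^ 9" by (simp add: sum_divide_distrib)
    moreover have "real_of_int (int L * (\<Sum>e\<in>cut i. Y e)) \<le> real_of_int (int L ^ 9 * (int L * B i + kap + 1))"
      using cuts that by (intro of_int_le_iff[THEN iffD2]) auto
    then have "real L * real_of_int (\<Sum>e\<in>cut i. Y e) / real L ^ 9 \<le> real_of_int (int L * B i + kap + 1)"
      using N by (simp add: pos_divide_le_eq mult.commute)
    ultimately show ?thesis by simp
  qed
  ultimately have "adm fx A B (kap + 1) (mix p)" using mix_pst[OF p(1)] by (simp add: adm_def)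
  moreover have "cst (mix p) = real_of_int (\<Sum>e<m. C e * Y e) / real L ^ 9"
    unfolding cst_int[symmetric] cst_divide[symmetric] using p(2) by (intro cst_cong) auto
  ultimately show ?thesis using p(1) N by auto
qed

lemma test_sound:
  assumes inv: "drift_inv h fx A B kap (L ^ 9) lam Y" and t: "test c0 h fx A B kap Y"
  shows "\<exists>p. distr p \<and> rg c0 h fx A B (kap + 1) (mix p)"
proof -
  have L0: "0 < real L ^ 7" using L_pos by simp
  obtain p where p: "distr p" "adm fx A B (kap + 1) (mix p)" "real L ^ 9 * cst (mix p) = real_of_int (\<Sum>e<m. C e * Y e)"
    using test_feasible[OF inv] t unfolding test_def by blast
  have "real_of_int (4 * int L ^ 7 * ((\<Sum>e<m. C e * Y e) - c0)) \<le> real_of_int (kap * int L ^ 9 * h * int L ^ 5)"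
    using t unfolding test_def by (intro of_int_le_iff[THEN iffD2]) auto
  then have "4 * real L ^ 7 * real_of_int (\<Sum>e<m. C e * Y e) \<le>
     4 * real L ^ 7 * real_of_int c0 + real_of_int kap * real L ^ 9 * real_of_int h * real L ^ 5"
    by (simp add: right_diff_distrib)
  then have "4 * real L ^ 7 * (real L ^ 9 * cst (mix p)) \<le> 4 * real L ^ 7 * (real L ^ 9 * zb c0 h (kap + 1))"
    unfolding p(3) zb_mult by simp
  then have "cst (mix p) \<le> zb c0 h (kap + 1)" using L_pos by simp
  then show ?thesis using p by (auto simp: rg_def)
qed

lemma halve: "8 * p * q \<le> 2 * r \<Longrightarrow> 4 * p * q \<le> (r :: real)"
  by simp

text \<open>Used in the contrapositive: a failed test proves that the region with this edge fixed is
  empty. As the run loses only half an increment of \<open>zb\<close>, the cost test is passed with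
  room to spare.\<close>

lemma test_complete:
  assumes inv: "drift_inv h fx A B kap (L ^ 9) lam Y" and x: "rg c0 h fx A B kap x" and h: "0 < h" and A: "finite A"
    and cmin: "\<And>T. tree T \<Longrightarrow> cmin \<le> cst (chi T)" and near: "zb c0 h kap \<le> cmin + real_of_int h"
  shows "test c0 h fx A B kap Y"
proof -
  have x': "adm fx A B kap x" "cst x \<le> zb c0 h kap" using x by (auto simp: rg_def)
  have near': "cst x \<le> cmin + real_of_int h" using x' near by linarith
  note tests = drift_tests[OF inv x'(1) h A cmin near']
  define D where "D = real_of_int h * real L ^ 5"
  have D: "0 \<le> real L ^ 9 * D" using h by (simp add: D_def)
  have "8 * real L ^ 7 * cst (\<lambda>e. real_of_int (Y e)) \<le> real L ^ 9 * (8 * real L ^ 7 * cst x + D)"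
    using drift_cost[OF inv x'(1) h] by (simp add: D_def)
  also have "\<dots> \<le> real L ^ 9 * (8 * real L ^ 7 * zb c0 h kap + D)"
    using x'(2) by (intro mult_left_mono add_right_mono) auto
  also have "\<dots> = 2 * (4 * real L ^ 7 * (real L ^ 9 * zb c0 h kap)) + real L ^ 9 * D" by (simp add: algebra_simps)
  also have "\<dots> \<le> 2 * (4 * real L ^ 7 * real_of_int c0 + real_of_int (kap - 1) * real L ^ 9 * real_of_int h * real L ^ 5) + 2 * (real L ^ 9 * D)"
    unfolding zb_mult using D by linarith
  also have "\<dots> = 2 * (4 * real L ^ 7 * real_of_int c0 + real_of_int kap * real L ^ 9 * real_of_int h * real L ^ 5)"
    by (simp add: D_def algebra_simps)
  finally have "4 * real L ^ 7 * real_of_int (\<Sum>e<m. C e * Y e) \<le> 4 * real L ^ 7 * real_of_int c0 + real_of_int kap * real L ^ 9 * real_of_int h * real L ^ 5"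
    unfolding cst_int by (rule halve)
  then have "real_of_int (4 * int L ^ 7 * ((\<Sum>e<m. C e * Y e) - c0)) \<le> real_of_int (kap * int L ^ 9 * h * int L ^ 5)"
    by (simp add: right_diff_distrib)
  then show ?thesis using tests unfolding test_def by (simp only: of_int_le_iff) blast
qed

text \<open>The cost bound acts as a further constraint, with index \<open>None\<close>; hence
  \<open>card A + 1\<close>.\<close>

lemma few_unfixed:
  assumes p0: "distr p0" "rg c0 h fx A B kap (mix p0)" and A: "A \<subseteq> {..<k}"
    and fx: "\<And>e. e < m \<Longrightarrow> fx e \<in> {0, 1, 2}"
    and no: "\<And>e x. e < m \<Longrightarrow> fx e = 0 \<Longrightarrow> \<not> rg c0 h (fx(e := 1)) A B kap x \<and> \<not> rg c0 h (fx(e := 2)) A B kap x"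
  shows "card {e. e < m \<and> fx e = 0} \<le> 2 * (card A + 1)"
proof -
  define U where "U = {e. e < m \<and> fx e = 0}"
  define A' where "A' = insert None (Some ` A)"
  define a where "a = (\<lambda>i e. case i of None \<Rightarrow> real_of_int (C e) | Some i \<Rightarrow> of_bool (e \<in> cut i))"
  define r where "r = (\<lambda>i. case i of None \<Rightarrow> zb c0 h kap | Some i \<Rightarrow> real_of_int (B i) + real_of_int kap / real L)"
  have fA: "finite A" using A finite_subset by blast
  have sc: "(\<Sum>e<m. of_bool (e \<in> cut i) * x e) = sum x (cut i)" for i and x :: "nat \<Rightarrow> real"
  proof -
    have "(\<Sum>e<m. of_bool (e \<in> cut i) * x e) = (\<Sum>e<m. if e \<in> cut i then x e else 0)" by (intro sum.cong) auto
    also have "\<dots> = sum x ({..<m} \<inter> cut i)" by (simp add: sum.If_cases Int_def)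
    also have "{..<m} \<inter> cut i = cut i" using cut_sub by auto
    finally show ?thesis .
  qed
  have div: "sum x (cut i) \<le> real_of_int (B i) + real_of_int kap / real L \<longleftrightarrow> real L * sum x (cut i) \<le> real L * real_of_int (B i) + real_of_int kap" for x :: "nat \<Rightarrow> real" and i
    using L_pos by (simp add: field_simps)
  have con: "(\<forall>i\<in>A'. (\<Sum>e<m. a i e * x e) \<le> r i) \<longleftrightarrow> cst x \<le> zb c0 h kap \<and> (\<forall>i\<in>A. real L * sum x (cut i) \<le> real L * real_of_int (B i) + real_of_int kap)" for x
    by (simp add: A'_def a_def r_def sc div cst_def)
  have ob: "(\<forall>e<m. e \<notin> U \<longrightarrow> x e = of_bool (fx e = 1)) \<longleftrightarrow> obeys fx x" for x :: "nat \<Rightarrow> real"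
  proof
    assume l: "\<forall>e<m. e \<notin> U \<longrightarrow> x e = of_bool (fx e = 1)"
    then show "obeys fx x" unfolding obeys_def U_def by auto
  next
    assume "obeys fx x"
    then show "\<forall>e<m. e \<notin> U \<longrightarrow> x e = of_bool (fx e = 1)" using fx unfolding obeys_def U_def by fastforce
  qed
  have "card U \<le> 2 * card A'"
  proof (rule few_fractional[where v = "\<lambda>e. of_bool (fx e = 1)" and a = a and r = r])
    show "finite A'" using fA by (simp add: A'_def)
    show "distr p0" by fact
    have m0: "obeys fx (mix p0)" "cst (mix p0) \<le> zb c0 h kap" "\<forall>i\<in>A. real L * sum (mix p0) (cut i) \<le> real L * real_of_int (B i) + real_of_int kap"
      using p0(2) by (auto simp: rg_def adm_def)
    show "\<forall>e<m. e \<notin> U \<longrightarrow> mix p0 e = of_bool (fx e = 1)" using m0(1) ob by blast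
    show "\<forall>i\<in>A'. (\<Sum>e<m. a i e * mix p0 e) \<le> r i" using m0(2,3) con by blast
    fix p e assume p: "distr p" "\<forall>e<m. e \<notin> U \<longrightarrow> mix p e = of_bool (fx e = 1)" "\<forall>i\<in>A'. (\<Sum>e<m. a i e * mix p e) \<le> r i" and e: "e \<in> U"
    have em: "e < m" "fx e = 0" using e by (auto simp: U_def)
    have ox: "obeys fx (mix p)" using p(2) ob by blast
    have rest: "cst (mix p) \<le> zb c0 h kap" "\<forall>i\<in>A. real L * sum (mix p) (cut i) \<le> real L * real_of_int (B i) + real_of_int kap"
      using p(3) con by blast+
    have "rg c0 h (fx(e := 1)) A B kap (mix p)" if "mix p e = 1"
      using rest ox that mix_pst[OF p(1)] by (auto simp: rg_def adm_def obeys_def)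
    moreover have "rg c0 h (fx(e := 2)) A B kap (mix p)" if "mix p e = 0"
      using rest ox that mix_pst[OF p(1)] by (auto simp: rg_def adm_def obeys_def)
    ultimately show "mix p e \<noteq> 0 \<and> mix p e \<noteq> 1" using no[OF em] by blast
  qed (auto simp: U_def)
  also have "card A' = card A + 1" using fA by (simp add: A'_def card_image)
  finally show ?thesis by (simp add: U_def)
qed

subsection \<open>Dropping constraints\<close>

definition atree :: "(nat \<Rightarrow> int) \<Rightarrow> nat set \<Rightarrow> bool" where
  "atree fx T \<longleftrightarrow> tree T \<and> obeys fx (chi T)"

definition exc :: "(nat \<Rightarrow> int) \<Rightarrow> nat \<Rightarrow> nat set \<Rightarrow> int" where
  "exc B i T = int (card (T \<inter> cut i)) - B i"

definition chosen :: "(nat \<Rightarrow> int) \<Rightarrow> nat set \<Rightarrow> nat set" where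
  "chosen fx F = {e \<in> F. e < m \<and> fx e = 1}"

definition differ :: "(nat \<Rightarrow> int) \<Rightarrow> nat set \<Rightarrow> nat set \<Rightarrow> nat set" where
  "differ fx F G = {e. e < m \<and> fx e = 0 \<and> (e \<in> F) \<noteq> (e \<in> G)}"

text \<open>Fixed edges contribute the same to all obeying points, and an unfixed edge in just one
  of the two sets contributes at most 1.\<close>

lemma near_sum:
  fixes x :: "nat \<Rightarrow> real"
  assumes x: "pst x" "obeys fx x" and fx: "\<And>e. e < m \<Longrightarrow> fx e \<in> {0, 1, 2}" and F: "F \<subseteq> {..<m}" and G: "G \<subseteq> {..<m}"
  shows "sum x F \<le> sum x G + real (card (chosen fx F)) - real (card (chosen fx G)) + real (card (differ fx F G))"
proof -
  have s: "sum x F = (\<Sum>e<m. x e * of_bool (e \<in> F))" if "F \<subseteq> {..<m}" for F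
  proof -
    have "(\<Sum>e<m. x e * of_bool (e \<in> F)) = (\<Sum>e<m. if e \<in> F then x e else 0)" by (intro sum.cong) auto
    also have "\<dots> = sum x ({..<m} \<inter> F)" by (simp add: sum.If_cases Int_def)
    also have "{..<m} \<inter> F = F" using that by auto
    finally show ?thesis by simp
  qed
  have c: "real (card {e. e < m \<and> P e}) = (\<Sum>e<m. of_bool (P e))" for P
    by (simp add: Int_def)
  have ch: "real (card (chosen fx F)) = (\<Sum>e<m. of_bool (e \<in> F \<and> fx e = 1))" for F
    unfolding c[symmetric] chosen_def by (intro arg_cong[where f = real] arg_cong[where f = card]) auto
  have "sum x F - sum x G - real (card (chosen fx F)) + real (card (chosen fx G)) - real (card (differ fx F G)) =
    (\<Sum>e<m. x e * of_bool (e \<in> F) - x e * of_bool (e \<in> G) - of_bool (e \<in> F \<and> fx e = 1) + of_bool (e \<in> G \<and> fx e = 1) -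
       of_bool (fx e = 0 \<and> (e \<in> F) \<noteq> (e \<in> G)))"
    unfolding s[OF F] s[OF G] ch differ_def c by (simp only: sum_subtractf sum.distrib)
  also have "\<dots> \<le> 0"
  proof (rule sum_nonpos)
    fix e assume "e \<in> {..<m}"
    then have e: "e < m" by simp
    have "0 \<le> x e" "x e \<le> 1" using x(1) e pst_le1 by (auto simp: pst_def)
    moreover have "fx e = 1 \<longrightarrow> x e = 1" "fx e = 2 \<longrightarrow> x e = 0" using x(2) e by (auto simp: obeys_def)
    ultimately show "x e * of_bool (e \<in> F) - x e * of_bool (e \<in> G) - of_bool (e \<in> F \<and> fx e = 1) + of_bool (e \<in> G \<and> fx e = 1) -
       of_bool (fx e = 0 \<and> (e \<in> F) \<noteq> (e \<in> G)) \<le> 0"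
      using fx[OF e] by auto
  qed
  finally show ?thesis by linarith
qed

text \<open>
  Every constraint is satisfied up to a final error, or its excess is controlled by that of an active
  one, with \<open>q\<close> rounds of dropping so far; in the current round the constraints below \<open>r\<close> are already settled.
\<close>

definition linked :: "(nat \<Rightarrow> int) \<Rightarrow> int \<Rightarrow> int \<Rightarrow> nat \<Rightarrow> (nat \<Rightarrow> int) \<Rightarrow> nat set \<Rightarrow> (nat \<Rightarrow> int) \<Rightarrow> bool" where
  "linked B0 Q q r fx A B \<longleftrightarrow> (\<forall>i<k.
     (\<exists>j\<in>A. \<forall>T. atree fx T \<longrightarrow> exc B0 i T \<le> exc B j T + 62 * (q + of_bool (j < r))) \<or>
     (\<forall>T. atree fx T \<longrightarrow> exc B0 i T \<le> 62 * Q + 32))"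

lemma linked_mono:
  assumes "linked B0 Q q r fx A B" "r \<le> r'" "\<And>T. atree fx' T \<Longrightarrow> atree fx T"
  shows "linked B0 Q q r' fx' A B"
proof -
  have "62 * (q + of_bool (j < r)) \<le> 62 * (q + of_bool (j < r'))" for j using assms(2) by auto
  then show ?thesis using assms(1,3) unfolding linked_def by (meson order_trans add_left_mono)
qed

lemma atree_fix: "fx e = 0 \<Longrightarrow> atree (fx(e := b)) T \<Longrightarrow> atree fx T"
  unfolding atree_def obeys_def by (metis fun_upd_apply one_neq_zero zero_neq_numeral)

lemma near_tree:
  assumes T: "atree fx T" and fx: "\<And>e. e < m \<Longrightarrow> fx e \<in> {0, 1, 2}" and G: "G \<subseteq> {..<m}"
  shows "int (card (T \<inter> cut i)) \<le> int (card (T \<inter> G)) + int (card (chosen fx (cut i))) - int (card (chosen fx G)) + int (card (differ fx (cut i) G))"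
proof -
  have fG: "finite G" using G finite_subset by blast
  have "real (card (T \<inter> cut i)) \<le> real (card (T \<inter> G)) + real (card (chosen fx (cut i))) - real (card (chosen fx G)) + real (card (differ fx (cut i) G))"
    using near_sum[of "chi T" fx "cut i" G] tree_pst[of T] T fx cut_sub G
    unfolding sum_chi[OF finite_cut] sum_chi[OF fG] atree_def by blast
  then show ?thesis by linarith
qed

text \<open>The cut is nearly decided. Its chosen edges number at most \<open>B r + 1\<close>,
  because the admissible point exceeds \<open>B r\<close> by at most \<open>kap / L <= 1\<close>,
  and at most 31 unfixed edges can join them. So every later tree has excess at most 32.\<close>

lemma drop_empty:
  assumes lk: "linked B0 Q q r fx A B" and q: "q \<le> Q" and x: "adm fx A B kap x" and kap: "kap \<le> int L"
    and fx: "\<And>e. e < m \<Longrightarrow> fx e \<in> {0, 1, 2}" and r: "r \<in> A" and d: "card (differ fx (cut r) {}) \<le> 31"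
  shows "linked B0 Q q (Suc r) fx (A - {r}) B" "rg c0 h fx A B kap y \<Longrightarrow> rg c0 h fx (A - {r}) B kap y"
proof -
  have px: "pst x" "obeys fx x" "real L * sum x (cut r) \<le> real L * real_of_int (B r) + real_of_int kap"
    using x r by (auto simp: adm_def)
  have "real (card (chosen fx (cut r))) \<le> sum x (cut r)"
  proof -
    have "real (card (chosen fx (cut r))) = sum x (chosen fx (cut r))"
      using px(2) by (simp add: chosen_def obeys_def)
    also have "\<dots> \<le> sum x (cut r)" using finite_cut px(1) cut_sub unfolding pst_def by (intro sum_mono2) (auto simp: chosen_def)
    finally show ?thesis .
  qed
  moreover have "sum x (cut r) \<le> real_of_int (B r) + 1"
  proof -
    have "real L * sum x (cut r) \<le> real L * (real_of_int (B r) + 1)" using px(3) kap by (simp add: distrib_left)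
    then show ?thesis using L_pos by simp
  qed
  ultimately have ch: "int (card (chosen fx (cut r))) \<le> B r + 1" by linarith
  have ex: "exc B r T \<le> 32" if T: "atree fx T" for T
    using near_tree[OF T fx, of "{}" r] ch d unfolding exc_def by (simp add: chosen_def)
  show "linked B0 Q q (Suc r) fx (A - {r}) B"
    unfolding linked_def
  proof (intro allI impI)
    fix i assume "i < k"
    then consider j where "j \<in> A" "\<forall>T. atree fx T \<longrightarrow> exc B0 i T \<le> exc B j T + 62 * (q + of_bool (j < r))"
      | "\<forall>T. atree fx T \<longrightarrow> exc B0 i T \<le> 62 * Q + 32"
      using lk unfolding linked_def by blast
    then show "(\<exists>j\<in>A - {r}. \<forall>T. atree fx T \<longrightarrow> exc B0 i T \<le> exc B j T + 62 * (q + of_bool (j < Suc r))) \<or>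
         (\<forall>T. atree fx T \<longrightarrow> exc B0 i T \<le> 62 * Q + 32)"
    proof cases
      case (1 j)
      show ?thesis
      proof (cases "j = r")
        case True
        have "exc B0 i T \<le> 62 * Q + 32" if T: "atree fx T" for T
        proof -
          have "exc B0 i T \<le> exc B j T + 62 * (q + of_bool (j < r))" using 1(2) T by blast
          then have "exc B0 i T \<le> exc B r T + 62 * q" using True by simp
          then show ?thesis using ex[OF T] q by linarith
        qed
        then show ?thesis by blast
      next
        case False
        have "exc B0 i T \<le> exc B j T + 62 * (q + of_bool (j < Suc r))" if "atree fx T" for T
        proof -
          have "exc B0 i T \<le> exc B j T + 62 * (q + of_bool (j < r))" using 1(2) that by blast
          also have "\<dots> \<le> exc B j T + 62 * (q + of_bool (j < Suc r))" by simp
          finally show ?thesis .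
        qed
        then show ?thesis using 1(1) False by blast
      qed
    qed blast
  qed
  show "rg c0 h fx (A - {r}) B kap y" if "rg c0 h fx A B kap y" using that by (auto simp: rg_def adm_def)
qed

text \<open>The constraint \<open>r\<close> is transferred to the nearby cut \<open>j0\<close>. The
  distance 31 enters twice: once in \<open>B'\<close>, so that the fractional points of the region
  survive, and once more when the crossing number of a tree at \<open>r\<close> is estimated by that
  at \<open>j0\<close>.\<close>

lemma drop_near:
  assumes lk: "linked B0 Q q r fx A B"
    and fx: "\<And>e. e < m \<Longrightarrow> fx e \<in> {0, 1, 2}" and r: "r \<in> A" and j0: "j0 \<in> A" "j0 < r"
    and d: "card (differ fx (cut r) (cut j0)) \<le> 31"
    and B': "B' = B(j0 := min (B j0) (B r + int (card (chosen fx (cut j0))) - int (card (chosen fx (cut r))) + 31))"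
  shows "linked B0 Q q (Suc r) fx (A - {r}) B'" "rg c0 h fx A B kap y \<Longrightarrow> rg c0 h fx (A - {r}) B' kap y"
proof -
  have mono: "exc B j T \<le> exc B' j T" for j T by (simp add: B' exc_def)
  have ex: "exc B r T \<le> exc B' j0 T + 62" if T: "atree fx T" for T
    using near_tree[OF T fx cut_sub, of r j0] d unfolding exc_def B' by simp
  show "linked B0 Q q (Suc r) fx (A - {r}) B'"
    unfolding linked_def
  proof (intro allI impI)
    fix i assume "i < k"
    then consider j where "j \<in> A" "\<forall>T. atree fx T \<longrightarrow> exc B0 i T \<le> exc B j T + 62 * (q + of_bool (j < r))"
      | "\<forall>T. atree fx T \<longrightarrow> exc B0 i T \<le> 62 * Q + 32"
      using lk unfolding linked_def by blast
    then show "(\<exists>j\<in>A - {r}. \<forall>T. atree fx T \<longrightarrow> exc B0 i T \<le> exc B' j T + 62 * (q + of_bool (j < Suc r))) \<or>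
         (\<forall>T. atree fx T \<longrightarrow> exc B0 i T \<le> 62 * Q + 32)"
    proof cases
      case (1 j)
      show ?thesis
      proof (cases "j = r")
        case True
        have "exc B0 i T \<le> exc B' j0 T + 62 * (q + of_bool (j0 < Suc r))" if T: "atree fx T" for T
        proof -
          have "exc B0 i T \<le> exc B j T + 62 * (q + of_bool (j < r))" using 1(2) T by blast
          \<comment> \<open>The indicator of \<open>r < r\<close> is 0: a link through
            \<open>r\<close> has lost nothing in this round, so the loss 62 is charged once, and
            from then on it is counted by \<open>j0 < Suc r\<close>.\<close>
          then have "exc B0 i T \<le> exc B r T + 62 * q" using True by simp
          then show ?thesis using ex[OF T] j0(2) by simp
        qed
        then show ?thesis using j0 by blast
      next
        case False
        have "exc B0 i T \<le> exc B' j T + 62 * (q + of_bool (j < Suc r))" if "atree fx T" for T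
        proof -
          have "exc B0 i T \<le> exc B j T + 62 * (q + of_bool (j < r))" using 1(2) that by blast
          also have "\<dots> \<le> exc B' j T + 62 * (q + of_bool (j < Suc r))" using mono by (intro add_mono) auto
          finally show ?thesis .
        qed
        then show ?thesis using 1(1) False by blast
      qed
    qed blast
  qed
  show "rg c0 h fx (A - {r}) B' kap y" if y: "rg c0 h fx A B kap y"
  proof -
    have py: "pst y" "obeys fx y" "\<And>i. i \<in> A \<Longrightarrow> real L * sum y (cut i) \<le> real L * real_of_int (B i) + real_of_int kap"
      using y by (auto simp: rg_def adm_def)
    have "real L * sum y (cut i) \<le> real L * real_of_int (B' i) + real_of_int kap" if i: "i \<in> A" for i
    proof (cases "B' i = B i")
      case False
      then have i0: "i = j0" "B' i = B r + int (card (chosen fx (cut j0))) - int (card (chosen fx (cut r))) + 31"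
        by (auto simp: B' min_def split: if_splits)
      have "differ fx (cut j0) (cut r) = differ fx (cut r) (cut j0)" by (auto simp: differ_def)
      then have "sum y (cut j0) \<le> sum y (cut r) + (real (card (chosen fx (cut j0))) - real (card (chosen fx (cut r))) + 31)"
        using near_sum[OF py(1,2) fx cut_sub cut_sub, of j0 r] d by simp
      then have "real L * sum y (cut j0) \<le> real L * (sum y (cut r) + (real (card (chosen fx (cut j0))) - real (card (chosen fx (cut r))) + 31))"
        by (intro mult_left_mono) auto
      also have "\<dots> \<le> real L * real_of_int (B r) + real_of_int kap + real L * (real (card (chosen fx (cut j0))) - real (card (chosen fx (cut r))) + 31)"
        using py(3)[OF r] by (simp add: distrib_left)
      also have "\<dots> = real L * real_of_int (B' i) + real_of_int kap" unfolding i0(2) by (simp add: algebra_simps)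
      finally show ?thesis using i0 by simp
    qed (use py(3)[OF i] in simp)
    then show ?thesis using y by (auto simp: rg_def adm_def)
  qed
qed

text \<open>\<open>laminar_net\<close> with distance 31 gives 32 card A <= 4 card U. The threshold
  is chosen so that the factor 8 beats the factor in \<open>few_unfixed\<close> and halves the
  number of constraints.\<close>

lemma net_small:
  assumes A: "A \<subseteq> {..<k}"
    and far0: "\<And>i. i \<in> A \<Longrightarrow> 31 < card (differ fx (cut i) {})"
    and far: "\<And>i j. i \<in> A \<Longrightarrow> j \<in> A \<Longrightarrow> j < i \<Longrightarrow> 31 < card (differ fx (cut i) (cut j))"
  shows "8 * card A \<le> card {e. e < m \<and> fx e = 0}"
proof -
  let ?U = "{e. e < m \<and> fx e = 0}"
  have fA: "finite A" using A finite_subset by blast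
  have far': "31 < card (differ fx (cut i) (cut j))" if "i \<in> A" "j \<in> A" "i \<noteq> j" for i j
  proof -
    have "differ fx (cut i) (cut j) = differ fx (cut j) (cut i)" by (auto simp: differ_def)
    then show ?thesis using far[of i j] far[of j i] that by (cases i j rule: linorder_cases) auto
  qed
  have eq: "differ fx (cut i) (cut j) = {e \<in> ?U. ((src e \<in> S i) \<noteq> (tgt e \<in> S i)) \<noteq> ((src e \<in> S j) \<noteq> (tgt e \<in> S j))}" for i j
    by (auto simp: differ_def cut_def)
  have eq0: "differ fx (cut i) {} = {e \<in> ?U. ((src e \<in> S i) \<noteq> (tgt e \<in> S i)) \<noteq> ((src e \<in> {}) \<noteq> (tgt e \<in> {}))}" for i
    by (auto simp: differ_def cut_def)
  have inj: "inj_on S A"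
  proof (rule inj_onI)
    fix i j assume ij: "i \<in> A" "j \<in> A" "S i = S j"
    show "i = j"
    proof (rule ccontr)
      assume "i \<noteq> j"
      from far'[OF ij(1,2) this] show False using ij(3) unfolding eq by simp
    qed
  qed
  have "(31 + 1) * card (S ` A) \<le> 4 * card ?U"
  proof (rule laminar_net)
    show "{} \<notin> S ` A"
    proof
      assume "{} \<in> S ` A"
      then obtain i where "i \<in> A" "S i = {}" by auto
      then show False using far0[of i] unfolding eq0 by simp
    qed
    show "X \<inter> Y = {} \<or> X \<subseteq> Y \<or> Y \<subseteq> X" if "X \<in> S ` A" "Y \<in> S ` A" for X Y
      using that A laminar by (metis imageE lessThan_iff subsetD)
    fix X Y assume X: "X \<in> S ` A" and Y: "Y \<in> insert {} (S ` A)" and ne: "X \<noteq> Y"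
    obtain i where i: "i \<in> A" "X = S i" using X by auto
    show "31 < card {e \<in> ?U. ((src e \<in> X) \<noteq> (tgt e \<in> X)) \<noteq> ((src e \<in> Y) \<noteq> (tgt e \<in> Y))}"
    proof (cases "Y = {}")
      case True
      then show ?thesis using far0[OF i(1)] unfolding eq0 i(2) by simp
    next
      case False
      then obtain j where j: "j \<in> A" "Y = S j" using Y by auto
      then show ?thesis using far'[of i j] i ne unfolding eq by auto
    qed
  qed (use fA in auto)
  then show ?thesis using inj by (simp add: card_image)
qed

subsection \<open>The scale of the multipliers\<close>

text \<open>\<open>c0 / L^9\<close> exceeds the comparison cost by at most half an increment
  \<open>h / (4 L^2)\<close>, and fewer than \<open>L\<close> increments follow.\<close>

lemma zb_le:
  assumes c0: "8 * real L ^ 7 * real_of_int c0 \<le> real L ^ 9 * (8 * real L ^ 7 * z + real_of_int h * real L ^ 5)"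
    and h: "0 < h" and kap: "1 \<le> kap" "kap \<le> int L"
  shows "zb c0 h kap \<le> z + real_of_int h / (4 * real L)"
proof -
  define D where "D = real_of_int h * real L ^ 5"
  have D: "0 \<le> D" using h by (simp add: D_def)
  have "4 * real L ^ 7 * (real L ^ 9 * zb c0 h kap) \<le> real L ^ 9 * (4 * real L ^ 7 * z + D) + real_of_int (kap - 1) * (real L ^ 9 * D)"
  proof -
    have "4 * real L ^ 7 * real_of_int c0 \<le> real L ^ 9 * (4 * real L ^ 7 * z) + real L ^ 9 * D / 2"
      using c0 by (simp add: D_def algebra_simps)
    moreover have "0 \<le> real L ^ 9 * D" using D by simp
    ultimately have "4 * real L ^ 7 * real_of_int c0 \<le> real L ^ 9 * (4 * real L ^ 7 * z + D)" by (simp add: algebra_simps)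
    then show ?thesis unfolding zb_mult D_def by (simp add: algebra_simps)
  qed
  also have "\<dots> = real L ^ 9 * (4 * real L ^ 7 * z + real_of_int kap * D)" by (simp add: algebra_simps)
  also have "\<dots> \<le> real L ^ 9 * (4 * real L ^ 7 * z + real L * D)"
    using kap D by (intro mult_left_mono add_left_mono mult_right_mono) auto
  also have "\<dots> = 4 * real L ^ 7 * (real L ^ 9 * (z + real_of_int h / (4 * real L)))"
  proof -
    have "real L ^ 7 * (real_of_int h / real L) = real_of_int h * real L ^ 6" using L_pos by (simp add: eval_nat_numeral)
    moreover have "real L * D = real_of_int h * real L ^ 6" by (simp add: D_def eval_nat_numeral)
    ultimately have "real L * D = real L ^ 7 * (real_of_int h / real L)" by simp
    moreover have "q * (4 * p * z + p * u) = 4 * p * (q * (z + u / 4))" for p q u by (simp add: algebra_simps)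
    moreover have "real_of_int h / (4 * real L) = real_of_int h / real L / 4" by simp
    ultimately show ?thesis by presburger
  qed
  finally have "real L ^ 9 * zb c0 h kap \<le> real L ^ 9 * (z + real_of_int h / (4 * real L))"
    using L_pos by (simp add: mult_le_cancel_left_pos)
  then show ?thesis using L_pos by (simp add: mult_le_cancel_left_pos)
qed

definition lpx :: "(nat \<Rightarrow> real) \<Rightarrow> (nat \<Rightarrow> real) \<Rightarrow> bool" where
  "lpx b x \<longleftrightarrow> pst x \<and> (\<forall>i<k. sum x (cut i) \<le> b i)"

text \<open>The tree part adds less than 1 to any cut, which the relaxation by one permits, and
  moves the cost by 1/n of the way towards that of \<open>T0\<close>. The cap at
  \<open>card V\<close> excludes nothing, since the coordinates of a point sum to n - 1.\<close>

lemma slack_point: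
  assumes x: "lpx b x" and T0: "tree T0" and B0: "\<And>i. i < k \<Longrightarrow> B0 i = min (\<lceil>b i\<rceil> + 1) (int (card V))"
    and fx: "\<And>e. e < m \<Longrightarrow> fx e = 0"
  defines "y \<equiv> \<lambda>e. (1 - 1 / real (card V)) * x e + 1 / real (card V) * chi T0 e"
  shows "adm fx {..<k} B0 0 y" "cst y = cst x - (cst x - cst (chi T0)) / real (card V)"
proof -
  define n where "n = real (card V)"
  have n: "1 \<le> n" using V_ne finite_V unfolding n_def by (simp add: Suc_leI card_gt_0_iff)
  have px: "pst x" using x by (simp add: lpx_def)
  have py: "pst y"
  proof (rule pst_sum[of "UNIV :: bool set" "\<lambda>b. if b then 1 - 1 / n else 1 / n" "\<lambda>b. if b then x else chi T0"])
    show "pst (if b then x else chi T0)" for b using px tree_pst[OF T0] by (cases b) auto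
  qed (use n in \<open>auto simp: UNIV_bool y_def n_def\<close>)
  have sy: "sum y F = (1 - 1 / n) * sum x F + 1 / n * sum (chi T0) F" for F
    unfolding y_def n_def by (simp only: sum.distrib sum_distrib_left)
  have "sum y (cut i) \<le> real_of_int (B0 i)" if i: "i < k" for i
  proof -
    have "card (T0 \<inter> cut i) \<le> card T0" using T0 by (intro card_mono) (auto simp: tree_def intro: finite_subset)
    then have "sum (chi T0) (cut i) \<le> n" unfolding sum_chi[OF finite_cut] n_def using T0 by (simp add: tree_def)
    then have "1 / n * sum (chi T0) (cut i) \<le> 1 / n * n" using n by (intro mult_left_mono) auto
    then have a: "1 / n * sum (chi T0) (cut i) \<le> 1" using n by simp
    have "0 \<le> sum x (cut i)" using px cut_sub unfolding pst_def by (intro sum_nonneg) auto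
    then have "(1 - 1 / n) * sum x (cut i) \<le> 1 * sum x (cut i)" using n by (intro mult_right_mono) auto
    then have "sum y (cut i) \<le> b i + 1" using a x i unfolding sy lpx_def by fastforce
    moreover have "b i + 1 \<le> real_of_int (\<lceil>b i\<rceil> + 1)" by simp
    ultimately have "sum y (cut i) \<le> real_of_int (\<lceil>b i\<rceil> + 1)" by linarith
    moreover have "sum y (cut i) \<le> sum y {..<m}" using py cut_sub unfolding pst_def by (intro sum_mono2) auto
    then have "sum y (cut i) \<le> real (card V)" using py unfolding pst_def by linarith
    ultimately show ?thesis unfolding B0[OF i] by (simp add: min_def)
  qed
  then have "real L * sum y (cut i) \<le> real L * real_of_int (B0 i)" if "i < k" for i
    using that by (intro mult_left_mono) auto
  then show "adm fx {..<k} B0 0 y" using py fx by (auto simp: adm_def obeys_def)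
  have "cst y = (1 - 1 / n) * cst x + 1 / n * cst (chi T0)"
    unfolding cst_def sum_distrib_left sum.distrib[symmetric] by (intro sum.cong) (auto simp: y_def n_def algebra_simps)
  then show "cst y = cst x - (cst x - cst (chi T0)) / real (card V)" unfolding n_def[symmetric] using n by (simp add: field_simps)
qed

text \<open>With D = \<open>zs - cm\<close>, the scale must be large enough for near-optimal LP
  points to lie within \<open>2 ^ j\<close> of the minimum, and at most 4 D for the cost error to be
  covered by the saving. If D >= 1/2, the largest power of two below 4 D does both. If D < 1/2,
  \<open>j = 0\<close> keeps \<open>z\<close> below \<open>cm + 1\<close>, and integrality makes
  every tree of cost at most \<open>z\<close> a minimum tree. The hypothesis on the total cost keeps
  \<open>j\<close> below L^2.\<close>

lemma choose_scale:
  assumes x0: "lpx b x0" and T0: "tree T0" and min: "\<And>x. pst x \<Longrightarrow> cst (chi T0) \<le> cst x"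
    and big: "(\<Sum>e<m. C e) < 2 ^ (L\<^sup>2 - 3)"
  shows "\<exists>j<L\<^sup>2. (\<exists>x. lpx b x \<and> cst x \<le> cst (chi T0) + 2 ^ j) \<and>
    (\<forall>z. (\<forall>x. lpx b x \<longrightarrow> z \<le> cst x - (cst x - cst (chi T0)) / real (card V) + 2 ^ j / (4 * real L)) \<longrightarrow>
       z \<le> cst (chi T0) + 2 ^ j \<and> (\<forall>T x. tree T \<and> lpx b x \<and> cst (chi T) \<le> z \<longrightarrow> cst (chi T) \<le> cst x))"
proof -
  define cm where "cm = cst (chi T0)"
  define n where "n = real (card V)"
  have n: "1 \<le> n" "n \<le> real L" using V_ne finite_V L unfolding n_def by (auto simp: Suc_leI card_gt_0_iff)
  define zs where "zs = Inf (cst ` Collect (lpx b))"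
  have bdd: "bdd_below (cst ` Collect (lpx b))" using min by (intro bdd_belowI[of _ cm]) (auto simp: lpx_def cm_def)
  have zs_le: "zs \<le> cst x" if "lpx b x" for x unfolding zs_def using that bdd by (intro cInf_lower) auto
  have zs_ge: "c \<le> zs" if "\<And>x. lpx b x \<Longrightarrow> c \<le> cst x" for c unfolding zs_def using that x0 by (intro cInf_greatest) auto
  \<comment> \<open>Points close to the infimum stand in for a minimizer of the relaxation.\<close>
  have zs_near: "\<exists>x. lpx b x \<and> cst x < c" if "zs < c" for c
  proof (rule ccontr)
    assume "\<not> ?thesis"
    then have "c \<le> zs" by (intro zs_ge) (meson not_le)
    then show False using that by simp
  qed
  define \<Delta> where "\<Delta> = zs - cm"
  have \<Delta>0: "0 \<le> \<Delta>" using zs_ge[of cm] min unfolding \<Delta>_def cm_def lpx_def by auto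
  have cmx: "cm \<le> cst x" if "lpx b x" for x using min that by (auto simp: cm_def lpx_def)
  show ?thesis
  proof (cases "\<Delta> < 1 / 2")
    case True
    show ?thesis
    proof (intro exI[of _ 0] conjI allI impI)
      show "0 < L\<^sup>2" using L by simp
      have "zs < cm + 1" using True by (simp add: \<Delta>_def)
      then show "\<exists>x. lpx b x \<and> cst x \<le> cst (chi T0) + 2 ^ 0" using zs_near[of "cm + 1"] unfolding cm_def by (auto intro: less_imp_le)
      fix z assume z: "\<forall>x. lpx b x \<longrightarrow> z \<le> cst x - (cst x - cst (chi T0)) / real (card V) + 2 ^ 0 / (4 * real L)"
      have "1 / (4 * real L) \<le> 1 / 4" using n by (simp add: field_simps)
      then have "z - 1 / 4 \<le> cst x" if "lpx b x" for x
      proof -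
        have "0 \<le> (cst x - cm) / n" using cmx[OF that] n by simp
        moreover have "z \<le> cst x - (cst x - cm) / n + 1 / (4 * real L)" using z that unfolding cm_def n_def by simp
        ultimately show ?thesis using \<open>1 / (4 * real L) \<le> 1 / 4\<close> by linarith
      qed
      then have zc: "z < cm + 1" using zs_ge[of "z - 1 / 4"] True unfolding \<Delta>_def by force
      then show "z \<le> cst (chi T0) + 2 ^ 0" by (simp add: cm_def)
      fix T x assume a: "tree T \<and> lpx b x \<and> cst (chi T) \<le> z"
      have int: "cst (chi X) \<in> \<int>" for X unfolding cst_def by (intro Ints_sum Ints_mult) auto
      have "cst (chi T) < cm + 1" using a zc by linarith
      then have "cst (chi T) \<le> cm" using int[of T] int[of T0] unfolding cm_def by (auto elim!: Ints_cases)
      then show "cst (chi T) \<le> cst x" using cmx[of x] a by linarith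
    qed
  next
    case False
    define t where "t = \<lfloor>log 2 (4 * \<Delta>)\<rfloor>"
    have p4: "2 \<le> 4 * \<Delta>" using False by simp
    have t0: "0 \<le> t" unfolding t_def using p4 by simp
    define j where "j = nat t"
    have tj: "real_of_int t = real j" using t0 by (simp add: j_def)
    have h1: "2 ^ j \<le> 4 * \<Delta>"
    proof -
      have "real j \<le> log 2 (4 * \<Delta>)" unfolding tj[symmetric] t_def by simp
      then have "2 powr real j \<le> 4 * \<Delta>" using p4 by (simp add: le_log_iff)
      then show ?thesis by (simp add: powr_realpow)
    qed
    have h2: "2 * \<Delta> < 2 ^ j"
    proof -
      have "log 2 (4 * \<Delta>) < real (j + 1)" unfolding of_nat_add tj[symmetric] t_def by simp
      then have "4 * \<Delta> < 2 powr real (j + 1)" using p4 by (simp add: log_less_iff)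
      then have "4 * \<Delta> < 2 ^ (j + 1)" by (subst (asm) powr_realpow) auto
      then show ?thesis by simp
    qed
    have "j < L\<^sup>2"
    proof -
      have "cst x0 \<le> (\<Sum>e<m. real_of_int (C e) * 1)"
        unfolding cst_def using C_nonneg pst_le1 x0 by (intro sum_mono mult_left_mono) (auto simp: lpx_def)
      then have "cst x0 \<le> real_of_int (\<Sum>e<m. C e)" by simp
      also have "\<dots> < real_of_int (2 ^ (L\<^sup>2 - 3))" using big by (intro of_int_less_iff[THEN iffD2])
      finally have "cst x0 < 2 ^ (L\<^sup>2 - 3)" by simp
      moreover have "0 \<le> cm" unfolding cm_def cst_def using C_nonneg by (intro sum_nonneg) auto
      ultimately have "\<Delta> < 2 ^ (L\<^sup>2 - 3)" using zs_le[OF x0] unfolding \<Delta>_def by linarith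
      then have "(2::real) ^ j < 2 ^ 2 * 2 ^ (L\<^sup>2 - 3)" using h1 by simp
      then have "(2::real) ^ j < 2 ^ (2 + (L\<^sup>2 - 3))" by (simp only: power_add)
      then have "j < 2 + (L\<^sup>2 - 3)" by (rule power_less_imp_less_exp[rotated]) simp
      moreover have "4\<^sup>2 \<le> L\<^sup>2" using L by (intro power_mono) auto
      ultimately show ?thesis by simp
    qed
    moreover have "\<exists>x. lpx b x \<and> cst x \<le> cst (chi T0) + 2 ^ j"
      using zs_near[of "cm + 2 ^ j"] h2 \<Delta>0 unfolding \<Delta>_def cm_def by (force intro: less_imp_le)
    moreover have "z \<le> cst (chi T0) + 2 ^ j \<and> (\<forall>T x. tree T \<and> lpx b x \<and> cst (chi T) \<le> z \<longrightarrow> cst (chi T) \<le> cst x)"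
      if z: "\<forall>x. lpx b x \<longrightarrow> z \<le> cst x - (cst x - cst (chi T0)) / real (card V) + 2 ^ j / (4 * real L)" for z
    proof -
      have zx: "z \<le> cst x" if x: "lpx b x" for x
      proof -
        have "2 ^ j / (4 * real L) \<le> 4 * (cst x - cm) / (4 * n)"
          using h1 zs_le[OF x] n \<Delta>0 cmx[OF x] unfolding \<Delta>_def by (intro frac_le) auto
        also have "\<dots> = (cst x - cm) / n" by (rule mult_divide_mult_cancel_left) simp
        finally have "2 ^ j / (4 * real L) \<le> (cst x - cm) / n" .
        moreover have "z \<le> cst x - (cst x - cm) / n + 2 ^ j / (4 * real L)" using z x unfolding cm_def n_def by blast
        ultimately show ?thesis by linarith
      qed
      then have "z \<le> zs" by (rule zs_ge)
      moreover have "\<Delta> \<le> 2 * \<Delta>" using \<Delta>0 by simp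
      then have "\<Delta> < 2 ^ j" using h2 by (rule le_less_trans)
      then have "zs \<le> cm + 2 ^ j" unfolding \<Delta>_def by simp
      ultimately have "z \<le> cm + 2 ^ j" by (rule order_trans)
      then show ?thesis using zx unfolding cm_def by fastforce
    qed
    ultimately show ?thesis by blast
  qed
qed

end

section \<open>The program\<close>

primrec wr :: "lc \<Rightarrow> nat set" where
  "wr Nop = {}"
| "wr (Asg v i e) = {v}"
| "wr (Sq a b) = wr a \<union> wr b"
| "wr (Cond e a b) = wr a \<union> wr b"
| "wr (Loop a) = wr a"

lemma den_frame: "v \<notin> wr c \<Longrightarrow> den L c s v = s v"
proof (induction c arbitrary: s)
  case (Loop c)
  have "(den L c ^^ n) s v = s v" for n
    by (induction n) (use Loop in auto)
  then show ?case by simp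
qed auto

notation Sq (infixr ";;" 60)

abbreviation X :: "nat \<Rightarrow> ex" where "X v \<equiv> At v (K 0)"
abbreviation setx :: "nat \<Rightarrow> ex \<Rightarrow> lc" where "setx v e \<equiv> Asg v (K 0) e"

definition If1 :: "ex \<Rightarrow> lc \<Rightarrow> lc" where "If1 a c = Cond a c Nop"
definition IfNe :: "ex \<Rightarrow> ex \<Rightarrow> lc \<Rightarrow> lc" where "IfNe a b c = Cond (Minus a b) c (Cond (Minus b a) c Nop)"
definition IfEq :: "ex \<Rightarrow> ex \<Rightarrow> lc \<Rightarrow> lc" where "IfEq a b c = Cond (Minus a b) Nop (Cond (Minus b a) Nop c)"
definition IfGt :: "ex \<Rightarrow> ex \<Rightarrow> lc \<Rightarrow> lc" where "IfGt a b c = Cond (Minus a b) c Nop"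
text \<open>A loop of \<open>L\<close> rounds with a guard: it needs a bound of at most
  \<open>L\<close>, and the excess rounds do nothing.\<close>

definition For :: "nat \<Rightarrow> nat \<Rightarrow> lc \<Rightarrow> lc" where
  "For iv nv c = setx iv (K 0) ;; Loop (If1 (Minus (X nv) (X iv)) (c ;; setx iv (Plus (X iv) (K 1))))"
primrec Rep :: "nat \<Rightarrow> lc \<Rightarrow> lc" where
  "Rep 0 c = c"
| "Rep (Suc n) c = Loop (Rep n c)"

lemma wr_macros [simp]: "wr (If1 a c) = wr c" "wr (IfNe a b c) = wr c" "wr (IfEq a b c) = wr c" "wr (IfGt a b c) = wr c"
  "wr (For iv nv c) = insert iv (wr c)" "wr (Rep n c) = wr c"
  by (auto simp: If1_def IfNe_def IfEq_def IfGt_def For_def) (induction n, auto)+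

lemma den_macros [simp]:
  "den L (If1 a c) s = (if ev a s > 0 then den L c s else s)"
  "den L (IfNe a b c) s = (if ev a s \<noteq> ev b s then den L c s else s)"
  "den L (IfEq a b c) s = (if ev a s = ev b s then den L c s else s)"
  "den L (IfGt a b c) s = (if ev a s > ev b s then den L c s else s)"
  by (auto simp: If1_def IfNe_def IfEq_def IfGt_def)

lemma den_Rep: "den L (Rep n c) s = (den L c ^^ (L ^ n)) s"
proof (induction n arbitrary: s)
  case (Suc n)
  have "den L (Rep n c) = den L c ^^ (L ^ n)" using Suc by (simp add: fun_eq_iff)
  then show ?case by (simp add: funpow_mult mult.commute)
qed simp

text \<open>The step may assume that arrays the body does not write are unchanged, so invariants
  need to speak of written arrays only.\<close>

lemma pow_rule:
  assumes "I 0 s" "\<And>j t. j < n \<Longrightarrow> I j t \<Longrightarrow> (\<forall>v. v \<notin> wr c \<longrightarrow> t v = s v) \<Longrightarrow> I (Suc j) (den L c t)"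
  shows "I n ((den L c ^^ n) s)"
proof -
  have "j \<le> n \<Longrightarrow> I j ((den L c ^^ j) s) \<and> (\<forall>v. v \<notin> wr c \<longrightarrow> (den L c ^^ j) s v = s v)" for j
    by (induction j) (use assms den_frame in auto)
  then show ?thesis by simp
qed

lemma Rep_rule:
  assumes "I 0 s" "\<And>j t. j < L ^ d \<Longrightarrow> I j t \<Longrightarrow> (\<forall>v. v \<notin> wr c \<longrightarrow> t v = s v) \<Longrightarrow> I (Suc j) (den L c t)"
  shows "I (L ^ d) (den L (Rep d c) s)"
  unfolding den_Rep by (rule pow_rule[OF assms])

lemma Loop_rule:
  assumes "I 0 s" "\<And>j t. j < L \<Longrightarrow> I j t \<Longrightarrow> (\<forall>v. v \<notin> wr c \<longrightarrow> t v = s v) \<Longrightarrow> I (Suc j) (den L c t)"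
  shows "I L (den L (Loop c) s)"
  unfolding den.simps by (rule pow_rule[OF assms])

lemma For_rule:
  assumes n: "s nv 0 = int n" "n \<le> L" "iv \<notin> wr c" "nv \<notin> wr c" "iv \<noteq> nv"
    and ins: "\<And>j t x. I j t \<Longrightarrow> I j (t(iv := x))"
    and base: "I 0 s"
    and step: "\<And>j t. j < n \<Longrightarrow> I j t \<Longrightarrow> t iv 0 = int j \<Longrightarrow> (\<forall>v. v \<noteq> iv \<and> v \<notin> wr c \<longrightarrow> t v = s v) \<Longrightarrow> I (Suc j) (den L c t)"
  shows "I n (den L (For iv nv c) s)"
proof -
  let ?b = "If1 (Minus (X nv) (X iv)) (c ;; setx iv (Plus (X iv) (K 1)))"
  let ?s = "s(iv := (s iv)(0 := 0))"
  define J where "J = (\<lambda>j (t :: store). t iv 0 = int (min j n) \<and> I (min j n) t \<and> (\<forall>v. v \<noteq> iv \<and> v \<notin> wr c \<longrightarrow> t v = s v))"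
  have "J L ((den L ?b ^^ L) ?s)"
  proof (rule pow_rule)
    show "J 0 ?s" using base ins by (auto simp: J_def)
    fix j t assume J: "J j t"
    have nv: "t nv 0 = int n" using J n by (auto simp: J_def)
    have fr: "\<forall>v. v \<noteq> iv \<and> v \<notin> wr c \<longrightarrow> t v = s v" using J by (simp add: J_def)
    show "J (Suc j) (den L ?b t)"
    proof (cases "j < n")
      case True
      then have mn: "min j n = j" "min (Suc j) n = Suc j" by auto
      have t: "t iv 0 = int j" "I j t" using J unfolding J_def mn by auto
      define t' where "t' = den L c t"
      have "I (Suc j) t'" unfolding t'_def using True t fr by (intro step) auto
      moreover have "t' iv 0 = int j" unfolding t'_def using den_frame[OF n(3)] t by simp
      moreover have "den L ?b t = t'(iv := (t' iv)(0 := t' iv 0 + 1))" using nv t True by (simp add: t'_def)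
      moreover have "\<forall>v. v \<noteq> iv \<and> v \<notin> wr c \<longrightarrow> t' v = s v" using fr den_frame[of _ c L t] by (simp add: t'_def)
      ultimately show ?thesis unfolding J_def mn using ins by simp
    next
      case False
      then have mn: "min j n = n" "min (Suc j) n = n" by auto
      have t: "t iv 0 = int n" "I n t" using J unfolding J_def mn by auto
      then show ?thesis unfolding J_def mn using fr nv by simp
    qed
  qed
  moreover have "min L n = n" using n(2) by simp
  ultimately show ?thesis unfolding J_def For_def by simp
qed

lemma For_sum:
  assumes n: "s nv 0 = int n" "n \<le> L" "iv \<notin> wr c" "nv \<notin> wr c" "iv \<noteq> nv" "v \<noteq> iv"
    and s0: "s v 0 = 0"
    and step: "\<And>j t. j < n \<Longrightarrow> t iv 0 = int j \<Longrightarrow> (\<forall>v. v \<noteq> iv \<and> v \<notin> wr c \<longrightarrow> t v = s v) \<Longrightarrow> den L c t v 0 = t v 0 + f j"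
  shows "den L (For iv nv c) s v 0 = (\<Sum>j<n. f j)"
proof (rule For_rule[where I = "\<lambda>j (t :: store). t v 0 = (\<Sum>j<j. f j)" and n = n])
qed (use n s0 step in auto)

text \<open>For loops that set entry \<open>j\<close> in round \<open>j\<close>, possibly from its
  old value, which is therefore known to be still the initial one.\<close>

lemma For_fill:
  assumes n: "s nv 0 = int n" "n \<le> L" "iv \<notin> wr c" "nv \<notin> wr c" "iv \<noteq> nv" "v \<noteq> iv"
    and step: "\<And>j t. j < n \<Longrightarrow> t iv 0 = int j \<Longrightarrow> (\<forall>u. u \<noteq> iv \<and> u \<notin> wr c \<longrightarrow> t u = s u) \<Longrightarrow>
       (\<And>i. j \<le> i \<Longrightarrow> i < n \<Longrightarrow> t v (int i) = s v (int i)) \<Longrightarrow> \<exists>x. den L c t v = (t v)(int j := x) \<and> P j x"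
  shows "\<forall>j<n. P j (den L (For iv nv c) s v (int j))"
proof -
  have "(\<lambda>j t. (\<forall>i<j. P i (t v (int i))) \<and> (\<forall>i. j \<le> i \<longrightarrow> i < n \<longrightarrow> t v (int i) = s v (int i))) n (den L (For iv nv c) s)"
  proof (rule For_rule[where I = "\<lambda>j (t :: store). (\<forall>i<j. P i (t v (int i))) \<and> (\<forall>i. j \<le> i \<longrightarrow> i < n \<longrightarrow> t v (int i) = s v (int i))"])
    fix j t
    assume a: "j < n" "(\<forall>i<j. P i (t v (int i))) \<and> (\<forall>i. j \<le> i \<longrightarrow> i < n \<longrightarrow> t v (int i) = s v (int i))" "t iv 0 = int j" "\<forall>u. u \<noteq> iv \<and> u \<notin> wr c \<longrightarrow> t u = s u"
    then obtain x where "den L c t v = (t v)(int j := x)" "P j x" using step[of j t] by auto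
    then show "(\<forall>i<Suc j. P i (den L c t v (int i))) \<and> (\<forall>i. Suc j \<le> i \<longrightarrow> i < n \<longrightarrow> den L c t v (int i) = s v (int i))"
      using a by (auto simp: less_Suc_eq)
  qed (use n in auto)
  then show ?thesis by blast
qed

abbreviation LL :: ex where "LL \<equiv> At 0 (K 0)"

text \<open>Powers of \<open>L\<close> enter one factor at a time: \<open>tame\<close> wants right
  factors of lower level, and \<open>L\<close> is stored at level 0.\<close>

primrec TimesL :: "nat \<Rightarrow> ex \<Rightarrow> ex" where
  "TimesL 0 e = e"
| "TimesL (Suc n) e = Times (TimesL n e) LL"

lemma ev_TimesL [simp]: "ev (TimesL n e) s = ev e s * s 0 0 ^ n"
  by (induction n) auto

section \<open>The greedy algorithm and the penalty iteration as programs\<close>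

text \<open>
  Arrays: 0 input (entry 0 is \<open>L\<close>), 1 output, 2 \<open>n\<close>, 4 \<open>m\<close>, 5 and 6 edge ends, 8 number of constraints,
  12 cut incidence (entry \<open>e + L * i\<close>), 13 original bounds, 14 the logarithm of \<open>n\<close>, 16 \<open>h\<close>, 17 whether a tree is
  stored, 18 \<open>fx\<close>, 19 active constraints, 20 their bounds, 21 \<open>kap\<close>, 22 progress flag, 23 test result,
  24 selected edge plus one, 27 component labels, 28 current tree, 29 stored tree, 30 sum of trees, 65 costs, 66 multipliers,
  69 cost of the initial run, 70 cost of the stored tree, 128 penalised weights, 129 the penalty for fixed edges.
\<close>

definition label_init :: lc where
  "label_init = For 43 2 (Asg 27 (At 0 (Plus (X 43) (K 2))) (At 0 (Plus (X 43) (K 2))))"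

definition select :: lc where
  "select = For 40 4 (IfNe (At 27 (At 5 (X 40))) (At 27 (At 6 (X 40)))
     (Cond (X 24) (IfGt (At 128 (Minus (X 24) (K 1))) (At 128 (X 40)) (setx 24 (Plus (X 40) (K 1))))
       (setx 24 (Plus (X 40) (K 1)))))"

definition relabel :: lc where
  "relabel = For 43 2 (IfEq (At 27 (At 0 (Plus (X 43) (K 2)))) (X 25) (Asg 27 (At 0 (Plus (X 43) (K 2))) (X 26)))"

definition join :: lc where
  "join = Asg 28 (Minus (X 24) (K 1)) (K 1) ;;
     setx 25 (At 27 (At 5 (Minus (X 24) (K 1)))) ;; setx 26 (At 27 (At 6 (Minus (X 24) (K 1)))) ;; relabel"

definition kruskal :: lc where
  "kruskal = label_init ;; For 40 4 (Asg 28 (X 40) (K 0)) ;; Loop (setx 24 (K 0) ;; select ;; If1 (X 24) join)"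

lemma wr_kruskal [simp]: "wr label_init = {27, 43}" "wr select = {24, 40}" "wr relabel = {27, 43}"
  "wr join = {25, 26, 27, 28, 43}" "wr kruskal = {24, 25, 26, 27, 28, 40, 43}"
  by (auto simp: label_init_def select_def relabel_def join_def kruskal_def)

definition crx :: "ex \<Rightarrow> ex \<Rightarrow> ex" where
  "crx e i = At 12 (Plus e (Times LL i))"

lemma ev_crx [simp]: "ev (crx e i) s = s 12 (ev e s + s 0 0 * ev i s)"
  by (simp add: crx_def)

text \<open>The penalty is the sum of the unpenalised weights plus one, hence larger than this sum,
  as \<open>penalised_tree\<close> demands. The fixed edges therefore receive it in a separate last
  pass.\<close>

definition mkW :: lc where
  "mkW = For 40 4 (setx 67 (K 0) ;;
       For 41 8 (If1 (crx (X 40) (X 41)) (setx 67 (Plus (X 67) (At 66 (X 41))))) ;;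
       Asg 128 (X 40) (Plus (TimesL 7 (Times (At 65 (X 40)) (K 4))) (TimesL 1 (Times (X 67) (X 16))))) ;;
     setx 129 (K 0) ;; For 40 4 (setx 129 (Plus (X 129) (At 128 (X 40)))) ;;
     setx 129 (Plus (X 129) (K 1)) ;;
     For 40 4 (IfEq (At 18 (X 40)) (K 1) (Asg 128 (X 40) (Minus (At 128 (X 40)) (X 129))) ;;
       IfEq (At 18 (X 40)) (K 2) (Asg 128 (X 40) (Plus (At 128 (X 40)) (X 129))))"

definition cntT :: "ex \<Rightarrow> lc" where
  "cntT i = setx 31 (K 0) ;; For 40 4 (If1 (At 28 (X 40)) (setx 31 (Plus (X 31) (crx (X 40) i))))"

definition upd :: lc where
  "upd = For 41 8 (cntT (X 41) ;;
       If1 (At 19 (X 41)) (Asg 66 (X 41) (Minus (Minus (Plus (At 66 (X 41)) (TimesL 1 (X 31))) (TimesL 1 (At 20 (X 41)))) (X 21)) ;;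
         IfGt (K 0) (At 66 (X 41)) (Asg 66 (X 41) (K 0)))) ;;
     For 40 4 (Asg 30 (X 40) (Plus (At 30 (X 40)) (At 28 (X 40))))"

definition drift :: lc where
  "drift = For 41 8 (Asg 66 (X 41) (K 0)) ;; For 40 4 (Asg 30 (X 40) (K 0)) ;; Rep 9 (mkW ;; kruskal ;; upd)"

locale prog = crossing_trees +
  fixes vs :: "nat list" and B0 :: "nat \<Rightarrow> int"
  assumes vs: "set vs = V" "distinct vs"
begin

definition stat :: "store \<Rightarrow> bool" where
  "stat s \<longleftrightarrow> s 0 0 = int L \<and> s 2 0 = int (length vs) \<and> (\<forall>i<length vs. s 0 (int i + 2) = int (vs ! i)) \<and>
     s 4 0 = int m \<and> s 8 0 = int k \<and>
     (\<forall>e<m. s 5 (int e) = int (src e) \<and> s 6 (int e) = int (tgt e) \<and> s 65 (int e) = C e) \<and>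
     (\<forall>i<k. s 13 (int i) = B0 i \<and> (\<forall>e<m. s 12 (int e + int L * int i) = of_bool (e \<in> cut i)))"

lemma stat_cong: "stat s \<Longrightarrow> (\<And>v. v \<in> {0, 2, 4, 5, 6, 8, 12, 13, 65} \<Longrightarrow> t v = s v) \<Longrightarrow> stat t"
  unfolding stat_def by simp

lemma stat_den: "stat s \<Longrightarrow> wr c \<inter> {0, 2, 4, 5, 6, 8, 12, 13, 65} = {} \<Longrightarrow> stat (den L c s)"
  by (erule stat_cong) (rule den_frame, blast)

lemma card_vs: "card V = length vs"
  using vs distinct_card by fastforce

lemma bounds: "length vs \<le> L" "m \<le> L" "k \<le> L"
  using L card_vs by auto

definition flags :: "nat \<Rightarrow> store \<Rightarrow> nat set" where
  "flags v s = {e. e < m \<and> s v (int e) = 1}"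

lemma kruskal_init:
  assumes "stat s"
  defines "t \<equiv> den L label_init s"
  shows "\<And>v. v \<in> V \<Longrightarrow> t 27 (int v) = int v"
proof -
  have "\<forall>i<length vs. t 27 (int (vs ! i)) = int (vs ! i)"
    unfolding t_def label_init_def
  proof (rule For_rule[where I = "\<lambda>j (t :: store). \<forall>i<j. t 27 (int (vs ! i)) = int (vs ! i)"])
    fix j t assume a: "j < length vs" "\<forall>i<j. t 27 (int (vs ! i)) = int (vs ! i)" "t 43 0 = int j"
      "\<forall>v. v \<noteq> 43 \<and> v \<notin> wr (Asg 27 (At 0 (Plus (X 43) (K 2))) (At 0 (Plus (X 43) (K 2)))) \<longrightarrow> t v = s v"
    have "t 0 (int j + 2) = int (vs ! j)" using a assms by (simp add: stat_def)
    then show "\<forall>i<Suc j. den L (Asg 27 (At 0 (Plus (X 43) (K 2))) (At 0 (Plus (X 43) (K 2)))) t 27 (int (vs ! i)) = int (vs ! i)"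
      using a by (auto simp: less_Suc_eq)
  qed (use assms bounds in \<open>auto simp: stat_def\<close>)
  then show "v \<in> V \<Longrightarrow> t 27 (int v) = int v" for v using vs by (metis in_set_conv_nth)
qed

lemma kruskal_select:
  assumes st: "stat s" and s24: "s 24 0 = 0"
  defines "t \<equiv> den L select s"
  defines "um \<equiv> \<lambda>e. s 27 (int (src e)) \<noteq> s 27 (int (tgt e))"
  shows "(t 24 0 = 0 \<and> (\<forall>e<m. \<not> um e)) \<or>
    (\<exists>g<m. t 24 0 = int g + 1 \<and> um g \<and> (\<forall>e<m. um e \<longrightarrow> s 128 (int g) \<le> s 128 (int e)))"
proof -
  define I where "I = (\<lambda>j (t :: store). (t 24 0 = (0::int) \<and> (\<forall>e<j. \<not> um e)) \<or>
    (\<exists>g<j. t 24 0 = int g + 1 \<and> um g \<and> (\<forall>e<j. um e \<longrightarrow> s 128 (int g) \<le> s 128 (int e))))"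
  let ?c = "IfNe (At 27 (At 5 (X 40))) (At 27 (At 6 (X 40)))
         (Cond (X 24) (IfGt (At 128 (Minus (X 24) (K 1))) (At 128 (X 40)) (setx 24 (Plus (X 40) (K 1))))
           (setx 24 (Plus (X 40) (K 1))))"
  have "I m t"
    unfolding t_def select_def
  proof (rule For_rule)
    show "I 0 s" using s24 by (simp add: I_def)
    fix j t assume a: "j < m" "I j t" "t 40 0 = int j" "\<forall>v. v \<noteq> 40 \<and> v \<notin> wr ?c \<longrightarrow> t v = s v"
    have fr: "t 5 = s 5" "t 6 = s 6" "t 27 = s 27" "t 128 = s 128" using a(4) by auto
    have ends: "t 5 (int j) = int (src j)" "t 6 (int j) = int (tgt j)" using st a(1) fr by (auto simp: stat_def)
    have um: "ev (At 27 (At 5 (X 40))) t \<noteq> ev (At 27 (At 6 (X 40))) t \<longleftrightarrow> um j" using a(3) ends fr by (simp add: um_def)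
    from a(2) consider "t 24 0 = 0" "\<forall>e<j. \<not> um e"
      | g where "g < j" "t 24 0 = int g + 1" "um g" "\<forall>e<j. um e \<longrightarrow> s 128 (int g) \<le> s 128 (int e)"
      unfolding I_def by blast
    then show "I (Suc j) (den L ?c t)"
    proof cases
      case 1
      then show ?thesis using um a(3) by (auto simp: I_def less_Suc_eq)
    next
      case (2 g)
      show ?thesis
      proof (cases "um j \<and> s 128 (int g) > s 128 (int j)")
        case True
        then have "den L ?c t 24 0 = int j + 1" using um a(3) 2 fr by simp
        moreover have "\<forall>e<Suc j. um e \<longrightarrow> s 128 (int j) \<le> s 128 (int e)" using 2(4) True by (fastforce simp: less_Suc_eq)
        ultimately show ?thesis using True unfolding I_def by blast
      next
        case False
        then have "den L ?c t 24 0 = int g + 1" using um a(3) 2 fr by auto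
        moreover have "\<forall>e<Suc j. um e \<longrightarrow> s 128 (int g) \<le> s 128 (int e)" using 2(4) False by (auto simp: less_Suc_eq)
        ultimately show ?thesis using 2(1,3) unfolding I_def by (meson less_SucI)
      qed
    qed
  qed (use st bounds in \<open>auto simp: stat_def I_def\<close>)
  then show ?thesis unfolding I_def .
qed

lemma kruskal_relabel:
  assumes st: "stat s"
  defines "t \<equiv> den L relabel s"
  shows "\<And>v. v \<in> V \<Longrightarrow> t 27 (int v) = (if s 27 (int v) = s 25 0 then s 26 0 else s 27 (int v))"
proof -
  let ?c = "IfEq (At 27 (At 0 (Plus (X 43) (K 2)))) (X 25) (Asg 27 (At 0 (Plus (X 43) (K 2))) (X 26))"
  define I where "I = (\<lambda>j (t :: store). \<forall>i<length vs. t 27 (int (vs ! i)) =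
     (if i < j \<and> s 27 (int (vs ! i)) = s 25 0 then s 26 0 else s 27 (int (vs ! i))))"
  have "I (length vs) t"
    unfolding t_def relabel_def
  proof (rule For_rule)
    fix j t assume a: "j < length vs" "I j t" "t 43 0 = int j" "\<forall>v. v \<noteq> 43 \<and> v \<notin> wr ?c \<longrightarrow> t v = s v"
    have fr: "t 0 = s 0" "t 25 = s 25" "t 26 = s 26" using a(4) by auto
    have vj: "t 0 (int j + 2) = int (vs ! j)" using st a(1) fr by (simp add: stat_def)
    have inj: "i < length vs \<Longrightarrow> vs ! i = vs ! j \<longleftrightarrow> i = j" for i using vs(2) a(1) by (simp add: nth_eq_iff_index_eq)
    have tj: "t 27 (int (vs ! j)) = s 27 (int (vs ! j))" using a(1,2) by (simp add: I_def)
    have "den L ?c t 27 (int (vs ! i)) = (if i < Suc j \<and> s 27 (int (vs ! i)) = s 25 0 then s 26 0 else s 27 (int (vs ! i)))"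
      if i: "i < length vs" for i
    proof -
      have ti: "t 27 (int (vs ! i)) = (if i < j \<and> s 27 (int (vs ! i)) = s 25 0 then s 26 0 else s 27 (int (vs ! i)))"
        using a(2) i unfolding I_def by blast
      show ?thesis
      proof (cases "i = j")
        case True
        then show ?thesis using fr vj tj a(3) by simp
      next
        case False
        then have "i < Suc j \<longleftrightarrow> i < j" by auto
        moreover have "int (vs ! i) \<noteq> int (vs ! j)" using inj[OF i] False by simp
        ultimately show ?thesis using fr vj ti a(3) by simp
      qed
    qed
    then show "I (Suc j) (den L ?c t)" unfolding I_def by blast
  qed (use st bounds in \<open>auto simp: stat_def I_def\<close>)
  then show "v \<in> V \<Longrightarrow> t 27 (int v) = (if s 27 (int v) = s 25 0 then s 26 0 else s 27 (int v))" for v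
    using vs unfolding I_def by (metis in_set_conv_nth)
qed

text \<open>Each round adds an edge unless everything is merged. Since the selected edges never
  exceed n - 1 in number and this is less than \<open>L\<close>, the final labelling must be
  constant along all edges.\<close>

lemma kruskal_correct:
  assumes st: "stat s"
  defines "t \<equiv> den L kruskal s"
  shows "tree (flags 28 t)" "\<And>e. e < m \<Longrightarrow> t 28 (int e) = of_bool (e \<in> flags 28 t)"
    "\<And>x :: nat \<Rightarrow> real. pst x \<Longrightarrow> (\<Sum>e\<in>flags 28 t. real_of_int (s 128 (int e))) \<le> (\<Sum>e<m. real_of_int (s 128 (int e)) * x e)"
proof -
  define w where "w = (\<lambda>e. s 128 (int e))"
  let ?B = "For 40 4 (Asg 28 (X 40) (K 0))"
  let ?body = "setx 24 (K 0) ;; select ;; If1 (X 24) join"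
  define s1 where "s1 = den L label_init s"
  define s2 where "s2 = den L ?B s1"
  have st1: "stat s1" unfolding s1_def by (rule stat_den[OF st]) auto
  have st2: "stat s2" unfolding s2_def by (rule stat_den[OF st1]) auto
  have lab: "s2 27 (int v) = int v" if "v \<in> V" for v
    using kruskal_init[OF st that] den_frame[of 27 ?B L s1] by (simp add: s1_def s2_def)
  have w2: "s2 128 = s 128" using den_frame[of 128 ?B L s1] den_frame[of 128 label_init L s] by (simp add: s1_def s2_def)
  have T0: "\<forall>e<m. s2 28 (int e) = 0"
    unfolding s2_def by (rule For_fill) (use st1 bounds in \<open>auto simp: stat_def\<close>)
  define J where "J = (\<lambda>j (t :: store). stat t \<and> t 128 = s 128 \<and> kinv w (flags 28 t) (\<lambda>v. t 27 (int v)) \<and>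
    (\<forall>e<m. t 28 (int e) \<in> {0, 1}) \<and> ((\<forall>e<m. t 27 (int (src e)) = t 27 (int (tgt e))) \<or> j \<le> card (flags 28 t)))"
  have "J L (den L (Loop ?body) s2)"
  proof (rule Loop_rule)
    have "flags 28 s2 = {}" using T0 by (auto simp: flags_def)
    moreover have "inj_on (\<lambda>v. s2 27 (int v)) V" using lab by (auto simp: inj_on_def)
    ultimately show "J 0 s2" using st2 w2 T0 kinv_init by (auto simp: J_def)
  next
    fix j t assume J: "J j t"
    have stt: "stat t" and wt: "t 128 = s 128" and K: "kinv w (flags 28 t) (\<lambda>v. t 27 (int v))" and z: "\<forall>e<m. t 28 (int e) \<in> {0, 1}"
      using J by (auto simp: J_def)
    define t0 where "t0 = t(24 := (t 24)(0 := 0))"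
    have st0: "stat t0" unfolding t0_def by (rule stat_cong[OF stt]) auto
    define t1 where "t1 = den L select t0"
    have st1: "stat t1" unfolding t1_def by (rule stat_den[OF st0]) auto
    have fr1: "v \<notin> {24, 40} \<Longrightarrow> t1 v = t v" for v
      using den_frame[of v select L t0] by (auto simp: t1_def t0_def)
    define um where "um = (\<lambda>e. t 27 (int (src e)) \<noteq> t 27 (int (tgt e)))"
    have sel: "(t1 24 0 = 0 \<and> (\<forall>e<m. \<not> um e)) \<or>
        (\<exists>g<m. t1 24 0 = int g + 1 \<and> um g \<and> (\<forall>e<m. um e \<longrightarrow> w g \<le> w e))"
      using kruskal_select[OF st0] unfolding t1_def um_def w_def t0_def by (simp add: wt)
    have body: "den L ?body t = (if t1 24 0 > 0 then den L join t1 else t1)"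
      by (simp only: den.simps den_macros ev.simps t1_def t0_def)
    from sel show "J (Suc j) (den L ?body t)"
    proof
      assume a: "t1 24 0 = 0 \<and> (\<forall>e<m. \<not> um e)"
      then have "den L ?body t = t1" unfolding body by simp
      moreover have "flags 28 t1 = flags 28 t" by (simp add: flags_def fr1)
      ultimately show ?thesis using a st1 wt K z fr1 by (auto simp: J_def um_def)
    next
      assume "\<exists>g<m. t1 24 0 = int g + 1 \<and> um g \<and> (\<forall>e<m. um e \<longrightarrow> w g \<le> w e)"
      then obtain g where g: "g < m" "t1 24 0 = int g + 1" "um g" "\<And>e. e < m \<Longrightarrow> um e \<Longrightarrow> w g \<le> w e" by blast
      define t2 where "t2 = t1(28 := (t1 28)(int g := 1), 25 := (t1 25)(0 := t 27 (int (src g))), 26 := (t1 26)(0 := t 27 (int (tgt g))))"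
      have sg: "t1 5 (int g) = int (src g)" "t1 6 (int g) = int (tgt g)" using st1 g(1) by (auto simp: stat_def)
      have b2: "den L ?body t = den L relabel t2" unfolding body using g(2) sg fr1 by (simp add: join_def t2_def)
      have st2: "stat t2" unfolding t2_def by (rule stat_cong[OF st1]) auto
      have st3: "stat (den L relabel t2)" by (rule stat_den[OF st2]) auto
      have fr3: "v \<notin> {27, 43} \<Longrightarrow> den L relabel t2 v = t2 v" for v by (rule den_frame) auto
      have fl: "flags 28 (den L relabel t2) = insert g (flags 28 t)"
        using g(1) fr3[of 28] fr1 by (auto simp: flags_def t2_def)
      have lb: "den L relabel t2 27 (int v) = (if t 27 (int v) = t 27 (int (src g)) then t 27 (int (tgt g)) else t 27 (int v))" if "v \<in> V" for v
        using kruskal_relabel[OF st2 that] fr1[of 27] by (simp add: t2_def)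
      have ks: "kinv w (insert g (flags 28 t)) (\<lambda>v. den L relabel t2 27 (int v))" "g \<notin> flags 28 t"
        using kinv_step[OF K g(1), of "\<lambda>v. den L relabel t2 27 (int v)"] g(3,4) lb unfolding um_def by blast+
      have nd: "j \<le> card (flags 28 t)" using J g(1,3) unfolding J_def um_def by blast
      have "finite (flags 28 t)" by (simp add: flags_def)
      then have "Suc j \<le> card (insert g (flags 28 t))" using nd ks(2) by simp
      moreover have "\<forall>e<m. den L relabel t2 28 (int e) \<in> {0, 1}" using z fr3[of 28] fr1[of 28] by (auto simp: t2_def)
      moreover have "den L relabel t2 128 = s 128" using fr3[of 128] fr1[of 128] wt by (simp add: t2_def)
      ultimately show ?thesis unfolding J_def b2 fl using st3 ks(1) by blast
    qed
  qed
  moreover have "den L (Loop ?body) s2 = t" by (simp only: t_def kruskal_def s1_def s2_def den.simps)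
  ultimately have J: "J L t" by simp
  then have K: "kinv w (flags 28 t) (\<lambda>v. t 27 (int v))" by (simp add: J_def)
  have "\<not> L \<le> card (flags 28 t)" using kinv_card[OF K] L(2) by linarith
  then have fin: "\<And>e. e < m \<Longrightarrow> t 27 (int (src e)) = t 27 (int (tgt e))" using J by (auto simp: J_def)
  show "tree (flags 28 t)" by (rule kinv_final(1)[OF K fin connected])
  show "e < m \<Longrightarrow> t 28 (int e) = of_bool (e \<in> flags 28 t)" for e using J by (auto simp: J_def flags_def)
  show "(\<Sum>e\<in>flags 28 t. real_of_int (s 128 (int e))) \<le> (\<Sum>e<m. real_of_int (s 128 (int e)) * x e)" if "pst x" for x :: "nat \<Rightarrow> real"
    using kinv_final(2)[OF K fin connected that] by (simp add: w_def)
qed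

end

lemma For_check:
  assumes n: "s nv 0 = int n" "n \<le> L" "iv \<notin> wr c" "nv \<notin> wr c" "iv \<noteq> nv" "v \<noteq> iv"
    and s0: "s v 0 = of_bool b"
    and step: "\<And>j t. j < n \<Longrightarrow> t iv 0 = int j \<Longrightarrow> (\<forall>u. u \<noteq> iv \<and> u \<notin> wr c \<longrightarrow> t u = s u) \<Longrightarrow>
       den L c t v 0 = (if P j then t v 0 else 0)"
  shows "den L (For iv nv c) s v 0 = of_bool (b \<and> (\<forall>j<n. P j))"
proof (rule For_rule[where I = "\<lambda>j (t :: store). t v 0 = of_bool (b \<and> (\<forall>i<j. P i))" and n = n])
  fix j t assume "j < n" "t v 0 = of_bool (b \<and> (\<forall>i<j. P i))" "t iv 0 = int j" "\<forall>u. u \<noteq> iv \<and> u \<notin> wr c \<longrightarrow> t u = s u"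
  then show "den L c t v 0 = of_bool (b \<and> (\<forall>i<Suc j. P i))" using step[of j t] by (auto simp: less_Suc_eq)
qed (use n s0 in auto)

definition wsum :: lc where
  "wsum = For 41 8 (If1 (crx (X 40) (X 41)) (setx 67 (Plus (X 67) (At 66 (X 41)))))"

lemma wr_wsum [simp]: "wr wsum = {41, 67}"
  by (auto simp: wsum_def)

definition mkW1 :: lc where
  "mkW1 = For 40 4 (setx 67 (K 0) ;; wsum ;;
     Asg 128 (X 40) (Plus (TimesL 7 (Times (At 65 (X 40)) (K 4))) (TimesL 1 (Times (X 67) (X 16)))))"

definition mkW2 :: lc where
  "mkW2 = For 40 4 (setx 129 (Plus (X 129) (At 128 (X 40))))"

definition mkW3 :: lc where
  "mkW3 = For 40 4 (IfEq (At 18 (X 40)) (K 1) (Asg 128 (X 40) (Minus (At 128 (X 40)) (X 129))) ;;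
       IfEq (At 18 (X 40)) (K 2) (Asg 128 (X 40) (Plus (At 128 (X 40)) (X 129))))"

lemma mkW_parts: "mkW = mkW1 ;; setx 129 (K 0) ;; mkW2 ;; setx 129 (Plus (X 129) (K 1)) ;; mkW3"
  by (simp add: mkW_def mkW1_def mkW2_def mkW3_def wsum_def)

lemma wr_mkW [simp]: "wr mkW1 = {40, 41, 67, 128}" "wr mkW2 = {40, 129}" "wr mkW3 = {40, 128}" "wr mkW = {40, 41, 67, 128, 129}"
  by (auto simp: mkW_parts mkW1_def mkW2_def mkW3_def)

lemma wr_cntT [simp]: "wr (cntT i) = {31, 40}"
  by (auto simp: cntT_def)

lemma wr_upd [simp]: "wr upd = {30, 31, 40, 41, 66}"
  by (auto simp: upd_def)

lemma wr_drift [simp]: "wr drift = {24, 25, 26, 27, 28, 30, 31, 40, 41, 43, 66, 67, 128, 129}"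
  by (auto simp: drift_def)

definition check_fix :: lc where
  "check_fix = For 40 4 (IfEq (At 18 (X 40)) (K 1) (IfNe (At 30 (X 40)) (TimesL 9 (K 1)) (setx 23 (K 0))) ;;
     IfEq (At 18 (X 40)) (K 2) (IfNe (At 30 (X 40)) (K 0) (setx 23 (K 0))))"

definition cntY :: lc where
  "cntY = For 40 4 (If1 (crx (X 40) (X 41)) (setx 31 (Plus (X 31) (At 30 (X 40)))))"

definition check_cuts :: lc where
  "check_cuts = For 41 8 (If1 (At 19 (X 41)) (setx 31 (K 0) ;; cntY ;;
     IfGt (TimesL 1 (X 31)) (TimesL 9 (Plus (Plus (TimesL 1 (At 20 (X 41))) (X 21)) (K 1))) (setx 23 (K 0))))"

definition costY :: "nat \<Rightarrow> lc" where
  "costY v = setx v (K 0) ;; For 40 4 (setx v (Plus (X v) (Times (At 65 (X 40)) (At 30 (X 40)))))"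

definition testp :: lc where
  "testp = setx 23 (K 1) ;; check_fix ;; check_cuts ;; costY 68 ;;
     IfGt (TimesL 7 (Times (Minus (X 68) (X 69)) (K 4))) (TimesL 5 (Times (TimesL 9 (X 21)) (X 16))) (setx 23 (K 0))"

lemma wr_test [simp]: "wr check_fix = {23, 40}" "wr cntY = {31, 40}" "wr check_cuts = {23, 31, 40, 41}" "wr (costY v) = {v, 40}"
  "wr testp = {23, 31, 40, 41, 68}"
  by (auto simp: check_fix_def cntY_def check_cuts_def costY_def testp_def)

text \<open>An accepted run raises \<open>kap\<close> and fixes the edge; a rejected one releases it
  again.\<close>

definition attempt :: "int \<Rightarrow> lc" where
  "attempt b = IfEq (At 18 (X 44)) (K 0) (Asg 18 (X 44) (K b) ;; drift ;; testp ;;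
     Cond (X 23) (setx 22 (K 1) ;; setx 21 (Plus (X 21) (K 1))) (Asg 18 (X 44) (K 0)))"

definition pass :: lc where
  "pass = For 44 4 (attempt 1 ;; attempt 2)"

lemma wr_pass [simp]: "wr (attempt b) = {18, 21, 22, 23, 24, 25, 26, 27, 28, 30, 31, 40, 41, 43, 66, 67, 68, 128, 129}"
  "wr pass = {18, 21, 22, 23, 24, 25, 26, 27, 28, 30, 31, 40, 41, 43, 44, 66, 67, 68, 128, 129}"
  by (auto simp: attempt_def pass_def)

context prog
begin

lemma stat_vals:
  assumes "stat s"
  shows "s 0 0 = int L" "s 2 0 = int (length vs)" "s 4 0 = int m" "s 8 0 = int k"
    "\<And>e. e < m \<Longrightarrow> s 5 (int e) = int (src e)" "\<And>e. e < m \<Longrightarrow> s 6 (int e) = int (tgt e)" "\<And>e. e < m \<Longrightarrow> s 65 (int e) = C e"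
    "\<And>i. i < k \<Longrightarrow> s 13 (int i) = B0 i" "\<And>i e. i < k \<Longrightarrow> e < m \<Longrightarrow> s 12 (int e + int L * int i) = of_bool (e \<in> cut i)"
  using assms by (auto simp: stat_def)

definition w0 :: "int \<Rightarrow> (nat \<Rightarrow> int) \<Rightarrow> nat \<Rightarrow> int" where
  "w0 h lam e = C e * (4 * int L ^ 7) + (\<Sum>i<k. if e \<in> cut i then lam i else 0) * h * int L"

lemma mkW1_correct:
  assumes st: "stat s"
  defines "t \<equiv> den L mkW1 s"
  shows "\<forall>e<m. t 128 (int e) = w0 (s 16 0) (\<lambda>i. s 66 (int i)) e"
  unfolding t_def mkW1_def
proof (rule For_fill)
  let ?c = "setx 67 (K 0) ;; wsum ;;
     Asg 128 (X 40) (Plus (TimesL 7 (Times (At 65 (X 40)) (K 4))) (TimesL 1 (Times (X 67) (X 16))))"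
  fix j t assume a: "j < m" "t 40 0 = int j" "\<forall>u. u \<noteq> 40 \<and> u \<notin> wr ?c \<longrightarrow> t u = s u"
  have stt: "stat t" using st by (rule stat_cong) (use a(3) in auto)
  have fr: "t 66 = s 66" "t 16 = s 16" using a(3) by auto
  let ?t = "t(67 := (t 67)(0 := 0))"
  have "den L wsum ?t 67 0 = (\<Sum>i<k. if j \<in> cut i then s 66 (int i) else 0)"
    unfolding wsum_def
  proof (rule For_sum)
    fix i u assume b: "i < k" "u 41 0 = int i" "\<forall>v. v \<noteq> 41 \<and> v \<notin> wr (If1 (crx (X 40) (X 41)) (setx 67 (Plus (X 67) (At 66 (X 41))))) \<longrightarrow> u v = ?t v"
    have "u 0 0 = int L" "u 12 = t 12" "u 40 = t 40" "u 66 = t 66" using b(3) stat_vals(1)[OF stt] by auto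
    then show "den L (If1 (crx (X 40) (X 41)) (setx 67 (Plus (X 67) (At 66 (X 41))))) u 67 0 = u 67 0 + (if j \<in> cut i then s 66 (int i) else 0)"
      using stat_vals(9)[OF stt b(1) a(1)] a(2) b(2) fr by simp
  qed (use stat_vals(4)[OF stt] bounds in auto)
  moreover have "den L wsum ?t v = ?t v" if "v \<notin> {41, 67}" for v using that by (intro den_frame) simp
  ultimately show "\<exists>x. den L ?c t 128 = (t 128)(int j := x) \<and> x = w0 (s 16 0) (\<lambda>i. s 66 (int i)) j"
    using a(2) fr stat_vals(1)[OF stt] stat_vals(7)[OF stt a(1)] by (simp add: w0_def mult.assoc)
qed (use stat_vals(3)[OF st] bounds in auto)

lemma mkW_correct:
  assumes st: "stat s"
  defines "t \<equiv> den L mkW s"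
  defines "w \<equiv> w0 (s 16 0) (\<lambda>i. s 66 (int i))"
  defines "bg \<equiv> (\<Sum>e<m. w e) + 1"
  shows "\<forall>e<m. t 128 (int e) = w e - (if s 18 (int e) = 1 then bg else 0) + (if s 18 (int e) = 2 then bg else 0)"
proof -
  define s1 where "s1 = den L mkW1 s"
  define s2 where "s2 = s1(129 := (s1 129)(0 := 0))"
  define s3 where "s3 = den L mkW2 s2"
  define s4 where "s4 = s3(129 := (s3 129)(0 := s3 129 0 + 1))"
  have t: "t = den L mkW3 s4"
    by (simp add: t_def mkW_parts s1_def s2_def s3_def s4_def)
  have st1: "stat s1" unfolding s1_def by (rule stat_den[OF st]) simp
  have st2: "stat s2" unfolding s2_def by (rule stat_cong[OF st1]) auto
  have st3: "stat s3" unfolding s3_def by (rule stat_den[OF st2]) simp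
  have st4: "stat s4" unfolding s4_def by (rule stat_cong[OF st3]) auto
  have w1: "\<forall>e<m. s2 128 (int e) = w e" using mkW1_correct[OF st] unfolding s1_def s2_def w_def by simp
  have "s3 129 0 = (\<Sum>e<m. w e)"
    unfolding s3_def mkW2_def
    by (rule For_sum) (use w1 stat_vals(3)[OF st2] bounds in \<open>auto simp: s2_def\<close>)
  moreover have fr3: "s3 v = s2 v" if "v \<notin> {40, 129}" for v unfolding s3_def using that by (intro den_frame) simp
  ultimately have s4: "s4 129 0 = bg" "\<forall>e<m. s4 128 (int e) = w e" using w1 by (simp_all add: s4_def bg_def)
  have fr: "s4 18 = s 18" using fr3[of 18] den_frame[of 18 mkW1 L s] by (simp add: s4_def s2_def s1_def)
  show ?thesis
    unfolding t mkW3_def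
  proof (rule For_fill)
    let ?c = "IfEq (At 18 (X 40)) (K 1) (Asg 128 (X 40) (Minus (At 128 (X 40)) (X 129))) ;;
       IfEq (At 18 (X 40)) (K 2) (Asg 128 (X 40) (Plus (At 128 (X 40)) (X 129)))"
    fix j u assume a: "j < m" "u 40 0 = int j" "\<forall>v. v \<noteq> 40 \<and> v \<notin> wr ?c \<longrightarrow> u v = s4 v"
      and un: "\<And>i. j \<le> i \<Longrightarrow> i < m \<Longrightarrow> u 128 (int i) = s4 128 (int i)"
    have "u 18 = s 18" "u 129 0 = bg" "u 128 (int j) = w j" using a un[of j] fr s4 by auto
    then show "\<exists>x. den L ?c u 128 = (u 128)(int j := x) \<and> x = w j - (if s 18 (int j) = 1 then bg else 0) + (if s 18 (int j) = 2 then bg else 0)"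
      using a(2) by (intro exI[of _ "w j - (if s 18 (int j) = 1 then bg else 0) + (if s 18 (int j) = 2 then bg else 0)"]) (auto simp: fun_eq_iff)
  qed (use stat_vals(3)[OF st4] bounds in auto)
qed

lemma cntT_correct:
  assumes st: "stat s" and i: "i < k" and e: "\<And>u. (\<forall>v. v \<notin> {31, 40} \<longrightarrow> u v = s v) \<Longrightarrow> ev ex u = int i"
    and fl: "\<And>e. e < m \<Longrightarrow> s 28 (int e) = of_bool (e \<in> flags 28 s)"
  shows "den L (cntT ex) s 31 0 = int (card (flags 28 s \<inter> cut i))"
proof -
  let ?s = "s(31 := (s 31)(0 := 0))"
  let ?c = "If1 (At 28 (X 40)) (setx 31 (Plus (X 31) (crx (X 40) ex)))"
  have "den L (For 40 4 ?c) ?s 31 0 = (\<Sum>e<m. of_bool (e \<in> flags 28 s \<inter> cut i))"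
  proof (rule For_sum)
    fix j t assume a: "j < m" "t 40 0 = int j" "\<forall>v. v \<noteq> 40 \<and> v \<notin> wr ?c \<longrightarrow> t v = ?s v"
    have fr: "t 28 = s 28" "t 0 = s 0" "t 12 = s 12" using a(3) by auto
    have "ev ex t = int i" using a(3) by (intro e) auto
    then show "den L ?c t 31 0 = t 31 0 + of_bool (j \<in> flags 28 s \<inter> cut i)"
      using fl[OF a(1)] a(2) fr stat_vals(1)[OF st] stat_vals(9)[OF st i a(1)] by auto
  qed (use stat_vals(3)[OF st] bounds in auto)
  also have "\<dots> = int (card (flags 28 s \<inter> cut i))"
  proof -
    have "{..<m} \<inter> {e. e \<in> flags 28 s \<inter> cut i} = flags 28 s \<inter> cut i" by (auto simp: flags_def)
    then show ?thesis by simp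
  qed
  finally show ?thesis by (simp add: cntT_def)
qed

lemma upd_correct:
  assumes st: "stat s" and fl: "\<And>e. e < m \<Longrightarrow> s 28 (int e) = of_bool (e \<in> flags 28 s)"
  defines "t \<equiv> den L upd s"
  shows "\<forall>i<k. t 66 (int i) = (if s 19 (int i) > 0 then max 0 (s 66 (int i) + int L * int (card (flags 28 s \<inter> cut i)) - int L * s 20 (int i) - s 21 0)
     else s 66 (int i))" "\<forall>e<m. t 30 (int e) = s 30 (int e) + of_bool (e \<in> flags 28 s)"
proof -
  let ?c = "cntT (X 41) ;;
       If1 (At 19 (X 41)) (Asg 66 (X 41) (Minus (Minus (Plus (At 66 (X 41)) (TimesL 1 (X 31))) (TimesL 1 (At 20 (X 41)))) (X 21)) ;;
         IfGt (K 0) (At 66 (X 41)) (Asg 66 (X 41) (K 0)))"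
  let ?d = "Asg 30 (X 40) (Plus (At 30 (X 40)) (At 28 (X 40)))"
  define s1 where "s1 = den L (For 41 8 ?c) s"
  have t: "t = den L (For 40 4 ?d) s1" by (simp add: t_def upd_def s1_def)
  have st1: "stat s1" unfolding s1_def by (rule stat_den[OF st]) simp
  have 1: "\<forall>i<k. s1 66 (int i) = (if s 19 (int i) > 0 then max 0 (s 66 (int i) + int L * int (card (flags 28 s \<inter> cut i)) - int L * s 20 (int i) - s 21 0)
     else s 66 (int i))"
    unfolding s1_def
  proof (rule For_fill)
    fix j u assume a: "j < k" "u 41 0 = int j" "\<forall>v. v \<noteq> 41 \<and> v \<notin> wr ?c \<longrightarrow> u v = s v"
      and un: "\<And>i. j \<le> i \<Longrightarrow> i < k \<Longrightarrow> u 66 (int i) = s 66 (int i)"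
    have fr: "u 28 = s 28" "u 19 = s 19" "u 20 = s 20" "u 21 = s 21" using a(3) by auto
    have stu: "stat u" by (rule stat_cong[OF st]) (use a(3) in auto)
    have flu: "flags 28 u = flags 28 s" using fr by (simp add: flags_def)
    define u' where "u' = den L (cntT (X 41)) u"
    have u31: "u' 31 0 = int (card (flags 28 s \<inter> cut j))"
      unfolding u'_def flu[symmetric] by (rule cntT_correct[OF stu a(1)]) (use a(2) fl fr flu in auto)
    have fr': "u' v = u v" if "v \<notin> {31, 40}" for v unfolding u'_def using that by (intro den_frame) simp
    have uj: "u 66 (int j) = s 66 (int j)" using un[of j] a(1) by simp
    let ?x = "if s 19 (int j) > 0 then max 0 (s 66 (int j) + int L * int (card (flags 28 s \<inter> cut j)) - int L * s 20 (int j) - s 21 0)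
     else s 66 (int j)"
    have "den L ?c u = den L (If1 (At 19 (X 41)) (Asg 66 (X 41) (Minus (Minus (Plus (At 66 (X 41)) (TimesL 1 (X 31))) (TimesL 1 (At 20 (X 41)))) (X 21)) ;;
         IfGt (K 0) (At 66 (X 41)) (Asg 66 (X 41) (K 0)))) u'" by (simp only: den.simps u'_def)
    then have "den L ?c u 66 = (u 66)(int j := ?x)"
      using u31 a(2) fr uj stat_vals(1)[OF stu] fr'[of 66] fr'[of 41] fr'[of 19] fr'[of 20] fr'[of 21] fr'[of 0]
      by (auto simp: fun_eq_iff mult.commute)
    then show "\<exists>x. den L ?c u 66 = (u 66)(int j := x) \<and> x = ?x" by blast
  qed (use stat_vals(4)[OF st] bounds in auto)
  have fr: "s1 v = s v" if "v \<notin> {31, 40, 41, 66}" for v unfolding s1_def using that by (intro den_frame) auto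
  show "\<forall>e<m. t 30 (int e) = s 30 (int e) + of_bool (e \<in> flags 28 s)"
    unfolding t
  proof (rule For_fill)
    fix j u assume a: "j < m" "u 40 0 = int j" "\<forall>v. v \<noteq> 40 \<and> v \<notin> wr ?d \<longrightarrow> u v = s1 v"
      and un: "\<And>i. j \<le> i \<Longrightarrow> i < m \<Longrightarrow> u 30 (int i) = s1 30 (int i)"
    have "u 28 = s 28" "u 30 (int j) = s 30 (int j)" using a un[of j] fr by auto
    then show "\<exists>x. den L ?d u 30 = (u 30)(int j := x) \<and> x = s 30 (int j) + of_bool (j \<in> flags 28 s)"
      using a(2) fl[OF a(1)] by simp
  qed (use stat_vals(3)[OF st1] bounds in auto)
  have "t 66 = s1 66" unfolding t by (intro den_frame) simp
  then show "\<forall>i<k. t 66 (int i) = (if s 19 (int i) > 0 then max 0 (s 66 (int i) + int L * int (card (flags 28 s \<inter> cut i)) - int L * s 20 (int i) - s 21 0)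
     else s 66 (int i))" using 1 by simp
qed

definition fxof :: "store \<Rightarrow> nat \<Rightarrow> int" where "fxof s e = s 18 (int e)"
definition act :: "store \<Rightarrow> nat set" where "act s = {i. i < k \<and> s 19 (int i) = 1}"
definition bof :: "store \<Rightarrow> nat \<Rightarrow> int" where "bof s i = s 20 (int i)"
definition yof :: "store \<Rightarrow> nat \<Rightarrow> int" where "yof s e = s 30 (int e)"

lemma of_cong: "t 18 = s 18 \<Longrightarrow> fxof t = fxof s" "t 19 = s 19 \<Longrightarrow> act t = act s" "t 20 = s 20 \<Longrightarrow> bof t = bof s" "t 30 = s 30 \<Longrightarrow> yof t = yof s"
  by (simp_all add: fun_eq_iff fxof_def act_def bof_def yof_def)

lemma drift_correct:
  assumes st: "stat s" and h: "0 < s 16 0" and A: "\<forall>i<k. s 19 (int i) \<in> {0, 1} \<and> bof s i \<le> int (card V)"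
    and kap: "0 \<le> s 21 0" "s 21 0 \<le> int L"
  defines "t \<equiv> den L drift s"
  shows "\<exists>lam. drift_inv (s 16 0) (fxof s) (act s) (bof s) (s 21 0) (L ^ 9) lam (yof t)"
proof -
  let ?a = "For 41 8 (Asg 66 (X 41) (K 0))" and ?b = "For 40 4 (Asg 30 (X 40) (K 0))"
  let ?c = "mkW ;; kruskal ;; upd"
  define s1 where "s1 = den L ?a s"
  define s2 where "s2 = den L ?b s1"
  have t: "t = den L (Rep 9 ?c) s2" by (simp add: t_def drift_def s1_def s2_def)
  have st1: "stat s1" unfolding s1_def by (rule stat_den[OF st]) simp
  have st2: "stat s2" unfolding s2_def by (rule stat_den[OF st1]) simp
  have l0: "\<forall>i<k. s1 66 (int i) = 0" unfolding s1_def by (rule For_fill) (use stat_vals(4)[OF st] bounds in auto)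
  have y0: "\<forall>e<m. s2 30 (int e) = 0" unfolding s2_def by (rule For_fill) (use stat_vals(3)[OF st1] bounds in auto)
  have fr2: "s2 v = s v" if "v \<notin> {30, 40, 41, 66}" for v
    using den_frame[of v ?b L s1] den_frame[of v ?a L s] that by (simp add: s1_def s2_def)
  have l2: "\<forall>i<k. s2 66 (int i) = 0" using l0 den_frame[of 66 ?b L s1] by (simp add: s2_def)
  let ?DI = "\<lambda>n u. drift_inv (s 16 0) (fxof s) (act s) (bof s) (s 21 0) n (\<lambda>i. u 66 (int i)) (yof u)"
  \<comment> \<open>The program sums multipliers over all constraints, the analysis over active ones
    only; zero multipliers elsewhere reconcile them.\<close>
  define I where "I = (\<lambda>n (u :: store). stat u \<and> ?DI n u \<and> (\<forall>i<k. i \<notin> act s \<longrightarrow> u 66 (int i) = 0))"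
  have "I (L ^ 9) (den L (Rep 9 ?c) s2)"
  proof (rule Rep_rule)
    have "?DI 0 s2" by (rule drift_init) (use l2 y0 in \<open>auto simp: act_def yof_def\<close>)
    then show "I 0 s2" using st2 l2 by (simp add: I_def)
  next
    fix j u assume I: "I j u" and fru: "\<forall>v. v \<notin> wr ?c \<longrightarrow> u v = s2 v"
    have stu: "stat u" and DI: "?DI j u" and lz: "\<forall>i<k. i \<notin> act s \<longrightarrow> u 66 (int i) = 0" using I by (auto simp: I_def)
    have fr: "u 16 = s 16" "u 18 = s 18" "u 19 = s 19" "u 20 = s 20" "u 21 = s 21" using fru fr2 by auto
    define u1 where "u1 = den L mkW u"
    define u2 where "u2 = den L kruskal u1"
    define u3 where "u3 = den L upd u2"
    have u3: "den L ?c u = u3" by (simp only: den.simps u1_def u2_def u3_def)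
    have st1: "stat u1" unfolding u1_def by (rule stat_den[OF stu]) simp
    have st2: "stat u2" unfolding u2_def by (rule stat_den[OF st1]) simp
    have st3: "stat u3" unfolding u3_def by (rule stat_den[OF st2]) simp
    have f1: "u1 v = u v" if "v \<notin> {40, 41, 67, 128, 129}" for v unfolding u1_def using that by (intro den_frame) simp
    have f2: "u2 v = u1 v" if "v \<notin> {24, 25, 26, 27, 28, 40, 43}" for v unfolding u2_def using that by (intro den_frame) simp
    define T where "T = flags 28 u2"
    define w where "w = w0 (s 16 0) (\<lambda>i. u 66 (int i))"
    define bg where "bg = (\<Sum>e<m. w e) + 1"
    have W: "u1 128 (int e) = w e - (if fxof s e = 1 then bg else 0) + (if fxof s e = 2 then bg else 0)" if "e < m" for e
      using mkW_correct[OF stu] that fr unfolding u1_def w_def bg_def fxof_def by simp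
    have kr: "tree T" "\<And>e. e < m \<Longrightarrow> u2 28 (int e) = of_bool (e \<in> T)"
      "\<And>x :: nat \<Rightarrow> real. pst x \<Longrightarrow> (\<Sum>e\<in>T. real_of_int (u1 128 (int e))) \<le> (\<Sum>e<m. real_of_int (u1 128 (int e)) * x e)"
      using kruskal_correct[OF st1] unfolding u2_def T_def by blast+
    have U: "\<forall>i<k. u3 66 (int i) = (if u2 19 (int i) > 0 then max 0 (u2 66 (int i) + int L * int (card (T \<inter> cut i)) - int L * u2 20 (int i) - u2 21 0)
       else u2 66 (int i))" "\<forall>e<m. u3 30 (int e) = u2 30 (int e) + of_bool (e \<in> T)"
      using upd_correct[OF st2] kr(2) unfolding u3_def T_def by blast+
    have Y': "yof u3 e = yof u e + of_bool (e \<in> T)" if "e < m" for e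
      using U(2) that f1[of 30] f2[of 30] by (simp add: yof_def)
    have lam': "u3 66 (int i) = max 0 (u 66 (int i) + int L * int (card (T \<inter> cut i)) - int L * bof s i - s 21 0)" if "i \<in> act s" for i
      using U(1) that f1[of 66] f2[of 66] f1[of 19] f2[of 19] f1[of 20] f2[of 20] f1[of 21] f2[of 21] fr by (simp add: bof_def act_def)
    have w0: "w e = C e * (4 * int L ^ 7) + (\<Sum>i\<in>{i\<in>act s. e \<in> cut i}. u 66 (int i)) * s 16 0 * int L" for e
    proof -
      have "(\<Sum>i<k. if e \<in> cut i then u 66 (int i) else 0) = (\<Sum>i\<in>{i\<in>act s. e \<in> cut i}. u 66 (int i))"
        by (rule sum.mono_neutral_cong_right) (use lz in \<open>auto simp: act_def\<close>)
      then show ?thesis by (simp add: w_def w0_def)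
    qed
    have "drift_inv (s 16 0) (fxof s) (act s) (bof s) (s 21 0) (Suc j) (\<lambda>i. u3 66 (int i)) (yof u3)"
      by (rule drift_step[OF DI kr(1,3) W w0]) (use A kap h lam' Y' in \<open>auto simp: act_def bg_def\<close>)
    moreover have "\<forall>i<k. i \<notin> act s \<longrightarrow> u3 66 (int i) = 0"
    proof (intro allI impI)
      fix i assume i: "i < k" "i \<notin> act s"
      then have "s 19 (int i) = 0" using A by (auto simp: act_def)
      then show "u3 66 (int i) = 0" using U(1) i lz f1[of 66] f2[of 66] f1[of 19] f2[of 19] fr by simp
    qed
    ultimately show "I (Suc j) (den L ?c u)" using st3 unfolding I_def u3 by blast
  qed
  then show ?thesis unfolding I_def t by blast
qed

lemma testp_correct:
  assumes st: "stat s" and A: "\<forall>i<k. s 19 (int i) \<in> {0, 1}"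
  defines "t \<equiv> den L testp s"
  shows "t 23 0 = of_bool (test (s 69 0) (s 16 0) (fxof s) (act s) (bof s) (s 21 0) (yof s))"
proof -
  define s1 where "s1 = s(23 := (s 23)(0 := 1))"
  define s2 where "s2 = den L check_fix s1"
  define s3 where "s3 = den L check_cuts s2"
  define s4 where "s4 = den L (costY 68) s3"
  have st1: "stat s1" unfolding s1_def by (rule stat_cong[OF st]) auto
  have st2: "stat s2" unfolding s2_def by (rule stat_den[OF st1]) simp
  have st3: "stat s3" unfolding s3_def by (rule stat_den[OF st2]) simp
  have st4: "stat s4" unfolding s4_def by (rule stat_den[OF st3]) simp
  have f2: "s2 v = s v" if "v \<notin> {23, 40}" for v
    using that den_frame[of v check_fix L s1] by (auto simp: s1_def s2_def)
  have f3: "s3 v = s v" if "v \<notin> {23, 31, 40, 41}" for v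
    using that den_frame[of v check_cuts L s2] f2[of v] by (auto simp: s3_def)
  have f4: "s4 v = s v" if "v \<notin> {23, 31, 40, 41, 68}" for v
    using that den_frame[of v "costY 68" L s3] f3[of v] by (auto simp: s4_def)
  define P1 where "P1 = (\<lambda>e. (fxof s e = 1 \<longrightarrow> yof s e = int L ^ 9) \<and> (fxof s e = 2 \<longrightarrow> yof s e = 0))"
  have 1: "s2 23 0 = of_bool (True \<and> (\<forall>e<m. P1 e))"
    unfolding s2_def check_fix_def
  proof (rule For_check)
    let ?c = "IfEq (At 18 (X 40)) (K 1) (IfNe (At 30 (X 40)) (TimesL 9 (K 1)) (setx 23 (K 0))) ;;
     IfEq (At 18 (X 40)) (K 2) (IfNe (At 30 (X 40)) (K 0) (setx 23 (K 0)))"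
    fix j u assume a: "j < m" "u 40 0 = int j" "\<forall>v. v \<noteq> 40 \<and> v \<notin> wr ?c \<longrightarrow> u v = s1 v"
    have "u 18 = s 18" "u 30 = s 30" "u 0 0 = int L" using a(3) stat_vals(1)[OF st] by (auto simp: s1_def)
    then show "den L ?c u 23 0 = (if P1 j then u 23 0 else 0)" using a(2) by (auto simp: P1_def fxof_def yof_def)
  qed (use stat_vals(3)[OF st1] bounds in \<open>auto simp: s1_def\<close>)
  define P2 where "P2 = (\<lambda>i. i \<in> act s \<longrightarrow> int L * (\<Sum>e\<in>cut i. yof s e) \<le> int L ^ 9 * (int L * bof s i + s 21 0 + 1))"
  have 2: "s3 23 0 = of_bool ((\<forall>e<m. P1 e) \<and> (\<forall>i<k. P2 i))"
    unfolding s3_def check_cuts_def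
  proof (rule For_check)
    let ?c = "If1 (At 19 (X 41)) (setx 31 (K 0) ;; cntY ;;
     IfGt (TimesL 1 (X 31)) (TimesL 9 (Plus (Plus (TimesL 1 (At 20 (X 41))) (X 21)) (K 1))) (setx 23 (K 0)))"
    fix j u assume a: "j < k" "u 41 0 = int j" "\<forall>v. v \<noteq> 41 \<and> v \<notin> wr ?c \<longrightarrow> u v = s2 v"
    have fr: "u v = s v" if "v \<in> {0, 19, 20, 21, 30, 12, 4}" for v using a(3) f2[of v] that by auto
    have stu: "stat u" by (rule stat_cong[OF st2]) (use a(3) in auto)
    let ?u = "u(31 := (u 31)(0 := 0))"
    have "den L cntY ?u 31 0 = (\<Sum>e<m. if e \<in> cut j then yof s e else 0)"
      unfolding cntY_def
    proof (rule For_sum)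
      let ?d = "If1 (crx (X 40) (X 41)) (setx 31 (Plus (X 31) (At 30 (X 40))))"
      fix i z assume b: "i < m" "z 40 0 = int i" "\<forall>v. v \<noteq> 40 \<and> v \<notin> wr ?d \<longrightarrow> z v = ?u v"
      have "z 0 0 = int L" "z 12 = u 12" "z 41 = u 41" "z 30 = s 30" using b(3) stat_vals(1)[OF stu] fr by auto
      then show "den L ?d z 31 0 = z 31 0 + (if i \<in> cut j then yof s i else 0)"
        using stat_vals(9)[OF stu a(1) b(1)] a(2) b(2) by (simp add: yof_def)
    qed (use stat_vals(3)[OF stu] bounds in auto)
    also have "\<dots> = (\<Sum>e\<in>cut j. yof s e)"
    proof -
      have "{..<m} \<inter> {e. e \<in> cut j} = cut j" using cut_sub by auto
      then show ?thesis by (simp add: sum.If_cases)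
    qed
    finally have c31: "den L cntY ?u 31 0 = (\<Sum>e\<in>cut j. yof s e)" .
    have fc: "den L cntY ?u v = ?u v" if "v \<notin> {31, 40}" for v using that by (intro den_frame) simp
    show "den L ?c u 23 0 = (if P2 j then u 23 0 else 0)"
      using c31 fc[of 0] fc[of 20] fc[of 21] fc[of 41] fc[of 23] fr[of 0] fr[of 19] fr[of 20] fr[of 21] stat_vals(1)[OF st] a(1,2) A
      by (auto simp: P2_def act_def bof_def mult.commute)
  qed (use stat_vals(4)[OF st2] bounds 1 in auto)
  have 3: "s4 68 0 = (\<Sum>e<m. C e * yof s e)"
  proof -
    let ?c = "setx 68 (Plus (X 68) (Times (At 65 (X 40)) (At 30 (X 40))))"
    have "den L (For 40 4 ?c) (s3(68 := (s3 68)(0 := 0))) 68 0 = (\<Sum>e<m. C e * yof s e)"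
    proof (rule For_sum)
      fix j u assume a: "j < m" "u 40 0 = int j" "\<forall>v. v \<noteq> 40 \<and> v \<notin> wr ?c \<longrightarrow> u v = (s3(68 := (s3 68)(0 := 0))) v"
      have "u 65 = s3 65" "u 30 = s 30" using a(3) f3[of 30] by auto
      then show "den L ?c u 68 0 = u 68 0 + C j * yof s j" using a(2) stat_vals(7)[OF st3 a(1)] by (simp add: yof_def)
    qed (use stat_vals(3)[OF st3] bounds in auto)
    then show ?thesis by (simp add: s4_def costY_def)
  qed
  have t: "t = den L (IfGt (TimesL 7 (Times (Minus (X 68) (X 69)) (K 4))) (TimesL 5 (Times (TimesL 9 (X 21)) (X 16))) (setx 23 (K 0))) s4"
    by (simp add: t_def testp_def s1_def s2_def s3_def s4_def)
  have s4v: "s4 23 0 = s3 23 0" "s4 69 = s 69" "s4 21 = s 21" "s4 16 = s 16" "s4 0 0 = int L"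
    using den_frame[of 23 "costY 68" L s3] f4 stat_vals(1)[OF st4] by (auto simp: s4_def)
  have ea: "ev (TimesL 7 (Times (Minus (X 68) (X 69)) (K 4))) s4 = 4 * int L ^ 7 * ((\<Sum>e<m. C e * yof s e) - s 69 0)"
    unfolding ev_TimesL ev.simps s4v 3 by (simp only: mult_ac)
  have eb: "ev (TimesL 5 (Times (TimesL 9 (X 21)) (X 16))) s4 = s 21 0 * int L ^ 9 * s 16 0 * int L ^ 5"
    unfolding ev_TimesL ev.simps s4v by (simp only: mult_ac)
  have "t 23 0 = of_bool ((\<forall>e<m. P1 e) \<and> (\<forall>i<k. P2 i) \<and>
      4 * int L ^ 7 * ((\<Sum>e<m. C e * yof s e) - s 69 0) \<le> s 21 0 * int L ^ 9 * s 16 0 * int L ^ 5)"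
    unfolding t den_macros ea eb using s4v(1) 2 by (auto simp: not_le)
  then show ?thesis
    unfolding test_def P1_def P2_def act_def by auto
qed

end

section \<open>One scale: fixing edges and dropping constraints\<close>

text \<open>\<open>h\<close> is the scale of this search and \<open>c0\<close> the cost of its
  initial run. \<open>near\<close> is the condition under which a failed test is conclusive.\<close>

locale search = prog +
  fixes lgn :: nat and cmin :: real and h c0 :: int
  assumes pow_lgn: "card V \<le> 2 ^ lgn" and simple: "m \<le> (card V)\<^sup>2" and Lmk: "m + k \<le> L"
    and cmin: "\<And>T. tree T \<Longrightarrow> cmin \<le> cst (chi T)" and h: "0 < h"
    and near: "\<And>kap. 1 \<le> kap \<Longrightarrow> kap \<le> int L \<Longrightarrow> zb c0 h kap \<le> cmin + real_of_int h"
begin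

definition unf :: "store \<Rightarrow> nat set" where "unf s = {e. e < m \<and> fxof s e = 0}"

text \<open>\<open>kap\<close> grows only together with the set of fixed edges; the sum in the first
  line keeps it at most \<open>m + 1 <= L\<close>. The region is witnessed by a distribution on
  trees because \<open>few_unfixed\<close> exchanges edges in its support.\<close>

definition core :: "nat \<Rightarrow> store \<Rightarrow> bool" where
  "core q t \<longleftrightarrow> stat t \<and> t 16 0 = h \<and> t 69 0 = c0 \<and> 1 \<le> t 21 0 \<and> t 21 0 + int (card (unf t)) \<le> int m + 1 \<and>
     (\<forall>e<m. fxof t e \<in> {0, 1, 2}) \<and> (\<forall>i<k. t 19 (int i) \<in> {0, 1} \<and> bof t i \<le> int (card V)) \<and>
     (\<exists>p. distr p \<and> rg c0 h (fxof t) (act t) (bof t) (t 21 0) (mix p)) \<and>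
     linked B0 (2 * int lgn) (int q) 0 (fxof t) (act t) (bof t)"

lemma core_cong: "core q s \<Longrightarrow> (\<And>v. v \<in> {0, 2, 4, 5, 6, 8, 12, 13, 65, 16, 69, 21, 18, 19, 20} \<Longrightarrow> t v = s v) \<Longrightarrow> core q t"
proof -
  assume c: "core q s" and e: "\<And>v. v \<in> {0, 2, 4, 5, 6, 8, 12, 13, 65, 16, 69, 21, 18, 19, 20} \<Longrightarrow> t v = s v"
  have "stat s" using c by (simp add: core_def)
  then have "stat t" by (rule stat_cong) (use e in auto)
  moreover have "fxof t = fxof s" "act t = act s" "bof t = bof s" using e by (auto intro!: of_cong)
  moreover have "unf t = unf s" using \<open>fxof t = fxof s\<close> by (simp add: unf_def)
  ultimately show ?thesis using c e by (simp add: core_def)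
qed

lemma attempt_correct:
  assumes co: "core q s" and e: "s 44 0 = int e" "e < m" and b: "b \<in> {1, 2}"
  defines "t \<equiv> den L (attempt b) s"
  shows "core q t \<and> act t = act s \<and> bof t = bof s \<and>
    ((fxof t = fxof s \<and> t 21 0 = s 21 0 \<and> t 22 0 = s 22 0 \<and>
       (fxof s e = 0 \<longrightarrow> (\<forall>x. \<not> rg c0 h ((fxof s)(e := b)) (act s) (bof s) (s 21 0) x))) \<or>
     (t 22 0 = 1 \<and> unf t \<subset> unf s))"
proof (cases "fxof s e = 0")
  case False
  then have "t = s" using e by (simp add: t_def attempt_def fxof_def)
  then show ?thesis using co False by simp
next
  case True
  have c: "stat s" "s 16 0 = h" "s 69 0 = c0" "1 \<le> s 21 0" "s 21 0 + int (card (unf s)) \<le> int m + 1"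
     "\<forall>e<m. fxof s e \<in> {0, 1, 2}" "\<forall>i<k. s 19 (int i) \<in> {0, 1} \<and> bof s i \<le> int (card V)"
     "linked B0 (2 * int lgn) (int q) 0 (fxof s) (act s) (bof s)" using co by (auto simp: core_def)
  have se: "s 18 (int e) = 0" using True by (simp add: fxof_def)
  define s1 where "s1 = s(18 := (s 18)(int e := b))"
  define s2 where "s2 = den L drift s1"
  define s3 where "s3 = den L testp s2"
  have st1: "stat s1" unfolding s1_def by (rule stat_cong[OF c(1)]) auto
  have st2: "stat s2" unfolding s2_def by (rule stat_den[OF st1]) simp
  have st3: "stat s3" unfolding s3_def by (rule stat_den[OF st2]) simp
  have f2: "s2 v = s1 v" if "v \<in> {16, 18, 19, 20, 21, 22, 44, 69}" for v unfolding s2_def using that by (intro den_frame) auto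
  have f3: "s3 v = s1 v" if "v \<in> {16, 18, 19, 20, 21, 22, 44, 69}" for v
    using that f2[of v] den_frame[of v testp L s2] by (auto simp: s3_def)
  have fx1: "fxof s1 = (fxof s)(e := b)" by (auto simp: fun_eq_iff fxof_def s1_def)
  have ab1: "act s1 = act s" "bof s1 = bof s" by (auto simp: act_def bof_def s1_def)
  have e_unf: "e \<in> unf s" using e True by (simp add: unf_def)
  have fu: "finite (unf s)" by (simp add: unf_def)
  have "0 < card (unf s)" using e_unf fu by (auto simp: card_gt_0_iff)
  then have kap: "s 21 0 \<le> int L" "s 21 0 + 1 \<le> int L + 1" using c(5) bounds by linarith+
  have s1v: "s1 16 = s 16" "s1 19 = s 19" "s1 21 = s 21" "s1 69 = s 69" by (simp_all add: s1_def)
  obtain lam where "drift_inv (s1 16 0) (fxof s1) (act s1) (bof s1) (s1 21 0) (L ^ 9) lam (yof s2)"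
    using drift_correct[OF st1] c h kap s1v ab1 unfolding s2_def by auto
  then have DI: "drift_inv h ((fxof s)(e := b)) (act s) (bof s) (s 21 0) (L ^ 9) lam (yof s2)"
    unfolding fx1 ab1 using s1v c by simp
  have "s3 23 0 = of_bool (test (s2 69 0) (s2 16 0) (fxof s2) (act s2) (bof s2) (s2 21 0) (yof s2))"
    unfolding s3_def by (rule testp_correct[OF st2]) (use c f2[of 19] s1v in auto)
  moreover have "fxof s2 = (fxof s)(e := b)" "act s2 = act s" "bof s2 = bof s"
    using fx1 ab1 f2[of 18] f2[of 19] f2[of 20] of_cong[of s2 s1] by auto
  ultimately have ok: "s3 23 0 = of_bool (test c0 h ((fxof s)(e := b)) (act s) (bof s) (s 21 0) (yof s2))"
    using c f2[of 69] f2[of 16] f2[of 21] s1v by simp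
  have t: "t = den L (Cond (X 23) (setx 22 (K 1) ;; setx 21 (Plus (X 21) (K 1))) (Asg 18 (X 44) (K 0))) s3"
    using se e by (simp add: t_def attempt_def s1_def s2_def s3_def)
  show ?thesis
  proof (cases "test c0 h ((fxof s)(e := b)) (act s) (bof s) (s 21 0) (yof s2)")
    case yes: True
    then have tv: "t = s3(22 := (s3 22)(0 := 1), 21 := (s3 21)(0 := s3 21 0 + 1))" using ok unfolding t by simp
    have fxt: "fxof t = (fxof s)(e := b)" "act t = act s" "bof t = bof s"
      using fx1 ab1 f3[of 18] f3[of 19] f3[of 20] of_cong[of t s1] by (auto simp: tv)
    have unft: "unf t = unf s - {e}" using b by (auto simp: unf_def fxt)
    then have "card (unf t) + 1 = card (unf s)" using e_unf fu by (simp add: card_Diff_singleton \<open>0 < card (unf s)\<close> Suc_leI)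
    moreover have t21: "t 21 0 = s 21 0 + 1" using f3[of 21] s1v by (simp add: tv)
    moreover have "stat t" by (rule stat_cong[OF st3]) (auto simp: tv)
    moreover have "\<exists>p. distr p \<and> rg c0 h (fxof t) (act t) (bof t) (t 21 0) (mix p)"
      using test_sound[OF DI yes] unfolding fxt t21 .
    moreover have "linked B0 (2 * int lgn) (int q) 0 (fxof t) (act t) (bof t)"
      unfolding fxt by (rule linked_mono[OF c(8) order_refl]) (use atree_fix[of "fxof s" e b] True in blast)
    moreover have "t 16 0 = h" "t 69 0 = c0" "t 19 = s 19" using f3[of 16] f3[of 69] f3[of 19] s1v c by (auto simp: tv)
    moreover have "\<forall>e<m. fxof t e \<in> {0, 1, 2}" using c(6) b unfolding fxt by auto
    ultimately have "core q t" unfolding core_def using c by (auto simp: fxt)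
    moreover have "unf t \<subset> unf s" using unft e_unf by auto
    ultimately show ?thesis using fxt by (simp add: tv)
  next
    case no: False
    then have tv: "t = s3(18 := (s3 18)(int e := 0))" using ok f3[of 44] e unfolding t by (simp add: s1_def)
    have t18: "t 18 = s 18" using f3[of 18] se by (auto simp: tv s1_def)
    have fxt: "fxof t = fxof s" "act t = act s" "bof t = bof s"
      using f3[of 19] f3[of 20] t18 of_cong[of t s] by (auto simp: tv s1_def)
    have "t v = s v" if "v \<in> {0, 2, 4, 5, 6, 8, 12, 13, 65, 16, 69, 21, 18, 19, 20}" for v
    proof (cases "v = 18")
      case False
      then have "t v = s3 v" by (simp add: tv)
      also have "\<dots> = s2 v" unfolding s3_def by (rule den_frame) (use that in auto)
      also have "\<dots> = s1 v" unfolding s2_def by (rule den_frame) (use that in auto)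
      finally show ?thesis using False by (simp add: s1_def)
    qed (simp add: t18)
    from core_cong[OF co this] have "core q t" by blast
    moreover have "\<not> rg c0 h ((fxof s)(e := b)) (act s) (bof s) (s 21 0) x" for x
    proof
      assume x: "rg c0 h ((fxof s)(e := b)) (act s) (bof s) (s 21 0) x"
      have "finite (act s)" by (simp add: act_def)
      from test_complete[OF DI x h this cmin near[OF c(4) kap(1)]] no show False by blast
    qed
    moreover have "t 21 0 = s 21 0" "t 22 0 = s 22 0" using f3[of 21] f3[of 22] by (auto simp: tv s1_def)
    ultimately show ?thesis using fxt by blast
  qed
qed

text \<open>A failed test concerns the region at the time of the test. The certificates can be
  collected only if the whole pass changes nothing; after any success the pass merely counts as
  progress.\<close>

lemma pass_correct:
  assumes co: "core q s" and f0: "s 22 0 = 0"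
  defines "t \<equiv> den L pass s"
  shows "core q t \<and> act t = act s \<and> bof t = bof s \<and>
    ((fxof t = fxof s \<and> t 21 0 = s 21 0 \<and> t 22 0 = 0 \<and>
       (\<forall>e<m. fxof s e = 0 \<longrightarrow> (\<forall>x. \<not> rg c0 h ((fxof s)(e := 1)) (act s) (bof s) (s 21 0) x \<and> \<not> rg c0 h ((fxof s)(e := 2)) (act s) (bof s) (s 21 0) x))) \<or>
     (t 22 0 = 1 \<and> unf t \<subset> unf s))"
proof -
  define no where "no = (\<lambda>e. fxof s e = 0 \<longrightarrow> (\<forall>x. \<not> rg c0 h ((fxof s)(e := 1)) (act s) (bof s) (s 21 0) x \<and> \<not> rg c0 h ((fxof s)(e := 2)) (act s) (bof s) (s 21 0) x))"
  define I where "I = (\<lambda>j (t :: store). core q t \<and> act t = act s \<and> bof t = bof s \<and>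
    ((fxof t = fxof s \<and> t 21 0 = s 21 0 \<and> t 22 0 = 0 \<and> (\<forall>e<j. no e)) \<or> (t 22 0 = 1 \<and> unf t \<subset> unf s)))"
  have "I m t"
    unfolding t_def pass_def
  proof (rule For_rule)
    show "s 4 0 = int m" using co stat_vals(3) by (simp add: core_def)
    show "I 0 s" using co f0 by (simp add: I_def)
    show "I j (u(44 := x))" if "I j u" for j u x
    proof -
      have "fxof (u(44 := x)) = fxof u" "act (u(44 := x)) = act u" "bof (u(44 := x)) = bof u" by (auto intro!: of_cong)
      moreover have "core q u \<Longrightarrow> core q (u(44 := x))" by (erule core_cong[of q u "u(44 := x)"]) auto
      ultimately show ?thesis using that by (simp add: I_def unf_def)
    qed
  next
    fix j u assume j: "j < m" and I: "I j u" and uj: "u 44 0 = int j"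
    define u1 where "u1 = den L (attempt 1) u"
    define u2 where "u2 = den L (attempt 2) u1"
    have u44: "u1 44 0 = int j" using uj den_frame[of 44 "attempt 1" L u] by (simp add: u1_def)
    have cu: "core q u" "act u = act s" "bof u = bof s" using I by (auto simp: I_def)
    have 1: "core q u1 \<and> act u1 = act u \<and> bof u1 = bof u \<and>
    ((fxof u1 = fxof u \<and> u1 21 0 = u 21 0 \<and> u1 22 0 = u 22 0 \<and>
       (fxof u j = 0 \<longrightarrow> (\<forall>x. \<not> rg c0 h ((fxof u)(j := 1)) (act u) (bof u) (u 21 0) x))) \<or>
     (u1 22 0 = 1 \<and> unf u1 \<subset> unf u))"
      unfolding u1_def by (rule attempt_correct[OF cu(1) uj j]) simp
    then have cu1: "core q u1" by blast
    have 2: "core q u2 \<and> act u2 = act u1 \<and> bof u2 = bof u1 \<and>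
    ((fxof u2 = fxof u1 \<and> u2 21 0 = u1 21 0 \<and> u2 22 0 = u1 22 0 \<and>
       (fxof u1 j = 0 \<longrightarrow> (\<forall>x. \<not> rg c0 h ((fxof u1)(j := 2)) (act u1) (bof u1) (u1 21 0) x))) \<or>
     (u2 22 0 = 1 \<and> unf u2 \<subset> unf u1))"
      unfolding u2_def by (rule attempt_correct[OF cu1 u44 j]) simp
    have same: "fxof a = fxof b \<Longrightarrow> unf a = unf b" for a b by (simp add: unf_def)
    have "I (Suc j) u2"
    proof (cases "fxof u = fxof s \<and> u 21 0 = s 21 0 \<and> u 22 0 = 0 \<and> (\<forall>e<j. no e)")
      case True
      show ?thesis
      proof (cases "fxof u1 = fxof u \<and> u1 21 0 = u 21 0 \<and> u1 22 0 = u 22 0 \<and> (fxof u j = 0 \<longrightarrow> (\<forall>x. \<not> rg c0 h ((fxof u)(j := 1)) (act u) (bof u) (u 21 0) x))")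
        case a: True
        then show ?thesis using 1 2 True cu same[of u s] same[of u1 u] unfolding I_def no_def by (auto simp: less_Suc_eq)
      next
        case False
        then have "u1 22 0 = 1" "unf u1 \<subset> unf u" using 1 by blast+
        moreover have "u2 22 0 = 1 \<and> unf u2 \<subseteq> unf u1" using 2 calculation same[of u2 u1] by auto
        ultimately show ?thesis using 1 2 cu True same[of u s] unfolding I_def by auto
      qed
    next
      case False
      then have u: "u 22 0 = 1" "unf u \<subset> unf s" using I unfolding I_def by blast+
      have "u1 22 0 = 1 \<and> unf u1 \<subseteq> unf u" using 1 u same[of u1 u] by auto
      moreover have "u2 22 0 = 1 \<and> unf u2 \<subseteq> unf u1" using 2 calculation same[of u2 u1] by auto
      ultimately show ?thesis using 1 2 cu u unfolding I_def by auto
    qed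
    then show "I (Suc j) (den L (attempt 1 ;; attempt 2) u)" by (simp add: u1_def u2_def)
  qed (use bounds in auto)
  then show ?thesis unfolding I_def no_def .
qed

end

section \<open>The sweep over the active constraints\<close>

definition dist0 :: lc where
  "dist0 = setx 31 (K 0) ;; For 40 4 (IfEq (At 18 (X 40)) (K 0) (If1 (crx (X 40) (X 45)) (setx 31 (Plus (X 31) (K 1)))))"

definition dist1 :: lc where
  "dist1 = setx 31 (K 0) ;; setx 32 (K 0) ;; For 40 4 (IfNe (crx (X 40) (X 45)) (crx (X 40) (X 46))
     (IfEq (At 18 (X 40)) (K 0) (setx 31 (Plus (X 31) (K 1))) ;;
      IfEq (At 18 (X 40)) (K 1) (setx 32 (Minus (Plus (X 32) (crx (X 40) (X 46))) (crx (X 40) (X 45))))))"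

definition replace :: lc where
  "replace = Asg 19 (X 45) (K 0) ;; setx 33 (Plus (Plus (At 20 (X 45)) (X 32)) (K 31)) ;;
     IfGt (At 20 (X 46)) (X 33) (Asg 20 (X 46) (X 33))"

text \<open>The test of constraint \<open>r\<close>, kept in variable 45, is repeated for every
  \<open>j\<close>, so that the scan becomes idle once \<open>r\<close> has been dropped.\<close>

definition near_j :: lc where
  "near_j = If1 (At 19 (X 45)) (If1 (At 19 (X 46)) (dist1 ;; IfGt (K 32) (X 31) replace))"

definition net_r :: lc where
  "net_r = If1 (At 19 (X 45)) (dist0 ;; IfGt (K 32) (X 31) (Asg 19 (X 45) (K 0)) ;; For 46 45 near_j)"

definition net :: lc where
  "net = For 45 8 net_r"

lemma wr_net [simp]: "wr dist0 = {31, 40}" "wr dist1 = {31, 32, 40}" "wr replace = {19, 20, 33}"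
  "wr near_j = {19, 20, 31, 32, 33, 40}"
  "wr net_r = {19, 20, 31, 32, 33, 40, 46}" "wr net = {19, 20, 31, 32, 33, 40, 45, 46}"
  by (auto simp: dist0_def dist1_def replace_def near_j_def net_r_def net_def)

definition round :: lc where
  "round = setx 22 (K 0) ;; pass ;; IfEq (X 22) (K 0) net"

definition finish :: lc where
  "finish = For 41 8 (Asg 66 (X 41) (K 0)) ;; mkW ;; kruskal"

lemma wr_round [simp]:
  "wr round = {18, 19, 20, 21, 22, 23, 24, 25, 26, 27, 28, 30, 31, 32, 33, 40, 41, 43, 44, 45, 46, 66, 67, 68, 128, 129}"
  "wr finish = {24, 25, 26, 27, 28, 40, 41, 43, 66, 67, 128, 129}"
  by (auto simp: round_def finish_def)

context prog
begin

lemma dist0_correct: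
  assumes st: "stat s" and r: "s 45 0 = int r" "r < k"
  shows "den L dist0 s 31 0 = int (card (differ (fxof s) (cut r) {}))"
proof -
  let ?s = "s(31 := (s 31)(0 := 0))"
  let ?c = "IfEq (At 18 (X 40)) (K 0) (If1 (crx (X 40) (X 45)) (setx 31 (Plus (X 31) (K 1))))"
  have "den L (For 40 4 ?c) ?s 31 0 = (\<Sum>e<m. of_bool (fxof s e = 0 \<and> e \<in> cut r))"
  proof (rule For_sum)
    fix j t assume a: "j < m" "t 40 0 = int j" "\<forall>v. v \<noteq> 40 \<and> v \<notin> wr ?c \<longrightarrow> t v = ?s v"
    have "t 18 = s 18" "t 0 0 = int L" "t 12 = s 12" "t 45 0 = int r" using a(3) stat_vals(1)[OF st] r by auto
    then show "den L ?c t 31 0 = t 31 0 + of_bool (fxof s j = 0 \<and> j \<in> cut r)"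
      using a(2) stat_vals(9)[OF st r(2) a(1)] by (auto simp: fxof_def)
  qed (use stat_vals(3)[OF st] bounds in auto)
  also have "\<dots> = int (card (differ (fxof s) (cut r) {}))"
  proof -
    have "{..<m} \<inter> {e. fxof s e = 0 \<and> e \<in> cut r} = differ (fxof s) (cut r) {}" by (auto simp: differ_def)
    then show ?thesis by simp
  qed
  finally show ?thesis by (simp add: dist0_def)
qed

lemma dist1_correct:
  assumes st: "stat s" and r: "s 45 0 = int r" "r < k" and j: "s 46 0 = int j" "j < k"
  defines "t \<equiv> den L dist1 s"
  shows "t 31 0 = int (card (differ (fxof s) (cut r) (cut j)))"
    "t 32 0 = int (card (chosen (fxof s) (cut j))) - int (card (chosen (fxof s) (cut r)))"
proof -
  let ?s = "s(31 := (s 31)(0 := 0), 32 := (s 32)(0 := 0))"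
  let ?c = "IfNe (crx (X 40) (X 45)) (crx (X 40) (X 46))
     (IfEq (At 18 (X 40)) (K 0) (setx 31 (Plus (X 31) (K 1))) ;;
      IfEq (At 18 (X 40)) (K 1) (setx 32 (Minus (Plus (X 32) (crx (X 40) (X 46))) (crx (X 40) (X 45)))))"
  have t: "t = den L (For 40 4 ?c) ?s" by (simp add: t_def dist1_def)
  have step: "den L ?c u 31 0 = u 31 0 + of_bool (fxof s e = 0 \<and> (e \<in> cut r) \<noteq> (e \<in> cut j)) \<and>
     den L ?c u 32 0 = u 32 0 + (of_bool (e \<in> cut j \<and> fxof s e = 1) - of_bool (e \<in> cut r \<and> fxof s e = 1))"
    if a: "e < m" "u 40 0 = int e" "\<forall>v. v \<noteq> 40 \<and> v \<notin> wr ?c \<longrightarrow> u v = ?s v" for e u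
  proof -
    have "u 18 = s 18" "u 0 0 = int L" "u 12 = s 12" "u 45 0 = int r" "u 46 0 = int j" using a(3) stat_vals(1)[OF st] r j by auto
    then show ?thesis using a(2) stat_vals(9)[OF st r(2) a(1)] stat_vals(9)[OF st j(2) a(1)] by (auto simp: fxof_def)
  qed
  have "t 31 0 = (\<Sum>e<m. of_bool (fxof s e = 0 \<and> (e \<in> cut r) \<noteq> (e \<in> cut j)))"
    unfolding t by (rule For_sum) (use step stat_vals(3)[OF st] bounds in auto)
  also have "\<dots> = int (card (differ (fxof s) (cut r) (cut j)))"
  proof -
    have "{..<m} \<inter> {e. fxof s e = 0 \<and> (e \<in> cut r) \<noteq> (e \<in> cut j)} = differ (fxof s) (cut r) (cut j)" by (auto simp: differ_def)
    then show ?thesis by simp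
  qed
  finally show "t 31 0 = int (card (differ (fxof s) (cut r) (cut j)))" .
  have "t 32 0 = (\<Sum>e<m. of_bool (e \<in> cut j \<and> fxof s e = 1) - of_bool (e \<in> cut r \<and> fxof s e = 1))"
    unfolding t by (rule For_sum) (use step stat_vals(3)[OF st] bounds in auto)
  also have "\<dots> = int (card (chosen (fxof s) (cut j))) - int (card (chosen (fxof s) (cut r)))"
  proof -
    have "{..<m} \<inter> {e. e \<in> cut i \<and> fxof s e = 1} = chosen (fxof s) (cut i)" for i by (auto simp: chosen_def)
    then show ?thesis by (simp add: sum_subtractf)
  qed
  finally show "t 32 0 = int (card (chosen (fxof s) (cut j))) - int (card (chosen (fxof s) (cut r)))" .
qed

text \<open>This holds from any store with the instance in place, also at scales where the
  invariants of the search fail; so it is always a spanning tree that \<open>check\<close> and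
  \<open>costT\<close> judge.\<close>

lemma finish_tree:
  assumes "stat s"
  defines "t \<equiv> den L finish s"
  shows "tree (flags 28 t)" "\<And>e. e < m \<Longrightarrow> t 28 (int e) = of_bool (e \<in> flags 28 t)"
proof -
  define u where "u = den L mkW (den L (For 41 8 (Asg 66 (X 41) (K 0))) s)"
  have "stat u" unfolding u_def by (intro stat_den assms) auto
  moreover have "t = den L kruskal u" by (simp add: t_def finish_def u_def)
  ultimately show "tree (flags 28 t)" "\<And>e. e < m \<Longrightarrow> t 28 (int e) = of_bool (e \<in> flags 28 t)"
    using kruskal_correct(1,2)[of u] by auto
qed

end

context search
begin

text \<open>The part of \<open>core\<close> that a sweep preserves with one and the same
  distribution: neither the fixed edges nor \<open>kap\<close> change, and the regions only
  grow.\<close>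

definition nb :: "(nat \<Rightarrow> int) \<Rightarrow> int \<Rightarrow> (nat set \<Rightarrow> real) \<Rightarrow> store \<Rightarrow> bool" where
  "nb fx kap p t \<longleftrightarrow> stat t \<and> t 16 0 = h \<and> t 69 0 = c0 \<and> t 21 0 = kap \<and> fxof t = fx \<and>
     (\<forall>i<k. t 19 (int i) \<in> {0, 1} \<and> bof t i \<le> int (card V)) \<and> rg c0 h fx (act t) (bof t) kap (mix p)"

lemma nb_cong: "nb fx kap p s \<Longrightarrow> (\<And>v. v \<in> {0, 2, 4, 5, 6, 8, 12, 13, 65, 16, 69, 21, 18, 19, 20} \<Longrightarrow> t v = s v) \<Longrightarrow> nb fx kap p t"
proof -
  assume c: "nb fx kap p s" and e: "\<And>v. v \<in> {0, 2, 4, 5, 6, 8, 12, 13, 65, 16, 69, 21, 18, 19, 20} \<Longrightarrow> t v = s v"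
  have "stat s" using c by (simp add: nb_def)
  then have "stat t" by (rule stat_cong) (use e in auto)
  moreover have "fxof t = fxof s" "act t = act s" "bof t = bof s" using e by (auto intro!: of_cong)
  ultimately show ?thesis using c e by (simp add: nb_def)
qed

definition far_below :: "(nat \<Rightarrow> int) \<Rightarrow> nat \<Rightarrow> nat set \<Rightarrow> bool" where
  "far_below fx r A \<longleftrightarrow> (\<forall>i\<in>A. i < r \<longrightarrow> 31 < card (differ fx (cut i) {}) \<and> (\<forall>j\<in>A. j < i \<longrightarrow> 31 < card (differ fx (cut i) (cut j))))"

lemma act_remove: "act (t(19 := (t 19)(int r := 0))) = act t - {r}"
  by (auto simp: act_def)

lemma net_r_correct:
  assumes nb: "nb fx kap p s" and kap: "kap \<le> int L" and fx: "\<And>e. e < m \<Longrightarrow> fx e \<in> {0, 1, 2}"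
    and r: "s 45 0 = int r" "r < k" and lk: "linked B0 (2 * int lgn) q r fx (act s) (bof s)"
    and q: "q \<le> 2 * int lgn" and far: "far_below fx r (act s)"
  defines "t \<equiv> den L net_r s"
  shows "nb fx kap p t \<and> act t \<subseteq> act s \<and> linked B0 (2 * int lgn) q (Suc r) fx (act t) (bof t) \<and> far_below fx (Suc r) (act t)"
proof (cases "r \<in> act s")
  case False
  then have "s 19 (int r) = 0" using nb r by (auto simp: nb_def act_def)
  then have "t = s" using r by (simp add: t_def net_r_def)
  moreover have "linked B0 (2 * int lgn) q (Suc r) fx (act s) (bof s)" by (rule linked_mono[OF lk]) auto
  moreover have "far_below fx (Suc r) (act s)" using far False unfolding far_below_def by (metis less_Suc_eq)
  ultimately show ?thesis using nb by simp
next
  case True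
  have adm: "adm fx (act s) (bof s) kap (mix p)" and rg: "rg c0 h fx (act s) (bof s) kap (mix p)" using nb by (auto simp: nb_def rg_def)
  have sr: "s 19 (int r) = 1" using True by (simp add: act_def)
  have sts: "stat s" and fxs: "fxof s = fx" using nb by (auto simp: nb_def)
  define s1 where "s1 = den L dist0 s"
  have nb1: "nb fx kap p s1" by (rule nb_cong[OF nb]) (auto simp: s1_def intro!: den_frame)
  have f1: "s1 v = s v" if "v \<notin> {31, 40}" for v unfolding s1_def using that by (intro den_frame) simp
  have d0: "s1 31 0 = int (card (differ fx (cut r) {}))" unfolding s1_def using dist0_correct[OF sts r] fxs by simp
  define s2 where "s2 = (if card (differ fx (cut r) {}) \<le> 31 then s1(19 := (s1 19)(int r := 0)) else s1)"
  have t: "t = den L (For 46 45 near_j) s2"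
  proof -
    have "t = den L (For 46 45 near_j) (den L (IfGt (K 32) (X 31) (Asg 19 (X 45) (K 0))) s1)"
      using sr r by (simp add: t_def net_r_def s1_def)
    moreover have "den L (IfGt (K 32) (X 31) (Asg 19 (X 45) (K 0))) s1 = s2"
      using d0 f1[of 45] r by (auto simp: s2_def)
    ultimately show ?thesis by simp
  qed
  \<comment> \<open>Either \<open>r\<close> is still active and far from all active cuts scanned so
    far, or it is gone and the links already count it as settled.\<close>
  define M where "M = (\<lambda>j (u :: store). nb fx kap p u \<and> act u \<subseteq> act s \<and> u 45 0 = int r \<and>
     ((r \<in> act u \<and> linked B0 (2 * int lgn) q r fx (act u) (bof u) \<and> 31 < card (differ fx (cut r) {}) \<and>
         (\<forall>j'\<in>act u. j' < j \<longrightarrow> 31 < card (differ fx (cut r) (cut j')))) \<or>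
      (r \<notin> act u \<and> linked B0 (2 * int lgn) q (Suc r) fx (act u) (bof u))))"
  have "M r t"
    unfolding t
  proof (rule For_rule)
    show "s2 45 0 = int r" using f1[of 45] r by (simp add: s2_def)
    show "M 0 s2"
    proof (cases "card (differ fx (cut r) {}) \<le> 31")
      case near: True
      have a: "act s2 = act s - {r}" "bof s2 = bof s"
        using act_remove[of s1 r] of_cong(2)[of s1 s] f1[of 19] of_cong(3)[of s2 s] f1[of 20] near by (auto simp: s2_def)
      have d: "linked B0 (2 * int lgn) q (Suc r) fx (act s - {r}) (bof s)" "rg c0 h fx (act s - {r}) (bof s) kap (mix p)"
        by (rule drop_empty(1)[OF lk q adm kap _ True near]; use fx in blast) (rule drop_empty(2)[OF lk q adm kap _ True near rg]; use fx in blast)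
      have "stat s2" "s2 16 0 = h" "s2 69 0 = c0" "s2 21 0 = kap" "fxof s2 = fx" "\<forall>i<k. s2 19 (int i) \<in> {0, 1}"
        using nb1 near by (auto simp: nb_def s2_def fxof_def stat_def)
      moreover have "\<forall>i<k. bof s2 i \<le> int (card V)" using nb a by (simp add: nb_def)
      ultimately have "nb fx kap p s2" using d(2) a by (simp add: nb_def)
      then show ?thesis using d(1) a r f1[of 45] unfolding M_def by (auto simp: s2_def)
    next
      case False
      then have s2: "s2 = s1" by (simp add: s2_def)
      have "act s1 = act s" "bof s1 = bof s" using f1 by (auto intro!: of_cong)
      then show ?thesis using nb1 True lk False r f1[of 45] unfolding M_def s2 by simp
    qed
    show "M j (u(46 := x))" if "M j u" for j u x
    proof -
      have "act (u(46 := x)) = act u" "bof (u(46 := x)) = bof u" by (auto intro!: of_cong)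
      moreover have "nb fx kap p u \<Longrightarrow> nb fx kap p (u(46 := x))" by (erule nb_cong[of fx kap p u "u(46 := x)"]) auto
      ultimately show ?thesis using that by (simp add: M_def)
    qed
  next
    fix j u assume j: "j < r" and M: "M j u" and uj: "u 46 0 = int j"
    have nbu: "nb fx kap p u" and u45: "u 45 0 = int r" and sub: "act u \<subseteq> act s" using M by (auto simp: M_def)
    have stu: "stat u" and fxu: "fxof u = fx" using nbu by (auto simp: nb_def)
    have jk: "j < k" using j r by simp
    show "M (Suc j) (den L near_j u)"
    proof (cases "r \<in> act u \<and> j \<in> act u")
      case False
      then have "u 19 (int r) = 0 \<or> u 19 (int j) = 0" using nbu r jk by (auto simp: nb_def act_def)
      then have "den L near_j u = u" using u45 uj by (auto simp: near_j_def)
      then show ?thesis using M False unfolding M_def by (auto simp: less_Suc_eq)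
    next
      case both: True
      then have lku: "linked B0 (2 * int lgn) q r fx (act u) (bof u)" and d0': "31 < card (differ fx (cut r) {})"
        and fj: "\<forall>j'\<in>act u. j' < j \<longrightarrow> 31 < card (differ fx (cut r) (cut j'))" using M by (auto simp: M_def)
      define u1 where "u1 = den L dist1 u"
      have fu1: "u1 v = u v" if "v \<notin> {31, 32, 40}" for v unfolding u1_def using that by (intro den_frame) simp
      have nbu1: "nb fx kap p u1" by (rule nb_cong[OF nbu]) (use fu1 in auto)
      have ab1: "act u1 = act u" "bof u1 = bof u" using fu1 by (auto intro!: of_cong)
      have dd: "u1 31 0 = int (card (differ fx (cut r) (cut j)))"
        "u1 32 0 = int (card (chosen fx (cut j))) - int (card (chosen fx (cut r)))"
        using dist1_correct[OF stu u45 r(2) uj jk] fxu unfolding u1_def by auto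
      have red: "den L near_j u = den L (IfGt (K 32) (X 31) replace) u1"
        using both u45 uj by (simp add: near_j_def u1_def act_def)
      show ?thesis
      proof (cases "card (differ fx (cut r) (cut j)) \<le> 31")
        case False
        then have "den L near_j u = u1" using dd(1) unfolding red by simp
        moreover have "\<forall>j'\<in>act u. j' < Suc j \<longrightarrow> 31 < card (differ fx (cut r) (cut j'))" using fj False by (auto simp: less_Suc_eq)
        ultimately show ?thesis using nbu1 ab1 both lku d0' sub u45 fu1[of 45] unfolding M_def by simp
      next
        case near: True
        define B' where "B' = (bof u)(j := min (bof u j) (bof u r + int (card (chosen fx (cut j))) - int (card (chosen fx (cut r))) + 31))"
        define u2 where "u2 = den L near_j u"
        have u2: "u2 = den L replace u1" using dd(1) near unfolding u2_def red by simp
        have jr: "j \<noteq> r" using j by simp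
        have a19: "u2 19 = (u 19)(int r := 0)" using u45 fu1[of 45] fu1[of 19] by (simp add: u2 replace_def)
        have a20: "u2 20 = (if u 20 (int j) > bof u r + int (card (chosen fx (cut j))) - int (card (chosen fx (cut r))) + 31
            then (u 20)(int j := bof u r + int (card (chosen fx (cut j))) - int (card (chosen fx (cut r))) + 31) else u 20)"
        proof -
          have "u2 20 = (if u 20 (int j) > bof u r + u1 32 0 + 31 then (u 20)(int j := bof u r + u1 32 0 + 31) else u 20)"
            using u45 uj fu1[of 45] fu1[of 46] fu1[of 20] by (simp add: u2 replace_def bof_def)
          moreover have "bof u r + u1 32 0 + 31 = bof u r + int (card (chosen fx (cut j))) - int (card (chosen fx (cut r))) + 31"
            using dd(2) by simp
          ultimately show ?thesis by metis
        qed
        have fu2: "u2 v = u v" if "v \<notin> {19, 20, 31, 32, 33, 40}" for v unfolding u2_def using that by (intro den_frame) simp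
        have act2: "act u2 = act u - {r}" using a19 by (auto simp: act_def)
        have bof2: "bof u2 = B'" using a20 by (auto simp: fun_eq_iff B'_def bof_def min_def)
        have rgu: "rg c0 h fx (act u) (bof u) kap (mix p)" using nbu by (simp add: nb_def)
        have jj: "j \<in> act u" and rr: "r \<in> act u" using both by auto
        have d: "linked B0 (2 * int lgn) q (Suc r) fx (act u - {r}) B'" "rg c0 h fx (act u - {r}) B' kap (mix p)"
          by (rule drop_near(1)[OF lku _ rr jj j near B'_def]; use fx in blast) (rule drop_near(2)[OF lku _ rr jj j near B'_def rgu]; use fx in blast)
        have "stat u2" by (rule stat_cong[OF stu]) (use fu2 in auto)
        moreover have "fxof u2 = fx" using fxu fu2[of 18] of_cong(1)[of u2 u] by simp
        moreover have "\<forall>i<k. u2 19 (int i) \<in> {0, 1} \<and> bof u2 i \<le> int (card V)"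
          using nbu unfolding a19 bof2 B'_def by (auto simp: nb_def min_def)
        ultimately have "nb fx kap p u2" using d(2) nbu fu2[of 16] fu2[of 69] fu2[of 21] act2 bof2 by (simp add: nb_def)
        then show ?thesis using d(1) sub u45 fu2[of 45] unfolding M_def u2_def[symmetric] act2 bof2 by auto
      qed
    qed
  qed (use bounds r in auto)
  then have nbt: "nb fx kap p t" and sub: "act t \<subseteq> act s" and
    alt: "(r \<in> act t \<and> linked B0 (2 * int lgn) q r fx (act t) (bof t) \<and> 31 < card (differ fx (cut r) {}) \<and>
         (\<forall>j'\<in>act t. j' < r \<longrightarrow> 31 < card (differ fx (cut r) (cut j')))) \<or>
      (r \<notin> act t \<and> linked B0 (2 * int lgn) q (Suc r) fx (act t) (bof t))" unfolding M_def by blast+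
  have "linked B0 (2 * int lgn) q (Suc r) fx (act t) (bof t)"
    using alt linked_mono[of B0 "2 * int lgn" q r fx "act t" "bof t" "Suc r" fx] by auto
  moreover have "far_below fx (Suc r) (act t)"
    using alt far sub unfolding far_below_def by (metis less_Suc_eq subsetD)
  ultimately show ?thesis using nbt sub by blast
qed

lemma net_correct:
  assumes co: "core q s" and q: "act s \<noteq> {} \<Longrightarrow> q \<le> 2 * lgn"
  defines "t \<equiv> den L net s"
  shows "core (Suc q) t" "unf t = unf s" "act t \<subseteq> act s" "8 * card (act t) \<le> card (unf s)"
proof -
  define fx where "fx = fxof s"
  define kap where "kap = s 21 0"
  have st: "stat s" and fx: "\<And>e. e < m \<Longrightarrow> fx e \<in> {0, 1, 2}" and k1: "1 \<le> kap" "kap + int (card (unf s)) \<le> int m + 1"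
    and lk: "linked B0 (2 * int lgn) (int q) 0 fx (act s) (bof s)"
    using co by (auto simp: core_def fx_def kap_def)
  have kapL: "kap \<le> int L" using k1 L(3) by linarith
  obtain p where p: "distr p" and nb: "nb fx kap p s" using co unfolding core_def nb_def fx_def kap_def by blast
  define I where "I = (\<lambda>r (u :: store). nb fx kap p u \<and> act u \<subseteq> act s \<and> linked B0 (2 * int lgn) (int q) r fx (act u) (bof u) \<and> far_below fx r (act u))"
  have "I k t"
    unfolding t_def net_def
  proof (rule For_rule)
    show "I 0 s" using nb lk by (simp add: I_def far_below_def)
    show "I j (u(45 := x))" if "I j u" for j u x
    proof -
      have "act (u(45 := x)) = act u" "bof (u(45 := x)) = bof u" by (auto intro!: of_cong)
      moreover have "nb fx kap p u \<Longrightarrow> nb fx kap p (u(45 := x))" by (erule nb_cong[of fx kap p u "u(45 := x)"]) auto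
      ultimately show ?thesis using that by (simp add: I_def)
    qed
  next
    fix r u assume r: "r < k" and I: "I r u" and u45: "u 45 0 = int r"
    have Iu: "nb fx kap p u" "act u \<subseteq> act s" "linked B0 (2 * int lgn) (int q) r fx (act u) (bof u)" "far_below fx r (act u)"
      using I by (auto simp: I_def)
    show "I (Suc r) (den L net_r u)"
    proof (cases "r \<in> act u")
      case True
      then have "act s \<noteq> {}" using Iu(2) by blast
      then have "q \<le> 2 * lgn" by (rule q)
      then have "int q \<le> 2 * int lgn" by simp
      have "nb fx kap p (den L net_r u) \<and> act (den L net_r u) \<subseteq> act u \<and>
          linked B0 (2 * int lgn) (int q) (Suc r) fx (act (den L net_r u)) (bof (den L net_r u)) \<and> far_below fx (Suc r) (act (den L net_r u))"
        by (rule net_r_correct[OF Iu(1) kapL _ u45 r Iu(3) \<open>int q \<le> 2 * int lgn\<close> Iu(4)]; use fx in blast)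
      then show ?thesis using Iu(2) unfolding I_def by blast
    next
      case False
      then have "u 19 (int r) = 0" using Iu(1) r by (auto simp: nb_def act_def)
      then have "den L net_r u = u" using u45 by (simp add: net_r_def)
      moreover have "linked B0 (2 * int lgn) (int q) (Suc r) fx (act u) (bof u)" by (rule linked_mono[OF Iu(3)]) auto
      moreover have "far_below fx (Suc r) (act u)" using Iu(4) False unfolding far_below_def by (metis less_Suc_eq)
      ultimately show ?thesis using Iu by (simp add: I_def)
    qed
  qed (use stat_vals(4)[OF st] bounds in auto)
  then have I: "nb fx kap p t" "act t \<subseteq> act s" "linked B0 (2 * int lgn) (int q) k fx (act t) (bof t)" "far_below fx k (act t)"
    by (auto simp: I_def)
  have actk: "act t \<subseteq> {..<k}" by (auto simp: act_def)
  have fxt: "fxof t = fx" using I(1) by (simp add: nb_def)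
  show unf: "unf t = unf s" using fxt by (simp add: unf_def fx_def)
  \<comment> \<open>All active indices lie below \<open>k\<close>, so the indicator is 1 throughout
    and amounts to one full round.\<close>
  have "linked B0 (2 * int lgn) (int (Suc q)) 0 fx (act t) (bof t)"
    using I(3) actk unfolding linked_def by (simp add: subset_iff) (smt (verit))
  then show "core (Suc q) t" using I(1) p fx k1 unf unfolding core_def nb_def by (auto simp: fxt)
  show "act t \<subseteq> act s" by fact
  have "8 * card (act t) \<le> card {e. e < m \<and> fx e = 0}"
    by (rule net_small[OF actk]) (use I(4) actk in \<open>auto simp: far_below_def\<close>)
  then show "8 * card (act t) \<le> card (unf s)" by (simp add: unf_def fx_def)
qed

text \<open>At the start the number of constraints is not bounded in terms of the graph, hence the
  exception for \<open>q = 0\<close>; after the first sweep it is at most m/8 and thus at most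
  n^2/8.\<close>

definition stage :: "nat \<Rightarrow> store \<Rightarrow> bool" where
  "stage q t \<longleftrightarrow> core q t \<and> (act t \<noteq> {} \<longrightarrow> q = 0 \<or> 2 ^ q * card (act t) \<le> (card V)\<^sup>2)"

text \<open>With a constraint left, 2^q <= n^2; so the number of sweeps is at most
  \<open>2 * lgn\<close>, which is the \<open>Q\<close> of \<open>linked\<close>.\<close>

lemma stage_q: "stage q s \<Longrightarrow> act s \<noteq> {} \<Longrightarrow> q \<le> 2 * lgn"
proof (cases "q = 0")
  case False
  assume s: "stage q s" "act s \<noteq> {}"
  have "finite (act s)" by (simp add: act_def)
  then have "1 \<le> card (act s)" using s(2) by (simp add: Suc_leI card_gt_0_iff)
  then have "2 ^ q * 1 \<le> 2 ^ q * card (act s)" by (rule mult_le_mono2)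
  also have "\<dots> \<le> (card V)\<^sup>2" using s False by (simp add: stage_def)
  also have "\<dots> \<le> (2 ^ lgn)\<^sup>2" using pow_lgn by (intro power_mono) auto
  also have "\<dots> = 2 ^ (2 * lgn)" by (simp add: power_mult[symmetric] mult.commute)
  finally have "(2::nat) ^ q \<le> 2 ^ (2 * lgn)" by simp
  then show ?thesis by (rule power_le_imp_le_exp[rotated]) simp
qed simp

text \<open>Unfixed edges plus active constraints decrease in every round while a constraint is
  active. If the pass is stuck with \<open>a >= 1\<close> active constraints and \<open>u\<close>
  unfixed edges, the sweep keeps a' of them with 8 a' <= u <= 2 (a + 1) <= 4 a.\<close>

lemma round_correct:
  assumes sg: "stage q s" and sz: "act s = {} \<or> card (unf s) + card (act s) + j \<le> m + k"
  defines "t \<equiv> den L round s"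
  shows "\<exists>q'. stage q' t \<and> (act t = {} \<or> card (unf t) + card (act t) + Suc j \<le> m + k)"
proof -
  define s1 where "s1 = s(22 := (s 22)(0 := 0))"
  define s2 where "s2 = den L pass s1"
  have eq1: "fxof s1 = fxof s" "act s1 = act s" "bof s1 = bof s" "unf s1 = unf s" "s1 21 = s 21" unfolding s1_def
    by (auto simp: unf_def intro!: of_cong) (auto simp: fxof_def)
  have co0: "core q s" using sg by (simp add: stage_def)
  have co1: "core q s1" by (rule core_cong[OF co0]) (auto simp: s1_def)
  have f0: "s1 22 0 = 0" by (simp add: s1_def)
  have P: "core q s2 \<and> act s2 = act s \<and> bof s2 = bof s \<and>
    ((fxof s2 = fxof s \<and> s2 21 0 = s 21 0 \<and> s2 22 0 = 0 \<and>
       (\<forall>e<m. fxof s e = 0 \<longrightarrow> (\<forall>x. \<not> rg c0 h ((fxof s)(e := 1)) (act s) (bof s) (s 21 0) x \<and> \<not> rg c0 h ((fxof s)(e := 2)) (act s) (bof s) (s 21 0) x))) \<or>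
     (s2 22 0 = 1 \<and> unf s2 \<subset> unf s))"
    by (rule pass_correct[OF co1 f0, folded s2_def, unfolded eq1])
  have fu: "finite (unf u)" for u by (simp add: unf_def)
  have t: "t = (if s2 22 0 = 0 then den L net s2 else s2)"
    by (simp add: t_def round_def s1_def s2_def)
  show ?thesis
  proof (cases "s2 22 0 = 0")
    case False
    then have "unf s2 \<subset> unf s" using P by auto
    then have "card (unf s2) < card (unf s)" using fu by (intro psubset_card_mono)
    then have "act t = {} \<or> card (unf t) + card (act t) + Suc j \<le> m + k" using sz P False unfolding t by auto
    moreover have "stage q t" using sg P False unfolding t stage_def by simp
    ultimately show ?thesis by blast
  next
    case True
    then have no: "fxof s2 = fxof s" "s2 21 0 = s 21 0"
      "\<forall>e<m. fxof s e = 0 \<longrightarrow> (\<forall>x. \<not> rg c0 h ((fxof s)(e := 1)) (act s) (bof s) (s 21 0) x \<and> \<not> rg c0 h ((fxof s)(e := 2)) (act s) (bof s) (s 21 0) x)"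
      using P by auto
    have tn: "t = den L net s2" using True unfolding t by simp
    have co2: "core q s2" and ab: "act s2 = act s" "bof s2 = bof s" using P by auto
    have q2: "act s2 \<noteq> {} \<Longrightarrow> q \<le> 2 * lgn" using stage_q[OF sg] ab by simp
    note N = net_correct[OF co2 q2, folded tn]
    show ?thesis
    proof (cases "act s = {}")
      case True
      then have "act t = {}" using N(3) ab by auto
      then show ?thesis using N(1) by (auto simp: stage_def)
    next
      case ne: False
      have fa: "finite (act s)" by (simp add: act_def)
      have a1: "1 \<le> card (act s)" using ne fa by (simp add: Suc_leI card_gt_0_iff)
      have un: "unf s2 = unf s" using no by (simp add: unf_def)
      obtain p where p: "distr p" "rg c0 h (fxof s) (act s) (bof s) (s 21 0) (mix p)"
        using sg unfolding stage_def core_def by blast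
      have "card {e. e < m \<and> fxof s e = 0} \<le> 2 * (card (act s) + 1)"
      proof (rule few_unfixed[OF p])
        show "act s \<subseteq> {..<k}" by (auto simp: act_def)
        show "e < m \<Longrightarrow> fxof s e \<in> {0, 1, 2}" for e using sg by (simp add: stage_def core_def)
      qed (use no(3) in blast)
      then have few: "card (unf s) \<le> 2 * (card (act s) + 1)" by (simp add: unf_def)
      have N4: "8 * card (act t) \<le> card (unf s)" using N(4) un by simp
      have half: "2 * card (act t) \<le> card (act s)" using N4 few a1 by arith
      have "stage (Suc q) t"
        unfolding stage_def
      proof (intro conjI impI disjI2)
        show "core (Suc q) t" by (rule N(1))
        show "2 ^ Suc q * card (act t) \<le> (card V)\<^sup>2"
        proof (cases "q = 0")
          case True
          have "card (unf s) \<le> card {..<m}" by (intro card_mono) (auto simp: unf_def)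
          then have "8 * card (act t) \<le> (card V)\<^sup>2" using N4 simple by simp
          then show ?thesis using True by simp
        next
          case False
          have "2 ^ Suc q * card (act t) = 2 ^ q * (2 * card (act t))" by simp
          also have "\<dots> \<le> 2 ^ q * card (act s)" using half by (rule mult_le_mono2)
          also have "\<dots> \<le> (card V)\<^sup>2" using sg ne False by (simp add: stage_def)
          finally show ?thesis .
        qed
      qed
      moreover have "card (unf t) + card (act t) + Suc j \<le> m + k" using sz ne half a1 N(2) un by simp
      ultimately show ?thesis by blast
    qed
  qed
qed

text \<open>The measure starts at no more than \<open>m + k <= L\<close>, so \<open>L\<close> rounds
  exhaust it.\<close>

lemma rounds_correct:
  assumes co: "core 0 s"
  defines "t \<equiv> den L (Loop round) s"
  shows "\<exists>q. core q t \<and> act t = {}"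
proof -
  define J where "J = (\<lambda>j (u :: store). \<exists>q. stage q u \<and> (act u = {} \<or> card (unf u) + card (act u) + j \<le> m + k))"
  have c: "card (unf s) \<le> card {..<m}" "card (act s) \<le> card {..<k}"
    by (rule card_mono; auto simp: unf_def act_def)+
  have "J L t"
    unfolding t_def
  proof (rule Loop_rule)
    have "stage 0 s" using co by (simp add: stage_def)
    then show "J 0 s" unfolding J_def using c by (intro exI[of _ 0]) auto
    fix j u assume "J j u"
    then obtain q where q: "stage q u" "act u = {} \<or> card (unf u) + card (act u) + j \<le> m + k" unfolding J_def by blast
    show "J (Suc j) (den L round u)" unfolding J_def by (rule round_correct[OF q])
  qed
  then obtain q where q: "stage q t" "act t = {} \<or> card (unf t) + card (act t) + L \<le> m + k" unfolding J_def by blast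
  have "finite (act t)" by (simp add: act_def)
  moreover have "card (act t) = 0" if "act t \<noteq> {}" using q(2) Lmk that by linarith
  ultimately have "act t = {}" by auto
  then show ?thesis using q(1) by (auto simp: stage_def)
qed

text \<open>With no active constraint, \<open>linked\<close> is left with its second alternative for
  every tree that obeys \<open>fx\<close>. The multipliers are reset, so the last tree is the
  cheapest obeying one and costs at most as much as the point of the region.\<close>

lemma finish_correct:
  assumes co: "core q s" and A: "act s = {}"
  defines "T \<equiv> flags 28 (den L finish s)"
  shows "\<And>i. i < k \<Longrightarrow> exc B0 i T \<le> 124 * int lgn + 32" "\<exists>kap. 1 \<le> kap \<and> kap \<le> int L \<and> cst (chi T) \<le> zb c0 h kap"
proof -
  define s1 where "s1 = den L (For 41 8 (Asg 66 (X 41) (K 0))) s"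
  define s2 where "s2 = den L mkW s1"
  have st: "stat s" using co by (simp add: core_def)
  have st1: "stat s1" unfolding s1_def by (rule stat_den[OF st]) simp
  have st2: "stat s2" unfolding s2_def by (rule stat_den[OF st1]) simp
  have T: "T = flags 28 (den L kruskal s2)" by (simp add: T_def finish_def s1_def s2_def)
  have l0: "\<forall>i<k. s1 66 (int i) = 0" unfolding s1_def by (rule For_fill) (use stat_vals(4)[OF st] bounds in auto)
  have f1: "s1 18 = s 18" unfolding s1_def by (intro den_frame) simp
  define w where "w = (\<lambda>e. C e * (4 * int L ^ 7))"
  have w0: "w0 (s1 16 0) (\<lambda>i. s1 66 (int i)) e = w e" for e
  proof -
    have "(\<Sum>i<k. if e \<in> cut i then s1 66 (int i) else 0) = 0" by (rule sum.neutral) (use l0 in auto)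
    then show ?thesis unfolding w0_def w_def by simp
  qed
  define bg where "bg = (\<Sum>e<m. w e) + 1"
  have W: "s2 128 (int e) = w e - (if fxof s e = 1 then bg else 0) + (if fxof s e = 2 then bg else 0)" if "e < m" for e
    using mkW_correct[OF st1] that f1 unfolding s2_def w0 bg_def fxof_def by simp
  note kr = kruskal_correct[OF st2, folded T]
  obtain p where p: "distr p" "rg c0 h (fxof s) (act s) (bof s) (s 21 0) (mix p)" using co unfolding core_def by blast
  have px: "pst (mix p)" "obeys (fxof s) (mix p)" "cst (mix p) \<le> zb c0 h (s 21 0)" using p(2) by (auto simp: rg_def adm_def)
  have wn: "0 \<le> w e" if "e < m" for e using C_nonneg[OF that] by (simp add: w_def)
  have pen: "obeys (fxof s) (chi T)" "(\<Sum>e<m. real_of_int (w e) * chi T e) \<le> (\<Sum>e<m. real_of_int (w e) * mix p e)"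
    using penalised_tree[of T "\<lambda>e. s2 128 (int e)" w "fxof s" bg "mix p"] kr(1,3) W wn px(1,2) by (auto simp: bg_def)
  have "(\<Sum>e<m. real_of_int (w e) * y e) = 4 * real L ^ 7 * cst y" for y
    unfolding cst_def sum_distrib_left by (intro sum.cong) (auto simp: w_def)
  then have "4 * real L ^ 7 * cst (chi T) \<le> 4 * real L ^ 7 * cst (mix p)" using pen(2) by simp
  then have "cst (chi T) \<le> cst (mix p)" using L_pos by simp
  then have "cst (chi T) \<le> zb c0 h (s 21 0)" using px(3) by linarith
  moreover have "1 \<le> s 21 0" "s 21 0 \<le> int L" using co L(3) by (auto simp: core_def)
  ultimately show "\<exists>kap. 1 \<le> kap \<and> kap \<le> int L \<and> cst (chi T) \<le> zb c0 h kap" by blast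
  have at: "atree (fxof s) T" using kr(1) pen(1) by (simp add: atree_def)
  show "exc B0 i T \<le> 124 * int lgn + 32" if "i < k" for i
    using co A at that unfolding core_def linked_def by fastforce
qed

end

section \<open>Trying all scales\<close>

text \<open>The first run, with \<open>kap = 0\<close>, is not tested: its cost becomes the
  reference, and its mean is a point of the region for \<open>kap = 1\<close>.\<close>

definition init :: lc where
  "init = For 40 4 (Asg 18 (X 40) (K 0)) ;; For 41 8 (Asg 20 (X 41) (At 13 (X 41))) ;;
     For 41 8 (Asg 19 (X 41) (K 1)) ;; setx 21 (K 0) ;; drift ;; costY 69 ;; setx 21 (K 1)"

definition runh :: lc where
  "runh = init ;; Loop round ;; finish"

definition check :: lc where
  "check = setx 23 (K 1) ;; For 41 8 (cntT (X 41) ;;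
     IfGt (X 31) (Plus (At 13 (X 41)) (Plus (Times (X 14) (K 124)) (K 32))) (setx 23 (K 0)))"

definition costT :: lc where
  "costT = setx 68 (K 0) ;; For 40 4 (If1 (At 28 (X 40)) (setx 68 (Plus (X 68) (At 65 (X 40)))))"

definition copyT :: lc where
  "copyT = setx 17 (K 1) ;; setx 70 (X 68) ;; For 40 4 (Asg 29 (X 40) (At 28 (X 40)))"

definition keep :: lc where
  "keep = If1 (X 23) (Cond (X 17) (IfGt (X 70) (X 68) copyT) copyT)"

text \<open>The right scale depends on the LP value, which the program never learns. Among the trees
  of all \<open>L^2\<close> scales it keeps a cheapest one whose cuts pass
  \<open>check\<close>.\<close>

definition main :: lc where
  "main = setx 16 (K 1) ;; setx 17 (K 0) ;; Rep 2 (runh ;; check ;; costT ;; keep ;; setx 16 (Plus (X 16) (X 16)))"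

lemma wr_runh [simp]:
  "wr init = {18, 19, 20, 21, 24, 25, 26, 27, 28, 30, 31, 40, 41, 43, 66, 67, 69, 128, 129}"
  "wr runh = {18, 19, 20, 21, 22, 23, 24, 25, 26, 27, 28, 30, 31, 32, 33, 40, 41, 43, 44, 45, 46, 66, 67, 68, 69, 128, 129}"
  by (auto simp: init_def runh_def)

lemma wr_keep [simp]: "wr check = {23, 31, 40, 41}" "wr costT = {40, 68}" "wr copyT = {17, 29, 40, 70}" "wr keep = {17, 29, 40, 70}"
  by (auto simp: check_def costT_def copyT_def keep_def)

lemma wr_main [simp]: "wr main = {16, 17, 18, 19, 20, 21, 22, 23, 24, 25, 26, 27, 28, 29, 30, 31, 32, 33, 40, 41, 43, 44, 45, 46, 66, 67, 68, 69, 70, 128, 129}"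
  by (auto simp: main_def)

context prog
begin

lemma costY_correct:
  assumes st: "stat s" and v: "v \<notin> {0, 4, 30, 40, 65}"
  shows "den L (costY v) s v 0 = (\<Sum>e<m. C e * yof s e)"
proof -
  let ?s = "s(v := (s v)(0 := 0))"
  let ?c = "setx v (Plus (X v) (Times (At 65 (X 40)) (At 30 (X 40))))"
  have "den L (For 40 4 ?c) ?s v 0 = (\<Sum>e<m. C e * yof s e)"
  proof (rule For_sum)
    fix j t assume a: "j < m" "t 40 0 = int j" "\<forall>u. u \<noteq> 40 \<and> u \<notin> wr ?c \<longrightarrow> t u = ?s u"
    have "t 65 = s 65" "t 30 = s 30" using a(3) v by auto
    then show "den L ?c t v 0 = t v 0 + C j * yof s j"
      using a(2) stat_vals(7)[OF st a(1)] by (simp add: yof_def)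
  qed (use v stat_vals(3)[OF st] bounds in auto)
  then show ?thesis by (simp add: costY_def)
qed

lemma init_correct:
  assumes st: "stat s" and h: "0 < s 16 0" and B0: "\<forall>i<k. B0 i \<le> int (card V)"
  defines "t \<equiv> den L init s"
  shows "stat t" "t 16 0 = s 16 0" "t 21 0 = 1" "\<And>e. e < m \<Longrightarrow> fxof t e = 0" "\<And>i. i < k \<Longrightarrow> t 19 (int i) = 1"
    "\<And>i. i < k \<Longrightarrow> bof t i = B0 i" "t 69 0 = (\<Sum>e<m. C e * yof t e)"
    "\<exists>lam. drift_inv (s 16 0) (fxof t) {..<k} (bof t) 0 (L ^ 9) lam (yof t)"
proof -
  define s1 where "s1 = den L (For 40 4 (Asg 18 (X 40) (K 0))) s"
  define s2 where "s2 = den L (For 41 8 (Asg 20 (X 41) (At 13 (X 41)))) s1"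
  define s3 where "s3 = den L (For 41 8 (Asg 19 (X 41) (K 1))) s2"
  define s4 where "s4 = s3(21 := (s3 21)(0 := 0))"
  define s5 where "s5 = den L drift s4"
  define s6 where "s6 = den L (costY 69) s5"
  have t: "t = s6(21 := (s6 21)(0 := 1))" by (simp add: t_def init_def s1_def s2_def s3_def s4_def s5_def s6_def)
  have st1: "stat s1" unfolding s1_def by (rule stat_den[OF st]) simp
  have st2: "stat s2" unfolding s2_def by (rule stat_den[OF st1]) simp
  have st3: "stat s3" unfolding s3_def by (rule stat_den[OF st2]) simp
  have st4: "stat s4" unfolding s4_def by (rule stat_cong[OF st3]) auto
  have st5: "stat s5" unfolding s5_def by (rule stat_den[OF st4]) simp
  have st6: "stat s6" unfolding s6_def by (rule stat_den[OF st5]) simp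
  have f1: "s1 v = s v" if "v \<notin> {18, 40}" for v unfolding s1_def using that by (intro den_frame) simp
  have f2: "s2 v = s1 v" if "v \<notin> {20, 41}" for v unfolding s2_def using that by (intro den_frame) simp
  have f3: "s3 v = s2 v" if "v \<notin> {19, 41}" for v unfolding s3_def using that by (intro den_frame) simp
  have f5: "s5 v = s4 v" if "v \<notin> {24, 25, 26, 27, 28, 30, 31, 40, 41, 43, 66, 67, 128, 129}" for v
    unfolding s5_def using that by (intro den_frame) simp
  have f6: "s6 v = s5 v" if "v \<notin> {40, 69}" for v unfolding s6_def using that by (intro den_frame) simp
  have fx: "\<forall>e<m. s1 18 (int e) = 0" unfolding s1_def by (rule For_fill) (use stat_vals(3)[OF st] bounds in auto)
  have b: "\<forall>i<k. s2 20 (int i) = B0 i" unfolding s2_def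
    by (rule For_fill) (use stat_vals(4,8)[OF st1] bounds in auto)
  have ac: "\<forall>i<k. s3 19 (int i) = 1" unfolding s3_def by (rule For_fill) (use stat_vals(4)[OF st2] bounds in auto)
  have e16: "s4 16 = s 16" using f1[of 16] f2[of 16] f3[of 16] by (simp add: s4_def)
  have e18: "s4 18 = s1 18" using f2[of 18] f3[of 18] by (simp add: s4_def)
  have e20: "s4 20 = s2 20" using f3[of 20] by (simp add: s4_def)
  have e19: "s4 19 = s3 19" by (simp add: s4_def)
  have a4: "act s4 = {..<k}" using ac by (auto simp: act_def e19)
  have "\<exists>lam. drift_inv (s4 16 0) (fxof s4) (act s4) (bof s4) (s4 21 0) (L ^ 9) lam (yof s5)"
    unfolding s5_def
  proof (rule drift_correct[OF st4])
    show "0 < s4 16 0" using h e16 by simp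
    show "\<forall>i<k. s4 19 (int i) \<in> {0, 1} \<and> bof s4 i \<le> int (card V)"
      using ac b B0 by (simp add: e19 e20 bof_def)
  qed (simp_all add: s4_def)
  moreover have "s4 21 0 = 0" by (simp add: s4_def)
  moreover have q: "fxof t = fxof s4" "bof t = bof s4" "yof t = yof s5" "t 19 = s4 19"
    using f5 f6 by (auto simp: t intro!: of_cong)
  ultimately show "\<exists>lam. drift_inv (s 16 0) (fxof t) {..<k} (bof t) 0 (L ^ 9) lam (yof t)" using e16 a4 by simp
  show "stat t" unfolding t by (rule stat_cong[OF st6]) auto
  show "t 16 0 = s 16 0" using f6[of 16] f5[of 16] e16 by (simp add: t)
  show "t 21 0 = 1" by (simp add: t)
  show "fxof t e = 0" if "e < m" for e using fx that q(1) e18 by (simp add: fxof_def)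
  show "t 19 (int i) = 1" if "i < k" for i using ac that q(4) e19 by simp
  show "bof t i = B0 i" if "i < k" for i using b that q(2) e20 by (simp add: bof_def)
  show "t 69 0 = (\<Sum>e<m. C e * yof t e)" using costY_correct[OF st5, of 69] q(3) by (simp add: t s6_def)
qed

text \<open>Existence of a minimum tree is read off the correctness of the greedy program, applied
  to a store whose weights are the costs.\<close>

lemma min_tree:
  assumes "stat s"
  shows "\<exists>T. tree T \<and> (\<forall>x. pst x \<longrightarrow> cst (chi T) \<le> cst x)"
proof -
  define s' where "s' = s(128 := \<lambda>e. C (nat e))"
  have "stat s'" unfolding s'_def by (rule stat_cong[OF assms]) auto
  from kruskal_correct(1,3)[OF this] obtain T where T: "tree T" "\<And>x :: nat \<Rightarrow> real. pst x \<Longrightarrow> (\<Sum>e\<in>T. real_of_int (C e)) \<le> cst x"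
    by (auto simp: s'_def cst_def)
  have "cst (chi T) = (\<Sum>e\<in>T. real_of_int (C e))" unfolding cst_def by (rule sum_tree[OF T(1)])
  then show ?thesis using T by auto
qed

end

locale goal = prog +
  fixes b :: "nat \<Rightarrow> real" and lgn :: nat
  assumes feasible: "\<exists>x. lpx b x" and B0_eq: "\<And>i. i < k \<Longrightarrow> B0 i = min (\<lceil>b i\<rceil> + 1) (int (card V))"
    and pow_lgn: "card V \<le> 2 ^ lgn" and simple: "m \<le> (card V)\<^sup>2" and Lmk: "m + k \<le> L"
    and big: "(\<Sum>e<m. C e) < 2 ^ (L\<^sup>2 - 3)"
begin

definition balanced :: "nat set \<Rightarrow> bool" where
  "balanced T \<longleftrightarrow> (\<forall>i<k. exc B0 i T \<le> 124 * int lgn + 32)"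

text \<open>Two uses of \<open>slack_point\<close>: the points made from all LP points bound the
  reference cost \<open>c0\<close> from above, and the one made from \<open>x1\<close>, within
  \<open>2 ^ j\<close> of the minimum, bounds the cut violation of the initial run.\<close>

lemma runh_correct:
  assumes ex: "stat s0"
  shows "\<exists>j<L\<^sup>2. \<forall>s. stat s \<longrightarrow> s 16 0 = 2 ^ j \<longrightarrow> balanced (flags 28 (den L runh s)) \<and>
     (\<forall>x. lpx b x \<longrightarrow> cst (chi (flags 28 (den L runh s))) \<le> cst x)"
proof -
  obtain T0 where T0: "tree T0" "\<And>x. pst x \<Longrightarrow> cst (chi T0) \<le> cst x" using min_tree[OF ex] by blast
  obtain x0 where x0: "lpx b x0" using feasible by blast
  obtain j x1 where j: "j < L\<^sup>2" and x1: "lpx b x1" "cst x1 \<le> cst (chi T0) + 2 ^ j"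
    and G: "\<And>z. (\<And>x. lpx b x \<Longrightarrow> z \<le> cst x - (cst x - cst (chi T0)) / real (card V) + 2 ^ j / (4 * real L)) \<Longrightarrow>
       z \<le> cst (chi T0) + 2 ^ j \<and> (\<forall>T x. tree T \<and> lpx b x \<and> cst (chi T) \<le> z \<longrightarrow> cst (chi T) \<le> cst x)"
    using choose_scale[OF x0 T0 big] by blast
  have "balanced (flags 28 (den L runh s)) \<and> (\<forall>x. lpx b x \<longrightarrow> cst (chi (flags 28 (den L runh s))) \<le> cst x)"
    if st: "stat s" and h: "s 16 0 = 2 ^ j" for s
  proof -
    define t where "t = den L init s"
    define c0 where "c0 = t 69 0"
    define hh :: int where "hh = 2 ^ j"
    have hh: "s 16 0 = hh" "0 < s 16 0" "0 < hh" "real_of_int hh = 2 ^ j" using h by (auto simp: hh_def)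
    have B0V: "\<forall>i<k. B0 i \<le> int (card V)" using B0_eq by simp
    note I = init_correct[OF st hh(2) B0V, folded t_def]
    obtain lam where lam: "drift_inv hh (fxof t) {..<k} (bof t) 0 (L ^ 9) lam (yof t)" using I(8) hh(1) by auto
    define y where "y = (\<lambda>x e. (1 - 1 / real (card V)) * x e + 1 / real (card V) * (chi T0 e :: real))"
    have y: "adm (fxof t) {..<k} (bof t) 0 (y x)" "cst (y x) = cst x - (cst x - cst (chi T0)) / real (card V)" if "lpx b x" for x
    proof -
      have "adm (fxof t) {..<k} B0 0 (y x)" unfolding y_def by (rule slack_point(1)[OF that T0(1)]) (use B0_eq I(4) in auto)
      then show "adm (fxof t) {..<k} (bof t) 0 (y x)" unfolding adm_def using I(6) by simp
      show "cst (y x) = cst x - (cst x - cst (chi T0)) / real (card V)"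
        unfolding y_def by (rule slack_point(2)[OF that T0(1), of B0 "fxof t"]) (use B0_eq I(4) in auto)
    qed
    have c0: "cst (\<lambda>e. real_of_int (yof t e)) = real_of_int c0" unfolding c0_def I(7) cst_def by simp
    have zb_y: "zb c0 hh kap \<le> cst x - (cst x - cst (chi T0)) / real (card V) + 2 ^ j / (4 * real L)"
      if x: "lpx b x" and kap: "1 \<le> kap" "kap \<le> int L" for x kap
    proof -
      have "8 * real L ^ 7 * real_of_int c0 \<le> real L ^ 9 * (8 * real L ^ 7 * cst (y x) + real_of_int hh * real L ^ 5)"
        using drift_cost[OF lam y(1)[OF x] hh(3)] unfolding c0 by simp
      from zb_le[OF this hh(3) kap] show ?thesis using y(2)[OF x] hh(4) by simp
    qed
    have G': "zb c0 hh kap \<le> cst (chi T0) + 2 ^ j \<and> (\<forall>T x. tree T \<and> lpx b x \<and> cst (chi T) \<le> zb c0 hh kap \<longrightarrow> cst (chi T) \<le> cst x)"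
      if "1 \<le> kap" "kap \<le> int L" for kap
      by (rule G) (use zb_y that in blast)
    interpret search V m src tgt C S k L vs B0 lgn "cst (chi T0)" hh c0
    proof
      show "cst (chi T0) \<le> cst (chi T)" if "tree T" for T by (rule T0(2)[OF tree_pst[OF that]])
      show "zb c0 hh kap \<le> cst (chi T0) + real_of_int hh" if "1 \<le> kap" "kap \<le> int L" for kap
        using G'[OF that] hh(4) by simp
    qed (use pow_lgn simple Lmk hh(3) in auto)
    have act: "act t = {..<k}" using I(5) by (auto simp: act_def)
    \<comment> \<open>The cost of this mean equals \<open>zb c0 hh 1\<close> by the choice of
      \<open>c0\<close>; only the cuts need an argument.\<close>
    have "\<exists>p. distr p \<and> rg c0 hh (fxof t) (act t) (bof t) (t 21 0) (mix p)"
    proof -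
      have nr: "cst (y x1) \<le> cst (chi T0) + real_of_int hh"
      proof -
        have "0 \<le> (cst x1 - cst (chi T0)) / real (card V)" using T0(2) x1(1) by (simp add: lpx_def)
        then show ?thesis using y(2)[OF x1(1)] x1(2) hh(4) by simp
      qed
      have Tm: "cst (chi T0) \<le> cst (chi T)" if "tree T" for T by (rule T0(2)[OF tree_pst[OF that]])
      have "\<exists>p. distr p \<and> adm (fxof t) {..<k} (bof t) (0 + 1) (mix p) \<and> real L ^ 9 * cst (mix p) = real_of_int (\<Sum>e<m. C e * yof t e)"
      proof (rule test_feasible[OF lam])
        show "\<forall>e<m. (fxof t e = 1 \<longrightarrow> yof t e = int L ^ 9) \<and> (fxof t e = 2 \<longrightarrow> yof t e = 0)" using I(4) by simp
        show "\<forall>i\<in>{..<k}. int L * sum (yof t) (cut i) \<le> int L ^ 9 * (int L * bof t i + 0 + 1)"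
          using drift_tests(2)[OF lam y(1)[OF x1(1)] hh(3) _ Tm nr] by auto
      qed
      then obtain p where p: "distr p" "adm (fxof t) {..<k} (bof t) 1 (mix p)" "real L ^ 9 * cst (mix p) = real_of_int c0"
        using I(7) by (auto simp: c0_def)
      have "4 * real L ^ 7 * (real L ^ 9 * cst (mix p)) = 4 * real L ^ 7 * (real L ^ 9 * zb c0 hh 1)"
        unfolding zb_mult using p(3) by simp
      then have "cst (mix p) = zb c0 hh 1" using L_pos by simp
      then show ?thesis using p(1,2) I(3) act by (auto simp: rg_def)
    qed
    moreover have "card (unf t) \<le> m"
    proof -
      have "card (unf t) \<le> card {..<m}" by (rule card_mono) (auto simp: unf_def)
      then show ?thesis by simp
    qed
    moreover have "linked B0 (2 * int lgn) (int 0) 0 (fxof t) (act t) (bof t)"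
      unfolding linked_def
    proof (intro allI impI disjI1)
      fix i assume i: "i < k"
      then show "\<exists>ja\<in>act t. \<forall>T. atree (fxof t) T \<longrightarrow> exc B0 i T \<le> exc (bof t) ja T + 62 * (int 0 + of_bool (ja < 0))"
        by (intro bexI[of _ i]) (auto simp: act exc_def I(6))
    qed
    ultimately have co: "core 0 t" unfolding core_def
      using I(1,2,3,4,5,6) hh(1) B0V by (auto simp: c0_def)
    define u where "u = den L (Loop round) t"
    obtain q where q: "core q u" "act u = {}" using rounds_correct[OF co] unfolding u_def by blast
    define T where "T = flags 28 (den L finish u)"
    have fin: "den L runh s = den L finish u" by (simp add: runh_def t_def u_def)
    have stu: "stat u" using q(1) by (simp add: core_def)
    have tr: "tree T" unfolding T_def by (rule finish_tree(1)[OF stu])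
    obtain kap where kap: "1 \<le> kap" "kap \<le> int L" "cst (chi T) \<le> zb c0 hh kap"
      using finish_correct(2)[OF q] unfolding T_def by blast
    have "balanced T" unfolding balanced_def T_def using finish_correct(1)[OF q] by blast
    moreover have "cst (chi T) \<le> cst x" if "lpx b x" for x using G'[OF kap(1,2)] tr that kap(3) by blast
    ultimately show ?thesis unfolding fin T_def by blast
  qed
  then show ?thesis using j by blast
qed

lemma check_correct:
  assumes st: "stat s" and g: "s 14 0 = int lgn" and fl: "\<And>e. e < m \<Longrightarrow> s 28 (int e) = of_bool (e \<in> flags 28 s)"
  shows "den L check s 23 0 = of_bool (balanced (flags 28 s))"
proof -
  let ?s = "s(23 := (s 23)(0 := 1))"
  let ?c = "cntT (X 41) ;; IfGt (X 31) (Plus (At 13 (X 41)) (Plus (Times (X 14) (K 124)) (K 32))) (setx 23 (K 0))"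
  have "den L (For 41 8 ?c) ?s 23 0 = of_bool (True \<and> (\<forall>i<k. exc B0 i (flags 28 s) \<le> 124 * int lgn + 32))"
  proof (rule For_check)
    fix i t assume a: "i < k" "t 41 0 = int i" "\<forall>u. u \<noteq> 41 \<and> u \<notin> wr ?c \<longrightarrow> t u = ?s u"
    have f: "t 28 = s 28" "t 13 = s 13" "t 14 = s 14" using a(3) by auto
    have stt: "stat t" using st by (rule stat_cong) (use a(3) in auto)
    have flt: "flags 28 t = flags 28 s" using f by (simp add: flags_def)
    define u where "u = den L (cntT (X 41)) t"
    have fu: "u v = t v" if "v \<notin> {31, 40}" for v unfolding u_def using that by (intro den_frame) simp
    have "u 31 0 = int (card (flags 28 t \<inter> cut i))"
      unfolding u_def by (rule cntT_correct[OF stt a(1)]) (use a(2) f flt fl in auto)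
    then have "den L ?c t = (if exc B0 i (flags 28 s) \<le> 124 * int lgn + 32 then u else u(23 := (u 23)(0 := 0)))"
      using fu[of 13] fu[of 14] fu[of 41] f g a(2) stat_vals(8)[OF st a(1)] flt by (auto simp: u_def[symmetric] exc_def)
    then show "den L ?c t 23 0 = (if exc B0 i (flags 28 s) \<le> 124 * int lgn + 32 then t 23 0 else 0)"
      using fu[of 23] by simp
  qed (use stat_vals(4)[OF st] bounds in auto)
  then show ?thesis by (simp add: check_def balanced_def)
qed

lemma costT_correct:
  assumes st: "stat s" and fl: "\<And>e. e < m \<Longrightarrow> s 28 (int e) = of_bool (e \<in> flags 28 s)"
  shows "real_of_int (den L costT s 68 0) = cst (chi (flags 28 s))"
proof -
  let ?s = "s(68 := (s 68)(0 := 0))"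
  let ?c = "If1 (At 28 (X 40)) (setx 68 (Plus (X 68) (At 65 (X 40))))"
  have "den L (For 40 4 ?c) ?s 68 0 = (\<Sum>e<m. C e * of_bool (e \<in> flags 28 s))"
  proof (rule For_sum)
    fix j t assume a: "j < m" "t 40 0 = int j" "\<forall>u. u \<noteq> 40 \<and> u \<notin> wr ?c \<longrightarrow> t u = ?s u"
    have "t 65 = s 65" "t 28 = s 28" using a(3) by auto
    then show "den L ?c t 68 0 = t 68 0 + C j * of_bool (j \<in> flags 28 s)"
      using a(2) stat_vals(7)[OF st a(1)] fl[OF a(1)] by simp
  qed (use stat_vals(3)[OF st] bounds in auto)
  then show ?thesis by (simp add: costT_def cst_def)
qed

definition stored :: "store \<Rightarrow> bool" where
  "stored u \<longleftrightarrow> u 17 0 = 1 \<and> tree (flags 29 u) \<and> balanced (flags 29 u) \<and>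
     (\<forall>e<m. u 29 (int e) = of_bool (e \<in> flags 29 u)) \<and> real_of_int (u 70 0) = cst (chi (flags 29 u))"

lemma keep_correct:
  assumes st: "stat s" and T: "tree (flags 28 s)" and fl: "\<And>e. e < m \<Longrightarrow> s 28 (int e) = of_bool (e \<in> flags 28 s)"
    and ck: "s 23 0 = of_bool (balanced (flags 28 s))" and ct: "real_of_int (s 68 0) = cst (chi (flags 28 s))"
    and sd: "s 17 0 = 0 \<or> stored s"
  defines "t \<equiv> den L keep s"
  shows "t 17 0 = 0 \<and> s 17 0 = 0 \<or> stored t \<and> (s 17 0 = 1 \<longrightarrow> t 70 0 \<le> s 70 0)"
    "balanced (flags 28 s) \<Longrightarrow> stored t \<and> real_of_int (t 70 0) \<le> cst (chi (flags 28 s))"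
proof -
  define u where "u = den L copyT s"
  have u: "stored u" "u 70 0 = s 68 0" if bal: "balanced (flags 28 s)"
  proof -
    let ?c = "For 40 4 (Asg 29 (X 40) (At 28 (X 40)))"
    define s1 where "s1 = s(17 := (s 17)(0 := 1), 70 := (s 70)(0 := s 68 0))"
    have u1: "u = den L ?c s1" by (simp add: u_def copyT_def s1_def)
    have f: "u v = s1 v" if "v \<notin> {29, 40}" for v unfolding u1 using that by (intro den_frame) simp
    have "\<forall>e<m. u 29 (int e) = s 28 (int e)" unfolding u1
      by (rule For_fill) (use stat_vals(3)[OF st] bounds in \<open>auto simp: s1_def\<close>)
    then have "\<forall>e<m. u 29 (int e) = s 28 (int e)" "flags 29 u = flags 28 s" by (auto simp: flags_def)
    then show "stored u" "u 70 0 = s 68 0" using f[of 17] f[of 70] T bal fl ct by (auto simp: stored_def s1_def)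
  qed
  have t: "t = (if 0 < s 23 0 then if 0 < s 17 0 then if s 68 0 < s 70 0 then u else s else u else s)"
    by (simp add: t_def keep_def u_def)
  have s01: "s 17 0 = 0 \<or> s 17 0 = 1" using sd by (auto simp: stored_def)
  show "t 17 0 = 0 \<and> s 17 0 = 0 \<or> stored t \<and> (s 17 0 = 1 \<longrightarrow> t 70 0 \<le> s 70 0)"
  proof (cases "balanced (flags 28 s)")
    case False
    then show ?thesis using t ck sd by simp
  next
    case True
    then show ?thesis using t ck sd u by (auto split: if_splits)
  qed
  show "stored t \<and> real_of_int (t 70 0) \<le> cst (chi (flags 28 s))" if bal: "balanced (flags 28 s)"
  proof (cases "s 17 0 = 1 \<and> s 70 0 \<le> s 68 0")
    case True
    then have "t = s" using t ck bal by simp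
    moreover have "real_of_int (s 70 0) \<le> real_of_int (s 68 0)" using True by simp
    ultimately show ?thesis using True sd ct by (simp only: simp_thms) auto
  next
    case False
    then have "t = u" using t ck bal s01 by auto
    then show ?thesis using u[OF bal] ct by simp
  qed
qed

lemma main_correct:
  assumes st: "stat s" and g: "s 14 0 = int lgn"
  defines "t \<equiv> den L main s"
  shows "stored t" "\<And>x. lpx b x \<Longrightarrow> cst (chi (flags 29 t)) \<le> cst x"
proof -
  let ?c = "runh ;; check ;; costT ;; keep ;; setx 16 (Plus (X 16) (X 16))"
  obtain j0 where j0: "j0 < L\<^sup>2" "\<And>u. stat u \<Longrightarrow> u 16 0 = 2 ^ j0 \<Longrightarrow> balanced (flags 28 (den L runh u)) \<and>
     (\<forall>x. lpx b x \<longrightarrow> cst (chi (flags 28 (den L runh u))) \<le> cst x)" using runh_correct[OF st] by blast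
  define s1 where "s1 = s(16 := (s 16)(0 := 1), 17 := (s 17)(0 := 0))"
  \<comment> \<open>After the right scale \<open>j0\<close> the stored tree is optimal against the
    relaxation; from then on it is replaced only by balanced trees that are cheaper.\<close>
  define J where "J = (\<lambda>j (u :: store). stat u \<and> u 14 0 = int lgn \<and> u 16 0 = 2 ^ j \<and> (u 17 0 = 0 \<or> stored u) \<and>
     (j0 < j \<longrightarrow> stored u \<and> (\<forall>x. lpx b x \<longrightarrow> real_of_int (u 70 0) \<le> cst x)))"
  have "J (L ^ 2) (den L (Rep 2 ?c) s1)"
  proof (rule Rep_rule)
    have "stat s1" unfolding s1_def by (rule stat_cong[OF st]) auto
    then show "J 0 s1" using g by (simp add: J_def s1_def)
    fix j u assume J: "J j u"
    have stu: "stat u" and gu: "u 14 0 = int lgn" and hu: "u 16 0 = 2 ^ j" and sdu: "u 17 0 = 0 \<or> stored u"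
      and opt: "j0 < j \<Longrightarrow> stored u \<and> (\<forall>x. lpx b x \<longrightarrow> real_of_int (u 70 0) \<le> cst x)" using J unfolding J_def by blast+
    define u1 where "u1 = den L runh u"
    define u2 where "u2 = den L check u1"
    define u3 where "u3 = den L costT u2"
    define u4 where "u4 = den L keep u3"
    have b: "den L ?c u = u4(16 := (u4 16)(0 := 2 * u4 16 0))" by (simp add: u1_def u2_def u3_def u4_def)
    have f1: "u1 v = u v" if "v \<in> {0, 2, 4, 5, 6, 8, 12, 13, 65, 14, 16, 17, 29, 70}" for v
      unfolding u1_def using that by (intro den_frame) auto
    have f2: "u2 v = u1 v" if "v \<notin> {23, 31, 40, 41}" for v unfolding u2_def using that by (intro den_frame) simp
    have f3: "u3 v = u2 v" if "v \<notin> {40, 68}" for v unfolding u3_def using that by (intro den_frame) simp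
    have f4: "u4 v = u3 v" if "v \<notin> {17, 29, 40, 70}" for v unfolding u4_def using that by (intro den_frame) simp
    have st1: "stat u1" unfolding u1_def by (rule stat_den[OF stu]) simp
    have st2: "stat u2" unfolding u2_def by (rule stat_den[OF st1]) simp
    have st3: "stat u3" unfolding u3_def by (rule stat_den[OF st2]) simp
    have st4: "stat u4" unfolding u4_def by (rule stat_den[OF st3]) simp
    define T where "T = flags 28 u1"
    obtain w where w: "stat w" "u1 = den L finish w"
    proof
      show "u1 = den L finish (den L (Loop round) (den L init u))" by (simp add: u1_def runh_def)
      show "stat (den L (Loop round) (den L init u))" by (intro stat_den stu) simp_all
    qed
    have T: "tree T" "\<And>e. e < m \<Longrightarrow> u1 28 (int e) = of_bool (e \<in> T)"
      using finish_tree[OF w(1)] unfolding T_def w(2) by auto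
    have T2: "flags 28 u2 = T" "flags 28 u3 = T" using f2[of 28] f3[of 28] by (auto simp: T_def flags_def)
    have e28: "u2 28 = u1 28" "u3 28 = u1 28" using f2[of 28] f3[of 28] by auto
    have "u1 14 0 = int lgn" using f1[of 14] gu by simp
    then have "u2 23 0 = of_bool (balanced T)" unfolding u2_def T_def by (rule check_correct[OF st1]) (use T(2) in \<open>simp add: T_def\<close>)
    then have ck: "u3 23 0 = of_bool (balanced T)" using f3[of 23] by simp
    have ct: "real_of_int (u3 68 0) = cst (chi T)"
      using costT_correct[OF st2] T(2) unfolding u3_def T2 e28 by blast
    have eq: "u3 17 = u 17" "u3 29 = u 29" "u3 70 = u 70" using f1 f2 f3 by auto
    have "stored u3 = stored u" unfolding stored_def flags_def eq by simp
    then have sd3: "u3 17 0 = 0 \<or> stored u3" using sdu eq by simp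
    have "tree (flags 28 u3)" "\<And>e. e < m \<Longrightarrow> u3 28 (int e) = of_bool (e \<in> flags 28 u3)"
      "u3 23 0 = of_bool (balanced (flags 28 u3))" "real_of_int (u3 68 0) = cst (chi (flags 28 u3))"
      using T ck ct unfolding T2 e28 by auto
    note kp = keep_correct[OF st3 this sd3, folded u4_def, unfolded T2 eq]
    have s4: "stored (u4(16 := v)) = stored u4" for v by (simp add: stored_def flags_def)
    have a: "u4 17 0 = 0 \<or> stored u4" using kp(1) by blast
    have o: "stored u4 \<and> (\<forall>x. lpx b x \<longrightarrow> real_of_int (u4 70 0) \<le> cst x)" if "j0 < Suc j"
    proof (cases "j0 = j")
      case True
      have "balanced T" "\<And>x. lpx b x \<Longrightarrow> cst (chi T) \<le> cst x"
        using j0(2)[OF stu] hu True unfolding T_def u1_def by auto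
      then show ?thesis using kp(2) by (meson order_trans)
    next
      case False
      then have q: "stored u" "\<And>x. lpx b x \<Longrightarrow> real_of_int (u 70 0) \<le> cst x" using opt that by auto
      then have "u 17 0 = 1" by (simp add: stored_def)
      then have "stored u4" "u4 70 0 \<le> u 70 0" using kp(1) by auto
      then show ?thesis using q(2) by (meson of_int_le_iff order_trans)
    qed
    have st5: "stat (u4(16 := v))" for v by (rule stat_cong[OF st4]) auto
    have "u4 14 0 = int lgn" "u4 16 0 = 2 ^ j" using f1[of 14] f1[of 16] f2 f3 f4 gu hu by auto
    then show "J (Suc j) (den L ?c u)" unfolding J_def b s4 using st5 a o by simp
  qed
  moreover have "s1 = den L (setx 17 (K 0)) (den L (setx 16 (K 1)) s)" by (simp add: s1_def)
  then have "t = den L (Rep 2 ?c) s1" by (simp only: t_def main_def den.simps(3))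
  ultimately have J: "J (L ^ 2) t" by simp
  then have "stored t" "\<And>x. lpx b x \<Longrightarrow> real_of_int (t 70 0) \<le> cst x" using j0(1) unfolding J_def by blast+
  then show "stored t" "\<And>x. lpx b x \<Longrightarrow> cst (chi (flags 29 t)) \<le> cst x" by (auto simp: stored_def)
qed

end

section \<open>Reading the instance and writing the tree\<close>

abbreviation edge_word :: "int \<Rightarrow> ex" where
  "edge_word i \<equiv> At 0 (Plus (Plus (X 3) (Times (X 40) (K 4))) (K i))"

definition read_ends :: lc where
  "read_ends = For 40 4 (Asg 5 (X 40) (edge_word 1) ;; Asg 6 (X 40) (edge_word 2))"

text \<open>A common multiple of the denominators, which makes all costs integral after scaling;
  each factor is an input word of level 0, as \<open>tame\<close> demands.\<close>

definition read_denom :: lc where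
  "read_denom = setx 64 (K 1) ;; For 40 4 (setx 64 (Times (X 64) (edge_word 4)))"

definition read_costs :: lc where
  "read_costs = For 40 4 (Asg 65 (X 40) (Times (Quot (X 64) (edge_word 4)) (edge_word 3)))"

text \<open>Sets are stored as lists without repetition, so the count is the number of ends of the
  edge in the set, and 1 means that the edge is cut.\<close>

definition count_ends :: lc where
  "count_ends = setx 11 (K 0) ;; For 43 10 (
     IfEq (At 0 (Plus (Plus (X 9) (K 1)) (X 43))) (At 5 (X 40)) (setx 11 (Plus (X 11) (K 1))) ;;
     IfEq (At 0 (Plus (Plus (X 9) (K 1)) (X 43))) (At 6 (X 40)) (setx 11 (Plus (X 11) (K 1))))"

definition read_row :: lc where
  "read_row = For 40 4 (count_ends ;; Asg 12 (Plus (X 40) (Times LL (X 41))) (K 0) ;;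
     IfEq (X 11) (K 1) (Asg 12 (Plus (X 40) (Times LL (X 41))) (K 1)))"

abbreviation bound_word :: "int \<Rightarrow> ex" where
  "bound_word i \<equiv> At 0 (Plus (Plus (X 9) (X 10)) (K i))"

text \<open>\<open>(a + d - 1) div d\<close> is the ceiling of a/d. The result is the integer bound
  relaxed by one and capped at the number of vertices, as \<open>slack_point\<close>
  expects.\<close>

definition read_bound :: lc where
  "read_bound = Asg 13 (X 41) (Plus (Quot (Minus (Plus (bound_word 1) (bound_word 2)) (K 1)) (bound_word 2)) (K 1)) ;;
     IfGt (At 13 (X 41)) (X 2) (Asg 13 (X 41) (X 2))"

definition read_sets :: lc where
  "read_sets = setx 9 (Plus (X 7) (K 1)) ;;
     For 41 8 (setx 10 (At 0 (X 9)) ;; read_row ;; read_bound ;; setx 9 (Plus (Plus (X 9) (X 10)) (K 3)))"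

definition read_lg :: lc where
  "read_lg = setx 15 (K 1) ;; setx 14 (K 0) ;;
     Loop (IfGt (X 2) (X 15) (setx 15 (Plus (X 15) (X 15)) ;; setx 14 (Plus (X 14) (K 1))))"

definition parse :: lc where
  "parse = setx 2 (At 0 (K 1)) ;; setx 3 (Plus (X 2) (K 2)) ;; setx 4 (At 0 (X 3)) ;;
     setx 7 (Plus (Plus (X 3) (K 1)) (Times (X 4) (K 4))) ;; setx 8 (At 0 (X 7)) ;;
     read_ends ;; read_denom ;; read_costs ;; read_sets ;; read_lg"

definition emit :: lc where
  "emit = setx 32 (K 0) ;; For 40 4 (If1 (At 29 (X 40)) (Asg 1 (Plus (X 32) (K 1)) (At 5 (X 40)) ;;
     Asg 1 (Plus (X 32) (K 2)) (At 6 (X 40)) ;; setx 32 (Plus (X 32) (K 2)))) ;; setx 1 (X 32)"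

definition solver :: lc where
  "solver = parse ;; main ;; emit"

lemma macros_wfc [simp]:
  "wfc (If1 a c) \<longleftrightarrow> arrays_ok a \<and> wfc c" "depth (If1 a c) = depth c"
  "wfc (IfNe a b c) \<longleftrightarrow> arrays_ok a \<and> arrays_ok b \<and> wfc c" "depth (IfNe a b c) = depth c"
  "wfc (IfEq a b c) \<longleftrightarrow> arrays_ok a \<and> arrays_ok b \<and> wfc c" "depth (IfEq a b c) = depth c"
  "wfc (IfGt a b c) \<longleftrightarrow> arrays_ok a \<and> arrays_ok b \<and> wfc c" "depth (IfGt a b c) = depth c"
  by (auto simp: If1_def IfNe_def IfEq_def IfGt_def)

lemma loops_wfc [simp]:
  "wfc (For iv nv c) \<longleftrightarrow> iv < 192 \<and> nv < 192 \<and> wfc c" "depth (For iv nv c) = Suc (depth c)"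
  "wfc (Rep n c) = wfc c" "depth (Rep n c) = n + depth c"
  by (auto simp: For_def) (induction n, auto)+

lemma TimesL_ok [simp]: "arrays_ok (TimesL n e) = arrays_ok e" "0 < l \<Longrightarrow> tame l (TimesL n e) = tame l e"
  by (induction n) auto

lemma crx_ok [simp]: "arrays_ok (crx e i) \<longleftrightarrow> arrays_ok e \<and> arrays_ok i" "tame l (crx e i)"
  by (auto simp: crx_def)

lemma kruskal_wfc [simp]: "wfc kruskal" "depth kruskal = 2"
  by (simp_all add: kruskal_def label_init_def select_def relabel_def join_def)

lemma drift_wfc [simp]: "wfc mkW" "depth mkW = 2" "wfc (cntT (X 41))" "depth (cntT (X 41)) = 1" "wfc upd" "depth upd = 2" "wfc drift" "depth drift = 11"
  by (simp_all add: mkW_def cntT_def upd_def drift_def)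

lemma pass_wfc [simp]: "wfc testp" "depth testp = 2" "wfc (costY 69)" "depth (costY 69) = 1" "wfc pass" "depth pass = 12"
  by (simp_all add: testp_def check_fix_def cntY_def check_cuts_def costY_def pass_def attempt_def)

lemma runh_wfc [simp]: "wfc net" "depth net = 3" "wfc runh" "depth runh = 13"
  by (simp_all add: net_def net_r_def near_j_def replace_def dist0_def dist1_def runh_def init_def round_def finish_def)

lemma main_wfc [simp]: "wfc main" "depth main = 15"
  by (simp_all add: main_def check_def costT_def keep_def copyT_def)

lemma solver_wfc: "wfc solver" "depth solver \<le> 60"
  by (simp_all add: solver_def parse_def read_ends_def read_denom_def read_costs_def read_sets_def read_row_def read_bound_def
      count_ends_def read_lg_def emit_def)

lemma wr_read [simp]: "wr read_ends = {5, 6, 40}" "wr read_denom = {40, 64}" "wr read_costs = {40, 65}" "wr count_ends = {11, 43}"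
  "wr read_row = {11, 12, 40, 43}" "wr read_bound = {13}" "wr read_sets = {9, 10, 11, 12, 13, 40, 41, 43}" "wr read_lg = {14, 15}"
  "wr parse = {2, 3, 4, 5, 6, 7, 8, 9, 10, 11, 12, 13, 14, 15, 40, 41, 43, 64, 65}"
  by (auto simp: parse_def read_ends_def read_denom_def read_costs_def read_sets_def read_row_def read_bound_def count_ends_def read_lg_def)

lemma sum_nth_eq:
  assumes "distinct xs"
  shows "(\<Sum>i<length xs. of_bool (xs ! i = a)) = (of_bool (a \<in> set xs) :: int)"
proof -
  have "(\<Sum>i<length xs. of_bool (xs ! i = a)) = sum_list (map (\<lambda>x. of_bool (x = a) :: int) xs)"
    by (simp add: sum_list_sum_nth atLeast0LessThan)
  also have "\<dots> = (\<Sum>x\<in>set xs. of_bool (x = a))" using assms by (simp add: sum_list_distinct_conv_sum_set)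
  also have "\<dots> = of_bool (a \<in> set xs)" by (auto simp: of_bool_def)
  finally show ?thesis .
qed

locale words = prog +
  fixes cn cd :: "nat \<Rightarrow> int" and SS :: "nat \<Rightarrow> nat list" and bn bd :: "nat \<Rightarrow> int" and lgn :: nat
  assumes C_eq: "\<And>e. e < m \<Longrightarrow> C e = (\<Prod>e<m. cd e) div cd e * cn e"
    and SS: "\<And>i. i < k \<Longrightarrow> set (SS i) = S i \<and> distinct (SS i) \<and> length (SS i) \<le> L"
    and B0_words: "\<And>i. i < k \<Longrightarrow> B0 i = min ((bn i + bd i - 1) div bd i + 1) (int (length vs))"
    and lgn: "card V \<le> 2 ^ lgn" "2 ^ lgn < 2 * card V"
begin

text \<open>The address of a set block: its length, the members and two words for the bound. The
  summand 4 stands for address 0 and the words n, m and k.\<close>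

definition off :: "nat \<Rightarrow> int" where
  "off i = int (length vs) + 4 + 4 * int m + (\<Sum>i<i. int (length (SS i)) + 3)"

definition lay :: "(int \<Rightarrow> int) \<Rightarrow> bool" where
  "lay w \<longleftrightarrow> w 0 = int L \<and> w 1 = int (length vs) \<and> (\<forall>i<length vs. w (int i + 2) = int (vs ! i)) \<and> w (int (length vs) + 2) = int m \<and>
     (\<forall>e<m. w (int (length vs) + 2 + int e * 4 + 1) = int (src e) \<and> w (int (length vs) + 2 + int e * 4 + 2) = int (tgt e) \<and>
        w (int (length vs) + 2 + int e * 4 + 3) = cn e \<and> w (int (length vs) + 2 + int e * 4 + 4) = cd e) \<and>
     w (int (length vs) + 3 + int m * 4) = int k \<and>
     (\<forall>i<k. w (off i) = int (length (SS i)) \<and> (\<forall>j<length (SS i). w (off i + 1 + int j) = int (SS i ! j)) \<and>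
        w (off i + int (length (SS i)) + 1) = bn i \<and> w (off i + int (length (SS i)) + 2) = bd i)"

lemma lay_vals:
  assumes "lay w"
  shows "w 0 = int L" "w 1 = int (length vs)" "\<And>i. i < length vs \<Longrightarrow> w (int i + 2) = int (vs ! i)" "w (int (length vs) + 2) = int m"
    "\<And>e. e < m \<Longrightarrow> w (int (length vs) + 2 + int e * 4 + 1) = int (src e)" "\<And>e. e < m \<Longrightarrow> w (int (length vs) + 2 + int e * 4 + 2) = int (tgt e)"
    "\<And>e. e < m \<Longrightarrow> w (int (length vs) + 2 + int e * 4 + 3) = cn e" "\<And>e. e < m \<Longrightarrow> w (int (length vs) + 2 + int e * 4 + 4) = cd e"
    "w (int (length vs) + 3 + int m * 4) = int k"
    "\<And>i. i < k \<Longrightarrow> w (off i) = int (length (SS i))" "\<And>i j. i < k \<Longrightarrow> j < length (SS i) \<Longrightarrow> w (off i + 1 + int j) = int (SS i ! j)"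
    "\<And>i. i < k \<Longrightarrow> w (off i + int (length (SS i)) + 1) = bn i" "\<And>i. i < k \<Longrightarrow> w (off i + int (length (SS i)) + 2) = bd i"
  using assms unfolding lay_def by blast+

lemma read_ends_correct:
  assumes l: "lay (s 0)" and s: "s 3 0 = int (length vs) + 2" "s 4 0 = int m" and e: "e < m"
  shows "den L read_ends s 5 (int e) = int (src e)" "den L read_ends s 6 (int e) = int (tgt e)"
proof -
  have "\<forall>e<m. den L read_ends s 5 (int e) = int (src e)" unfolding read_ends_def
    by (rule For_fill) (use s bounds lay_vals(5)[OF l] in auto)
  moreover have "\<forall>e<m. den L read_ends s 6 (int e) = int (tgt e)" unfolding read_ends_def
    by (rule For_fill) (use s bounds lay_vals(6)[OF l] in auto)
  ultimately show "den L read_ends s 5 (int e) = int (src e)" "den L read_ends s 6 (int e) = int (tgt e)" using e by auto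
qed

lemma read_denom_correct:
  assumes l: "lay (s 0)" and s: "s 3 0 = int (length vs) + 2" "s 4 0 = int m"
  shows "den L read_denom s 64 0 = (\<Prod>e<m. cd e)"
proof -
  let ?s = "s(64 := (s 64)(0 := 1))"
  have "den L (For 40 4 (setx 64 (Times (X 64) (edge_word 4)))) ?s 64 0 = (\<Prod>e<m. cd e)"
    by (rule For_rule[where I = "\<lambda>j (t :: store). t 64 0 = (\<Prod>e<j. cd e)" and n = m])
      (use s bounds lay_vals(8)[OF l] in auto)
  then show ?thesis by (simp add: read_denom_def)
qed

lemma read_costs_correct:
  assumes l: "lay (s 0)" and s: "s 3 0 = int (length vs) + 2" "s 4 0 = int m" "s 64 0 = (\<Prod>e<m. cd e)" and e: "e < m"
  shows "den L read_costs s 65 (int e) = C e"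
proof -
  have "\<forall>e<m. den L read_costs s 65 (int e) = C e" unfolding read_costs_def
    by (rule For_fill) (use s bounds lay_vals(7,8)[OF l] C_eq in auto)
  then show ?thesis using e by auto
qed

lemma count_ends_correct:
  assumes l: "lay (s 0)" and s: "s 9 0 = off i" "s 10 0 = int (length (SS i))" and i: "i < k"
    and e: "s 40 0 = int e" "e < m" "s 5 (int e) = int (src e)" "s 6 (int e) = int (tgt e)"
  shows "den L count_ends s 11 0 = 1 \<longleftrightarrow> e \<in> cut i"
proof -
  let ?s = "s(11 := (s 11)(0 := 0))"
  let ?c = "IfEq (At 0 (Plus (Plus (X 9) (K 1)) (X 43))) (At 5 (X 40)) (setx 11 (Plus (X 11) (K 1))) ;;
     IfEq (At 0 (Plus (Plus (X 9) (K 1)) (X 43))) (At 6 (X 40)) (setx 11 (Plus (X 11) (K 1)))"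
  have "den L (For 43 10 ?c) ?s 11 0 = (\<Sum>j<length (SS i). of_bool (SS i ! j = src e) + of_bool (SS i ! j = tgt e))"
  proof (rule For_sum)
    fix j t assume a: "j < length (SS i)" "t 43 0 = int j" "\<forall>v. v \<noteq> 43 \<and> v \<notin> wr ?c \<longrightarrow> t v = ?s v"
    have f: "t 0 = s 0" "t 9 = s 9" "t 40 = s 40" "t 5 = s 5" "t 6 = s 6" using a(3) by auto
    show "den L ?c t 11 0 = t 11 0 + (of_bool (SS i ! j = src e) + of_bool (SS i ! j = tgt e))"
      using a(2) f s e lay_vals(11)[OF l i a(1)] by auto
  qed (use s SS[OF i] in auto)
  also have "\<dots> = of_bool (src e \<in> S i) + of_bool (tgt e \<in> S i)"
    using sum_nth_eq[of "SS i"] SS[OF i] by (simp add: sum.distrib)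
  finally show ?thesis using e(2) by (auto simp: count_ends_def cut_def)
qed

lemma row_inj: "e < m \<Longrightarrow> e' < m \<Longrightarrow> int e + int L * int i = int e' + int L * int i' \<Longrightarrow> e = e' \<and> i = i'"
proof -
  assume a: "e < m" "e' < m" "int e + int L * int i = int e' + int L * int i'"
  then have q: "e + L * i = e' + L * i'" by (metis of_nat_add of_nat_eq_iff of_nat_mult)
  have "e < L" "e' < L" using a L by auto
  then have "(e + L * i) mod L = e" "(e' + L * i') mod L = e'" "(e + L * i) div L = i" "(e' + L * i') div L = i'" by auto
  then show ?thesis using q by metis
qed

lemma read_row_correct:
  assumes l: "lay (s 0)" and s: "s 9 0 = off i" "s 10 0 = int (length (SS i))" "s 4 0 = int m" "s 41 0 = int i" and i: "i < k"
    and en: "\<And>e. e < m \<Longrightarrow> s 5 (int e) = int (src e) \<and> s 6 (int e) = int (tgt e)"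
  shows "e < m \<Longrightarrow> den L read_row s 12 (int e + int L * int i) = of_bool (e \<in> cut i)"
    "e < m \<Longrightarrow> i' < i \<Longrightarrow> den L read_row s 12 (int e + int L * int i') = s 12 (int e + int L * int i')"
proof -
  let ?c = "count_ends ;; Asg 12 (Plus (X 40) (Times LL (X 41))) (K 0) ;;
     IfEq (X 11) (K 1) (Asg 12 (Plus (X 40) (Times LL (X 41))) (K 1))"
  define I where "I = (\<lambda>j (u :: store). (\<forall>e<j. u 12 (int e + int L * int i) = of_bool (e \<in> cut i)) \<and>
     (\<forall>e<m. \<forall>i'<i. u 12 (int e + int L * int i') = s 12 (int e + int L * int i')))"
  have "I m (den L read_row s)"
    unfolding read_row_def
  proof (rule For_rule)
    fix j t assume a: "j < m" "I j t" "t 40 0 = int j" "\<forall>v. v \<noteq> 40 \<and> v \<notin> wr ?c \<longrightarrow> t v = s v"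
    have f: "t 0 = s 0" "t 9 = s 9" "t 10 = s 10" "t 5 = s 5" "t 6 = s 6" "t 41 = s 41" using a(4) by auto
    define u where "u = den L count_ends t"
    have fu: "u v = t v" if "v \<notin> {11, 43}" for v unfolding u_def using that by (intro den_frame) simp
    have "u 11 0 = 1 \<longleftrightarrow> j \<in> cut i" unfolding u_def
      by (rule count_ends_correct) (use f l s i a en in auto)
    moreover have "s 0 0 = int L" by (rule lay_vals(1)[OF l])
    ultimately have d: "den L ?c t 12 = (t 12)(int j + int L * int i := of_bool (j \<in> cut i))"
      using fu[of 0] fu[of 40] fu[of 41] fu[of 12] f s a(3) by (simp add: u_def[symmetric])
    show "I (Suc j) (den L ?c t)"
      unfolding I_def
    proof (intro conjI allI impI)
      fix e assume e: "e < Suc j"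
      show "den L ?c t 12 (int e + int L * int i) = of_bool (e \<in> cut i)"
        using e a(2) unfolding d I_def by (auto simp: less_Suc_eq)
    next
      fix e i' assume e: "e < m" "i' < i"
      have "int e + int L * int i' \<noteq> int j + int L * int i" using row_inj[OF e(1) a(1), of i' i] e(2) by auto
      then show "den L ?c t 12 (int e + int L * int i') = s 12 (int e + int L * int i')"
        using e a(2) unfolding d I_def by simp
    qed
  qed (use s bounds in \<open>auto simp: I_def\<close>)
  then show "e < m \<Longrightarrow> den L read_row s 12 (int e + int L * int i) = of_bool (e \<in> cut i)"
    "e < m \<Longrightarrow> i' < i \<Longrightarrow> den L read_row s 12 (int e + int L * int i') = s 12 (int e + int L * int i')" unfolding I_def by blast+
qed

lemma off_Suc: "off (Suc i) = off i + int (length (SS i)) + 3"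
  by (simp add: off_def)

lemma read_sets_correct:
  assumes l: "lay (s 0)" and s: "s 2 0 = int (length vs)" "s 7 0 = int (length vs) + 3 + int m * 4" "s 4 0 = int m" "s 8 0 = int k"
    and en: "\<And>e. e < m \<Longrightarrow> s 5 (int e) = int (src e) \<and> s 6 (int e) = int (tgt e)"
  shows "i < k \<Longrightarrow> e < m \<Longrightarrow> den L read_sets s 12 (int e + int L * int i) = of_bool (e \<in> cut i)"
    "i < k \<Longrightarrow> den L read_sets s 13 (int i) = B0 i"
proof -
  let ?c = "setx 10 (At 0 (X 9)) ;; read_row ;; read_bound ;; setx 9 (Plus (Plus (X 9) (X 10)) (K 3))"
  let ?s = "s(9 := (s 9)(0 := s 7 0 + 1))"
  define I where "I = (\<lambda>j (u :: store). u 9 0 = off j \<and> (\<forall>i<j. u 13 (int i) = B0 i) \<and>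
     (\<forall>i<j. \<forall>e<m. u 12 (int e + int L * int i) = of_bool (e \<in> cut i)))"
  have "I k (den L (For 41 8 ?c) ?s)"
  proof (rule For_rule)
    fix i t assume i: "i < k" and I: "I i t" and t41: "t 41 0 = int i" and fr: "\<forall>v. v \<noteq> 41 \<and> v \<notin> wr ?c \<longrightarrow> t v = ?s v"
    have f: "t 0 = s 0" "t 4 = s 4" "t 5 = s 5" "t 6 = s 6" "t 2 = s 2" using fr by auto
    have t9: "t 9 0 = off i" using I by (simp add: I_def)
    define u where "u = t(10 := (t 10)(0 := int (length (SS i))))"
    define u1 where "u1 = den L read_row u"
    define u2 where "u2 = den L read_bound u1"
    have du: "den L ?c t = u2(9 := (u2 9)(0 := u2 9 0 + u2 10 0 + 3))"
      using lay_vals(10)[OF l i] f t9 by (simp add: u_def u1_def u2_def)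
    have f1: "u1 v = u v" if "v \<notin> {11, 12, 40, 43}" for v unfolding u1_def using that by (intro den_frame) simp
    have f2: "u2 v = u1 v" if "v \<noteq> 13" for v unfolding u2_def using that by (intro den_frame) simp
    have row: "u1 12 (int e + int L * int i) = of_bool (e \<in> cut i)"
      "i' < i \<Longrightarrow> u1 12 (int e + int L * int i') = t 12 (int e + int L * int i')" if "e < m" for e i'
      using read_row_correct(1)[of u i e] read_row_correct(2)[of u i e i'] l f t9 s(3) t41 i en that unfolding u1_def by (auto simp: u_def)
    have v: "u1 0 = s 0" "u1 9 0 = off i" "u1 10 0 = int (length (SS i))" "u1 41 0 = int i" "u1 2 0 = int (length vs)" "u1 13 = t 13"
      using f1 f t9 t41 s(1) by (auto simp: u_def)
    have "u2 13 = (t 13)(int i := B0 i)"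
      using v lay_vals(12,13)[OF l i] B0_words[OF i] by (simp add: u2_def read_bound_def min_def)
    then show "I (Suc i) (den L ?c t)"
      unfolding du I_def using I row v f2[of 9] f2[of 10] f2[of 12] by (auto simp: off_Suc I_def less_Suc_eq)
  qed (use s bounds in \<open>auto simp: I_def off_def\<close>)
  moreover have "den L read_sets s = den L (For 41 8 ?c) ?s" by (simp add: read_sets_def)
  ultimately show "i < k \<Longrightarrow> e < m \<Longrightarrow> den L read_sets s 12 (int e + int L * int i) = of_bool (e \<in> cut i)"
    "i < k \<Longrightarrow> den L read_sets s 13 (int i) = B0 i" unfolding I_def by auto
qed

text \<open>Doubling stops at the first power of two that is at least n, which is
  \<open>2 ^ lgn\<close>; \<open>L\<close> rounds are enough because n < L < 2^L.\<close>

lemma read_lg_correct: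
  assumes "s 2 0 = int (length vs)"
  shows "den L read_lg s 14 0 = int lgn"
proof -
  let ?c = "IfGt (X 2) (X 15) (setx 15 (Plus (X 15) (X 15)) ;; setx 14 (Plus (X 14) (K 1)))"
  define s1 where "s1 = s(15 := (s 15)(0 := 1), 14 := (s 14)(0 := 0))"
  have n1: "1 \<le> card V" using V_ne finite_V by (simp add: Suc_leI card_gt_0_iff)
  define I where "I = (\<lambda>j (u :: store). \<exists>l. u 14 0 = int l \<and> u 15 0 = 2 ^ l \<and> (l = 0 \<or> 2 ^ l < 2 * card V) \<and> (card V \<le> 2 ^ l \<or> j \<le> l))"
  have "I L (den L (Loop ?c) s1)"
  proof (rule Loop_rule)
    show "I 0 s1" by (auto simp: I_def s1_def)
    fix j t assume a: "I j t" "\<forall>v. v \<notin> wr ?c \<longrightarrow> t v = s1 v"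
    then obtain l where l: "t 14 0 = int l" "t 15 0 = 2 ^ l" "l = 0 \<or> 2 ^ l < 2 * card V" "card V \<le> 2 ^ l \<or> j \<le> l" unfolding I_def by blast
    have n: "t 2 0 = int (card V)" using a(2) assms card_vs by (auto simp: s1_def)
    show "I (Suc j) (den L ?c t)"
    proof (cases "card V \<le> 2 ^ l")
      case True
      then have "int (card V) \<le> 2 ^ l" by (metis of_nat_le_iff of_nat_numeral of_nat_power)
      then have "den L ?c t = t" using n l(2) by simp
      then show ?thesis using l True unfolding I_def by auto
    next
      case False
      then have "2 ^ l < int (card V)" by (metis not_le of_nat_less_iff of_nat_numeral of_nat_power)
      then have "den L ?c t = t(15 := (t 15)(0 := 2 ^ Suc l), 14 := (t 14)(0 := int (Suc l)))" using n l(1,2) by (simp add: add.commute)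
      then show ?thesis using l False unfolding I_def by (intro exI[of _ "Suc l"]) auto
    qed
  qed
  then obtain l where l: "den L (Loop ?c) s1 14 0 = int l" "l = 0 \<or> 2 ^ l < 2 * card V" "card V \<le> 2 ^ l \<or> L \<le> l" unfolding I_def by blast
  have "L < 2 ^ L" by simp
  have "card V \<le> 2 ^ l"
  proof (rule ccontr)
    assume c: "\<not> card V \<le> 2 ^ l"
    then have "(2::nat) ^ L \<le> 2 ^ l" using l(3) by (intro power_increasing) auto
    then show False using c \<open>L < 2 ^ L\<close> L(2) by linarith
  qed
  moreover have "2 ^ l < 2 * card V" using l(2) n1 by auto
  ultimately have "(2::nat) ^ l < 2 ^ Suc lgn" "(2::nat) ^ lgn < 2 ^ Suc l" using lgn by auto
  then have "l < Suc lgn" "lgn < Suc l" by (auto intro: power_less_imp_less_exp[of "2 :: nat"] simp del: power_Suc)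
  then have "l = lgn" by simp
  moreover have "den L read_lg s = den L (Loop ?c) s1" by (simp add: read_lg_def s1_def)
  ultimately show ?thesis using l(1) by simp
qed

lemma parse_correct:
  assumes l: "lay (s 0)"
  shows "stat (den L parse s)" "den L parse s 14 0 = int lgn"
proof -
  define s0 where "s0 = s(2 := (s 2)(0 := int (length vs)), 3 := (s 3)(0 := int (length vs) + 2), 4 := (s 4)(0 := int m),
     7 := (s 7)(0 := 3 + int (length vs) + int m * 4), 8 := (s 8)(0 := int k))"
  define s1 where "s1 = den L read_ends s0"
  define s2 where "s2 = den L read_denom s1"
  define s3 where "s3 = den L read_costs s2"
  define s4 where "s4 = den L read_sets s3"
  define s5 where "s5 = den L read_lg s4"
  have p: "den L parse s = s5"
  proof -
    have "s 0 (3 + int (length vs) + int m * 4) = int k" using lay_vals(9)[OF l] by (simp only: add.commute)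
    then show ?thesis
      using lay_vals(2,4)[OF l] by (simp add: parse_def s0_def s1_def s2_def s3_def s4_def s5_def)
  qed
  have f1: "s1 v = s0 v" if "v \<notin> {5, 6, 40}" for v unfolding s1_def using that by (intro den_frame) simp
  have f2: "s2 v = s1 v" if "v \<notin> {40, 64}" for v unfolding s2_def using that by (intro den_frame) simp
  have f3: "s3 v = s2 v" if "v \<notin> {40, 65}" for v unfolding s3_def using that by (intro den_frame) simp
  have f4: "s4 v = s3 v" if "v \<notin> {9, 10, 11, 12, 13, 40, 41, 43}" for v unfolding s4_def using that by (intro den_frame) simp
  have f5: "s5 v = s4 v" if "v \<notin> {14, 15}" for v unfolding s5_def using that by (intro den_frame) simp
  have z0: "s0 0 = s 0" "s0 2 0 = int (length vs)" "s0 3 0 = int (length vs) + 2" "s0 4 0 = int m"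
    "s0 7 0 = int (length vs) + 3 + int m * 4" "s0 8 0 = int k" by (simp_all add: s0_def)
  have e1: "s1 5 (int e) = int (src e)" "s1 6 (int e) = int (tgt e)" if "e < m" for e
    unfolding s1_def by (rule read_ends_correct[of s0]; use z0 l that in simp)+
  have d2: "s2 64 0 = (\<Prod>e<m. cd e)"
    unfolding s2_def by (rule read_denom_correct) (use f1[of 0] f1[of 3] f1[of 4] z0 l in auto)
  have c3: "s3 65 (int e) = C e" if "e < m" for e
    unfolding s3_def by (rule read_costs_correct[of s2]) (use d2 that f1[of 0] f1[of 3] f1[of 4] f2[of 0] f2[of 3] f2[of 4] z0 l in auto)
  have f13: "s3 v = s0 v" if "v \<in> {0, 2, 3, 4, 7, 8}" for v
    using that f1[of v] f2[of v] f3[of v] by auto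
  have e3: "s3 5 = s1 5" "s3 6 = s1 6" using f2[of 5] f3[of 5] f2[of 6] f3[of 6] by auto
  have c4: "i < k \<Longrightarrow> e < m \<Longrightarrow> s4 12 (int e + int L * int i) = of_bool (e \<in> cut i)" "i < k \<Longrightarrow> s4 13 (int i) = B0 i" for i e
    unfolding s4_def using read_sets_correct(1)[of s3 i e] read_sets_correct(2)[of s3 i] f13 z0 l e1 unfolding e3 by auto
  have g: "s5 v = s3 v" if "v \<in> {0, 2, 4, 5, 6, 8, 65}" for v using that f4[of v] f5[of v] by auto
  have g': "s5 12 = s4 12" "s5 13 = s4 13" using f5 by auto
  show "stat (den L parse s)"
    unfolding p stat_def using g g' f13 z0 e1 e3 c3 c4 lay_vals(1,3)[OF l] by simp
  show "den L parse s 14 0 = int lgn"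
    unfolding p s5_def by (rule read_lg_correct) (use f4[of 2] f13[of 2] z0 in auto)
qed

lemma emit_correct:
  assumes st: "stat s" and fl: "\<And>e. e < m \<Longrightarrow> s 29 (int e) = of_bool (e \<in> T)"
  defines "ws \<equiv> concat (map (\<lambda>e. [int (src e), int (tgt e)]) (filter (\<lambda>e. e \<in> T) [0..<m]))"
  defines "t \<equiv> den L emit s"
  shows "t 1 0 = int (length ws)" "map (t 1) [1..int (length ws)] = ws"
proof -
  let ?c = "If1 (At 29 (X 40)) (Asg 1 (Plus (X 32) (K 1)) (At 5 (X 40)) ;;
     Asg 1 (Plus (X 32) (K 2)) (At 6 (X 40)) ;; setx 32 (Plus (X 32) (K 2)))"
  let ?s = "s(32 := (s 32)(0 := 0))"
  define W where "W = (\<lambda>j. concat (map (\<lambda>e. [int (src e), int (tgt e)]) (filter (\<lambda>e. e \<in> T) [0..<j])))"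
  define I where "I = (\<lambda>j (u :: store). u 32 0 = int (length (W j)) \<and> (\<forall>i<length (W j). u 1 (int i + 1) = W j ! i))"
  define u where "u = den L (For 40 4 ?c) ?s"
  have "I m u"
    unfolding u_def
  proof (rule For_rule)
    fix j v assume a: "j < m" "I j v" "v 40 0 = int j" "\<forall>w. w \<noteq> 40 \<and> w \<notin> wr ?c \<longrightarrow> v w = ?s w"
    have f: "v 5 = s 5" "v 6 = s 6" "v 29 = s 29" using a(4) by auto
    show "I (Suc j) (den L ?c v)"
    proof (cases "j \<in> T")
      case False
      then have "W (Suc j) = W j" by (simp add: W_def)
      moreover have "den L ?c v = v" using False fl[OF a(1)] a(3) f by simp
      ultimately show ?thesis using a(2) unfolding I_def by metis
    next
      case True
      then have W: "W (Suc j) = W j @ [int (src j), int (tgt j)]" by (simp add: W_def)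
      have l: "v 32 0 = int (length (W j))" using a(2) by (simp add: I_def)
      have "den L ?c v = v(1 := (v 1)(int (length (W j)) + 1 := int (src j), int (length (W j)) + 2 := int (tgt j)),
          32 := (v 32)(0 := int (length (W j)) + 2))"
        using True fl[OF a(1)] a(3) f l stat_vals(5,6)[OF st a(1)] by simp
      then show ?thesis using a(2) unfolding I_def W
        by (auto simp: nth_append less_Suc_eq nth_Cons')
    qed
  qed (use stat_vals(3)[OF st] bounds in \<open>auto simp: I_def W_def\<close>)
  moreover have "W m = ws" by (simp add: W_def ws_def)
  ultimately have I: "u 32 0 = int (length ws)" "\<And>i. i < length ws \<Longrightarrow> u 1 (int i + 1) = ws ! i" by (auto simp: I_def)
  have t: "t = u(1 := (u 1)(0 := u 32 0))" by (simp add: t_def emit_def u_def)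
  show "t 1 0 = int (length ws)" using I(1) t by simp
  show "map (t 1) [1..int (length ws)] = ws"
    by (rule nth_equalityI) (use I(2) t in \<open>auto simp: add.commute\<close>)
qed

end

locale full = goal V m src tgt C S k L vs B0 b lgn + words V m src tgt C S k L vs B0 cn cd SS bn bd lgn
  for V m src tgt C S k L vs B0 b lgn cn cd SS bn bd
begin

lemma solver_correct:
  assumes "lay (s 0)"
  obtains T ws where "tree T" "balanced T" "\<And>x. lpx b x \<Longrightarrow> cst (chi T) \<le> cst x"
    "ws = concat (map (\<lambda>e. [int (src e), int (tgt e)]) (filter (\<lambda>e. e \<in> T) [0..<m]))"
    "den L solver s 1 0 = int (length ws)" "map (den L solver s 1) [1..int (length ws)] = ws"
proof -
  define u where "u = den L main (den L parse s)"
  define T where "T = flags 29 u"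
  note p = parse_correct[of s, OF assms]
  have su: "stored u" "\<And>x. lpx b x \<Longrightarrow> cst (chi T) \<le> cst x"
    using main_correct[OF p] unfolding u_def T_def by blast+
  have st: "stat u" unfolding u_def by (rule stat_den[OF p(1)]) simp
  have d: "den L solver s = den L emit u" by (simp add: solver_def u_def)
  have fl: "\<And>e. e < m \<Longrightarrow> u 29 (int e) = of_bool (e \<in> T)" using su(1) by (simp add: stored_def T_def)
  show ?thesis
    by (rule that[of T]) (use su emit_correct[OF st fl] in \<open>auto simp: stored_def T_def[symmetric] d\<close>)
qed

end

section \<open>Graphs and encodings\<close>

lemma edge_list_product:
  "edge_list E = filter (\<lambda>(u, v). u < v \<and> {u, v} \<in> E) (List.product (sorted_list_of_set (\<Union>E)) (sorted_list_of_set (\<Union>E)))"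
proof -
  have inner: "concat (map (\<lambda>v. if u < v \<and> {u, v} \<in> E then [(u, v)] else []) ys) = filter (\<lambda>(u, v). u < v \<and> {u, v} \<in> E) (map (Pair u) ys)"
    for u and ys :: "nat list" by (induction ys) auto
  show ?thesis unfolding edge_list_def inner product_concat_map filter_concat map_map comp_def ..
qed

lemma finite_ends: "simple_graph V E \<Longrightarrow> finite (\<Union>E) \<and> finite E \<and> \<Union>E \<subseteq> V"
proof -
  assume s: "simple_graph V E"
  then have "\<Union>E \<subseteq> V" by (fastforce simp: simple_graph_def)
  moreover have "E \<subseteq> Pow V" using s by (fastforce simp: simple_graph_def)
  ultimately show ?thesis using s finite_subset by (metis finite_Pow_iff simple_graph_def)
qed

lemma edge_list_props:
  assumes "simple_graph V E"
  shows "distinct (edge_list E)" "set (edge_list E) = {(u, v). u < v \<and> {u, v} \<in> E}"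
  using finite_ends[OF assms] by (auto simp: edge_list_product distinct_product)

lemma product_filter: "List.product (filter p xs) (filter q ys) = filter (\<lambda>(a, b). p a \<and> q b) (List.product xs ys)"
proof -
  have "map (Pair x) (filter q ys) = filter (\<lambda>(a, b). p a \<and> q b) (map (Pair x) ys)" if "p x" for x
    using that by (induction ys) auto
  moreover have "filter (\<lambda>(a, b). p a \<and> q b) (map (Pair x) ys) = []" if "\<not> p x" for x
    using that by (induction ys) auto
  ultimately show ?thesis by (induction xs) auto
qed

text \<open>The listing order is inherited even though fewer end points may be involved; so the
  encoded output is obtained by scanning the numbered edges.\<close>

lemma edge_list_subset:
  assumes "simple_graph V E" "F \<subseteq> E"
  shows "edge_list F = filter (\<lambda>(u, v). {u, v} \<in> F) (edge_list E)"
proof -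
  have fin: "finite (\<Union>E)" using finite_ends[OF assms(1)] by simp
  have sub: "\<Union>F \<subseteq> \<Union>E" using assms(2) by blast
  have "sorted_list_of_set (\<Union>F) = filter (\<lambda>x. x \<in> \<Union>F) (sorted_list_of_set (\<Union>E))"
    by (rule sorted_distinct_set_unique) (use fin sub finite_subset[OF sub fin] in \<open>auto simp: sorted_wrt_filter\<close>)
  then show ?thesis
    unfolding edge_list_product[of F] edge_list_product[of E] using assms(2)
    by (simp only: product_filter filter_filter) (rule filter_cong; auto)
qed

text \<open>Edges are numbered by their position in \<open>edge_list\<close>, the order used by the
  encodings of both instance and tree.\<close>

locale listed =
  fixes V :: "nat set" and E :: "nat set set"
  assumes graph: "simple_graph V E" and conn: "connected_graph V E"
begin

definition m :: nat where "m = length (edge_list E)"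
definition src :: "nat \<Rightarrow> nat" where "src e = fst (edge_list E ! e)"
definition tgt :: "nat \<Rightarrow> nat" where "tgt e = snd (edge_list E ! e)"
definition ed :: "nat \<Rightarrow> nat set" where "ed e = {src e, tgt e}"

lemma nth_edge: "e < m \<Longrightarrow> src e < tgt e \<and> ed e \<in> E"
proof -
  assume "e < m"
  then have "edge_list E ! e \<in> set (edge_list E)" by (simp add: m_def)
  then show ?thesis using edge_list_props(2)[OF graph] by (auto simp: src_def tgt_def ed_def)
qed

sublocale mgraph V m src tgt
proof
  show "finite V" "V \<noteq> {}" using graph by (auto simp: simple_graph_def)
  show "src e \<in> V \<and> tgt e \<in> V \<and> src e \<noteq> tgt e" if "e < m" for e
    using nth_edge[OF that] finite_ends[OF graph] by (auto simp: ed_def)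
qed

lemma ed_inj: "inj_on ed {..<m}"
proof (rule inj_onI)
  fix e f assume a: "e \<in> {..<m}" "f \<in> {..<m}" "ed e = ed f"
  then have "src e = src f" "tgt e = tgt f" using nth_edge[of e] nth_edge[of f] by (auto simp: ed_def doubleton_eq_iff)
  then have "edge_list E ! e = edge_list E ! f" by (simp add: src_def tgt_def prod_eq_iff)
  then show "e = f" using a edge_list_props(1)[OF graph] by (simp add: m_def nth_eq_iff_index_eq)
qed

lemma ed_image: "ed ` {..<m} = E"
proof
  show "ed ` {..<m} \<subseteq> E" using nth_edge by auto
  show "E \<subseteq> ed ` {..<m}"
  proof
    fix x assume x: "x \<in> E"
    then obtain u v where uv: "x = {u, v}" "u < v" using graph unfolding simple_graph_def
      by (smt (verit, best) insert_commute linorder_neqE_nat mem_Collect_eq subsetD)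
    then have "(u, v) \<in> set (edge_list E)" using edge_list_props(2)[OF graph] x by auto
    then obtain e where "e < m" "edge_list E ! e = (u, v)" by (auto simp: in_set_conv_nth m_def)
    then show "x \<in> ed ` {..<m}" using uv by (auto simp: ed_def src_def tgt_def intro!: image_eqI[of _ _ e])
  qed
qed

lemma ed_eq: "{x, y} = ed e \<longleftrightarrow> (x = src e \<and> y = tgt e) \<or> (x = tgt e \<and> y = src e)"
  by (simp add: ed_def doubleton_eq_iff)

lemma adj_ed: "adj F = {(x, y). {x, y} \<in> ed ` F}"
  unfolding adj_def image_iff ed_eq ..

lemma connected_ed: "connected_graph V (ed ` F) \<longleftrightarrow> con F"
  by (simp add: connected_graph_def con_def adj_ed)

lemma con_all: "con {..<m}"
  using conn connected_ed[of "{..<m}"] by (simp add: ed_image)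

lemma induced_ed: "induced_edges E U = ed ` inner U"
proof -
  have "induced_edges E U = {x \<in> ed ` {..<m}. \<exists>u v. x = {u, v} \<and> u \<in> U \<and> v \<in> U}" by (simp add: induced_edges_def ed_image)
  also have "\<dots> = ed ` {e \<in> {..<m}. \<exists>u v. ed e = {u, v} \<and> u \<in> U \<and> v \<in> U}" by blast
  also have "{e \<in> {..<m}. \<exists>u v. ed e = {u, v} \<and> u \<in> U \<and> v \<in> U} = inner U"
    unfolding inner_def eq_commute[of "ed _"] ed_eq by blast
  finally show ?thesis .
qed

lemma cut_ed: "cut_edges E W = ed ` {e. e < m \<and> (src e \<in> W) \<noteq> (tgt e \<in> W)}"
proof -
  have "cut_edges E W = {x \<in> ed ` {..<m}. \<exists>u v. x = {u, v} \<and> u \<in> W \<and> v \<notin> W}" by (simp add: cut_edges_def ed_image)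
  also have "\<dots> = ed ` {e \<in> {..<m}. \<exists>u v. ed e = {u, v} \<and> u \<in> W \<and> v \<notin> W}" by blast
  also have "{e \<in> {..<m}. \<exists>u v. ed e = {u, v} \<and> u \<in> W \<and> v \<notin> W} = {e. e < m \<and> (src e \<in> W) \<noteq> (tgt e \<in> W)}"
    unfolding eq_commute[of "ed _"] ed_eq by blast
  finally show ?thesis .
qed

lemma sum_ed: "F \<subseteq> {..<m} \<Longrightarrow> sum x (ed ` F) = (\<Sum>e\<in>F. x (ed e))"
  using sum.reindex[OF inj_on_subset[OF ed_inj], of F x] by simp

lemma ed_mem: "T \<subseteq> {..<m} \<Longrightarrow> e < m \<Longrightarrow> ed e \<in> ed ` T \<longleftrightarrow> e \<in> T"
  using ed_inj by (auto simp: inj_on_def)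

text \<open>The rest of a cycle connects the ends of its closing edge, so that edge could be removed
  without disconnecting the tree; but n - 2 edges cannot connect n vertices.\<close>

lemma tree_spanning:
  assumes T: "tree T"
  shows "spanning_tree V E (ed ` T)"
  unfolding spanning_tree_def
proof (intro conjI notI)
  have Tm: "T \<subseteq> {..<m}" and cT: "con T" and card: "card T + 1 = card V" using T by (auto simp: tree_def)
  show "ed ` T \<subseteq> E" using Tm ed_image by blast
  show "connected_graph V (ed ` T)" using cT by (simp add: connected_ed)
  assume "\<exists>vs. is_cycle (ed ` T) vs"
  then obtain vs where vs: "3 \<le> length vs" "distinct vs" "\<And>i. i < length vs \<Longrightarrow> {vs ! i, vs ! (Suc i mod length vs)} \<in> ed ` T"
    by (auto simp: is_cycle_def)
  define n where "n = length vs - 1"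
  have n: "length vs = Suc n" "2 \<le> n" using vs(1) by (auto simp: n_def)
  obtain t where t: "t \<in> T" "{vs ! n, vs ! 0} = ed t" using vs(3)[of n] n by auto
  let ?F = "T - {t}"
  have step: "(vs ! i, vs ! Suc i) \<in> adj ?F" if i: "i < n" for i
  proof -
    obtain f where f: "f \<in> T" "{vs ! i, vs ! Suc i} = ed f" using vs(3)[of i] n i by auto
    \<comment> \<open>The length of at least 3 enters here: with two vertices the closing edge would
      be the first one again.\<close>
    have "{vs ! i, vs ! Suc i} \<noteq> {vs ! n, vs ! 0}"
      using vs(2) n i by (auto simp: doubleton_eq_iff nth_eq_iff_index_eq)
    then have "f \<noteq> t" using f t by auto
    then show ?thesis using f unfolding adj_ed by auto
  qed
  have path: "i \<le> n \<Longrightarrow> (vs ! 0, vs ! i) \<in> (adj ?F)\<^sup>*" for i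
  proof (induction i)
    case (Suc i)
    then show ?case using step[of i] by (meson Suc_le_lessD less_imp_le rtrancl.rtrancl_into_rtrancl)
  qed simp
  have p: "(vs ! 0, vs ! n) \<in> (adj ?F)\<^sup>*" by (rule path) simp
  have "(vs ! n = src t \<and> vs ! 0 = tgt t) \<or> (vs ! n = tgt t \<and> vs ! 0 = src t)" using t(2) unfolding ed_eq .
  then have ends: "(src t, tgt t) \<in> (adj ?F)\<^sup>*" "(tgt t, src t) \<in> (adj ?F)\<^sup>*"
    using p adj_sym[OF p] by metis+
  have "adj T \<subseteq> (adj ?F)\<^sup>*"
  proof (rule subrelI)
    fix x y assume "(x, y) \<in> adj T"
    then obtain e where e: "e \<in> T" "(x = src e \<and> y = tgt e) \<or> (x = tgt e \<and> y = src e)" unfolding adj_def by blast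
    show "(x, y) \<in> (adj ?F)\<^sup>*"
    proof (cases "e = t")
      case True
      then show ?thesis using e(2) ends by blast
    next
      case False
      then have "(x, y) \<in> adj ?F" using e unfolding adj_def by blast
      then show ?thesis by blast
    qed
  qed
  then have "(adj T)\<^sup>* \<subseteq> (adj ?F)\<^sup>*" by (metis rtrancl_idemp rtrancl_mono)
  then have cF: "con ?F" using cT unfolding con_def by blast
  have "?F \<subseteq> {..<m}" using Tm by blast
  then have "card V \<le> card ?F + 1" by (rule con_card[OF _ cF])
  moreover have "card ?F + 1 = card T" using t(1) finite_subset[OF Tm] card_Suc_Diff1[of T t] by simp
  ultimately show False using card by simp
qed

lemma encode_ed:
  assumes "T \<subseteq> {..<m}"
  shows "encode_edges (ed ` T) = concat (map (\<lambda>e. [int (src e), int (tgt e)]) (filter (\<lambda>e. e \<in> T) [0..<m]))"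
proof -
  have "edge_list (ed ` T) = filter (\<lambda>(u, v). {u, v} \<in> ed ` T) (map ((!) (edge_list E)) [0..<m])"
    using edge_list_subset[OF graph, of "ed ` T"] assms ed_image by (auto simp: m_def map_nth)
  also have "\<dots> = map ((!) (edge_list E)) (filter (\<lambda>e. ed e \<in> ed ` T) [0..<m])"
    by (simp add: filter_map comp_def case_prod_beta ed_def src_def tgt_def)
  also have "filter (\<lambda>e. ed e \<in> ed ` T) [0..<m] = filter (\<lambda>e. e \<in> T) [0..<m]"
    by (rule filter_cong) (use ed_mem[OF assms] in auto)
  finally show ?thesis by (simp add: encode_edges_def comp_def case_prod_beta src_def tgt_def)
qed

lemma card_edges: "m \<le> (card V)\<^sup>2"
proof -
  have "inj_on (\<lambda>e. (src e, tgt e)) {..<m}" using ed_inj by (auto simp: inj_on_def ed_def)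
  then have "card {..<m} \<le> card (V \<times> V)" by (rule card_inj_on_le) (use ends finite_V in auto)
  then show ?thesis by (simp add: card_cartesian_product power2_eq_square)
qed

end

section \<open>The input word as consecutive blocks, and rational numbers\<close>

definition seg :: "(int \<Rightarrow> int) \<Rightarrow> int \<Rightarrow> int list \<Rightarrow> bool" where
  "seg w a xs \<longleftrightarrow> (\<forall>i<length xs. w (a + int i) = xs ! i)"

lemma seg_Cons [simp]: "seg w a (x # xs) \<longleftrightarrow> w a = x \<and> seg w (a + 1) xs"
proof -
  have "seg w a (x # xs) \<longleftrightarrow> (\<forall>i<Suc (length xs). w (a + int i) = (x # xs) ! i)" by (simp add: seg_def)
  also have "\<dots> \<longleftrightarrow> w a = x \<and> (\<forall>i<length xs. w (a + int (Suc i)) = xs ! i)" by (subst All_less_Suc2) simp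
  finally show ?thesis by (simp add: seg_def add.assoc)
qed

lemma seg_Nil [simp]: "seg w a []"
  by (simp add: seg_def)

lemma seg_append [simp]: "seg w a (xs @ ys) \<longleftrightarrow> seg w a xs \<and> seg w (a + int (length xs)) ys"
  by (induction xs arbitrary: a) (auto simp: add.assoc)

lemma seg_concat: "seg w a (concat xss) \<Longrightarrow> j < length xss \<Longrightarrow> seg w (a + (\<Sum>i<j. int (length (xss ! i)))) (xss ! j)"
proof (induction xss arbitrary: a j)
  case (Cons xs xss)
  show ?case
  proof (cases j)
    case 0
    then show ?thesis using Cons.prems by simp
  next
    case (Suc i)
    have "seg w (a + int (length xs) + (\<Sum>i<i. int (length (xss ! i)))) (xss ! i)"
      using Cons.prems Suc by (intro Cons.IH) auto
    then show ?thesis unfolding Suc by (subst sum.lessThan_Suc_shift) (simp add: add.assoc)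
  qed
qed simp

definition rnum :: "real \<Rightarrow> int" where "rnum r = encode_rat r ! 0"
definition rden :: "real \<Rightarrow> int" where "rden r = encode_rat r ! 1"

lemma encode_rat_parts: "encode_rat r = [rnum r, rden r]"
  by (simp add: rnum_def rden_def encode_rat_def case_prod_beta)

lemma rat_value:
  assumes "r \<in> \<rat>"
  shows "0 < rden r" "r = real_of_int (rnum r) / real_of_int (rden r)"
proof -
  obtain q where q: "r = of_rat q" using assms by (auto elim: Rats_cases)
  then have "(THE q'. of_rat q' = r) = q" by (intro the_equality) auto
  moreover obtain a b where ab: "quotient_of q = (a, b)" by force
  ultimately have "rnum r = a" "rden r = b" by (simp_all add: rnum_def rden_def encode_rat_def)
  moreover have "0 < b" "q = of_int a / of_int b" using ab quotient_of_denom_pos quotient_of_div by blast+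
  ultimately show "0 < rden r" "r = real_of_int (rnum r) / real_of_int (rden r)" using q by (simp_all add: of_rat_divide)
qed

lemma rnum_nonneg: "r \<in> \<rat> \<Longrightarrow> 0 \<le> r \<Longrightarrow> 0 \<le> rnum r"
proof -
  assume r: "r \<in> \<rat>" "0 \<le> r"
  have "0 < real_of_int (rden r)" "0 \<le> real_of_int (rnum r) / real_of_int (rden r)" using rat_value[OF r(1)] r(2) by simp_all
  then have "0 \<le> real_of_int (rnum r)" by (simp add: zero_le_divide_iff)
  then show ?thesis by simp
qed

lemma ceiling_quot: "0 < d \<Longrightarrow> \<lceil>real_of_int a / real_of_int d\<rceil> = (a + d - 1) div d"
proof -
  assume d: "0 < d"
  have "(a + d - 1) div d = - ((- a) div d)"
  proof -
    define q where "q = (- a) div d"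
    define r where "r = (- a) mod d"
    have a: "a = - q * d - r" unfolding q_def r_def using div_mult_mod_eq[of "- a" d] by linarith
    have r: "0 \<le> r" "r < d" using d by (auto simp: r_def)
    have "a + d - 1 = (d - 1 - r) + (- q) * d" using a by simp
    then have "(a + d - 1) div d = (d - 1 - r) div d + (- q)" using d by (simp only: div_mult_self1)
    also have "(d - 1 - r) div d = 0" using r by (intro div_pos_pos_trivial) auto
    finally show ?thesis by (simp add: q_def)
  qed
  then show ?thesis by (simp add: ceiling_divide_eq_div)
qed

definition good :: "real \<Rightarrow> mcst \<Rightarrow> nat set set \<Rightarrow> bool" where
  "good M I T \<longleftrightarrow> spanning_tree (verts I) (edges I) T \<and> sum (cost I) T \<le> lp_opt I \<and>
     (\<forall>i < length (fam I). real (card (T \<inter> cut_edges (edges I) (fam I ! i))) \<le> bnd I ! i + M * ln (real (card (verts I))))"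

lemma power_of_two_above:
  assumes "1 \<le> n"
  shows "\<exists>l. n \<le> 2 ^ l \<and> 2 ^ l < 2 * (n :: nat)"
  using assms
proof (induction n rule: nat_induct_at_least)
  case base
  then show ?case by (intro exI[of _ 0]) simp
next
  case (Suc n)
  then obtain l where l: "n \<le> 2 ^ l" "2 ^ l < 2 * n" by blast
  show ?case
  proof (cases "n = 2 ^ l")
    case True
    then show ?thesis by (intro exI[of _ "Suc l"]) (use Suc(1) in auto)
  next
    case False
    then show ?thesis using l by (intro exI[of _ l]) auto
  qed
qed

section \<open>From trees of edge numbers to the guarantee\<close>

locale inst =
  fixes I :: mcst
  assumes lam: "laminar_mcst I" and feas: "lp_feasible I \<noteq> {}"
begin

sublocale listed "verts I" "edges I"
  using lam by unfold_locales (auto simp: laminar_mcst_def)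

lemma lp_restrict:
  assumes x: "x \<in> lp_feasible I"
  shows "pst (\<lambda>e. x (ed e))" "i < length (fam I) \<Longrightarrow> (\<Sum>e | e < m \<and> (src e \<in> fam I ! i) \<noteq> (tgt e \<in> fam I ! i). x (ed e)) \<le> bnd I ! i"
proof -
  have s: "sum x (induced_edges (edges I) U) = sum (\<lambda>e. x (ed e)) (inner U)" for U
    unfolding induced_ed by (rule sum_ed) (auto simp: inner_def)
  have iV: "inner (verts I) = {..<m}" using ends by (auto simp: inner_def)
  have total: "(\<Sum>e<m. x (ed e)) = real (card (verts I)) - 1" using x s[of "verts I"] iV by (simp add: lp_feasible_def)
  show "pst (\<lambda>e. x (ed e))"
    unfolding pst_def
  proof (intro conjI allI impI)
    show "0 \<le> x (ed e)" if "e < m" for e using x nth_edge[OF that] by (simp add: lp_feasible_def)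
    show "(\<Sum>e<m. x (ed e)) = real (card (verts I)) - 1" by (rule total)
    fix U assume U: "U \<subseteq> verts I \<and> U \<noteq> {}"
    show "sum (\<lambda>e. x (ed e)) (inner U) \<le> real (card U) - 1"
    proof (cases "U = verts I")
      case True
      then show ?thesis using total iV by simp
    next
      case False
      then have "sum x (induced_edges (edges I) U) \<le> real (card U) - 1" using x U by (simp add: lp_feasible_def psubset_eq)
      then show ?thesis by (simp only: s)
    qed
  qed
  assume i: "i < length (fam I)"
  have "sum x (cut_edges (edges I) (fam I ! i)) \<le> bnd I ! i" using x i by (simp add: lp_feasible_def)
  then show "(\<Sum>e | e < m \<and> (src e \<in> fam I ! i) \<noteq> (tgt e \<in> fam I ! i). x (ed e)) \<le> bnd I ! i"
    unfolding cut_ed by (subst (asm) sum_ed) auto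
qed

lemma bnd_nonneg: "i < length (fam I) \<Longrightarrow> 0 \<le> bnd I ! i"
proof -
  assume i: "i < length (fam I)"
  obtain x where x: "x \<in> lp_feasible I" using feas by blast
  have "0 \<le> (\<Sum>e | e < m \<and> (src e \<in> fam I ! i) \<noteq> (tgt e \<in> fam I ! i). x (ed e))"
    using lp_restrict(1)[OF x] by (intro sum_nonneg) (auto simp: pst_def)
  also have "\<dots> \<le> bnd I ! i" by (rule lp_restrict(2)[OF x i])
  finally show ?thesis .
qed

definition costs :: "nat \<Rightarrow> real" where "costs e = cost I (ed e)"

lemma lp_cost: "(\<Sum>e\<in>edges I. cost I e * x e) = (\<Sum>e<m. costs e * x (ed e))"
  using sum_ed[of "{..<m}" "\<lambda>e. cost I e * x e"] by (simp add: ed_image costs_def)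

lemma costs_nonneg: "e < m \<Longrightarrow> 0 \<le> costs e"
  using nth_edge[of e] lam by (auto simp: costs_def laminar_mcst_def)

lemma lp_opt_le:
  assumes "x \<in> lp_feasible I"
  shows "lp_opt I \<le> (\<Sum>e<m. costs e * x (ed e))"
  unfolding lp_opt_def lp_cost
proof (rule cINF_lower[OF _ assms])
  show "bdd_below ((\<lambda>x. \<Sum>e<m. costs e * x (ed e)) ` lp_feasible I)"
  proof (rule bdd_belowI[of _ 0])
    fix y assume "y \<in> (\<lambda>x. \<Sum>e<m. costs e * x (ed e)) ` lp_feasible I"
    then obtain x where x: "x \<in> lp_feasible I" "y = (\<Sum>e<m. costs e * x (ed e))" by blast
    show "0 \<le> y" unfolding x(2)
      using lp_restrict(1)[OF x(1)] costs_nonneg by (intro sum_nonneg mult_nonneg_nonneg) (auto simp: pst_def)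
  qed
qed

text \<open>The constant: rounding \<open>bnd\<close> up costs one more, so the excess is at most 34
  + 124 l. As l ln 2 < ln 2 + ln n, multiplying by ln 2 gives at most 158 ln 2 + 124 ln n, and this
  is at most 282 ln n for n >= 2.\<close>

lemma good_tree:
  assumes T: "tree T" and opt: "\<And>x. x \<in> lp_feasible I \<Longrightarrow> (\<Sum>e\<in>T. costs e) \<le> (\<Sum>e<m. costs e * x (ed e))"
    and l: "2 ^ l < 2 * card (verts I)"
    and cr: "\<And>i. i < length (fam I) \<Longrightarrow> int (card (T \<inter> {e. e < m \<and> (src e \<in> fam I ! i) \<noteq> (tgt e \<in> fam I ! i)})) \<le> \<lceil>bnd I ! i\<rceil> + 124 * int l + 33"
  shows "good (282 / ln 2) I (ed ` T)"
  unfolding good_def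
proof (intro conjI allI impI)
  have Tm: "T \<subseteq> {..<m}" using T by (simp add: tree_def)
  show "spanning_tree (verts I) (edges I) (ed ` T)" by (rule tree_spanning[OF T])
  show "sum (cost I) (ed ` T) \<le> lp_opt I"
    unfolding lp_opt_def lp_cost sum_ed[OF Tm] costs_def[symmetric] by (rule cINF_greatest[OF feas opt])
  fix i assume i: "i < length (fam I)"
  let ?F = "{e. e < m \<and> (src e \<in> fam I ! i) \<noteq> (tgt e \<in> fam I ! i)}"
  have "ed ` T \<inter> ed ` ?F = ed ` (T \<inter> ?F)" using ed_inj Tm by (intro inj_on_image_Int[symmetric]) auto
  then have card: "card (ed ` T \<inter> cut_edges (edges I) (fam I ! i)) = card (T \<inter> ?F)"
    unfolding cut_ed using card_image[OF inj_on_subset[OF ed_inj], of "T \<inter> ?F"] by auto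
  have n1: "1 \<le> card (verts I)" using V_ne finite_V by (simp add: Suc_leI card_gt_0_iff)
  show "real (card (ed ` T \<inter> cut_edges (edges I) (fam I ! i))) \<le> bnd I ! i + 282 / ln 2 * ln (real (card (verts I)))"
  \<comment> \<open>For a single vertex the logarithm vanishes and absorbs nothing; but then the
    tree is empty, and feasibility makes the bounds nonnegative.\<close>
  proof (cases "card (verts I) = 1")
    case True
    then have "T = {}" using T finite_subset[OF Tm] by (simp add: tree_def)
    then show ?thesis using bnd_nonneg[OF i] True by simp
  next
    case False
    define n where "n = real (card (verts I))"
    have n: "2 \<le> n" using False n1 by (simp add: n_def)
    have "(2::real) ^ l < 2 * n" using l unfolding n_def by (metis of_nat_less_iff of_nat_mult of_nat_numeral of_nat_power)
    then have "ln ((2::real) ^ l) < ln (2 * n)" using n by simp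
    then have "real l * ln 2 < ln 2 + ln n" using n by (simp add: ln_mult ln_realpow)
    moreover have "ln 2 \<le> ln n" using n by simp
    ultimately have "(34 + 124 * real l) * ln 2 \<le> 282 * ln n" by (simp add: algebra_simps)
    then have b: "34 + 124 * real l \<le> 282 / ln 2 * ln n" by (simp add: field_simps)
    have "real (card (T \<inter> ?F)) \<le> real_of_int \<lceil>bnd I ! i\<rceil> + 124 * real l + 33"
      using cr[OF i] by (metis (mono_tags, lifting) of_int_add of_int_le_iff of_int_mult of_int_numeral of_int_of_nat_eq)
    then have "real (card (T \<inter> ?F)) \<le> bnd I ! i + (34 + 124 * real l)" by linarith
    then show ?thesis using b unfolding card n_def by linarith
  qed
qed

end

section \<open>Rational instances\<close>

locale rat_inst = inst +
  assumes rat: "rational_mcst I"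
begin

definition vs :: "nat list" where "vs = sorted_list_of_set (verts I)"
definition k :: nat where "k = length (fam I)"
definition SS :: "nat \<Rightarrow> nat list" where "SS i = sorted_list_of_set (fam I ! i)"
definition cn :: "nat \<Rightarrow> int" where "cn e = rnum (costs e)"
definition cd :: "nat \<Rightarrow> int" where "cd e = rden (costs e)"
definition bn :: "nat \<Rightarrow> int" where "bn i = rnum (bnd I ! i)"
definition bd :: "nat \<Rightarrow> int" where "bd i = rden (bnd I ! i)"
definition D :: int where "D = (\<Prod>e<m. cd e)"
definition C :: "nat \<Rightarrow> int" where "C e = D div cd e * cn e"
definition B0 :: "nat \<Rightarrow> int" where "B0 i = min (\<lceil>bnd I ! i\<rceil> + 1) (int (card (verts I)))"
definition L :: nat where "L = word_size (encode_mcst I)"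

lemma vs: "set vs = verts I" "distinct vs" "length vs = card (verts I)"
  using finite_V by (simp_all add: vs_def)

lemma fam_sub: "i < k \<Longrightarrow> fam I ! i \<subseteq> verts I"
  using lam by (simp add: k_def laminar_mcst_def)

lemma len_bnd: "length (bnd I) = k"
  using lam by (simp add: k_def laminar_mcst_def)

lemma SS: "i < k \<Longrightarrow> set (SS i) = fam I ! i \<and> distinct (SS i) \<and> length (SS i) = card (fam I ! i) \<and> length (SS i) \<le> card (verts I)"
  using finite_subset[OF fam_sub finite_V, of i] card_mono[OF finite_V fam_sub, of i] by (simp add: SS_def)

lemma costs_rat: "e < m \<Longrightarrow> costs e \<in> \<rat>"
  using rat nth_edge[of e] by (auto simp: costs_def rational_mcst_def)

lemma bnd_rat: "i < k \<Longrightarrow> bnd I ! i \<in> \<rat>"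
  using rat len_bnd unfolding rational_mcst_def by (metis nth_mem subsetD)

lemma cd_pos: "e < m \<Longrightarrow> 0 < cd e"
  using rat_value(1)[OF costs_rat] by (simp add: cd_def)

lemma cn_nonneg: "e < m \<Longrightarrow> 0 \<le> cn e"
  using rnum_nonneg[OF costs_rat costs_nonneg] by (simp add: cn_def)

lemma D_pos: "0 < D"
  unfolding D_def by (rule prod_pos) (use cd_pos in auto)

lemma D_dvd: "e < m \<Longrightarrow> cd e dvd D"
  unfolding D_def by (rule dvd_prodI) auto

lemma C_value: "e < m \<Longrightarrow> real_of_int (C e) = real_of_int D * costs e"
proof -
  assume e: "e < m"
  have "costs e = real_of_int (cn e) / real_of_int (cd e)" using rat_value(2)[OF costs_rat[OF e]] by (simp add: cn_def cd_def)
  then show ?thesis using D_dvd[OF e] by (simp add: C_def real_of_int_div)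
qed

lemma C_nonneg: "e < m \<Longrightarrow> 0 \<le> C e"
  using cn_nonneg[of e] D_pos cd_pos[of e] by (simp add: C_def pos_imp_zdiv_nonneg_iff)

definition edge_blocks :: "int list list" where
  "edge_blocks = map (\<lambda>e. [int (src e), int (tgt e), cn e, cd e]) [0..<m]"

definition set_blocks :: "int list list" where
  "set_blocks = map (\<lambda>i. int (length (SS i)) # map int (SS i) @ [bn i, bd i]) [0..<k]"

lemma encode_layout: "encode_mcst I = int (length vs) # map int vs @ int m # concat edge_blocks @ int k # concat set_blocks"
proof -
  have "map (\<lambda>(u, v). [int u, int v] @ encode_rat (cost I {u, v})) (edge_list (edges I)) =
      map (\<lambda>(u, v). [int u, int v] @ encode_rat (cost I {u, v})) (map ((!) (edge_list (edges I))) [0..<m])"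
    by (simp add: m_def map_nth)
  also have "\<dots> = edge_blocks"
    by (simp add: edge_blocks_def encode_rat_parts case_prod_beta src_def tgt_def cn_def cd_def costs_def ed_def)
  finally have 1: "map (\<lambda>(u, v). [int u, int v] @ encode_rat (cost I {u, v})) (edge_list (edges I)) = edge_blocks" .
  have "zip (fam I) (bnd I) = map (\<lambda>i. (fam I ! i, bnd I ! i)) [0..<k]"
    by (rule nth_equalityI) (auto simp: len_bnd k_def[symmetric])
  then have 2: "map (\<lambda>(S, b). encode_vertices S @ encode_rat b) (zip (fam I) (bnd I)) = set_blocks"
    using SS by (simp add: set_blocks_def encode_rat_parts encode_vertices_def bn_def bd_def SS_def)
  show ?thesis
    unfolding encode_mcst_def 1 2 by (simp add: encode_vertices_def vs_def m_def k_def)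
qed

lemma nonneg_words: "w \<in> set (encode_mcst I) \<Longrightarrow> 0 \<le> w"
proof -
  have "0 \<le> w" if "w \<in> set (concat edge_blocks)"
    using that cn_nonneg cd_pos by (auto simp: edge_blocks_def less_imp_le)
  moreover have "0 \<le> bn i \<and> 0 < bd i" if "i < k" for i
    using rnum_nonneg[OF bnd_rat[OF that] bnd_nonneg] rat_value(1)[OF bnd_rat[OF that]] that by (simp add: bn_def bd_def k_def)
  then have "0 \<le> w" if "w \<in> set (concat set_blocks)"
    using that by (auto simp: set_blocks_def less_imp_le)
  ultimately show "w \<in> set (encode_mcst I) \<Longrightarrow> 0 \<le> w" unfolding encode_layout by auto
qed

lemma size_bounds: "card (verts I) + 3 + 4 * m + 3 * k \<le> L"
proof -
  have e: "length (concat edge_blocks) = 4 * m"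
    by (simp add: edge_blocks_def length_concat comp_def sum_list_triv)
  have "3 * k = sum_list (map (\<lambda>i. 3) [0..<k])" by (simp add: sum_list_triv)
  also have "\<dots> \<le> sum_list (map (\<lambda>i. length (SS i) + 3) [0..<k])" by (rule sum_list_mono) simp
  also have "\<dots> = length (concat set_blocks)" by (simp add: set_blocks_def length_concat comp_def numeral_3_eq_3)
  finally have "card (verts I) + 3 + 4 * m + 3 * k \<le> length (encode_mcst I)"
    using e vs(3) by (simp add: encode_layout)
  then show ?thesis using length_le_word_size[of "encode_mcst I"] by (simp add: L_def)
qed

lemma card_pos: "1 \<le> card (verts I)"
  using V_ne finite_V by (simp add: Suc_leI card_gt_0_iff)

text \<open>\<open>D\<close> is a product of m words, each at most 2^L, and there are m < 2^L costs,
  each at most D 2^L. The total is below 2^(L (m + 2)), and since m + 3 <= L and L >= 3, the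
  exponent is at most L^2 - 3.\<close>

lemma cost_sum_bound: "(\<Sum>e<m. C e) < 2 ^ (L\<^sup>2 - 3)"
proof -
  have w: "cn e \<le> 2 ^ L" "cd e \<le> 2 ^ L" if "e < m" for e
  proof -
    have "{cn e, cd e} \<subseteq> set (concat edge_blocks)" using that by (auto simp: edge_blocks_def)
    then have "cn e \<in> set (encode_mcst I)" "cd e \<in> set (encode_mcst I)" unfolding encode_layout by auto
    then show "cn e \<le> 2 ^ L" "cd e \<le> 2 ^ L" using word_le_pow nonneg_words unfolding L_def by blast+
  qed
  have "D \<le> (\<Prod>e<m. 2 ^ L)" unfolding D_def by (rule prod_mono) (use w cd_pos in \<open>auto simp: less_imp_le\<close>)
  then have D: "D \<le> 2 ^ (L * m)" by (simp add: power_mult)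
  have "C e \<le> 2 ^ (L * m) * 2 ^ L" if "e < m" for e
  proof -
    have "D div cd e \<le> D div 1" using cd_pos[OF that] D_pos by (intro zdiv_mono2) auto
    then show ?thesis unfolding C_def
      using D w(1)[OF that] cn_nonneg[OF that] D_pos cd_pos[OF that] by (intro mult_mono) (auto simp: pos_imp_zdiv_nonneg_iff)
  qed
  then have "(\<Sum>e<m. C e) \<le> int (card {..<m}) * (2 ^ (L * m) * 2 ^ L)" by (intro sum_bounded_above) auto
  also have "\<dots> < 2 ^ L * (2 ^ (L * m) * 2 ^ L)"
  proof -
    have "m < 2 ^ L" using size_bounds less_exp[of L] by linarith
    then have "int m < 2 ^ L" by (metis of_nat_less_iff of_nat_numeral of_nat_power)
    then show ?thesis by simp
  qed
  also have "\<dots> = 2 ^ (L * (m + 2))" by (simp add: power_add[symmetric] algebra_simps)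
  also have "\<dots> \<le> 2 ^ (L\<^sup>2 - 3)"
  proof (rule power_increasing)
    have "L * (m + 2) + L * 1 \<le> L * L"
      unfolding add_mult_distrib2[symmetric] using size_bounds by (intro mult_le_mono2) linarith
    moreover have "3 \<le> L" using size_bounds by linarith
    ultimately show "L * (m + 2) \<le> L\<^sup>2 - 3" by (simp add: power2_eq_square)
  qed simp
  finally show ?thesis .
qed

lemma solver_run:
  assumes s: "init_store (encode_mcst I) s"
  shows "\<exists>T n. good (282 / ln 2) I T \<and> n \<le> L \<and> den L solver s 1 0 = int n \<and> map (den L solver s 1) [1..int n] = encode_edges T"
proof -
  have len_vs: "length vs = card (verts I)" by (rule vs(3))
  obtain l where l: "card (verts I) \<le> 2 ^ l" "2 ^ l < 2 * card (verts I)" using power_of_two_above[OF card_pos] by blast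
  interpret crossing_trees "verts I" m src tgt C "\<lambda>i. fam I ! i" k L
  proof
    show "con {..<m}" by (rule con_all)
    show "fam I ! i \<inter> fam I ! j = {} \<or> fam I ! i \<subseteq> fam I ! j \<or> fam I ! j \<subseteq> fam I ! i" if "i < k" "j < k" for i j
      using lam that by (simp add: laminar_mcst_def laminar_def k_def)
  qed (use C_nonneg size_bounds card_pos in auto)
  interpret prog "verts I" m src tgt C "\<lambda>i. fam I ! i" k L vs B0
    by unfold_locales (use vs in auto)
  have cut: "cut i = {e. e < m \<and> (src e \<in> fam I ! i) \<noteq> (tgt e \<in> fam I ! i)}" for i by (simp add: cut_def)
  have cst: "cst x = real_of_int D * (\<Sum>e<m. costs e * x e)" for x
    unfolding cst_def sum_distrib_left by (rule sum.cong) (auto simp: C_value)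
  have lp: "lpx (\<lambda>i. bnd I ! i) (\<lambda>e. x (ed e))" if "x \<in> lp_feasible I" for x
    unfolding lpx_def cut using lp_restrict[OF that] by (simp add: k_def)
  interpret goal "verts I" m src tgt C "\<lambda>i. fam I ! i" k L vs B0 "\<lambda>i. bnd I ! i" l
  proof
    show "\<exists>x. lpx (\<lambda>i. bnd I ! i) x" using feas lp by blast
    show "(\<Sum>e<m. C e) < 2 ^ (L\<^sup>2 - 3)" by (rule cost_sum_bound)
  qed (use l card_edges size_bounds in \<open>auto simp: B0_def\<close>)
  interpret words "verts I" m src tgt C "\<lambda>i. fam I ! i" k L vs B0 cn cd SS bn bd l
  proof
    show "C e = (\<Prod>e<m. cd e) div cd e * cn e" for e by (simp add: C_def D_def)
    show "set (SS i) = fam I ! i \<and> distinct (SS i) \<and> length (SS i) \<le> L" if "i < k" for i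
      using SS[OF that] size_bounds by auto
    show "B0 i = min ((bn i + bd i - 1) div bd i + 1) (int (length vs))" if "i < k" for i
      using rat_value[OF bnd_rat[OF that]] ceiling_quot[of "bd i" "bn i"] len_vs by (simp add: B0_def bn_def bd_def)
  qed (use l in auto)
  interpret full "verts I" m src tgt C "\<lambda>i. fam I ! i" k L vs B0 "\<lambda>i. bnd I ! i" l cn cd SS bn bd ..
  have "seg (s 0) 1 (encode_mcst I)" using s by (simp add: init_store_def seg_def add.commute)
  then have sg: "s 0 1 = int (length vs)" "seg (s 0) 2 (map int vs)" "s 0 (2 + int (length vs)) = int m"
    "seg (s 0) (3 + int (length vs)) (concat edge_blocks)" "s 0 (3 + int (length vs) + int (length (concat edge_blocks))) = int k"
    "seg (s 0) (4 + int (length vs) + int (length (concat edge_blocks))) (concat set_blocks)"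
    unfolding encode_layout by (simp_all add: add.commute add.left_commute)
  have le: "length (concat edge_blocks) = 4 * m"
    by (simp add: edge_blocks_def length_concat comp_def sum_list_triv)
  have eb: "seg (s 0) (3 + int (length vs) + 4 * int e) [int (src e), int (tgt e), cn e, cd e]" if e: "e < m" for e
  proof -
    have "(\<Sum>i<e. int (length (edge_blocks ! i))) = (\<Sum>i<e. 4)" using e by (intro sum.cong) (auto simp: edge_blocks_def)
    then show ?thesis using seg_concat[OF sg(4), of e] e by (simp add: edge_blocks_def mult.commute)
  qed
  have sb: "seg (s 0) (off i) (int (length (SS i)) # map int (SS i) @ [bn i, bd i])" if i: "i < k" for i
  proof -
    have "(\<Sum>j<i. int (length (set_blocks ! j))) = (\<Sum>j<i. int (length (SS j)) + 3)" using i by (intro sum.cong) (auto simp: set_blocks_def)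
    moreover have "off i = 4 + int (length vs) + int (length (concat edge_blocks)) + (\<Sum>j<i. int (length (SS j)) + 3)"
      by (simp add: off_def le)
    ultimately show ?thesis using seg_concat[OF sg(6), of i] i by (simp add: set_blocks_def)
  qed
  have "lay (s 0)"
    unfolding lay_def
  proof (intro conjI allI impI)
    show "s 0 0 = int L" using s by (simp add: init_store_def L_def)
    show "s 0 1 = int (length vs)" by (rule sg(1))
    show "s 0 (int i + 2) = int (vs ! i)" if "i < length vs" for i using sg(2) that by (simp add: seg_def add.commute)
    show "s 0 (int (length vs) + 2) = int m" using sg(3) by (simp add: add.commute)
    show "s 0 (int (length vs) + 3 + int m * 4) = int k" using sg(5) le by (simp add: add.commute mult.commute)
    fix e assume "e < m"
    note q = eb[OF this]
    show "s 0 (int (length vs) + 2 + int e * 4 + 1) = int (src e)" "s 0 (int (length vs) + 2 + int e * 4 + 2) = int (tgt e)"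
      "s 0 (int (length vs) + 2 + int e * 4 + 3) = cn e" "s 0 (int (length vs) + 2 + int e * 4 + 4) = cd e"
      using q by (simp_all add: algebra_simps)
  next
    fix i assume i: "i < k"
    note q = sb[OF i]
    show "s 0 (off i) = int (length (SS i))" using q by simp
    show "s 0 (off i + 1 + int j) = int (SS i ! j)" if "j < length (SS i)" for j using q that by (simp add: seg_def[of _ _ "map int _"])
    show "s 0 (off i + int (length (SS i)) + 1) = bn i" "s 0 (off i + int (length (SS i)) + 2) = bd i"
      using q by (simp_all add: algebra_simps)
  qed
  then obtain T ws where T: "tree T" "balanced T" "\<And>x. lpx (\<lambda>i. bnd I ! i) x \<Longrightarrow> cst (chi T) \<le> cst x"
    and ws: "ws = concat (map (\<lambda>e. [int (src e), int (tgt e)]) (filter (\<lambda>e. e \<in> T) [0..<m]))"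
    and out: "den L solver s 1 0 = int (length ws)" "map (den L solver s 1) [1..int (length ws)] = ws"
    by (rule solver_correct) (rule that; assumption)
  have Tm: "T \<subseteq> {..<m}" using T(1) by (simp add: tree_def)
  have "good (282 / ln 2) I (ed ` T)"
  proof (rule good_tree[OF T(1) _ l(2)])
    fix x assume "x \<in> lp_feasible I"
    then have "real_of_int D * (\<Sum>e<m. costs e * chi T e) \<le> real_of_int D * (\<Sum>e<m. costs e * x (ed e))"
      using T(3) lp unfolding cst by blast
    then have "(\<Sum>e<m. costs e * chi T e) \<le> (\<Sum>e<m. costs e * x (ed e))" using D_pos by simp
    then show "(\<Sum>e\<in>T. costs e) \<le> (\<Sum>e<m. costs e * x (ed e))" using sum_tree[OF T(1), of costs] by simp
  next
    fix i assume "i < length (fam I)"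
    then have i: "i < k" by (simp add: k_def)
    then have "exc B0 i T \<le> 124 * int l + 32" using T(2) by (simp add: balanced_def)
    then show "int (card (T \<inter> {e. e < m \<and> (src e \<in> fam I ! i) \<noteq> (tgt e \<in> fam I ! i)})) \<le> \<lceil>bnd I ! i\<rceil> + 124 * int l + 33"
      unfolding exc_def cut B0_def by linarith
  qed
  moreover have "ws = encode_edges (ed ` T)" unfolding ws by (rule encode_ed[OF Tm, symmetric])
  moreover have "length ws \<le> L"
  proof -
    have "length ws = 2 * length (filter (\<lambda>e. e \<in> T) [0..<m])" unfolding ws by (simp add: length_concat comp_def sum_list_triv)
    also have "\<dots> \<le> 2 * m" using length_filter_le[of "\<lambda>e. e \<in> T" "[0..<m]"] by simp
    finally show ?thesis using size_bounds by linarith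
  qed
  ultimately show ?thesis using out by (intro exI[of _ "ed ` T"] exI[of _ "length ws"]) simp
qed

end

section \<open>Irrational data\<close>

text \<open>The program serves as an existence proof here: its denotation on any initial store
  already yields the tree.\<close>

lemma rational_good:
  assumes "rat_inst I"
  shows "\<exists>T. good (282 / ln 2) I T"
proof -
  interpret rat_inst I by fact
  obtain s where "init_store (encode_mcst I) s" using lc_polytime[OF solver_wfc] nonneg_words by blast
  then show ?thesis using solver_run by blast
qed

text \<open>The indices run through an infinite set because they will be those at which one
  particular tree occurs.\<close>

lemma le_limit:
  fixes a c :: real
  assumes inf: "infinite A" and le: "\<And>N. N \<in> A \<Longrightarrow> a \<le> c / real (Suc N)"
  shows "a \<le> 0"
proof (rule ccontr)
  assume "\<not> a \<le> 0"
  obtain N0 :: nat where N0: "\<bar>c\<bar> / a < real N0" using reals_Archimedean2 by blast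
  obtain N where N: "N0 \<le> N" "N \<in> A" using inf by (auto simp: infinite_nat_iff_unbounded_le)
  have "\<bar>c\<bar> < real N0 * a" using N0 \<open>\<not> a \<le> 0\<close> by (simp add: field_simps)
  also have "\<dots> \<le> real (Suc N) * a" using N(1) \<open>\<not> a \<le> 0\<close> by (intro mult_right_mono) auto
  also have "\<dots> \<le> c" using le[OF N(2)] by (simp add: field_simps)
  finally show False by simp
qed

lemma rational_above: "\<exists>f :: real \<Rightarrow> real. \<forall>r. f r \<in> \<rat> \<and> r \<le> f r \<and> f r \<le> r + 1 / real (Suc N)"
proof (rule choice, rule allI)
  fix r :: real
  obtain q where "q \<in> \<rat>" "r < q" "q < r + 1 / real (Suc N)" using Rats_dense_in_real[of r "r + 1 / real (Suc N)"] by auto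
  then show "\<exists>q. q \<in> \<rat> \<and> r \<le> q \<and> q \<le> r + 1 / real (Suc N)" by (intro exI[of _ q]) simp
qed

text \<open>All data are rounded upwards, so that costs stay nonnegative and every feasible point
  stays feasible.\<close>

lemma (in inst) perturbed:
  "\<exists>J. rat_inst J \<and> verts J = verts I \<and> edges J = edges I \<and> fam J = fam I \<and>
     (\<forall>e\<in>edges I. cost I e \<le> cost J e \<and> cost J e \<le> cost I e + 1 / real (Suc N)) \<and>
     (\<forall>i<length (fam I). bnd I ! i \<le> bnd J ! i \<and> bnd J ! i \<le> bnd I ! i + 1 / real (Suc N))"
proof -
  obtain f :: "real \<Rightarrow> real" where f: "\<And>r. f r \<in> \<rat>" "\<And>r. r \<le> f r" "\<And>r. f r \<le> r + 1 / real (Suc N)"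
    using rational_above by metis
  define J where "J = I\<lparr>cost := \<lambda>e. f (cost I e), bnd := map f (bnd I)\<rparr>"
  have J: "verts J = verts I" "edges J = edges I" "fam J = fam I" "cost J = (\<lambda>e. f (cost I e))" "bnd J = map f (bnd I)"
    by (simp_all add: J_def)
  have len: "length (bnd I) = length (fam I)" using lam by (simp add: laminar_mcst_def)
  have "0 \<le> f (cost I e)" if "e \<in> edges I" for e
    by (rule order_trans[OF _ f(2)]) (use lam that in \<open>simp add: laminar_mcst_def\<close>)
  then have "laminar_mcst J" using lam by (simp add: laminar_mcst_def J)
  moreover have "lp_feasible I \<subseteq> lp_feasible J"
  proof
    fix x assume x: "x \<in> lp_feasible I"
    have "sum x (cut_edges (edges I) (fam I ! i)) \<le> f (bnd I ! i)" if "i < length (fam I)" for i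
      by (rule order_trans[OF _ f(2)]) (use x that in \<open>simp add: lp_feasible_def\<close>)
    then show "x \<in> lp_feasible J" using x by (simp add: lp_feasible_def J len)
  qed
  then have "lp_feasible J \<noteq> {}" using feas by blast
  moreover have "rational_mcst J" using f(1) by (auto simp: rational_mcst_def J)
  ultimately have "rat_inst J" by unfold_locales
  then show ?thesis using J f(2,3) by (intro exI[of _ J]) (simp add: len)
qed

lemma (in inst) good_exists: "\<exists>T. good (282 / ln 2) I T"
proof -
  let ?c = "282 / ln (2 :: real)"
  have "\<forall>N. \<exists>J. rat_inst J \<and> verts J = verts I \<and> edges J = edges I \<and> fam J = fam I \<and>
     (\<forall>e\<in>edges I. cost I e \<le> cost J e \<and> cost J e \<le> cost I e + 1 / real (Suc N)) \<and>
     (\<forall>i<length (fam I). bnd I ! i \<le> bnd J ! i \<and> bnd J ! i \<le> bnd I ! i + 1 / real (Suc N))"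
    using perturbed by blast
  then obtain J where J: "\<And>N. rat_inst (J N)" "\<And>N. verts (J N) = verts I" "\<And>N. edges (J N) = edges I" "\<And>N. fam (J N) = fam I"
    "\<And>N e. e \<in> edges I \<Longrightarrow> cost I e \<le> cost (J N) e \<and> cost (J N) e \<le> cost I e + 1 / real (Suc N)"
    "\<And>N i. i < length (fam I) \<Longrightarrow> bnd I ! i \<le> bnd (J N) ! i \<and> bnd (J N) ! i \<le> bnd I ! i + 1 / real (Suc N)"
    by metis
  obtain T where T: "\<And>N. good ?c (J N) (T N)" using rational_good[OF J(1)] by metis
  have TE: "T N \<subseteq> edges I" for N using T[of N] J(3) by (simp add: good_def spanning_tree_def)
  have finE: "finite (edges I)" using finite_ends[OF graph] by simp
  have "finite (range T)" by (rule finite_subset[of _ "Pow (edges I)"]) (use TE finE in auto)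
  then obtain N0 where inf: "infinite {N. T N = T N0}"
    using pigeonhole_infinite[of "UNIV :: nat set" T] by auto
  define A where "A = {N. T N = T N0}"
  have TA: "T N = T N0" if "N \<in> A" for N using that by (simp add: A_def)
  have infA: "infinite A" using inf by (simp add: A_def)
  have "good ?c I (T N0)"
    unfolding good_def
  proof (intro conjI allI impI)
    show "spanning_tree (verts I) (edges I) (T N0)" using T[of N0] J(2,3) by (simp add: good_def)
    show "sum (cost I) (T N0) \<le> lp_opt I"
      unfolding lp_opt_def
    proof (rule cINF_greatest[OF feas])
      fix x assume x: "x \<in> lp_feasible I"
      have x0: "0 \<le> x e" if "e \<in> edges I" for e using x that by (simp add: lp_feasible_def)
      \<comment> \<open>Rounded costs are at least the true ones, and they raise the cost of
        \<open>x\<close> by at most its coordinate sum divided by N + 1; \<open>x\<close> remains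
        feasible for the rounded instance.\<close>
      have "sum (cost I) (T N0) - (\<Sum>e\<in>edges I. cost I e * x e) \<le> (\<Sum>e\<in>edges I. x e) / real (Suc N)" if N: "N \<in> A" for N
      proof -
        interpret J: rat_inst "J N" by (rule J(1))
        have xJ: "x \<in> lp_feasible (J N)"
        proof -
          have "sum x (cut_edges (edges I) (fam I ! i)) \<le> bnd (J N) ! i" if "i < length (fam I)" for i
            by (rule order_trans[of _ "bnd I ! i"]) (use x J(6)[OF that] that in \<open>simp_all add: lp_feasible_def\<close>)
          then show ?thesis using x by (simp add: lp_feasible_def J(2-4))
        qed
        have "sum (cost I) (T N0) \<le> sum (cost (J N)) (T N)"
          unfolding TA[OF N] by (rule sum_mono) (use TE J(5) in blast)
        also have "\<dots> \<le> lp_opt (J N)" using T[of N] by (simp add: good_def)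
        also have "\<dots> \<le> (\<Sum>e\<in>edges (J N). cost (J N) e * x e)" unfolding J.lp_cost by (rule J.lp_opt_le[OF xJ])
        also have "\<dots> = (\<Sum>e\<in>edges I. cost (J N) e * x e)" by (simp only: J(3))
        also have "\<dots> \<le> (\<Sum>e\<in>edges I. cost I e * x e + x e / real (Suc N))"
        proof (rule sum_mono)
          fix e assume e: "e \<in> edges I"
          have "cost (J N) e * x e \<le> (cost I e + 1 / real (Suc N)) * x e" using J(5)[OF e] x0[OF e] by (intro mult_right_mono) auto
          then show "cost (J N) e * x e \<le> cost I e * x e + x e / real (Suc N)" by (simp add: distrib_right)
        qed
        also have "\<dots> = (\<Sum>e\<in>edges I. cost I e * x e) + (\<Sum>e\<in>edges I. x e) / real (Suc N)"
          by (simp only: sum.distrib sum_divide_distrib)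
        finally show ?thesis by simp
      qed
      then have "sum (cost I) (T N0) - (\<Sum>e\<in>edges I. cost I e * x e) \<le> 0" by (rule le_limit[OF infA])
      then show "sum (cost I) (T N0) \<le> (\<Sum>e\<in>edges I. cost I e * x e)" by simp
    qed
    fix i assume i: "i < length (fam I)"
    let ?r = "real (card (T N0 \<inter> cut_edges (edges I) (fam I ! i)))" and ?l = "?c * ln (real (card (verts I)))"
    have "?r - (bnd I ! i + ?l) \<le> 1 / real (Suc N)" if N: "N \<in> A" for N
    proof -
      have "?r \<le> bnd (J N) ! i + ?l" using T[of N] i unfolding good_def J(2-4) TA[OF N] by blast
      then show ?thesis using J(6)[OF i, of N] by linarith
    qed
    then have "?r - (bnd I ! i + ?l) \<le> 0" by (rule le_limit[OF infA])
    then show "?r \<le> bnd I ! i + ?l" by simp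
  qed
  then show ?thesis by blast
qed

theorem theorem1:
  shows "\<exists>(alg :: mcst \<Rightarrow> nat set set) (K :: real).
    polytime_computable encode_mcst encode_edges
      {I. laminar_mcst I \<and> lp_feasible I \<noteq> {} \<and> rational_mcst I} alg \<and>
    (\<forall>I. laminar_mcst I \<and> lp_feasible I \<noteq> {} \<longrightarrow>
      spanning_tree (verts I) (edges I) (alg I) \<and>
      sum (cost I) (alg I) \<le> lp_opt I \<and>
      (\<forall>i < length (fam I).
        real (card (alg I \<inter> cut_edges (edges I) (fam I ! i)))
          \<le> bnd I ! i + K * ln (real (card (verts I)))))"
proof -
  obtain prog p where run: "\<forall>ks. (\<forall>k\<in>set ks. 0 \<le> k) \<longrightarrow> (\<exists>s. init_store ks s \<and>
    (\<forall>n \<le> word_size ks. den (word_size ks) solver s 1 0 = int n \<longrightarrow>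
      (\<exists>t u. exec prog (input_mem ks) t u \<and> t \<le> poly p (word_size ks) \<and>
        output_word u = map (den (word_size ks) solver s 1) [1..int n])))"
    using lc_polytime[OF solver_wfc] by (elim exE) (rule that)
  define Q where "Q = (\<lambda>I T. \<exists>t u. exec prog (input_mem (encode_mcst I)) t u \<and>
    t \<le> poly p (word_size (encode_mcst I)) \<and> output_word u = encode_edges T)"
  \<comment> \<open>One function has to cover all instances: on rational ones the chosen tree must
    be the output of the program, on the others only its quality is required. Choosing per instance
    combines the two.\<close>
  have "\<exists>T. (laminar_mcst I \<and> lp_feasible I \<noteq> {} \<longrightarrow> good (282 / ln 2) I T) \<and>
    (laminar_mcst I \<and> lp_feasible I \<noteq> {} \<and> rational_mcst I \<longrightarrow> Q I T)" for I
  proof (cases "laminar_mcst I \<and> lp_feasible I \<noteq> {}")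
    case True
    then interpret inst I by unfold_locales auto
    show ?thesis
    proof (cases "rational_mcst I")
      case False
      then show ?thesis using good_exists by blast
    next
      case rat: True
      interpret rat_inst I by unfold_locales (rule rat)
      have "\<forall>w\<in>set (encode_mcst I). 0 \<le> w" using nonneg_words by blast
      from mp[OF spec[OF run, of "encode_mcst I"] this, folded L_def]
      obtain s where s: "init_store (encode_mcst I) s" "\<forall>n\<le>L. den L solver s 1 0 = int n \<longrightarrow>
          (\<exists>t u. exec prog (input_mem (encode_mcst I)) t u \<and> t \<le> poly p L \<and> output_word u = map (den L solver s 1) [1..int n])"
        by (elim exE conjE) (rule that)
      obtain T n where T: "good (282 / ln 2) I T" and n: "n \<le> L" "den L solver s 1 0 = int n"
        "map (den L solver s 1) [1..int n] = encode_edges T" using solver_run[OF s(1)] by blast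
      have "Q I T" using mp[OF mp[OF spec[OF s(2), of n] n(1)] n(2)] unfolding n(3) unfolding Q_def L_def .
      then show ?thesis using T by blast
    qed
  qed blast
  then obtain alg where alg: "\<And>I. laminar_mcst I \<Longrightarrow> lp_feasible I \<noteq> {} \<Longrightarrow> good (282 / ln 2) I (alg I)"
    "\<And>I. laminar_mcst I \<Longrightarrow> lp_feasible I \<noteq> {} \<Longrightarrow> rational_mcst I \<Longrightarrow> Q I (alg I)"
    by metis
  show ?thesis
  proof (intro exI conjI)
    show "polytime_computable encode_mcst encode_edges {I. laminar_mcst I \<and> lp_feasible I \<noteq> {} \<and> rational_mcst I} alg"
      unfolding polytime_computable_def
      by (rule exI[of _ prog], rule exI[of _ p]) (use alg(2) in \<open>simp add: Q_def\<close>)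
    show "\<forall>I. laminar_mcst I \<and> lp_feasible I \<noteq> {} \<longrightarrow>
      spanning_tree (verts I) (edges I) (alg I) \<and> sum (cost I) (alg I) \<le> lp_opt I \<and>
      (\<forall>i < length (fam I). real (card (alg I \<inter> cut_edges (edges I) (fam I ! i)))
          \<le> bnd I ! i + 282 / ln 2 * ln (real (card (verts I))))"
      using alg(1) unfolding good_def by blast
  qed
qed

end
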